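(* For any $c\in(-1,1)$ there exists an invariant measure for the limit semigroup $(P^c_t)_{t\ge 0}$ on $\mathrm{H}_c$.
   Context: Setting. $\langle\cdot,\cdot\rangle$ is the scalar product of $L^2(0,1)$. $A$ is the Laplace operator on $L^2(0,1)$ with Neumann boundary conditions, $D(A)=\{h\in W^{2,2}(0,1): h'(0)=h'(1)=0\}$, with complete orthonormal system of eigenvectors $(e_i)_{i\ge 0}$, $e_0=1$, $e_i(\theta)=\sqrt2\cos(i\pi\theta)$, and eigenvalues $\lambda_i=-(i\pi)^2$. For $\gamma\in\mathbb{R}$, $V_\gamma=D((-A)^{\gamma/2})$ (defined by interpolation/completion), and for $h=\sum_i h_ie_i$ set $\bar h=h_0$ (the average of $h$), $|h|_\gamma=\big(\sum_{i\ge1}(-\lambda_i)^\gamma h_i^2\big)^{1/2}$, $\|h\|_\gamma=(|h|_\gamma^2+\bar h^2)^{1/2}$. Put $\mathrm{H}=V_{-1}$ and, for $c\in\mathbb{R}$, $\mathrm{H}_c=\{h\in \mathrm{H}:\bar h=c\}$ with metric $|x-y|_{-1}$. $\mathcal{B}_b(\mathrm{H}_c)$ is the space of bounded Borel functions $\mathrm{H}_c\to\mathbb{R}$. Noise. $W$ is a cylindrical Wiener process on $L^2(0,1)$; $B$ is a covariance operator (nonnegative, self-adjoint) on $L^2(0,1)$ with $\sqrt B e_0=0$ and $\mathrm{Tr}_{-1}<+\infty$, where $\mathrm{Tr}_\gamma=\mathrm{Tr}[\sqrt B(-A)^\gamma\sqrt B^{*}]$. Approximated equation. Fix $\lambda\in\mathbb{R}$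 and for $n\in\mathbb{N}$ let $f_n(u)=-2\sum_{k=0}^n\frac{u^{2k+1}}{2k+1}+\lambda u$. For $x\in \mathrm{H}$, $X^n=X^n(\cdot,x)$ is the unique solution, a.s. in $C([0,T];\mathrm{H})\cap L^{2n+2}((0,T)\times(0,1))$ for every $T>0$, of $$dX^n+\tfrac12\big(A^2X^n+Af_n(X^n)\big)dt=\sqrt B\,dW,\qquad X^n(0)=x.$$ The average of $X^n(t)$ does not depend on $t$. For $c\in\mathbb{R}$ set $P^{n,c}_t\varphi(x)=\mathbb{E}[\varphi(X^n(t,x))]$, $x\in \mathrm{H}_c$, $\varphi\in\mathcal{B}_b(\mathrm{H}_c)$. Limit semigroup. For $c\in(-1,1)$, $(P^c_t)_{t\ge0}$ denotes a transition semigroup on $\mathcal{B}_b(\mathrm{H}_c)$ obtained as limit along a subsequence $(n_k)$: $P^{n_k,c}_t\varphi(x)\to P^c_t\varphi(x)$ as $k\to\infty$ for all $\varphi\in\mathcal{B}_b(\mathrm{H}_c)$, $x\in \mathrm{H}_c$, $t\ge0$ (its existence is established in the paper). An invariant measure is a Borel probability measure $\nu$ on $\mathrm{H}_c$ with $\int P^c_t\varphi\,d\nu=\int\varphi\,d\nu$ for all $t\ge0$, $\varphi\in\mathcal{B}_b(\mathrm{H}_c)$. *)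

theory Defs
  imports "HOL-Probability.Probability"
begin

section \<open>The Neumann Laplacian and the scale \<open>V\<^sub>\<gamma>\<close>\<close>

text \<open>
  An element \<open>h = \<Sum>\<^sub>i h\<^sub>i e\<^sub>i\<close> of any \<open>V\<^sub>\<gamma>\<close> is represented by its sequence of coefficients
  \<open>h\<^sub>i\<close> in the eigenbasis \<open>(e\<^sub>i)\<close>.  In this representation \<open>V\<^sub>0\<close> is \<open>L\<^sup>2(0,1)\<close>, the completion
  defining \<open>V\<^sub>\<gamma>\<close> for negative \<open>\<gamma>\<close> is the set of sequences of finite norm, \<open>A\<close> multiplies the
  \<open>i\<close>-th coefficient by \<open>\<lambda>\<^sub>i\<close>, and the average of \<open>h\<close> is \<open>h 0\<close>.  Functions on \<open>(0,1)\<close> enter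
  through their coefficients \<^term>\<open>coeffs\<close>.
\<close>

type_synonym coefs = "nat \<Rightarrow> real"

definition eigfun :: "nat \<Rightarrow> real \<Rightarrow> real" where
  "eigfun i \<theta> = (if i = 0 then 1 else sqrt 2 * cos (real i * pi * \<theta>))"

definition eigval :: "nat \<Rightarrow> real" where
  "eigval i = - (real i * pi)\<^sup>2"

lemma eigfun_Neumann_eigenfunction:
  obtains d where "\<And>\<theta>. (eigfun i has_real_derivative d \<theta>) (at \<theta>)"
    and "\<And>\<theta>. (d has_real_derivative eigval i * eigfun i \<theta>) (at \<theta>)"
    and "d 0 = 0" "d 1 = 0"
proof
  let ?d = "\<lambda>\<theta>. - (if i = 0 then 0 else sqrt 2 * (real i * pi) * sin (real i * pi * \<theta>))"
  show "(eigfun i has_real_derivative ?d \<theta>) (at \<theta>)" for \<theta>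
    unfolding eigfun_def by (cases "i = 0") (auto intro!: derivative_eq_intros)
  show "(?d has_real_derivative eigval i * eigfun i \<theta>) (at \<theta>)" for \<theta>
    unfolding eigfun_def eigval_def
    by (cases "i = 0") (auto intro!: derivative_eq_intros simp: power2_eq_square)
qed auto

definition coeffs :: "(real \<Rightarrow> real) \<Rightarrow> coefs" where
  "coeffs g i = (LINT \<theta>:{0<..<1}|lborel. g \<theta> * eigfun i \<theta>)"

definition basis :: "nat \<Rightarrow> coefs" where
  "basis k = (\<lambda>i. if i = k then 1 else 0)"

lemma coeffs_eigfun: "coeffs (eigfun k) = basis k"
proof
  fix i :: nat
  define C where "C m = (LINT \<theta>:{0..1}|lborel. cos (of_int m * pi * \<theta>))" for m :: int
  have C: "C m = (if m = 0 then 1 else 0)" for m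
  proof (cases "m = 0")
    case False
    have "C m = sin (of_int m * pi * 1) / (of_int m * pi) - sin (of_int m * pi * 0) / (of_int m * pi)"
      unfolding C_def set_lebesgue_integral_def real_scaleR_def
      using False
      by (subst integral_FTC_Icc_real[where F = "\<lambda>\<theta>. sin (of_int m * pi * \<theta>) / (of_int m * pi)", symmetric])
        (auto intro!: derivative_eq_intros continuous_intros simp: mult_ac)
    then show ?thesis using False by (simp add: sin_int_times_real mult.commute)
  qed (simp add: C_def set_lebesgue_integral_def)
  have int: "set_integrable lborel {0..1} (\<lambda>\<theta>::real. cos (of_int m * pi * \<theta>))" for m :: int
    by (intro borel_integrable_atLeastAtMost') (auto intro!: continuous_intros)
  define q :: real where
    "q = (if k = 0 \<and> i = 0 then 1/2 else if k = 0 \<or> i = 0 then sqrt 2 / 2 else 1)"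
  have prod: "eigfun k \<theta> * eigfun i \<theta> =
      q * (cos (of_int (int k - int i) * pi * \<theta>) + cos (of_int (int k + int i) * pi * \<theta>))" for \<theta>
  proof -
    have "cos (of_int (int k - int i) * pi * \<theta>) + cos (of_int (int k + int i) * pi * \<theta>) =
        2 * (cos (real k * pi * \<theta>) * cos (real i * pi * \<theta>))"
      by (simp add: left_diff_distrib distrib_right cos_diff cos_add)
    then show ?thesis by (auto simp: q_def eigfun_def)
  qed
  have "coeffs (eigfun k) i = (LINT \<theta>:{0..1}|lborel. eigfun k \<theta> * eigfun i \<theta>)"
    unfolding coeffs_def set_lebesgue_integral_def
    by (intro integral_cong_AE AE_I[where N = "{0, 1}"])
      (auto simp: eigfun_def indicator_def emeasure_lborel_countable)
  also have "\<dots> = q * (C (int k - int i) + C (int k + int i))"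
    using set_integral_add(2)[OF int[of "int k - int i"] int[of "int k + int i"]]
    by (simp only: prod C_def set_integral_mult_right)
  also have "\<dots> = basis k i"
    by (auto simp: C q_def basis_def)
  finally show "coeffs (eigfun k) i = basis k i" .
qed

definition V :: "real \<Rightarrow> coefs set" where
  "V \<gamma> = {h. (\<lambda>i. (- eigval i) powr \<gamma> * (h i)\<^sup>2) summable_on {1..}}"

definition seminormV :: "real \<Rightarrow> coefs \<Rightarrow> real" where
  "seminormV \<gamma> h = sqrt (\<Sum>\<^sub>\<infinity>i\<in>{1..}. (- eigval i) powr \<gamma> * (h i)\<^sup>2)"

definition normV :: "real \<Rightarrow> coefs \<Rightarrow> real" where
  "normV \<gamma> h = sqrt ((seminormV \<gamma> h)\<^sup>2 + (h 0)\<^sup>2)"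

abbreviation L2 :: "coefs set" where
  "L2 \<equiv> V 0"

definition innerL2 :: "coefs \<Rightarrow> coefs \<Rightarrow> real" where
  "innerL2 h k = (\<Sum>\<^sub>\<infinity>i. h i * k i)"

text \<open>\<open>(-A)\<^sup>\<gamma>\<close>; for negative \<open>\<gamma>\<close> this is the inverse power on zero-average elements.\<close>

definition negA_pow :: "real \<Rightarrow> coefs \<Rightarrow> coefs" where
  "negA_pow \<gamma> h = (\<lambda>i. if i = 0 then 0 else (- eigval i) powr \<gamma> * h i)"

definition H :: "coefs set" where
  "H = V (- 1)"

definition Hc :: "real \<Rightarrow> coefs set" where
  "Hc c = {h \<in> H. h 0 = c}"

definition dist_H :: "coefs \<Rightarrow> coefs \<Rightarrow> real" where
  "dist_H x y = normV (- 1) (\<lambda>i. x i - y i)"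

definition dist_Hc :: "coefs \<Rightarrow> coefs \<Rightarrow> real" where
  "dist_Hc x y = seminormV (- 1) (\<lambda>i. x i - y i)"

lemma weighted_l2_triangle:
  fixes w a b :: "'i \<Rightarrow> real"
  assumes w: "\<And>i. i \<in> I \<Longrightarrow> w i \<ge> 0"
    and a: "(\<lambda>i. w i * (a i)\<^sup>2) summable_on I" and b: "(\<lambda>i. w i * (b i)\<^sup>2) summable_on I"
  shows "(\<lambda>i. w i * (a i + b i)\<^sup>2) summable_on I"
    and "sqrt (\<Sum>\<^sub>\<infinity>i\<in>I. w i * (a i + b i)\<^sup>2)
      \<le> sqrt (\<Sum>\<^sub>\<infinity>i\<in>I. w i * (a i)\<^sup>2) + sqrt (\<Sum>\<^sub>\<infinity>i\<in>I. w i * (b i)\<^sup>2)" (is "_ \<le> ?R")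
proof -
  have fin: "(\<Sum>i\<in>F. w i * (a i + b i)\<^sup>2) \<le> ?R\<^sup>2" if F: "finite F" "F \<subseteq> I" for F
  proof -
    let ?a = "\<lambda>i. sqrt (w i) * a i" and ?b = "\<lambda>i. sqrt (w i) * b i"
    have sq: "(\<Sum>i\<in>F. (sqrt (w i) * g i)\<^sup>2) = (\<Sum>i\<in>F. w i * (g i)\<^sup>2)" for g :: "'i \<Rightarrow> real"
      using F w by (intro sum.cong) (auto simp: power_mult_distrib)
    have le: "sqrt (\<Sum>i\<in>F. w i * (g i)\<^sup>2) \<le> sqrt (\<Sum>\<^sub>\<infinity>i\<in>I. w i * (g i)\<^sup>2)"
      if "(\<lambda>i. w i * (g i)\<^sup>2) summable_on I" for g :: "'i \<Rightarrow> real"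
      using finite_sum_le_infsum[OF that F(1,2)] w by auto
    have "sqrt (\<Sum>i\<in>F. w i * (a i + b i)\<^sup>2) = L2_set (\<lambda>i. ?a i + ?b i) F"
      using sq[of "\<lambda>i. a i + b i"] by (simp add: L2_set_def distrib_left)
    also have "\<dots> \<le> L2_set ?a F + L2_set ?b F"
      by (rule L2_set_triangle_ineq)
    also have "\<dots> \<le> ?R"
      unfolding L2_set_def sq by (intro add_mono le a b)
    finally have "sqrt (\<Sum>i\<in>F. w i * (a i + b i)\<^sup>2) \<le> ?R" .
    then show ?thesis by (rule sqrt_le_D)
  qed
  show s: "(\<lambda>i. w i * (a i + b i)\<^sup>2) summable_on I"
    using fin w by (intro nonneg_bounded_partial_sums_imp_summable_on[where C = "?R\<^sup>2"])
      (auto intro!: eventually_finite_subsets_at_top_weakI)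
  have "0 \<le> ?R" using w by (auto intro!: add_nonneg_nonneg infsum_nonneg)
  moreover have "(\<Sum>\<^sub>\<infinity>i\<in>I. w i * (a i + b i)\<^sup>2) \<le> ?R\<^sup>2"
    by (rule infsum_le_finite_sums[OF s fin])
  ultimately show "sqrt (\<Sum>\<^sub>\<infinity>i\<in>I. w i * (a i + b i)\<^sup>2) \<le> ?R"
    by (intro real_le_lsqrt) auto
qed

lemma normV_alt:
  assumes "h \<in> V \<gamma>"
  shows "normV \<gamma> h = sqrt (\<Sum>\<^sub>\<infinity>i. (if i = 0 then 1 else (- eigval i) powr \<gamma>) * (h i)\<^sup>2)"
    and "(\<lambda>i. (if i = 0 then 1 else (- eigval i) powr \<gamma>) * (h i)\<^sup>2) summable_on UNIV"
proof -
  let ?f = "\<lambda>i::nat. (if i = 0 then 1 else (- eigval i) powr \<gamma>) * (h i)\<^sup>2"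
  have U: "(UNIV :: nat set) = insert 0 {1..}" by auto
  have c: "?f summable_on {1..} \<longleftrightarrow> (\<lambda>i. (- eigval i) powr \<gamma> * (h i)\<^sup>2) summable_on {1..}"
    by (intro summable_on_cong) auto
  have s: "?f summable_on {1..}" using assms unfolding c by (simp add: V_def)
  then show "?f summable_on UNIV" unfolding U by (subst summable_on_insert_iff)
  have "infsum ?f UNIV = ?f 0 + infsum ?f {1..}"
    unfolding U by (subst infsum_insert[OF s]) auto
  also have "infsum ?f {1..} = (\<Sum>\<^sub>\<infinity>i\<in>{1..}. (- eigval i) powr \<gamma> * (h i)\<^sup>2)"
    by (intro infsum_cong) auto
  finally show "normV \<gamma> h = sqrt (infsum ?f UNIV)"
    by (simp add: normV_def seminormV_def infsum_nonneg add.commute)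
qed

lemma V_diff: "x \<in> V \<gamma> \<Longrightarrow> y \<in> V \<gamma> \<Longrightarrow> (\<lambda>i. x i - y i) \<in> V \<gamma>"
  using weighted_l2_triangle(1)[of "{1..}" "\<lambda>i. (- eigval i) powr \<gamma>" x "\<lambda>i. - y i"]
  by (simp add: V_def)

lemma Metric_space_H: "Metric_space H dist_H"
proof
  fix x y z :: coefs
  show "0 \<le> dist_H x y" by (simp add: dist_H_def normV_def)
  show "dist_H x y = dist_H y x"
    by (simp add: dist_H_def normV_def seminormV_def power2_commute)
  let ?w = "\<lambda>i::nat. if i = 0 then 1 else (- eigval i) powr (- 1)"
  note alt = normV_alt[where \<gamma> = "- 1"]
  { assume xy: "x \<in> H" "y \<in> H"
    then have m: "(\<lambda>i. x i - y i) \<in> V (- 1)" by (simp add: H_def V_diff)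
    show "dist_H x y = 0 \<longleftrightarrow> x = y"
    proof
      assume "dist_H x y = 0"
      then have "(\<Sum>\<^sub>\<infinity>i. ?w i * (x i - y i)\<^sup>2) = 0"
        unfolding dist_H_def alt(1)[OF m] by simp
      then have z: "?w i * (x i - y i)\<^sup>2 = 0" for i
        using nonneg_infsum_le_0D[of "\<lambda>i. ?w i * (x i - y i)\<^sup>2" UNIV i] alt(2)[OF m] by auto
      have "x i = y i" for i
      proof -
        have "?w i \<noteq> 0" by (simp add: eigval_def)
        with z[of i] have "(x i - y i)\<^sup>2 = 0" by (simp only: mult_eq_0_iff simp_thms)
        then show ?thesis by simp
      qed
      then show "x = y" by auto
    qed (simp add: dist_H_def normV_def seminormV_def)
    assume z: "z \<in> H"
    with xy have n: "(\<lambda>i. y i - z i) \<in> V (- 1)" "(\<lambda>i. x i - z i) \<in> V (- 1)"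
      by (simp_all add: H_def V_diff)
    show "dist_H x z \<le> dist_H x y + dist_H y z"
      using weighted_l2_triangle(2)[OF _ alt(2)[OF m] alt(2)[OF n(1)]]
      by (simp add: dist_H_def alt(1) m n)
  }
qed

lemma dist_H_eq_dist_Hc: "x \<in> Hc c \<Longrightarrow> y \<in> Hc c \<Longrightarrow> dist_H x y = dist_Hc x y"
  by (auto simp: Hc_def dist_H_def dist_Hc_def normV_def seminormV_def infsum_nonneg)

definition top_H :: "coefs topology" where
  "top_H = Metric_space.mtopology H dist_H"

definition borel_H :: "coefs measure" where
  "borel_H = sigma H {U. openin top_H U}"

definition borel_Hc :: "real \<Rightarrow> coefs measure" where
  "borel_Hc c = sigma (Hc c) {U. openin (Metric_space.mtopology (Hc c) dist_Hc) U}"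

definition Bb :: "real \<Rightarrow> (coefs \<Rightarrow> real) set" where
  "Bb c = {\<phi> \<in> borel_measurable (borel_Hc c). bounded (\<phi> ` Hc c)}"


section \<open>Noise\<close>

definition standard_Brownian_motion :: "'w measure \<Rightarrow> (real \<Rightarrow> 'w \<Rightarrow> real) \<Rightarrow> bool" where
  "standard_Brownian_motion M b \<longleftrightarrow>
     (\<forall>t\<ge>0. b t \<in> borel_measurable M) \<and>
     (AE \<omega> in M. b 0 \<omega> = 0) \<and>
     (AE \<omega> in M. continuous_on {0..} (\<lambda>t. b t \<omega>)) \<and>
     (\<forall>s\<ge>0. \<forall>t>s. distributed M lborel (\<lambda>\<omega>. b t \<omega> - b s \<omega>) (normal_density 0 (sqrt (t - s)))) \<and>
     (\<forall>s\<ge>0. \<forall>t>s. prob_space.indep_set M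
        (sigma_sets (space M) {b r -` U \<inter> space M | r U. r \<in> {0..s} \<and> U \<in> sets borel})
        {(\<lambda>\<omega>. b t \<omega> - b s \<omega>) -` U \<inter> space M | U. U \<in> sets borel})"

text \<open>The cylindrical Wiener process \<open>W = \<Sum>\<^sub>k \<beta>\<^sub>k e\<^sub>k\<close> is given by its coordinates \<open>\<beta>\<^sub>k\<close>.\<close>

definition cylindrical_Wiener :: "'w measure \<Rightarrow> (nat \<Rightarrow> real \<Rightarrow> 'w \<Rightarrow> real) \<Rightarrow> bool" where
  "cylindrical_Wiener M \<beta> \<longleftrightarrow>
     (\<forall>k. standard_Brownian_motion M (\<beta> k)) \<and>
     prob_space.indep_vars M (\<lambda>_. PiM {0..} (\<lambda>_. borel)) (\<lambda>k \<omega>. \<lambda>t\<in>{0..}. \<beta> k t \<omega>) UNIV"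

definition nonneg_selfadjoint :: "(coefs \<Rightarrow> coefs) \<Rightarrow> bool" where
  "nonneg_selfadjoint T \<longleftrightarrow>
     (\<forall>h\<in>L2. T h \<in> L2) \<and>
     (\<forall>h\<in>L2. \<forall>k\<in>L2. \<forall>a b. T (\<lambda>i. a * h i + b * k i) = (\<lambda>i. a * T h i + b * T k i)) \<and>
     (\<exists>C. \<forall>h\<in>L2. normV 0 (T h) \<le> C * normV 0 h) \<and>
     (\<forall>h\<in>L2. \<forall>k\<in>L2. innerL2 (T h) k = innerL2 h (T k)) \<and>
     (\<forall>h\<in>L2. 0 \<le> innerL2 (T h) h)"

definition is_sqrt_op :: "(coefs \<Rightarrow> coefs) \<Rightarrow> (coefs \<Rightarrow> coefs) \<Rightarrow> bool" where
  "is_sqrt_op S B \<longleftrightarrow> nonneg_selfadjoint S \<and> (\<forall>h\<in>L2. S (S h) = B h)"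

text \<open>\<open>Tr[S (-A)\<^sup>\<gamma> S*] < \<infinity>\<close> for a self-adjoint \<open>S\<close> (so \<open>S* = S\<close>); the diagonal terms are
  nonnegative.\<close>

definition finite_trace :: "real \<Rightarrow> (coefs \<Rightarrow> coefs) \<Rightarrow> bool" where
  "finite_trace \<gamma> S \<longleftrightarrow> (\<lambda>k. innerL2 (S (negA_pow \<gamma> (S (basis k)))) (basis k)) summable_on UNIV"


section \<open>The approximated equation\<close>

definition fpoly :: "real \<Rightarrow> nat \<Rightarrow> real \<Rightarrow> real" where
  "fpoly lam n u = - 2 * (\<Sum>k\<le>n. u ^ (2 * k + 1) / real (2 * k + 1)) + lam * u"

text \<open>
  \<open>CH_path lam n x X u\<close>: the path \<open>X\<close> starts at \<open>x\<close>, is continuous in \<open>H\<close>, and is given on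
  \<open>(0,\<infinity>) \<times> (0,1)\<close> by a function \<open>u\<close> that lies in \<open>L\<^sup>2\<^sup>n\<^sup>+\<^sup>2((0,T) \<times> (0,1))\<close> for every \<open>T\<close>.
\<close>

definition CH_path :: "nat \<Rightarrow> coefs \<Rightarrow> (real \<Rightarrow> coefs) \<Rightarrow> (real \<Rightarrow> real \<Rightarrow> real) \<Rightarrow> bool" where
  "CH_path n x X u \<longleftrightarrow>
     X 0 = x \<and>
     continuous_map (top_of_set {0..}) top_H X \<and>
     (\<lambda>(s, \<theta>). u s \<theta>) \<in> borel_measurable borel \<and>
     (\<forall>T>0. set_integrable lborel ({0<..<T} \<times> {0<..<1}) (\<lambda>(s, \<theta>). u s \<theta> ^ (2 * n + 2))) \<and>
     (AE s in lborel. 0 < s \<longrightarrow> X s = coeffs (u s))"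

text \<open>\<open>X(t) - x + 1/2 \<integral>\<^sub>0\<^sup>t (A\<^sup>2 X + A f\<^sub>n(X)) ds\<close>, as a (generalised) element of the scale.\<close>

definition CH_lhs ::
  "real \<Rightarrow> nat \<Rightarrow> coefs \<Rightarrow> (real \<Rightarrow> coefs) \<Rightarrow> (real \<Rightarrow> real \<Rightarrow> real) \<Rightarrow> real \<Rightarrow> coefs" where
  "CH_lhs lam n x X u t i = X t i - x i + 1/2 * (LINT s:{0..t}|lborel.
     (eigval i)\<^sup>2 * X s i + eigval i * coeffs (\<lambda>\<theta>. fpoly lam n (u s \<theta>)) i)"

text \<open>
  The equation is required in every \<open>V\<^sub>\<gamma>\<close>-coordinate, i.e. weakly against the eigenfunctions.
  The \<open>i\<close>-th coordinate of \<open>S W(t)\<close> is \<open>\<Sum>\<^sub>k \<beta>\<^sub>k(t) \<langle>S e\<^sub>k, e\<^sub>i\<rangle>\<close>, a series of independent centred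
  Gaussians which converges almost surely for each fixed \<open>t\<close>.
\<close>

definition CH_solution ::
  "'w measure \<Rightarrow> (nat \<Rightarrow> real \<Rightarrow> 'w \<Rightarrow> real) \<Rightarrow> (coefs \<Rightarrow> coefs) \<Rightarrow> real \<Rightarrow> nat \<Rightarrow> coefs
    \<Rightarrow> (real \<Rightarrow> 'w \<Rightarrow> coefs) \<Rightarrow> bool" where
  "CH_solution M \<beta> S lam n x X \<longleftrightarrow>
     (\<forall>t\<ge>0. X t \<in> M \<rightarrow>\<^sub>M borel_H) \<and>
     (\<exists>u. (AE \<omega> in M. CH_path n x (\<lambda>t. X t \<omega>) (u \<omega>)) \<and>
          (\<forall>t\<ge>0. AE \<omega> in M. \<forall>i.
             (\<lambda>k. \<beta> k t \<omega> * S (basis k) i) sums CH_lhs lam n x (\<lambda>t. X t \<omega>) (u \<omega>) t i))"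

definition CH_unique_solution ::
  "'w measure \<Rightarrow> (nat \<Rightarrow> real \<Rightarrow> 'w \<Rightarrow> real) \<Rightarrow> (coefs \<Rightarrow> coefs) \<Rightarrow> real \<Rightarrow> nat \<Rightarrow> coefs
    \<Rightarrow> (real \<Rightarrow> 'w \<Rightarrow> coefs) \<Rightarrow> bool" where
  "CH_unique_solution M \<beta> S lam n x X \<longleftrightarrow>
     CH_solution M \<beta> S lam n x X \<and>
     (\<forall>Y. CH_solution M \<beta> S lam n x Y \<longrightarrow> (AE \<omega> in M. \<forall>t\<ge>0. Y t \<omega> = X t \<omega>))"


section \<open>Semigroups and invariant measures\<close>

text \<open>
  Since the average is conserved, \<open>X(t,x)\<close> lies in \<open>Hc c\<close> almost surely for \<open>x \<in> Hc c\<close>.  The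
  expectation is taken over that event because \<open>\<phi> \<in> Bb c\<close> carries no information outside
  \<open>Hc c\<close>.
\<close>

definition approx_semigroup ::
  "'w measure \<Rightarrow> (coefs \<Rightarrow> real \<Rightarrow> 'w \<Rightarrow> coefs) \<Rightarrow> real
    \<Rightarrow> real \<Rightarrow> (coefs \<Rightarrow> real) \<Rightarrow> coefs \<Rightarrow> real" where
  "approx_semigroup M X c t \<phi> x =
     (LINT \<omega>:{\<omega> \<in> space M. X x t \<omega> \<in> Hc c}|M. \<phi> (X x t \<omega>))"

definition transition_semigroup ::
  "real \<Rightarrow> (real \<Rightarrow> (coefs \<Rightarrow> real) \<Rightarrow> coefs \<Rightarrow> real) \<Rightarrow> bool" where
  "transition_semigroup c P \<longleftrightarrow>
     (\<exists>\<kappa>. \<forall>t\<ge>0. \<kappa> t \<in> borel_Hc c \<rightarrow>\<^sub>M prob_algebra (borel_Hc c) \<and>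
        (\<forall>\<phi>\<in>Bb c. \<forall>x\<in>Hc c. P t \<phi> x = (LINT y|\<kappa> t x. \<phi> y))) \<and>
     (\<forall>\<phi>\<in>Bb c. \<forall>x\<in>Hc c. P 0 \<phi> x = \<phi> x) \<and>
     (\<forall>\<phi>\<in>Bb c. \<forall>x\<in>Hc c. \<forall>s\<ge>0. \<forall>t\<ge>0. P (s + t) \<phi> x = P s (P t \<phi>) x)"

definition invariant_measure ::
  "real \<Rightarrow> (real \<Rightarrow> (coefs \<Rightarrow> real) \<Rightarrow> coefs \<Rightarrow> real) \<Rightarrow> coefs measure \<Rightarrow> bool" where
  "invariant_measure c P \<nu> \<longleftrightarrow>
     prob_space \<nu> \<and> sets \<nu> = sets (borel_Hc c) \<and>
     (\<forall>t\<ge>0. \<forall>\<phi>\<in>Bb c. (LINT x|\<nu>. P t \<phi> x) = (LINT x|\<nu>. \<phi> x))"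

end

theory Submission
  imports Defs
begin

text \<open>
  The measure is obtained by Krylov and Bogoliubov's method from the orbit of the constant function
  \<open>c\<close>.

  Tightness rests on \<open>E \<integral>\<^sub>0\<^sup>T |X|\<^sub>1 dt \<le> C T\<close> with \<open>C\<close> independent of \<open>n \<ge> 1\<close>.  Ito's formula
  is avoided: the solution is compared with an explicit Euler--Galerkin scheme, whose second moments
  are computed from the independence of Brownian increments alone, and the drift satisfies
  \<open>\<langle>f\<^sub>n(u), u - c\<rangle> \<le> C\<close> since \<open>|c| < 1\<close>.  The comparison uses only that \<open>f\<^sub>n\<close> is decreasing up to
  a linear term.  As \<open>X\<close> is merely an \<open>L\<^sup>p\<close> function in space, it is projected by Fejer means
  rather than sharp truncations: the Fejer kernel is positive, so by Jensen's inequality the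
  projection respects the convex primitive of the polynomial part of \<open>-f\<^sub>n\<close>, up to a defect
  (\<open>err\<close> below) that vanishes in the limit.
  The same argument for two solutions gives a Lipschitz estimate uniform in \<open>n\<close>, which makes
  \<open>P\<^sup>c\<^sub>t\<close> preserve bounded Lipschitz functions.

  Prokhorov's theorem on \<open>H\<^sub>c\<close> is reduced to Helly's selection theorem on the line by coding all
  coordinates of a point into one real number with a continuous left inverse.
\<close>

section \<open>Fejer means\<close>

text \<open>Each coordinate of the equation is known almost surely for one time at a time, and such
  statements are combined over countably many times. Hence every comparison runs along the grids
  \<open>k * (T / M)\<close>, and the noise is met as a difference of \<open>CH_lhs\<close> between
  grid points.

  All energies are of \<open>|.|_{-1}\<close> type: dividing mode \<open>i\<close> by its eigenvalue
  turns the fourth-order term into the square of \<open>|.|_1\<close> and the nonlinear term into a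
  plain \<open>L2\<close> pairing with \<open>f_n(u)\<close>. The linear part of \<open>f_n\<close>
  can have the wrong sign; it is absorbed by interpolating the \<open>L2\<close> norm between
  \<open>|.|_1\<close> and \<open>|.|_{-1}\<close>.

  The limit semigroup comes without a process, so it is reached through pointwise limits of
  expectations. Whatever is to survive, a bound on an integral or a Lipschitz constant, must be an
  inequality uniform in \<open>n\<close>. Bounded Lipschitz functions are therefore the test class,
  and \<open>|.|_1\<close> enters through its truncations \<open>psi m\<close>, cut off at a level.
  Balls of \<open>|.|_1\<close> are compact in \<open>Hc c\<close> because the eigenvalues grow;
  this is used in the quantitative form of \<open>dist_trunc_decode\<close>.\<close>

definition leb01 :: "real measure" where
  "leb01 = restrict_space lborel {0<..<1}"

lemma measurable_leb01 [measurable (raw)]: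
  "f \<in> borel_measurable borel \<Longrightarrow> f \<in> borel_measurable leb01"
  unfolding leb01_def by (intro measurable_restrict_space1) simp

lemma prob_space_leb01: "prob_space leb01"
  by (rule prob_spaceI) (simp add: leb01_def space_restrict_space emeasure_restrict_space)

interpretation leb01: prob_space leb01
  by (rule prob_space_leb01)

lemma coeffs_leb01: "coeffs g i = (\<integral>\<theta>. g \<theta> * eigfun i \<theta> \<partial>leb01)"
  by (simp add: coeffs_def leb01_def integral_restrict_space set_lebesgue_integral_def)

lemma integral_leb01: "(LINT \<theta>:{0<..<1}|lborel. f \<theta>) = (\<integral>\<theta>. f \<theta> \<partial>leb01)" for f :: "real \<Rightarrow> real"
  by (simp add: leb01_def integral_restrict_space set_lebesgue_integral_def)

lemma continuous_eigfun [continuous_intros]: "continuous_on A (eigfun i)"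
  unfolding eigfun_def by (cases "i = 0") (auto intro!: continuous_intros)

lemma borel_eigfun [measurable]: "eigfun i \<in> borel_measurable borel"
  by (intro borel_measurable_continuous_onI continuous_eigfun)

lemma abs_eigfun_le: "\<bar>eigfun i \<theta>\<bar> \<le> 2"
proof -
  have "sqrt 2 * \<bar>cos (real i * pi * \<theta>)\<bar> \<le> sqrt 2 * 1" by (intro mult_left_mono) auto
  also have "\<dots> \<le> 2" by (simp add: real_le_lsqrt sqrt2_less_2 less_imp_le)
  finally show ?thesis by (auto simp: eigfun_def abs_mult)
qed

text \<open>Cesaro weights: averaging the partial sums of orders 0 to \<open>N\<close> of a cosine
  series multiplies mode \<open>i\<close> by this factor.\<close>

definition fejer :: "nat \<Rightarrow> nat \<Rightarrow> real" where
  "fejer N i = 1 - real i / (real N + 1)"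

lemma fejer_0 [simp]: "fejer N 0 = 1"
  by (simp add: fejer_def)

lemma fejer_pos: "i \<le> N \<Longrightarrow> 0 < fejer N i"
  by (simp add: fejer_def divide_less_eq)

lemma fejer_le_1: "fejer N i \<le> 1"
  by (simp add: fejer_def)

lemma tendsto_fejer: "(\<lambda>N. fejer N i) \<longlonglongrightarrow> 1"
  unfolding fejer_def by real_asymp

text \<open>The left side is \<open>|sum_{j<=N} e^{ijx}|^2\<close>, so the formula exhibits the
  Fejer kernel as a square up to a positive factor, which is the source of its positivity. Adding
  one more exponential changes the square by \<open>1 + 2 * D (N + 1)\<close>, where
  \<open>D\<close> is a partial sum of cosines and comes from the cross term; summing the
  \<open>D k\<close> counts mode \<open>i\<close> exactly \<open>N + 1 - i\<close> times.\<close>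

lemma fejer_sum_sq:
  "(\<Sum>j\<le>N. cos (real j * x))\<^sup>2 + (\<Sum>j\<le>N. sin (real j * x))\<^sup>2 =
     (real N + 1) * (1 + 2 * (\<Sum>i=1..N. fejer N i * cos (real i * x)))"
proof -
  define D where "D N = (\<Sum>i=1..N. cos (real i * x))" for N
  have cross: "cos y * (\<Sum>j\<le>N. cos (real j * x)) + sin y * (\<Sum>j\<le>N. sin (real j * x)) = D (Suc N)"
    if "y = real (Suc N) * x" for y N
  proof -
    have "cos y * (\<Sum>j\<le>N. cos (real j * x)) + sin y * (\<Sum>j\<le>N. sin (real j * x))
       = (\<Sum>j\<le>N. cos (real (Suc N - j) * x))"
      unfolding sum_distrib_left sum.distrib[symmetric]
      by (intro sum.cong refl) (auto simp: that of_nat_diff algebra_simps cos_diff cos_add sin_add)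
    also have "\<dots> = D (Suc N)"
      unfolding D_def
      by (rule sum.reindex_bij_witness[where i = "\<lambda>i. Suc N - i" and j = "\<lambda>j. Suc N - j"]) auto
    finally show ?thesis .
  qed
  have main: "(\<Sum>j\<le>N. cos (real j * x))\<^sup>2 + (\<Sum>j\<le>N. sin (real j * x))\<^sup>2 =
     real N + 1 + 2 * (\<Sum>k=1..N. D k)" for N
  proof (induction N)
    case (Suc N)
    let ?C = "\<Sum>j\<le>N. cos (real j * x)" and ?S = "\<Sum>j\<le>N. sin (real j * x)"
    let ?y = "real (Suc N) * x"
    have "(\<Sum>j\<le>Suc N. cos (real j * x))\<^sup>2 + (\<Sum>j\<le>Suc N. sin (real j * x))\<^sup>2
      = (?C\<^sup>2 + ?S\<^sup>2) + 2 * (cos ?y * ?C + sin ?y * ?S) + ((sin ?y)\<^sup>2 + (cos ?y)\<^sup>2)"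
      by (simp add: power2_eq_square algebra_simps)
    then show ?case
      unfolding Suc cross[OF refl] by (simp add: algebra_simps)
  qed simp
  have "(\<Sum>k=1..N. D k) = (\<Sum>i=1..N. (real N + 1 - real i) * cos (real i * x))"
  proof (induction N)
    case (Suc N)
    have "(\<Sum>i=1..Suc N. (real (Suc N) + 1 - real i) * cos (real i * x))
      = (\<Sum>i=1..Suc N. (real N + 1 - real i) * cos (real i * x) + cos (real i * x))"
      by (intro sum.cong) (auto simp: algebra_simps)
    also have "\<dots> = (\<Sum>i=1..N. (real N + 1 - real i) * cos (real i * x)) + D (Suc N)"
      unfolding sum.distrib D_def by simp
    finally show ?case using Suc by simp
  qed simp
  also have "\<dots> = (real N + 1) * (\<Sum>i=1..N. fejer N i * cos (real i * x))"
    unfolding sum_distrib_left by (intro sum.cong) (auto simp: fejer_def field_simps)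
  finally have "real N + 1 + 2 * (\<Sum>k=1..N. D k) =
      (real N + 1) * (1 + 2 * (\<Sum>i=1..N. fejer N i * cos (real i * x)))"
    by (simp add: algebra_simps)
  with main show ?thesis by simp
qed

definition fker :: "nat \<Rightarrow> real \<Rightarrow> real \<Rightarrow> real" where
  "fker N a b = (\<Sum>i\<le>N. fejer N i * eigfun i a * eigfun i b)"

lemma sum_0_1: "(\<Sum>i\<le>N. F i) = F 0 + (\<Sum>i=1..N. F (i::nat))" for F :: "nat \<Rightarrow> real"
  by (simp add: sum.atLeast0_atMost_Suc_shift atMost_atLeast0 sum.atLeast_Suc_atMost)

text \<open>By the product-to-sum formula the kernel is the mean of two values of the periodic Fejer
  kernel, at \<open>pi * (a - b)\<close> and at \<open>pi * (a + b)\<close>: the Neumann condition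
  amounts to even reflection.\<close>

lemma fker_nonneg: "0 \<le> fker N a b"
proof -
  let ?k = "\<lambda>x. 1 + 2 * (\<Sum>i=1..N. fejer N i * cos (real i * x))"
  have nn: "0 \<le> ?k x" for x
  proof -
    have "0 \<le> (real N + 1) * ?k x"
      unfolding fejer_sum_sq[symmetric] by simp
    then show ?thesis by (simp add: zero_le_mult_iff)
  qed
  have "fejer N i * eigfun i a * eigfun i b =
      fejer N i * cos (real i * (pi * (a - b))) + fejer N i * cos (real i * (pi * (a + b)))"
    if "i \<in> {1..N}" for i
  proof -
    have "cos (real i * (pi * (a - b))) + cos (real i * (pi * (a + b))) =
        2 * (cos (real i * pi * a) * cos (real i * pi * b))"
      by (simp add: algebra_simps cos_diff cos_add)
    then show ?thesis using that by (simp add: eigfun_def flip: distrib_left)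
  qed
  then have "fker N a b = 1 + ((\<Sum>i=1..N. fejer N i * cos (real i * (pi * (a - b)))) +
      (\<Sum>i=1..N. fejer N i * cos (real i * (pi * (a + b)))))"
    unfolding fker_def sum_0_1 by (simp add: eigfun_def flip: sum.distrib)
  also have "\<dots> = (?k (pi * (a - b)) + ?k (pi * (a + b))) / 2"
    by simp
  finally show ?thesis using nn[of "pi * (a - b)"] nn[of "pi * (a + b)"] by simp
qed

section \<open>The averaging operator on functions of the interval\<close>

definition Kop :: "nat \<Rightarrow> (real \<Rightarrow> real) \<Rightarrow> real \<Rightarrow> real" where
  "Kop N w \<theta> = (\<Sum>i\<le>N. fejer N i * coeffs w i * eigfun i \<theta>)"

lemma integrable_mult_bounded01:
  assumes "integrable leb01 w" "b \<in> borel_measurable borel" "\<And>x. \<bar>b x\<bar> \<le> (C::real)"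
  shows "integrable leb01 (\<lambda>x. w x * b x)" "integrable leb01 (\<lambda>x. b x * w x)"
proof -
  have w: "w \<in> borel_measurable leb01" using assms(1) by auto
  note [measurable] = assms(2) w
  show *: "integrable leb01 (\<lambda>x. w x * b x)"
  proof (rule Bochner_Integration.integrable_bound)
    show "integrable leb01 (\<lambda>x. w x * C)" using assms by simp
    show "AE x in leb01. norm (w x * b x) \<le> norm (w x * C)"
    proof (rule AE_I2)
      fix x
      have "\<bar>b x\<bar> \<le> \<bar>C\<bar>" using assms(3)[of x] by linarith
      then show "norm (w x * b x) \<le> norm (w x * C)" by (simp add: abs_mult mult_left_mono)
    qed
  qed simp
  then show "integrable leb01 (\<lambda>x. b x * w x)" by (simp add: mult.commute)
qed

lemma integrable_mult_eigfun: "integrable leb01 w \<Longrightarrow> integrable leb01 (\<lambda>x. w x * eigfun i x)"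
  by (rule integrable_mult_bounded01(1)[where C = 2]) (auto simp: abs_eigfun_le)

lemma integrable_bounded01:
  assumes "b \<in> borel_measurable borel" "\<And>x. \<bar>b x\<bar> \<le> (C::real)"
  shows "integrable leb01 b"
  using integrable_mult_bounded01(2)[of "\<lambda>_. 1" b C] assms by simp

lemma integrable_eigfun: "integrable leb01 (eigfun i)"
  by (rule integrable_bounded01[where C = 2]) (auto simp: abs_eigfun_le)

lemma Kop_kernel:
  assumes "integrable leb01 w"
  shows "Kop N w a = (\<integral>b. fker N a b * w b \<partial>leb01)" "integrable leb01 (\<lambda>b. fker N a b * w b)"
proof -
  have *: "fker N a b * w b = (\<Sum>i\<le>N. fejer N i * eigfun i a * (w b * eigfun i b))" for b
    by (simp add: fker_def sum_distrib_left sum_distrib_right algebra_simps)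
  show "Kop N w a = (\<integral>b. fker N a b * w b \<partial>leb01)" "integrable leb01 (\<lambda>b. fker N a b * w b)"
    unfolding * using integrable_mult_eigfun[OF assms]
    by (auto simp: Kop_def coeffs_leb01 intro!: sum.cong)
qed

lemma coeffs_const: "coeffs (\<lambda>_. c) i = c * basis 0 i"
proof -
  have "eigfun 0 = (\<lambda>_. 1)" by (auto simp: eigfun_def)
  then have "coeffs (\<lambda>_. 1) i = basis 0 i" using coeffs_eigfun[of 0] by simp
  then show ?thesis by (simp add: coeffs_leb01)
qed

lemma coeffs_0: "coeffs w 0 = (\<integral>x. w x \<partial>leb01)"
  by (simp add: coeffs_leb01 eigfun_def)

lemma Kop_const: "Kop N (\<lambda>_. c) \<theta> = c"
proof -
  have "Kop N (\<lambda>_. c) \<theta> = (\<Sum>i\<le>N. if i = 0 then c else 0)"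
    unfolding Kop_def coeffs_const by (intro sum.cong) (auto simp: basis_def eigfun_def)
  then show ?thesis by simp
qed

lemma Kop_add:
  "integrable leb01 v \<Longrightarrow> integrable leb01 w \<Longrightarrow> Kop N (\<lambda>x. v x + w x) \<theta> = Kop N v \<theta> + Kop N w \<theta>"
  unfolding Kop_def coeffs_leb01
  by (simp add: distrib_right distrib_left integrable_mult_eigfun sum.distrib)

lemma Kop_mult: "Kop N (\<lambda>x. c * w x) \<theta> = c * Kop N w \<theta>"
  unfolding Kop_def coeffs_leb01 by (simp add: sum_distrib_left mult_ac)

lemma Kop_mono:
  assumes "integrable leb01 v" "integrable leb01 w" "\<And>x. v x \<le> w x"
  shows "Kop N v \<theta> \<le> Kop N w \<theta>"
  unfolding Kop_kernel(1)[OF assms(1)] Kop_kernel(1)[OF assms(2)]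
  by (intro integral_mono Kop_kernel assms mult_left_mono fker_nonneg)

lemma Kop_abs:
  assumes "integrable leb01 v"
  shows "\<bar>Kop N v \<theta>\<bar> \<le> Kop N (\<lambda>x. \<bar>v x\<bar>) \<theta>"
proof -
  have "Kop N (\<lambda>x. -1 * v x) \<theta> \<le> Kop N (\<lambda>x. \<bar>v x\<bar>) \<theta>"
    using assms by (intro Kop_mono) auto
  moreover have "Kop N v \<theta> \<le> Kop N (\<lambda>x. \<bar>v x\<bar>) \<theta>"
    using assms by (intro Kop_mono) auto
  ultimately show ?thesis unfolding Kop_mult by auto
qed

text \<open>The right side is symmetric in \<open>v\<close> and \<open>w\<close>: averaging is
  self-adjoint, and integrals against averages become weighted sums of coefficients, the form in
  which the equation delivers them.\<close>

lemma integral_Kop_mult: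
  assumes "integrable leb01 w"
  shows "integrable leb01 (\<lambda>x. Kop N v x * w x)"
    "(\<integral>x. Kop N v x * w x \<partial>leb01) = (\<Sum>i\<le>N. fejer N i * coeffs v i * coeffs w i)"
proof -
  have *: "Kop N v x * w x = (\<Sum>i\<le>N. fejer N i * coeffs v i * (w x * eigfun i x))" for x
    by (simp add: Kop_def sum_distrib_left sum_distrib_right algebra_simps)
  show "integrable leb01 (\<lambda>x. Kop N v x * w x)"
    "(\<integral>x. Kop N v x * w x \<partial>leb01) = (\<Sum>i\<le>N. fejer N i * coeffs v i * coeffs w i)"
    unfolding * using integrable_mult_eigfun[OF assms]
    by (auto simp: coeffs_leb01)
qed

lemma integral_trig_mult:
  assumes "integrable leb01 w"
  shows "integrable leb01 (\<lambda>x. (\<Sum>i\<le>N. y i * eigfun i x) * w x)"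
    "(\<integral>x. (\<Sum>i\<le>N. y i * eigfun i x) * w x \<partial>leb01) = (\<Sum>i\<le>N. y i * coeffs w i)"
proof -
  have *: "(\<Sum>i\<le>N. y i * eigfun i x) * w x = (\<Sum>i\<le>N. y i * (w x * eigfun i x))" for x
    by (simp add: sum_distrib_left sum_distrib_right algebra_simps)
  show "integrable leb01 (\<lambda>x. (\<Sum>i\<le>N. y i * eigfun i x) * w x)"
    "(\<integral>x. (\<Sum>i\<le>N. y i * eigfun i x) * w x \<partial>leb01) = (\<Sum>i\<le>N. y i * coeffs w i)"
    unfolding * using integrable_mult_eigfun[OF assms]
    by (auto simp: coeffs_leb01)
qed

lemma abs_trig_le: "\<bar>\<Sum>i\<le>N. y i * eigfun i x\<bar> \<le> (\<Sum>i\<le>N. \<bar>y i\<bar> * 2)"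
  by (rule order_trans[OF sum_abs])
    (auto simp: abs_mult intro!: sum_mono mult_left_mono abs_eigfun_le)

lemma integrable_trig: "integrable leb01 (\<lambda>x. \<Sum>i\<le>N. y i * eigfun i x)"
  by (intro Bochner_Integration.integrable_sum integrable_mult_right integrable_eigfun)

lemma coeffs_trig: "coeffs (\<lambda>x. \<Sum>i\<le>N. y i * eigfun i x) j = (if j \<le> N then y j else 0)"
proof -
  have "coeffs (\<lambda>x. \<Sum>i\<le>N. y i * eigfun i x) j = (\<Sum>i\<le>N. y i * coeffs (eigfun j) i)"
    unfolding coeffs_leb01[of _ j] by (rule integral_trig_mult(2)[OF integrable_eigfun])
  also have "\<dots> = (\<Sum>i\<le>N. if i = j then y i else 0)"
    unfolding coeffs_eigfun by (intro sum.cong) (auto simp: basis_def)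
  finally show ?thesis by simp
qed

lemma Kop_as_trig: "Kop N w = (\<lambda>x. \<Sum>i\<le>N. (fejer N i * coeffs w i) * eigfun i x)"
  by (auto simp: Kop_def)

lemma coeffs_Kop: "coeffs (Kop N w) j = (if j \<le> N then fejer N j * coeffs w j else 0)"
  unfolding Kop_as_trig by (rule coeffs_trig)

lemma integrable_Kop: "integrable leb01 (Kop N w)"
  unfolding Kop_as_trig by (rule integrable_trig)

lemma integral_Kop: "(\<integral>x. Kop N w x \<partial>leb01) = (\<integral>x. w x \<partial>leb01)"
  by (simp add: coeffs_0[symmetric] coeffs_Kop)

section \<open>Density of trigonometric polynomials\<close>

definition trig :: "(real \<Rightarrow> real) \<Rightarrow> bool" where
  "trig f \<longleftrightarrow> (\<exists>N y. f = (\<lambda>x. \<Sum>i\<le>N. y i * eigfun i x))"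

lemma trigI: "trig (\<lambda>x. \<Sum>i\<le>N. y i * eigfun i x)"
  by (auto simp: trig_def)

lemma trig_add: assumes "trig f" "trig g" shows "trig (\<lambda>x. f x + g x)"
proof -
  from assms obtain N y M z where f: "f = (\<lambda>x. \<Sum>i\<le>N. y i * eigfun i x)"
    and g: "g = (\<lambda>x. \<Sum>i\<le>M. z i * eigfun i x)" by (auto simp: trig_def)
  have pad: "(\<Sum>i\<le>N. y i * eigfun i x) = (\<Sum>i\<le>N + M. (if i \<le> N then y i else 0) * eigfun i x)"
    for N M y and x :: real
    by (rule sum.mono_neutral_cong_left) auto
  have "f x + g x = (\<Sum>i\<le>N + M. ((if i \<le> N then y i else 0) + (if i \<le> M then z i else 0)) * eigfun i x)" for x
    unfolding f g using pad[where N = N and M = M and y = y] pad[where N = M and M = N and y = z]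
    by (simp add: distrib_right sum.distrib add.commute)
  then show ?thesis by (simp only: trigI)
qed

lemma trig_mult_const: assumes "trig f" shows "trig (\<lambda>x. c * f x)"
proof -
  from assms obtain N y where f: "f = (\<lambda>x. \<Sum>i\<le>N. y i * eigfun i x)" by (auto simp: trig_def)
  have "c * f x = (\<Sum>i\<le>N. (c * y i) * eigfun i x)" for x
    by (simp add: f sum_distrib_left mult.assoc)
  then show ?thesis by (simp only: trigI)
qed

lemma trig_eigfun: "trig (eigfun i)"
proof -
  have "eigfun i x = (\<Sum>j\<le>i. (if j = i then 1 else 0) * eigfun j x)" for x
  proof -
    have "(\<Sum>j\<le>i. (if j = i then 1 else 0) * eigfun j x) = (\<Sum>j\<le>i. if j = i then eigfun j x else 0)"
      by (intro sum.cong) auto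
    then show ?thesis by simp
  qed
  then have "eigfun i = (\<lambda>x. \<Sum>j\<le>i. (if j = i then 1 else 0) * eigfun j x)" by (rule ext)
  then show ?thesis unfolding trig_def by (intro exI)
qed

lemma trig_cos: "trig (\<lambda>x. cos (real i * pi * x))"
proof (cases "i = 0")
  case True
  then show ?thesis using trig_eigfun[of 0] by (simp add: eigfun_def[abs_def])
next
  case False
  then have "cos (real i * pi * x) = 1 / sqrt 2 * eigfun i x" for x by (simp add: eigfun_def)
  then show ?thesis using trig_mult_const[OF trig_eigfun, of "1 / sqrt 2" i] by simp
qed

lemma trig_sum: "finite I \<Longrightarrow> (\<And>i. i \<in> I \<Longrightarrow> trig (F i)) \<Longrightarrow> trig (\<lambda>x. \<Sum>i\<in>I. F i x)"
proof (induction I rule: finite_induct)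
  case empty
  show ?case using trig_mult_const[OF trig_eigfun, of 0 0] by simp
next
  case (insert a I)
  then show ?case by (simp add: trig_add)
qed

text \<open>Product-to-sum formula. By induction all polynomials in \<open>cos (pi * x)\<close> are
  trigonometric, so Stone-Weierstrass can be applied to this algebra instead of a mere linear
  span.\<close>

lemma trig_mult_cos:
  assumes "trig f" shows "trig (\<lambda>x. cos (pi * x) * f x)"
proof -
  have e: "trig (\<lambda>x. cos (pi * x) * eigfun i x)" for i
  proof (cases "i = 0")
    case True
    then show ?thesis using trig_cos[of 1] by (simp add: eigfun_def)
  next
    case False
    then have i: "real (i - 1) = real i - 1" "real (i + 1) = real i + 1" by auto
    have "cos (pi * x) * eigfun i x =
        (sqrt 2 / 2) * (cos (real (i - 1) * pi * x) + cos (real (i + 1) * pi * x))" for x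
      unfolding i using False by (simp add: eigfun_def left_diff_distrib distrib_right cos_diff cos_add)
    then show ?thesis by (simp only: trig_mult_const trig_add trig_cos)
  qed
  from assms obtain N y where f: "f = (\<lambda>x. \<Sum>i\<le>N. y i * eigfun i x)" by (auto simp: trig_def)
  have "cos (pi * x) * f x = (\<Sum>i\<le>N. y i * (cos (pi * x) * eigfun i x))" for x
    by (simp add: f sum_distrib_left algebra_simps)
  then show ?thesis using e by (simp add: trig_sum trig_mult_const)
qed

lemma trig_poly_cos: "trig (\<lambda>x. poly p (cos (pi * x)))"
proof (induction p)
  case 0
  show ?case using trig_mult_const[OF trig_eigfun, of 0 0] by simp
next
  case (pCons a p)
  have "trig (\<lambda>x. a)" using trig_mult_const[OF trig_eigfun, of a 0] by (simp add: eigfun_def)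
  then show ?case using trig_add[OF _ trig_mult_cos[OF pCons(2)]] by simp
qed

text \<open>The polynomials in \<open>cos (pi * x)\<close> separate the points of the unit interval
  because the cosine is injective on \<open>[0, pi]\<close>.\<close>

lemma trig_uniform_approx:
  assumes "continuous_on {0..1} f" "0 < e"
  obtains q where "trig q" "\<And>x. x \<in> {0..1} \<Longrightarrow> \<bar>f x - q x\<bar> < e"
proof -
  interpret function_ring_on "range (\<lambda>p x. poly p (cos (pi * x)))" "{0..1::real}"
  proof
    fix f g :: "real \<Rightarrow> real" and c :: real
    assume f: "f \<in> range (\<lambda>p x. poly p (cos (pi * x)))"
    show "continuous_on {0..1} f" using f by (auto intro!: continuous_intros)
    assume g: "g \<in> range (\<lambda>p x. poly p (cos (pi * x)))"
    from f g obtain p q where "f = (\<lambda>x. poly p (cos (pi * x)))" "g = (\<lambda>x. poly q (cos (pi * x)))" by auto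
    then have "(\<lambda>x. f x + g x) = (\<lambda>x. poly (p + q) (cos (pi * x)))"
      and *: "(\<lambda>x. f x * g x) = (\<lambda>x. poly (p * q) (cos (pi * x)))" by auto
    from this(1) show "(\<lambda>x. f x + g x) \<in> range (\<lambda>p x. poly p (cos (pi * x)))"
      by (rule range_eqI)
    from * show "(\<lambda>x. f x * g x) \<in> range (\<lambda>p x. poly p (cos (pi * x)))"
      by (rule range_eqI)
  next
    fix c :: real
    have "(\<lambda>_. c) = (\<lambda>x::real. poly [:c:] (cos (pi * x)))" by auto
    then show "(\<lambda>_. c) \<in> range (\<lambda>p (x::real). poly p (cos (pi * x)))" by (rule range_eqI)
  next
    fix x y :: real assume xy: "x \<in> {0..1}" "y \<in> {0..1}" "x \<noteq> y"
    then have "cos (pi * x) \<noteq> cos (pi * y)"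
      using cos_inj_pi[of "pi * x" "pi * y"] mult_left_mono[of x 1 pi] mult_left_mono[of y 1 pi] by auto
    then show "\<exists>f\<in>range (\<lambda>p x. poly p (cos (pi * x))). f x \<noteq> f y"
      by (intro bexI[of _ "\<lambda>x. poly [:0, 1:] (cos (pi * x))"] rangeI) simp
  qed simp
  obtain g where "g \<in> range (\<lambda>p x. poly p (cos (pi * x)))" and *: "\<forall>x\<in>{0..1}. \<bar>f x - g x\<bar> < e"
    using Stone_Weierstrass_basic[OF assms] by blast
  from this(1) obtain p where p: "g = (\<lambda>x. poly p (cos (pi * x)))" by (rule rangeE)
  have "trig g" unfolding p by (rule trig_poly_cos)
  then show thesis by (rule that) (use * in simp)
qed

section \<open>Density of trigonometric polynomials in L^p\<close>

lemma AE_leb01I: "AE x in lborel. 0 < x \<longrightarrow> x < 1 \<longrightarrow> P x \<Longrightarrow> AE x in leb01. P x"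
  unfolding leb01_def by (subst AE_restrict_space_iff) auto

lemma even_power_sum3:
  fixes a b c :: real
  assumes "even p"
  shows "(a + b + c) ^ p \<le> 3 ^ p * (a ^ p + b ^ p + c ^ p)"
proof -
  define m where "m = max \<bar>a\<bar> (max \<bar>b\<bar> \<bar>c\<bar>)"
  have "\<bar>a + b + c\<bar> \<le> 3 * m" by (auto simp: m_def)
  then have "\<bar>a + b + c\<bar> ^ p \<le> (3 * m) ^ p" by (intro power_mono) auto
  also have "\<dots> = 3 ^ p * m ^ p" by (simp add: power_mult_distrib)
  also have "m ^ p \<le> a ^ p + b ^ p + c ^ p"
  proof -
    have "m ^ p \<in> {\<bar>a\<bar> ^ p, \<bar>b\<bar> ^ p, \<bar>c\<bar> ^ p}" by (auto simp: m_def max_def)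
    moreover have "0 \<le> a ^ p" "0 \<le> b ^ p" "0 \<le> c ^ p" using assms by (auto simp: zero_le_even_power)
    ultimately show ?thesis unfolding power_even_abs[OF assms] by auto
  qed
  finally show ?thesis unfolding power_even_abs[OF assms] by simp
qed

definition clip :: "real \<Rightarrow> real \<Rightarrow> real" where
  "clip R x = max (- R) (min R x)"

lemma continuous_on_clip [continuous_intros]:
  "continuous_on A f \<Longrightarrow> continuous_on A (\<lambda>x. clip R (f x))"
  unfolding clip_def by (intro continuous_intros)

lemma borel_clip [measurable]: "clip R \<in> borel_measurable borel"
  unfolding clip_def[abs_def] by measurable

lemma abs_clip_le: "0 \<le> R \<Longrightarrow> \<bar>clip R x\<bar> \<le> R"
  by (auto simp: clip_def)

lemma clip_eq: "\<bar>x\<bar> \<le> R \<Longrightarrow> clip R x = x"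
  by (auto simp: clip_def)

lemma abs_diff_clip_le: "0 \<le> R \<Longrightarrow> \<bar>x - clip R x\<bar> \<le> \<bar>x\<bar>"
  by (auto simp: clip_def)

lemma abs_clip_diff_le: "0 \<le> R \<Longrightarrow> \<bar>clip R x - clip R y\<bar> \<le> 2 * R"
  using abs_clip_le[of R x] abs_clip_le[of R y] by linarith

text \<open>The exponent is the one of the solution space. As \<open>f_n\<close> has degree at most
  \<open>2 * n + 1\<close>, it is exactly large enough for \<open>v * f_n(v)\<close> to be
  integrable.\<close>

definition Lp :: "nat \<Rightarrow> (real \<Rightarrow> real) \<Rightarrow> bool" where
  "Lp n v \<longleftrightarrow> v \<in> borel_measurable borel \<and> integrable leb01 (\<lambda>x. v x ^ (2 * n + 2))"

lemma Lp_integrable: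
  assumes "Lp n v" "F \<in> borel_measurable borel" "\<And>b. \<bar>F b\<bar> \<le> C * (1 + b ^ (2 * n + 2))"
  shows "integrable leb01 (\<lambda>x. F (v x))"
proof (rule Bochner_Integration.integrable_bound)
  have [measurable]: "v \<in> borel_measurable borel" "F \<in> borel_measurable borel"
    using assms by (auto simp: Lp_def)
  show "integrable leb01 (\<lambda>x. C * (1 + v x ^ (2 * n + 2)))"
    using assms(1) by (simp add: Lp_def)
  show "(\<lambda>x. F (v x)) \<in> borel_measurable leb01" by measurable
  show "AE x in leb01. norm (F (v x)) \<le> norm (C * (1 + v x ^ (2 * n + 2)))"
    using assms(3) by (intro AE_I2) (force intro: order_trans[OF _ abs_ge_self])
qed

text \<open>Three approximations in turn: the values of \<open>v\<close> are cut off at a level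
  \<open>R\<close>; the bounded function is an almost everywhere limit of continuous ones, which are
  cut off at the same level to have a dominating constant; a continuous function is uniformly close
  to a trigonometric polynomial.\<close>

lemma Lp_trig_dense:
  assumes v: "Lp n v" and e: "0 < e"
  obtains q where "trig q" "(\<integral>x. (v x - q x) ^ (2 * n + 2) \<partial>leb01) < e"
proof -
  define p where "p = 2 * n + 2"
  have p: "even p" "p \<noteq> 0" by (auto simp: p_def)
  have pp: "0 \<le> x ^ p" for x :: real by (rule zero_le_even_power[OF p(1)])
  have pmono: "\<bar>x\<bar> \<le> y \<Longrightarrow> x ^ p \<le> y ^ p" for x y :: real
    using power_mono[of "\<bar>x\<bar>" y p] unfolding power_even_abs[OF p(1)] by simp
  have pmono': "\<bar>x\<bar> \<le> \<bar>y\<bar> \<Longrightarrow> x ^ p \<le> y ^ p" for x y :: real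
    using pmono[of x "\<bar>y\<bar>"] unfolding power_even_abs[OF p(1)] by simp
  have [measurable]: "v \<in> borel_measurable borel" and vi: "integrable leb01 (\<lambda>x. v x ^ p)"
    using v by (auto simp: Lp_def p_def)
  \<comment> \<open>Each of the three errors is at most \<open>d\<close> and is multiplied by
    \<open>3 ^ p\<close> in \<open>even_power_sum3\<close>; the sum is
    \<open>3 / 4 * e\<close>.\<close>
  define d where "d = e / (4 * 3 ^ p)"
  have d: "0 < d" using e by (simp add: d_def)
  have "(\<lambda>j. \<integral>x. (v x - clip (real j) (v x)) ^ p \<partial>leb01) \<longlonglongrightarrow> (\<integral>x. 0 \<partial>leb01)"
  proof (rule integral_dominated_convergence[where w = "\<lambda>x. v x ^ p"])
    show "AE x in leb01. (\<lambda>j. (v x - clip (real j) (v x)) ^ p) \<longlonglongrightarrow> 0"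
    proof (rule AE_I2)
      fix x
      have "\<forall>\<^sub>F j in sequentially. real j \<ge> \<bar>v x\<bar>"
        using filterlim_real_sequentially by (auto simp: filterlim_at_top)
      then have "\<forall>\<^sub>F j in sequentially. (v x - clip (real j) (v x)) ^ p = 0"
        by eventually_elim (use p in \<open>simp add: clip_eq power_0_left\<close>)
      then show "(\<lambda>j. (v x - clip (real j) (v x)) ^ p) \<longlonglongrightarrow> 0"
        by (rule tendsto_eventually)
    qed
    show "AE x in leb01. norm ((v x - clip (real j) (v x)) ^ p) \<le> v x ^ p" for j
      using pp pmono'[OF abs_diff_clip_le] by (intro AE_I2) simp
  qed (use vi in auto)
  then have "\<forall>\<^sub>F j in sequentially. (\<integral>x. (v x - clip (real j) (v x)) ^ p \<partial>leb01) < d"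
    using d by (intro order_tendstoD(2)) auto
  then obtain j where "(\<integral>x. (v x - clip (real j) (v x)) ^ p \<partial>leb01) < d"
    by (rule eventually_happens'[OF sequentially_bot, THEN exE])
  then obtain R :: real where R: "R \<ge> 0" "(\<integral>x. (v x - clip R (v x)) ^ p \<partial>leb01) < d"
    using of_nat_0_le_iff by blast
  have "(\<lambda>x. clip R (v x)) \<in> borel_measurable lebesgue"
    by (rule measurable_completion) simp
  then have "(\<lambda>x. clip R (v x)) measurable_on UNIV"
    by (rule lebesgue_measurable_imp_measurable_on) simp
  \<comment> \<open>\<open>measurable_on\<close> unfolds to being the limit of continuous functions
    off a negligible set.\<close>
  then obtain Z g where Z: "negligible Z" and g: "\<And>j. continuous_on UNIV (g j)"
    and gl: "\<And>x. x \<notin> Z \<Longrightarrow> (\<lambda>j::nat. g j x) \<longlonglongrightarrow> clip R (v x)"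
    unfolding measurable_on_def by auto
  have [measurable]: "g j \<in> borel_measurable borel" for j
    by (rule borel_measurable_continuous_onI[OF g])
  have AZ: "AE x in leb01. x \<notin> Z"
  proof (rule AE_leb01I)
    have "AE x in lebesgue. x \<notin> Z"
      using Z by (intro AE_not_in) (simp add: negligible_iff_null_sets)
    then have "AE x in lborel. x \<notin> Z"
      unfolding AE_completion_iff .
    then show "AE x in lborel. 0 < x \<longrightarrow> x < 1 \<longrightarrow> x \<notin> Z"
      by eventually_elim simp
  qed
  have "(\<lambda>j. \<integral>x. (clip R (v x) - clip R (g j x)) ^ p \<partial>leb01) \<longlonglongrightarrow> (\<integral>x. 0 \<partial>leb01)"
  proof (rule integral_dominated_convergence[where w = "\<lambda>x. (2 * R) ^ p"])
    show "AE x in leb01. (\<lambda>j. (clip R (v x) - clip R (g j x)) ^ p) \<longlonglongrightarrow> 0"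
      using AZ
    proof eventually_elim
      case (elim x)
      have "(\<lambda>j. (clip R (v x) - clip R (g j x)) ^ p) \<longlonglongrightarrow> (clip R (v x) - clip R (clip R (v x))) ^ p"
        using gl[OF elim] unfolding clip_def by (intro tendsto_intros)
      moreover have "clip R (clip R (v x)) = clip R (v x)"
        using R abs_clip_le by (intro clip_eq) auto
      ultimately show ?case using p by (simp add: power_0_left)
    qed
    show "AE x in leb01. norm ((clip R (v x) - clip R (g j x)) ^ p) \<le> (2 * R) ^ p" for j
      using pp pmono[OF abs_clip_diff_le[OF R(1)]] by (intro AE_I2) simp
  qed (auto)
  then have "\<forall>\<^sub>F j in sequentially. (\<integral>x. (clip R (v x) - clip R (g j x)) ^ p \<partial>leb01) < d"
    using d by (intro order_tendstoD(2)) auto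
  then obtain j where j: "(\<integral>x. (clip R (v x) - clip R (g j x)) ^ p \<partial>leb01) < d"
    by (rule eventually_happens'[OF sequentially_bot, THEN exE])
  have gc: "continuous_on {0..1} (\<lambda>x. clip R (g j x))"
    using continuous_on_subset[OF g] by (intro continuous_intros) auto
  \<comment> \<open>A uniform error of at most 1 does not grow under the \<open>p\<close>-th power,
    hence the minimum with 1.\<close>
  obtain q where q: "trig q" "\<And>x. x \<in> {0..1} \<Longrightarrow> \<bar>clip R (g j x) - q x\<bar> < min 1 d"
    by (rule trig_uniform_approx[OF gc, of "min 1 d"]) (use d in auto)
  from q(1) obtain N y where qN: "q = (\<lambda>x. \<Sum>i\<le>N. y i * eigfun i x)" by (auto simp: trig_def)
  have [measurable]: "q \<in> borel_measurable borel" unfolding qN by measurable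
  have qd: "AE x in leb01. norm ((clip R (g j x) - q x) ^ p) \<le> d"
  proof (rule AE_leb01I, rule AE_I2, intro impI)
    fix x :: real assume x: "0 < x" "x < 1"
    have "(clip R (g j x) - q x) ^ p \<le> min 1 d ^ p"
      using q(2)[of x] x by (intro pmono) auto
    also have "\<dots> \<le> min 1 d ^ 1" using p d by (intro power_decreasing) auto
    finally show "norm ((clip R (g j x) - q x) ^ p) \<le> d" using pp by simp
  qed
  have qi: "integrable leb01 (\<lambda>x. (clip R (g j x) - q x) ^ p)"
    by (rule leb01.integrable_const_bound[OF qd]) simp
  have q3: "(\<integral>x. (clip R (g j x) - q x) ^ p \<partial>leb01) \<le> d"
  proof -
    have "(\<integral>x. (clip R (g j x) - q x) ^ p \<partial>leb01) \<le> (\<integral>x. d \<partial>leb01)"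
      using qi qd by (intro integral_mono_AE) (auto elim!: eventually_mono)
    then show ?thesis by (simp add: leb01.prob_space)
  qed
  have i1: "integrable leb01 (\<lambda>x. (v x - clip R (v x)) ^ p)"
    by (rule Bochner_Integration.integrable_bound[OF vi])
      (use pmono'[OF abs_diff_clip_le[OF R(1)]] pp in \<open>simp_all add: AE_I2\<close>)
  have i2: "integrable leb01 (\<lambda>x. (clip R (v x) - clip R (g j x)) ^ p)"
    by (rule leb01.integrable_const_bound[where B = "(2 * R) ^ p"])
      (use pmono[OF abs_clip_diff_le[OF R(1)]] pp in \<open>simp_all add: AE_I2\<close>)
  have sp: "(v x - q x) ^ p \<le> 3 ^ p * ((v x - clip R (v x)) ^ p + (clip R (v x) - clip R (g j x)) ^ p
      + (clip R (g j x) - q x) ^ p)" for x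
    using even_power_sum3[OF p(1), of "v x - clip R (v x)" "clip R (v x) - clip R (g j x)" "clip R (g j x) - q x"]
    by simp
  have "(\<integral>x. (v x - q x) ^ p \<partial>leb01) \<le> (\<integral>x. 3 ^ p * ((v x - clip R (v x)) ^ p
      + (clip R (v x) - clip R (g j x)) ^ p + (clip R (g j x) - q x) ^ p) \<partial>leb01)"
  proof (rule integral_mono[OF _ _ sp])
    show "integrable leb01 (\<lambda>x. (v x - q x) ^ p)"
      by (rule Bochner_Integration.integrable_bound[where f = "\<lambda>x. 3 ^ p * ((v x - clip R (v x)) ^ p
        + (clip R (v x) - clip R (g j x)) ^ p + (clip R (g j x) - q x) ^ p)"])
       (use i1 i2 qi sp pp in \<open>simp_all add: AE_I2 add_nonneg_nonneg\<close>)
  qed (use i1 i2 qi in auto)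
  also have "\<dots> < 3 ^ p * (d + d + d)"
    using i1 i2 qi R(2) j q3 by simp
  also have "\<dots> < e" using e by (simp add: d_def)
  finally show thesis using that q(1) by (simp add: p_def)
qed

section \<open>The nonlinearity and Fejer means\<close>

definition gpoly :: "nat \<Rightarrow> real \<Rightarrow> real" where
  "gpoly n u = (\<Sum>k\<le>n. u ^ (2 * k + 1) / real (2 * k + 1))"

definition Gpoly :: "nat \<Rightarrow> real \<Rightarrow> real" where
  "Gpoly n u = (\<Sum>k\<le>n. u ^ (2 * k + 2) / (real (2 * k + 1) * real (2 * k + 2)))"

text \<open>Minus \<open>f_n\<close>, with the coefficient of the linear part replaced by its
  absolute value. The averaging defect built on it then dominates two things at once: the defect of
  the convex part, and \<open>\<bar>lam\<bar>\<close> times the \<open>L2\<close> defect, which pays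
  for the linear part of either sign (see \<open>err_split\<close>).\<close>

definition ghat :: "real \<Rightarrow> nat \<Rightarrow> real \<Rightarrow> real" where
  "ghat lam n u = 2 * gpoly n u + \<bar>lam\<bar> * u"

lemma fpoly_gpoly: "fpoly lam n u = - 2 * gpoly n u + lam * u"
  by (simp add: fpoly_def gpoly_def)

lemma borel_polys [measurable]:
  "gpoly n \<in> borel_measurable borel" "Gpoly n \<in> borel_measurable borel"
  "ghat lam n \<in> borel_measurable borel" "fpoly lam n \<in> borel_measurable borel"
  unfolding gpoly_def[abs_def] Gpoly_def[abs_def] ghat_def[abs_def] fpoly_def[abs_def] by measurable

text \<open>Convexity of the even powers, term by term; \<open>gpoly\<close> is the derivative of
  \<open>Gpoly\<close>. Since the left side is affine in \<open>b\<close>, the inequality survives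
  integration over \<open>b\<close> against a positive kernel of mass 1, which is how Jensen's
  inequality is obtained below.\<close>

lemma Gpoly_tangent: "Gpoly n a + gpoly n a * (b - a) \<le> Gpoly n b"
proof -
  have t: "(2 * real k + 2) * a ^ (2 * k + 1) * (b - a) \<le> b ^ (2 * k + 2) - a ^ (2 * k + 2)" for k
  proof (rule convex_on_imp_above_tangent[where A = UNIV])
    show "convex_on UNIV (\<lambda>x::real. x ^ (2 * k + 2))" by (rule convex_power_even) simp
    show "((\<lambda>x. x ^ (2 * k + 2)) has_real_derivative (2 * real k + 2) * a ^ (2 * k + 1)) (at a)"
      by (rule DERIV_cong[OF DERIV_pow]) simp
  qed auto
  have "a ^ (2 * k + 2) / (real (2 * k + 1) * real (2 * k + 2)) + a ^ (2 * k + 1) / real (2 * k + 1) * (b - a)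
      \<le> b ^ (2 * k + 2) / (real (2 * k + 1) * real (2 * k + 2))" for k
  proof -
    have p: "0 < real (2 * k + 1) * real (2 * k + 2)" by simp
    have "a ^ (2 * k + 2) / (real (2 * k + 1) * real (2 * k + 2)) + a ^ (2 * k + 1) / real (2 * k + 1) * (b - a)
      = (a ^ (2 * k + 2) + (2 * real k + 2) * a ^ (2 * k + 1) * (b - a)) / (real (2 * k + 1) * real (2 * k + 2))"
    proof -
      have "a ^ (2 * k + 1) / real (2 * k + 1) * (b - a)
        = ((2 * real k + 2) * a ^ (2 * k + 1) * (b - a)) / (real (2 * k + 1) * real (2 * k + 2))"
        by (simp add: frac_eq_eq del: power_Suc)
      then show ?thesis by (simp only: add_divide_distrib)
    qed
    also have "\<dots> \<le> b ^ (2 * k + 2) / (real (2 * k + 1) * real (2 * k + 2))"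
      using t[of k] p by (intro divide_right_mono) auto
    finally show ?thesis .
  qed
  then show ?thesis
    unfolding Gpoly_def gpoly_def sum_distrib_right sum.distrib[symmetric] by (intro sum_mono)
qed

text \<open>Cutting the modulus off from below at 1 makes powers increasing in the exponent, so that
  one power dominates every lower monomial.\<close>

definition mx :: "real \<Rightarrow> real" where
  "mx b = max 1 \<bar>b\<bar>"

lemma mx_ge: "1 \<le> mx b" "\<bar>b\<bar> \<le> mx b" "0 \<le> mx b"
  by (auto simp: mx_def)

lemma even_pow_nonneg: "0 \<le> (x::real) ^ (2 * n + 2)"
  by (rule zero_le_even_power) simp

lemma mx_pow_le: "mx b ^ (2 * n + 2) \<le> 1 + b ^ (2 * n + 2)"
proof -
  have "\<bar>b\<bar> ^ (2 * n + 2) = b ^ (2 * n + 2)" by (rule power_even_abs) simp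
  then show ?thesis using even_pow_nonneg[of b n] by (auto simp: mx_def max_def simp del: power_Suc)
qed

lemma abs_pow_le_mx: "j \<le> m \<Longrightarrow> \<bar>b ^ j\<bar> \<le> mx b ^ m"
proof -
  assume "j \<le> m"
  have "\<bar>b ^ j\<bar> \<le> mx b ^ j" unfolding power_abs by (intro power_mono mx_ge) auto
  also have "\<dots> \<le> mx b ^ m" using \<open>j \<le> m\<close> mx_ge by (intro power_increasing) auto
  finally show ?thesis .
qed

definition Cg :: "real \<Rightarrow> nat \<Rightarrow> real" where
  "Cg lam n = 2 * (real n + 1) + \<bar>lam\<bar>"

lemma Cg_nonneg: "0 \<le> Cg lam n"
  by (simp add: Cg_def)

lemma abs_gpoly_le: "\<bar>gpoly n b\<bar> \<le> (real n + 1) * mx b ^ (2 * n + 1)"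
proof -
  have "\<bar>gpoly n b\<bar> \<le> (\<Sum>k\<le>n. \<bar>b ^ (2 * k + 1) / real (2 * k + 1)\<bar>)"
    unfolding gpoly_def by (rule sum_abs)
  also have "\<dots> \<le> (\<Sum>k\<le>n. mx b ^ (2 * n + 1))"
  proof (rule sum_mono)
    fix k assume "k \<in> {..n}"
    have "\<bar>b ^ (2 * k + 1) / real (2 * k + 1)\<bar> = \<bar>b ^ (2 * k + 1)\<bar> / real (2 * k + 1)"
      by (simp add: abs_divide)
    also have "\<dots> \<le> \<bar>b ^ (2 * k + 1)\<bar> / 1"
      by (intro divide_left_mono) auto
    also have "\<dots> \<le> mx b ^ (2 * n + 1)"
      using abs_pow_le_mx[of "2 * k + 1" "2 * n + 1" b] \<open>k \<in> {..n}\<close> by simp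
    finally show "\<bar>b ^ (2 * k + 1) / real (2 * k + 1)\<bar> \<le> mx b ^ (2 * n + 1)" .
  qed
  finally show ?thesis by (simp add: add.commute)
qed

lemma abs_poly_le:
  "\<bar>ghat lam n b\<bar> \<le> Cg lam n * mx b ^ (2 * n + 1)" "\<bar>fpoly lam n b\<bar> \<le> Cg lam n * mx b ^ (2 * n + 1)"
proof -
  have g: "\<bar>2 * gpoly n b\<bar> \<le> 2 * (real n + 1) * mx b ^ (2 * n + 1)"
  proof -
    have "\<bar>2 * gpoly n b\<bar> = 2 * \<bar>gpoly n b\<bar>" by simp
    also have "\<dots> \<le> 2 * ((real n + 1) * mx b ^ (2 * n + 1))" by (intro mult_left_mono abs_gpoly_le) simp
    finally show ?thesis by (simp only: mult.assoc)
  qed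
  have b: "\<bar>b\<bar> \<le> mx b ^ (2 * n + 1)" using abs_pow_le_mx[of 1 "2 * n + 1" b] by simp
  have l: "\<bar>lam * b\<bar> \<le> \<bar>lam\<bar> * mx b ^ (2 * n + 1)" "\<bar>\<bar>lam\<bar> * b\<bar> \<le> \<bar>lam\<bar> * mx b ^ (2 * n + 1)"
    using mult_left_mono[OF b, of "\<bar>lam\<bar>"] by (simp_all add: abs_mult)
  show "\<bar>ghat lam n b\<bar> \<le> Cg lam n * mx b ^ (2 * n + 1)"
    using abs_triangle_ineq[of "2 * gpoly n b" "\<bar>lam\<bar> * b"] g l
    unfolding ghat_def Cg_def distrib_right by linarith
  have "fpoly lam n b = - (2 * gpoly n b) + lam * b" by (simp add: fpoly_gpoly)
  then show "\<bar>fpoly lam n b\<bar> \<le> Cg lam n * mx b ^ (2 * n + 1)"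
    using abs_triangle_ineq[of "- (2 * gpoly n b)" "lam * b"] g l
    unfolding Cg_def distrib_right abs_minus_cancel by linarith
qed

text \<open>A crude form of Young's inequality. Comparing \<open>\<bar>a\<bar>\<close> with
  \<open>d * mx b\<close>, one of the two terms on the right dominates by itself in either
  case.\<close>

lemma mx_young:
  assumes "0 < d"
  shows "\<bar>a\<bar> * mx b ^ (2 * n + 1) \<le> d * mx b ^ (2 * n + 2) + a ^ (2 * n + 2) / d ^ (2 * n + 1)"
proof (cases "\<bar>a\<bar> \<le> d * mx b")
  case True
  have "\<bar>a\<bar> * mx b ^ (2 * n + 1) \<le> (d * mx b) * mx b ^ (2 * n + 1)"
    using True mx_ge(3) by (intro mult_right_mono) auto
  also have "\<dots> = d * mx b ^ (2 * n + 2)" by simp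
  finally show ?thesis using even_pow_nonneg[of a n] assms
    by (simp add: add_increasing2 del: power_Suc)
next
  case False
  then have "mx b \<le> \<bar>a\<bar> / d" using assms by (simp add: field_simps)
  then have "\<bar>a\<bar> * mx b ^ (2 * n + 1) \<le> \<bar>a\<bar> * (\<bar>a\<bar> / d) ^ (2 * n + 1)"
    using mx_ge(3) by (intro mult_left_mono power_mono) auto
  also have "\<dots> = \<bar>a\<bar> ^ (2 * n + 2) / d ^ (2 * n + 1)"
    by (simp add: power_divide)
  also have "\<bar>a\<bar> ^ (2 * n + 2) = a ^ (2 * n + 2)" by (rule power_even_abs) simp
  finally show ?thesis using assms mx_ge(3)[of b] by (simp add: add_increasing del: power_Suc)
qed

lemma Lp_borel: "Lp n v \<Longrightarrow> v \<in> borel_measurable borel"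
  by (simp add: Lp_def)

lemma Lp_pow: "Lp n v \<Longrightarrow> integrable leb01 (\<lambda>x. v x ^ (2 * n + 2))"
  by (simp add: Lp_def)

lemma mx_le_pow: "mx b ^ (2 * n + 1) \<le> 1 + b ^ (2 * n + 2)"
proof -
  have "mx b ^ (2 * n + 1) \<le> mx b ^ (2 * n + 2)" using mx_ge by (intro power_increasing) auto
  then show ?thesis using mx_pow_le[of b n] by linarith
qed

lemma mult_mx_le_pow: "\<bar>b\<bar> * mx b ^ (2 * n + 1) \<le> 1 + b ^ (2 * n + 2)"
proof -
  have "\<bar>b\<bar> * mx b ^ (2 * n + 1) \<le> mx b * mx b ^ (2 * n + 1)"
    using mx_ge by (intro mult_right_mono) auto
  then show ?thesis using mx_pow_le[of b n] by simp
qed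

lemma Lp_int:
  assumes "Lp n v"
  shows "integrable leb01 v" "integrable leb01 (\<lambda>x. gpoly n (v x))" "integrable leb01 (\<lambda>x. Gpoly n (v x))"
    "integrable leb01 (\<lambda>x. ghat lam n (v x))" "integrable leb01 (\<lambda>x. fpoly lam n (v x))"
    "integrable leb01 (\<lambda>x. v x * gpoly n (v x))" "integrable leb01 (\<lambda>x. v x * v x)"
    "integrable leb01 (\<lambda>x. v x * ghat lam n (v x))" "integrable leb01 (\<lambda>x. v x * fpoly lam n (v x))"
proof -
  note L = Lp_integrable[OF assms]
  have m: "a * mx b ^ (2 * n + 1) \<le> a * (1 + b ^ (2 * n + 2))" if "0 \<le> a" for a b
    using mx_le_pow that by (intro mult_left_mono)
  have m': "\<bar>b * c\<bar> \<le> a * (1 + b ^ (2 * n + 2))" if "0 \<le> a" "\<bar>c\<bar> \<le> a * mx b ^ (2 * n + 1)" for a b c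
  proof -
    have "\<bar>b * c\<bar> \<le> \<bar>b\<bar> * (a * mx b ^ (2 * n + 1))" unfolding abs_mult using that by (intro mult_left_mono) auto
    also have "\<dots> = a * (\<bar>b\<bar> * mx b ^ (2 * n + 1))" by simp
    also have "\<dots> \<le> a * (1 + b ^ (2 * n + 2))" using that mult_mx_le_pow by (intro mult_left_mono)
    finally show ?thesis .
  qed
  have v1: "\<bar>b\<bar> \<le> 1 * mx b ^ (2 * n + 1)" for b using abs_pow_le_mx[of 1 "2 * n + 1" b] by simp
  show "integrable leb01 v"
    using order_trans[OF v1 m[of 1]] by (intro L[where F = "\<lambda>x. x" and C = 1]) auto
  show "integrable leb01 (\<lambda>x. v x * v x)"
    by (rule L[where F = "\<lambda>x. x * x" and C = 1]) (use m'[OF _ v1] in auto)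
  show "integrable leb01 (\<lambda>x. gpoly n (v x))" "integrable leb01 (\<lambda>x. ghat lam n (v x))"
    "integrable leb01 (\<lambda>x. fpoly lam n (v x))"
    by (rule L[OF _ order_trans[OF abs_gpoly_le m]] L[OF _ order_trans[OF abs_poly_le(1) m]]
        L[OF _ order_trans[OF abs_poly_le(2) m]]; simp add: Cg_nonneg)+
  show "integrable leb01 (\<lambda>x. v x * gpoly n (v x))" "integrable leb01 (\<lambda>x. v x * ghat lam n (v x))"
    "integrable leb01 (\<lambda>x. v x * fpoly lam n (v x))"
    by (rule L[OF _ m'[OF _ abs_gpoly_le]] L[OF _ m'[OF _ abs_poly_le(1)]]
        L[OF _ m'[OF _ abs_poly_le(2)]]; simp add: Cg_nonneg)+
  have "\<bar>Gpoly n b\<bar> \<le> (real n + 1) * (1 + b ^ (2 * n + 2))" for b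
  proof -
    have "\<bar>Gpoly n b\<bar> \<le> (\<Sum>k\<le>n. \<bar>b ^ (2 * k + 2) / (real (2 * k + 1) * real (2 * k + 2))\<bar>)"
      unfolding Gpoly_def by (rule sum_abs)
    also have "\<dots> \<le> (\<Sum>k\<le>n. mx b ^ (2 * n + 2))"
    proof (rule sum_mono)
      fix k assume "k \<in> {..n}"
      have ge1: "1 \<le> real (2 * k + 1) * real (2 * k + 2)"
        using mult_mono[of 1 "real (2 * k + 1)" 1 "real (2 * k + 2)"] by simp
      have "\<bar>b ^ (2 * k + 2) / (real (2 * k + 1) * real (2 * k + 2))\<bar>
          = \<bar>b ^ (2 * k + 2)\<bar> / (real (2 * k + 1) * real (2 * k + 2))"
        unfolding abs_divide abs_mult abs_of_nat ..
      also have "\<dots> \<le> \<bar>b ^ (2 * k + 2)\<bar> / 1"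
        using ge1 by (intro divide_left_mono) auto
      also have "\<dots> \<le> mx b ^ (2 * n + 2)"
        using abs_pow_le_mx[of "2 * k + 2" "2 * n + 2" b] \<open>k \<in> {..n}\<close> by simp
      finally show "\<bar>b ^ (2 * k + 2) / (real (2 * k + 1) * real (2 * k + 2))\<bar> \<le> mx b ^ (2 * n + 2)" .
    qed
    also have "\<dots> = (real n + 1) * mx b ^ (2 * n + 2)" by (simp add: add.commute)
    also have "\<dots> \<le> (real n + 1) * (1 + b ^ (2 * n + 2))" by (intro mult_left_mono mx_pow_le) auto
    finally show ?thesis .
  qed
  then show "integrable leb01 (\<lambda>x. Gpoly n (v x))" by (intro L) auto
qed

text \<open>Young's inequality is applied under the positive kernel with \<open>b\<close> frozen.
  The average of \<open>z ^ (2 * n + 2)\<close> has the same integral as the function itself, so the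
  integrated bound does not see \<open>N\<close>.\<close>

lemma Kop_young:
  assumes z: "Lp n z" and d: "0 < d"
  shows "\<bar>Kop N z a\<bar> * mx b ^ (2 * n + 1) \<le> d * mx b ^ (2 * n + 2) + Kop N (\<lambda>x. z x ^ (2 * n + 2)) a / d ^ (2 * n + 1)"
proof -
  have "\<bar>Kop N z a\<bar> * mx b ^ (2 * n + 1) \<le> Kop N (\<lambda>x. \<bar>z x\<bar>) a * mx b ^ (2 * n + 1)"
    using Lp_int(1)[OF z] mx_ge(3) by (intro mult_right_mono Kop_abs zero_le_power)
  also have "\<dots> = Kop N (\<lambda>x. mx b ^ (2 * n + 1) * \<bar>z x\<bar>) a"
    unfolding Kop_mult by simp
  also have "\<dots> \<le> Kop N (\<lambda>x. d * mx b ^ (2 * n + 2) + (1 / d ^ (2 * n + 1)) * z x ^ (2 * n + 2)) a"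
  proof (rule Kop_mono)
    fix x
    show "mx b ^ (2 * n + 1) * \<bar>z x\<bar> \<le> d * mx b ^ (2 * n + 2) + (1 / d ^ (2 * n + 1)) * z x ^ (2 * n + 2)"
      using mx_young[OF d, of "z x" b n] by (simp add: mult.commute)
  qed (use Lp_int(1)[OF z] Lp_pow[OF z] in \<open>auto simp del: power_Suc\<close>)
  also have "\<dots> = d * mx b ^ (2 * n + 2) + (1 / d ^ (2 * n + 1)) * Kop N (\<lambda>x. z x ^ (2 * n + 2)) a"
  proof -
    have "integrable leb01 (\<lambda>x. (1 / d ^ (2 * n + 1)) * z x ^ (2 * n + 2))"
      using Lp_pow[OF z] by (rule integrable_mult_right)
    then have "Kop N (\<lambda>x. d * mx b ^ (2 * n + 2) + (1 / d ^ (2 * n + 1)) * z x ^ (2 * n + 2)) a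
      = Kop N (\<lambda>_. d * mx b ^ (2 * n + 2)) a + Kop N (\<lambda>x. (1 / d ^ (2 * n + 1)) * z x ^ (2 * n + 2)) a"
      by (intro Kop_add) simp_all
    then show ?thesis unfolding Kop_mult Kop_const .
  qed
  finally show ?thesis by (simp del: power_Suc)
qed

text \<open>The same right side for \<open>z\<close> and for its average, whatever \<open>N\<close>
  is: a remainder that is small in \<open>L^p\<close> stays harmless after averaging.\<close>

lemma integral_ghat_young:
  assumes v: "Lp n v" and z: "Lp n z" and d: "0 < d"
  shows "integrable leb01 (\<lambda>x. z x * ghat lam n (v x))"
    "\<bar>\<integral>x. z x * ghat lam n (v x) \<partial>leb01\<bar> \<le>
      Cg lam n * (d * (1 + (\<integral>x. v x ^ (2 * n + 2) \<partial>leb01)) + (\<integral>x. z x ^ (2 * n + 2) \<partial>leb01) / d ^ (2 * n + 1))"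
    "\<bar>\<integral>x. Kop N z x * ghat lam n (v x) \<partial>leb01\<bar> \<le>
      Cg lam n * (d * (1 + (\<integral>x. v x ^ (2 * n + 2) \<partial>leb01)) + (\<integral>x. z x ^ (2 * n + 2) \<partial>leb01) / d ^ (2 * n + 1))"
proof -
  note [measurable] = Lp_borel[OF v] Lp_borel[OF z]
  note vi = Lp_pow[OF v] and zi = Lp_pow[OF z]
  have step: "\<bar>a * ghat lam n b\<bar> \<le> Cg lam n * (d * (1 + b ^ (2 * n + 2)) + c)"
    if "\<bar>a\<bar> * mx b ^ (2 * n + 1) \<le> d * mx b ^ (2 * n + 2) + c" for a b c
  proof -
    have "\<bar>a * ghat lam n b\<bar> \<le> \<bar>a\<bar> * (Cg lam n * mx b ^ (2 * n + 1))"
      unfolding abs_mult by (intro mult_left_mono abs_poly_le) auto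
    also have "\<dots> = Cg lam n * (\<bar>a\<bar> * mx b ^ (2 * n + 1))" by simp
    also have "\<dots> \<le> Cg lam n * (d * mx b ^ (2 * n + 2) + c)"
      by (intro mult_left_mono that Cg_nonneg)
    also have "\<dots> \<le> Cg lam n * (d * (1 + b ^ (2 * n + 2)) + c)"
      using d by (intro mult_left_mono add_mono mx_pow_le Cg_nonneg) auto
    finally show ?thesis .
  qed
  let ?B = "\<lambda>x. Cg lam n * (d * (1 + v x ^ (2 * n + 2)) + z x ^ (2 * n + 2) / d ^ (2 * n + 1))"
  have Bi: "integrable leb01 ?B" using vi zi by (simp del: power_Suc)
  have p1: "\<bar>z x * ghat lam n (v x)\<bar> \<le> ?B x" for x by (rule step[OF mx_young[OF d]])
  show i1: "integrable leb01 (\<lambda>x. z x * ghat lam n (v x))"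
    by (rule Bochner_Integration.integrable_bound[OF Bi])
       (use p1 in \<open>auto intro!: AE_I2 order_trans[OF _ abs_ge_self] simp del: power_Suc\<close>)
  have "\<bar>\<integral>x. z x * ghat lam n (v x) \<partial>leb01\<bar> \<le> (\<integral>x. \<bar>z x * ghat lam n (v x)\<bar> \<partial>leb01)"
    by (rule integral_abs_bound)
  also have "\<dots> \<le> (\<integral>x. ?B x \<partial>leb01)"
    using i1 Bi p1 by (intro integral_mono) auto
  finally show "\<bar>\<integral>x. z x * ghat lam n (v x) \<partial>leb01\<bar> \<le>
      Cg lam n * (d * (1 + (\<integral>x. v x ^ (2 * n + 2) \<partial>leb01)) + (\<integral>x. z x ^ (2 * n + 2) \<partial>leb01) / d ^ (2 * n + 1))"
    using vi zi by (simp add: leb01.prob_space del: power_Suc)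
  let ?D = "\<lambda>x. Cg lam n * (d * (1 + v x ^ (2 * n + 2)) + Kop N (\<lambda>x. z x ^ (2 * n + 2)) x / d ^ (2 * n + 1))"
  have Di: "integrable leb01 ?D" using vi integrable_Kop by (simp del: power_Suc)
  have p2: "\<bar>Kop N z x * ghat lam n (v x)\<bar> \<le> ?D x" for x by (rule step[OF Kop_young[OF z d]])
  have i2: "integrable leb01 (\<lambda>x. Kop N z x * ghat lam n (v x))"
    by (rule integral_Kop_mult Lp_int v)+
  have "\<bar>\<integral>x. Kop N z x * ghat lam n (v x) \<partial>leb01\<bar> \<le> (\<integral>x. \<bar>Kop N z x * ghat lam n (v x)\<bar> \<partial>leb01)"
    by (rule integral_abs_bound)
  also have "\<dots> \<le> (\<integral>x. ?D x \<partial>leb01)"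
    using i2 Di p2 by (intro integral_mono) auto
  finally show "\<bar>\<integral>x. Kop N z x * ghat lam n (v x) \<partial>leb01\<bar> \<le>
      Cg lam n * (d * (1 + (\<integral>x. v x ^ (2 * n + 2) \<partial>leb01)) + (\<integral>x. z x ^ (2 * n + 2) \<partial>leb01) / d ^ (2 * n + 1))"
    using vi integrable_Kop by (simp add: leb01.prob_space integral_Kop del: power_Suc)
qed

section \<open>The averaging defect of the nonlinear term\<close>

definition err :: "real \<Rightarrow> nat \<Rightarrow> nat \<Rightarrow> (real \<Rightarrow> real) \<Rightarrow> real" where
  "err lam n N v = (\<integral>x. (v x - Kop N v x) * ghat lam n (v x) \<partial>leb01)"

lemma err_eq:
  assumes "Lp n v"
  shows "err lam n N v = (\<integral>x. v x * ghat lam n (v x) \<partial>leb01)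
    - (\<Sum>i\<le>N. fejer N i * coeffs v i * coeffs (\<lambda>x. ghat lam n (v x)) i)"
  unfolding err_def left_diff_distrib
  by (subst Bochner_Integration.integral_diff)
    (auto simp: assms Lp_int integral_Kop_mult)

text \<open>Uniform in \<open>N\<close>; this is the majorant for dominated convergence in
  time.\<close>

lemma abs_err_le:
  assumes "Lp n v"
  shows "\<bar>err lam n N v\<bar> \<le> 2 * Cg lam n * (1 + 2 * (\<integral>x. v x ^ (2 * n + 2) \<partial>leb01))"
proof -
  have "err lam n N v = (\<integral>x. v x * ghat lam n (v x) \<partial>leb01) - (\<integral>x. Kop N v x * ghat lam n (v x) \<partial>leb01)"
    using assms by (simp add: err_eq integral_Kop_mult Lp_int)
  then show ?thesis
    using integral_ghat_young(2)[OF assms assms, where d = 1 and lam = lam]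
      integral_ghat_young(3)[OF assms assms, where d = 1 and lam = lam and N = N]
    by (simp add: algebra_simps del: power_Suc)
qed

lemma Lp_trig_diff:
  assumes v: "Lp n v" and q: "trig q"
  shows "Lp n q" "Lp n (\<lambda>x. v x - q x)"
proof -
  from q obtain m y where qm: "q = (\<lambda>x. \<Sum>i\<le>m. y i * eigfun i x)" by (auto simp: trig_def)
  have [measurable]: "q \<in> borel_measurable borel" unfolding qm by measurable
  note [measurable] = Lp_borel[OF v]
  define Cq where "Cq = (\<Sum>i\<le>m. \<bar>y i\<bar> * 2)"
  have "\<bar>q x\<bar> \<le> Cq" for x unfolding qm Cq_def by (rule abs_trig_le)
  then have b: "\<bar>q x ^ (2 * n + 2)\<bar> \<le> Cq ^ (2 * n + 2)" for x
    unfolding power_abs by (intro power_mono) auto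
  have qi: "integrable leb01 (\<lambda>x. q x ^ (2 * n + 2))"
    by (rule integrable_bounded01[OF _ b]) measurable
  then show "Lp n q" by (simp add: Lp_def del: power_Suc)
  have le: "(v x - q x) ^ (2 * n + 2) \<le> 3 ^ (2 * n + 2) * (v x ^ (2 * n + 2) + q x ^ (2 * n + 2))" for x
  proof -
    have "(- q x) ^ (2 * n + 2) = q x ^ (2 * n + 2)" by (simp add: uminus_power_if)
    then show ?thesis
      using even_power_sum3[of "2 * n + 2" "v x" "- q x" 0] by (simp del: power_Suc)
  qed
  have "integrable leb01 (\<lambda>x. (v x - q x) ^ (2 * n + 2))"
  proof (rule Bochner_Integration.integrable_bound)
    show "integrable leb01 (\<lambda>x. 3 ^ (2 * n + 2) * (v x ^ (2 * n + 2) + q x ^ (2 * n + 2)))"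
      using Lp_pow[OF v] qi by (simp del: power_Suc)
    show "AE x in leb01. norm ((v x - q x) ^ (2 * n + 2)) \<le> norm (3 ^ (2 * n + 2) * (v x ^ (2 * n + 2) + q x ^ (2 * n + 2)))"
    proof (rule AE_I2)
      fix x
      show "norm ((v x - q x) ^ (2 * n + 2)) \<le> norm (3 ^ (2 * n + 2) * (v x ^ (2 * n + 2) + q x ^ (2 * n + 2)))"
        using le[of x] even_pow_nonneg[of "v x - q x" n] unfolding real_norm_def by linarith
    qed
  qed measurable
  then show "Lp n (\<lambda>x. v x - q x)" by (simp add: Lp_def del: power_Suc)
qed

text \<open>Split \<open>v\<close> into a trigonometric polynomial and a remainder \<open>z\<close>
  small in \<open>L^p\<close>. On the polynomial the defect is a finite sum with factors
  \<open>1 - fejer N i\<close>, which tend to 0; the contribution of \<open>z\<close> is small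
  uniformly in \<open>N\<close> by \<open>integral_ghat_young\<close>.\<close>

lemma tendsto_err:
  assumes v: "Lp n v"
  shows "(\<lambda>N. err lam n N v) \<longlonglongrightarrow> 0"
proof (rule LIMSEQ_I)
  fix e :: real assume e: "0 < e"
  define I where "I = (\<integral>x. v x ^ (2 * n + 2) \<partial>leb01)"
  have I: "0 \<le> I" unfolding I_def by (intro integral_nonneg_AE AE_I2 even_pow_nonneg)
  \<comment> \<open>The parameter of Young's inequality is chosen first, against the norm of
    \<open>v\<close>; the size \<open>s\<close> of the remainder is chosen next, against the power
    of \<open>d\<close> in the denominator. Both terms are then at most \<open>e / 8\<close>, so
    each of the two remainder integrals is at most \<open>e / 4\<close>.\<close>
  define d where "d = e / (8 * (Cg lam n + 1) * (1 + I))"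
  have d: "0 < d" using e I Cg_nonneg[of lam n] by (simp add: d_def)
  have dC: "Cg lam n * (d * (1 + I)) \<le> e / 8"
  proof -
    have "Cg lam n * (d * (1 + I)) = e / 8 * (Cg lam n / (Cg lam n + 1))"
    proof -
      have "d * (1 + I) = e / (8 * (Cg lam n + 1))" using I by (simp add: d_def)
      then show ?thesis by simp
    qed
    also have "\<dots> \<le> e / 8 * 1"
      using e Cg_nonneg[of lam n] by (intro mult_left_mono) auto
    finally show ?thesis by simp
  qed
  define s where "s = e * d ^ (2 * n + 1) / (8 * (Cg lam n + 1))"
  have s: "0 < s" using e d Cg_nonneg[of lam n] by (simp add: s_def)
  obtain q where q: "trig q" "(\<integral>x. (v x - q x) ^ (2 * n + 2) \<partial>leb01) < s"
    by (rule Lp_trig_dense[OF v s])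
  define z where "z x = v x - q x" for x
  have z: "Lp n z" unfolding z_def by (rule Lp_trig_diff[OF v q(1)])
  from q(1) obtain m y where qm: "q = (\<lambda>x. \<Sum>i\<le>m. y i * eigfun i x)" by (auto simp: trig_def)
  define w where "w i = coeffs (\<lambda>x. ghat lam n (v x)) i" for i
  have sC: "Cg lam n * ((\<integral>x. z x ^ (2 * n + 2) \<partial>leb01) / d ^ (2 * n + 1)) \<le> e / 8"
  proof -
    have "Cg lam n * ((\<integral>x. z x ^ (2 * n + 2) \<partial>leb01) / d ^ (2 * n + 1)) \<le> Cg lam n * (s / d ^ (2 * n + 1))"
      using q(2) d Cg_nonneg[of lam n] unfolding z_def
      by (intro mult_left_mono divide_right_mono) (auto simp del: power_Suc)
    also have "\<dots> = e / 8 * (Cg lam n / (Cg lam n + 1))"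
      using d by (simp add: s_def)
    also have "\<dots> \<le> e / 8 * 1"
      using e Cg_nonneg[of lam n] by (intro mult_left_mono) auto
    finally show ?thesis by simp
  qed
  have small: "\<bar>\<integral>x. z x * ghat lam n (v x) \<partial>leb01\<bar> \<le> e / 4" "\<bar>\<integral>x. Kop N z x * ghat lam n (v x) \<partial>leb01\<bar> \<le> e / 4" for N
    using integral_ghat_young(2)[OF v z d, where lam = lam]
      integral_ghat_young(3)[OF v z d, where lam = lam and N = N] dC sC
    unfolding distrib_left[of "Cg lam n"] I_def by linarith+
  have gi: "integrable leb01 (\<lambda>x. ghat lam n (v x))" by (rule Lp_int[OF v])
  have main: "err lam n N v = (\<integral>x. z x * ghat lam n (v x) \<partial>leb01) - (\<integral>x. Kop N z x * ghat lam n (v x) \<partial>leb01)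
      + (\<Sum>i\<le>m. (1 - fejer N i) * y i * w i)" if "m \<le> N" for N
  proof -
    have qi: "integrable leb01 q" unfolding qm by (rule integrable_trig)
    have "Kop N v x = Kop N z x + Kop N q x" for x
    proof -
      have "v = (\<lambda>x. z x + q x)" by (auto simp: z_def)
      then show ?thesis using Kop_add[OF Lp_int(1)[OF z] qi, of N x] by simp
    qed
    then have "(v x - Kop N v x) * ghat lam n (v x) = z x * ghat lam n (v x) - Kop N z x * ghat lam n (v x)
       + (q x * ghat lam n (v x) - Kop N q x * ghat lam n (v x))" for x
      by (simp add: z_def algebra_simps)
    then have "err lam n N v = (\<integral>x. z x * ghat lam n (v x) \<partial>leb01) - (\<integral>x. Kop N z x * ghat lam n (v x) \<partial>leb01)
       + ((\<integral>x. q x * ghat lam n (v x) \<partial>leb01) - (\<integral>x. Kop N q x * ghat lam n (v x) \<partial>leb01))"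
      unfolding err_def
      using integral_ghat_young(1)[OF v z d] integral_Kop_mult(1)[OF gi] integral_trig_mult(1)[OF gi, of y m]
      by (simp add: qm)
    also have "(\<integral>x. q x * ghat lam n (v x) \<partial>leb01) = (\<Sum>i\<le>m. y i * w i)"
      unfolding qm w_def by (rule integral_trig_mult(2)[OF gi])
    also have "(\<integral>x. Kop N q x * ghat lam n (v x) \<partial>leb01) = (\<Sum>i\<le>N. fejer N i * coeffs q i * w i)"
      unfolding w_def by (rule integral_Kop_mult(2)[OF gi])
    also have "\<dots> = (\<Sum>i\<le>m. fejer N i * y i * w i)"
      using that by (intro sum.mono_neutral_cong_right) (auto simp: qm coeffs_trig)
    also have "(\<Sum>i\<le>m. y i * w i) - (\<Sum>i\<le>m. fejer N i * y i * w i) = (\<Sum>i\<le>m. (1 - fejer N i) * y i * w i)"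
      by (simp add: algebra_simps sum_subtractf)
    finally show ?thesis .
  qed
  have "(\<lambda>N. \<Sum>i\<le>m. (1 - fejer N i) * y i * w i) \<longlonglongrightarrow> (\<Sum>i\<le>m. (1 - 1) * y i * w i)"
    by (intro tendsto_intros tendsto_fejer)
  then have "\<forall>\<^sub>F N in sequentially. \<bar>\<Sum>i\<le>m. (1 - fejer N i) * y i * w i\<bar> < e / 4"
    using e by (auto dest!: order_tendstoD(2)[OF tendsto_rabs, of _ _ _ "e / 4"])
  then obtain N0 where N0: "\<And>N. N \<ge> N0 \<Longrightarrow> \<bar>\<Sum>i\<le>m. (1 - fejer N i) * y i * w i\<bar> < e / 4"
    unfolding eventually_sequentially by metis
  show "\<exists>N0. \<forall>N\<ge>N0. norm (err lam n N v - 0) < e"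
  proof (intro exI allI impI)
    fix N assume N: "max N0 m \<le> N"
    then have N: "N0 \<le> N" "m \<le> N" by simp_all
    have "\<bar>err lam n N v\<bar> < e"
      using small(1) small(2)[of N] N0[OF N(1)] e unfolding main[OF N(2)] by linarith
    then show "norm (err lam n N v - 0) < e" by simp
  qed
qed

text \<open>The weights lie between 0 and 1, so the averaging operator \<open>K\<close> satisfies
  \<open>K^2 \<le> K\<close>, and therefore \<open>(1 - K)^2 \<le> 1 - K\<close>.\<close>

lemma Kop_sq_defect:
  assumes v: "Lp n v"
  shows "integrable leb01 (\<lambda>x. (v x - Kop N v x)\<^sup>2)"
    "(\<integral>x. (v x - Kop N v x)\<^sup>2 \<partial>leb01) \<le> (\<integral>x. (v x - Kop N v x) * v x \<partial>leb01)"
proof -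
  note i = Lp_int(1)[OF v] Lp_int(7)[OF v]
  have k: "integrable leb01 (\<lambda>x. Kop N v x * v x)" "integrable leb01 (\<lambda>x. Kop N v x * Kop N v x)"
    by (intro integral_Kop_mult i integrable_Kop)+
  have *: "(v x - Kop N v x)\<^sup>2 = v x * v x - 2 * (Kop N v x * v x) + Kop N v x * Kop N v x" for x
    by (simp add: power2_eq_square algebra_simps)
  show "integrable leb01 (\<lambda>x. (v x - Kop N v x)\<^sup>2)"
    unfolding * using i k by simp
  have "(\<integral>x. Kop N v x * Kop N v x \<partial>leb01) \<le> (\<integral>x. Kop N v x * v x \<partial>leb01)"
    unfolding integral_Kop_mult(2)[OF i(1)] integral_Kop_mult(2)[OF integrable_Kop] coeffs_Kop
  proof (rule sum_mono)
    fix i assume "i \<in> {..N}"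
    then have "fejer N i * (fejer N i * (coeffs v i)\<^sup>2) \<le> 1 * (fejer N i * (coeffs v i)\<^sup>2)"
      using fejer_pos[of i N] fejer_le_1[of N i] by (intro mult_right_mono) auto
    then show "fejer N i * coeffs v i * (if i \<le> N then fejer N i * coeffs v i else 0) \<le> fejer N i * coeffs v i * coeffs v i"
      using \<open>i \<in> {..N}\<close> by (simp add: power2_eq_square mult_ac)
  qed
  then show "(\<integral>x. (v x - Kop N v x)\<^sup>2 \<partial>leb01) \<le> (\<integral>x. (v x - Kop N v x) * v x \<partial>leb01)"
    unfolding * left_diff_distrib using i k by simp
qed

lemma err_split:
  assumes v: "Lp n v"
  shows "err lam n N v = 2 * (\<integral>x. (v x - Kop N v x) * gpoly n (v x) \<partial>leb01)
      + \<bar>lam\<bar> * (\<integral>x. (v x - Kop N v x) * v x \<partial>leb01)"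
    "integrable leb01 (\<lambda>x. (v x - Kop N v x) * gpoly n (v x))"
    "0 \<le> (\<integral>x. (v x - Kop N v x) * v x \<partial>leb01)"
proof -
  have i1: "integrable leb01 (\<lambda>x. (v x - Kop N v x) * gpoly n (v x))"
    unfolding left_diff_distrib by (intro Bochner_Integration.integrable_diff Lp_int[OF v] integral_Kop_mult)
  have i2: "integrable leb01 (\<lambda>x. (v x - Kop N v x) * v x)"
    unfolding left_diff_distrib by (intro Bochner_Integration.integrable_diff Lp_int[OF v] integral_Kop_mult)
  have "(v x - Kop N v x) * ghat lam n (v x)
      = 2 * ((v x - Kop N v x) * gpoly n (v x)) + \<bar>lam\<bar> * ((v x - Kop N v x) * v x)" for x
    by (simp add: ghat_def algebra_simps)
  then show "err lam n N v = 2 * (\<integral>x. (v x - Kop N v x) * gpoly n (v x) \<partial>leb01)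
      + \<bar>lam\<bar> * (\<integral>x. (v x - Kop N v x) * v x \<partial>leb01)"
    unfolding err_def using i1 i2 by simp
  show "integrable leb01 (\<lambda>x. (v x - Kop N v x) * gpoly n (v x))" by fact
  have "0 \<le> (\<integral>x. (v x - Kop N v x)\<^sup>2 \<partial>leb01)" by simp
  then show "0 \<le> (\<integral>x. (v x - Kop N v x) * v x \<partial>leb01)"
    using Kop_sq_defect(2)[OF v, of N] by linarith
qed

text \<open>The coefficient differences are those of \<open>U - Kop N v\<close>, while the
  nonlinearity is evaluated at \<open>U\<close> and at \<open>v\<close>, not at the average of
  \<open>v\<close>. The tangent inequality is used twice, at \<open>U\<close> averaged over the
  values of \<open>v\<close> and at \<open>v\<close> itself. What remains is
  \<open>Kop N (G(v)) - G(v)\<close>, with \<open>G = Gpoly n\<close>, whose integral vanishes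
  because averaging preserves the mean, and a defect contained in \<open>err\<close>. Equality of
  the zero modes lets the sum start at 1.\<close>

lemma galerkin_drift:
  assumes v: "Lp n v" and y0: "y 0 = coeffs v 0"
  shows "(\<Sum>i=1..N. (y i - fejer N i * coeffs v i) *
      (coeffs (\<lambda>x. fpoly lam n (\<Sum>i\<le>N. y i * eigfun i x)) i - coeffs (\<lambda>x. fpoly lam n (v x)) i))
    \<le> 3 / 2 * \<bar>lam\<bar> * (\<Sum>i=1..N. (y i - fejer N i * coeffs v i)\<^sup>2) + err lam n N v"
proof -
  define U where "U x = (\<Sum>i\<le>N. y i * eigfun i x)" for x
  define d where "d i = y i - fejer N i * coeffs v i" for i
  define D where "D x = (\<Sum>i\<le>N. d i * eigfun i x)" for x
  have D: "D x = U x - Kop N v x" for x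
    by (simp add: D_def U_def Kop_def d_def left_diff_distrib sum_subtractf)
  have U: "Lp n U" unfolding U_def by (rule Lp_trig_diff(1)[OF v trigI])
  have d0: "d 0 = 0" by (simp add: d_def y0)
  have fU: "integrable leb01 (\<lambda>x. fpoly lam n (U x))" and fv: "integrable leb01 (\<lambda>x. fpoly lam n (v x))"
    by (rule Lp_int[OF U] Lp_int[OF v])+
  have DI: "integrable leb01 (\<lambda>x. D x * w x)" "(\<integral>x. D x * w x \<partial>leb01) = (\<Sum>i\<le>N. d i * coeffs w i)"
    if "integrable leb01 w" for w
    unfolding D_def by (rule integral_trig_mult[OF that])+
  have Di: "integrable leb01 D" unfolding D_def by (rule integrable_trig)
  have "(\<Sum>i=1..N. d i * (coeffs (\<lambda>x. fpoly lam n (U x)) i - coeffs (\<lambda>x. fpoly lam n (v x)) i))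
     = (\<integral>x. D x * fpoly lam n (U x) \<partial>leb01) - (\<integral>x. D x * fpoly lam n (v x) \<partial>leb01)"
    unfolding DI(2)[OF fU] DI(2)[OF fv] sum_0_1 by (simp add: d0 right_diff_distrib sum_subtractf)
  also have "\<dots> = (\<integral>x. D x * (fpoly lam n (U x) - fpoly lam n (v x)) \<partial>leb01)"
    using DI(1)[OF fU] DI(1)[OF fv] by (simp add: right_diff_distrib)
  also have "\<dots> \<le> (\<integral>x. 2 * (Kop N (\<lambda>b. Gpoly n (v b)) x - Gpoly n (v x)) + 2 * ((v x - Kop N v x) * gpoly n (v x))
      + (3 / 2 * \<bar>lam\<bar> * (D x * D x) + 1 / 2 * \<bar>lam\<bar> * (v x - Kop N v x)\<^sup>2) \<partial>leb01)"
  proof (rule integral_mono)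
    show "integrable leb01 (\<lambda>x. D x * (fpoly lam n (U x) - fpoly lam n (v x)))"
      using DI(1)[OF fU] DI(1)[OF fv] by (simp add: right_diff_distrib)
    show "integrable leb01 (\<lambda>x. 2 * (Kop N (\<lambda>b. Gpoly n (v b)) x - Gpoly n (v x)) + 2 * ((v x - Kop N v x) * gpoly n (v x))
      + (3 / 2 * \<bar>lam\<bar> * (D x * D x) + 1 / 2 * \<bar>lam\<bar> * (v x - Kop N v x)\<^sup>2))"
      using DI(1)[OF Di] Kop_sq_defect(1)[OF v] err_split(2)[OF v] Lp_int(3)[OF v] integrable_Kop
      by simp
    fix x
    \<comment> \<open>Jensen's inequality at the point \<open>x\<close>: the tangent to
      \<open>Gpoly\<close> at \<open>U x\<close>, averaged over the values
      \<open>v b\<close>.\<close>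
    have m: "Kop N (\<lambda>b. (Gpoly n (U x) - gpoly n (U x) * U x) + gpoly n (U x) * v b) x \<le> Kop N (\<lambda>b. Gpoly n (v b)) x"
    proof (rule Kop_mono)
      show "Gpoly n (U x) - gpoly n (U x) * U x + gpoly n (U x) * v b \<le> Gpoly n (v b)" for b
        using Gpoly_tangent[of n "U x" "v b"] by (simp add: algebra_simps)
    qed (use Lp_int(1,3)[OF v] in auto)
    have "Kop N (\<lambda>b. (Gpoly n (U x) - gpoly n (U x) * U x) + gpoly n (U x) * v b) x
        = Gpoly n (U x) - gpoly n (U x) * U x + gpoly n (U x) * Kop N v x"
      using Lp_int(1)[OF v] by (subst Kop_add) (auto simp: Kop_mult Kop_const)
    with m have "gpoly n (U x) * (Kop N v x - U x) \<le> Kop N (\<lambda>b. Gpoly n (v b)) x - Gpoly n (U x)"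
      by (simp add: algebra_simps)
    moreover have "gpoly n (v x) * (U x - v x) \<le> Gpoly n (U x) - Gpoly n (v x)"
      using Gpoly_tangent[of n "v x" "U x"] by simp
    ultimately have g: "- 2 * (D x * (gpoly n (U x) - gpoly n (v x)))
       \<le> 2 * (Kop N (\<lambda>b. Gpoly n (v b)) x - Gpoly n (v x)) + 2 * ((v x - Kop N v x) * gpoly n (v x))"
      unfolding D by (simp add: algebra_simps)
    have "lam * (D x * (U x - v x)) \<le> \<bar>lam\<bar> * \<bar>D x * (U x - v x)\<bar>"
      by (metis abs_ge_self abs_mult)
    also have "\<dots> \<le> \<bar>lam\<bar> * (3 / 2 * (D x * D x) + 1 / 2 * (v x - Kop N v x)\<^sup>2)"
    proof (rule mult_left_mono)
      \<comment> \<open>With \<open>p = D x\<close> and \<open>q\<close> the defect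
        \<open>v x - Kop N v x\<close>, one has \<open>U x - v x = p - q\<close>. This bound is the
        origin of the factor 3/2 in front of \<open>lam\<close>; the term in \<open>q\<close> is
        absorbed into \<open>err\<close>.\<close>
      have *: "\<bar>p * (p - q)\<bar> \<le> 3 / 2 * (p * p) + 1 / 2 * q\<^sup>2" for p q :: real
      proof -
        have "(p - q)\<^sup>2 = p * p - 2 * (p * q) + q\<^sup>2" "(p + q)\<^sup>2 = p * p + 2 * (p * q) + q\<^sup>2"
          by (simp_all add: power2_eq_square algebra_simps)
        moreover have "p * (p - q) = p * p - p * q" by (simp add: algebra_simps)
        ultimately show ?thesis
          using zero_le_power2[of "p - q"] zero_le_power2[of "p + q"] zero_le_square[of p] zero_le_power2[of q]
          unfolding abs_le_iff by linarith
      qed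
      have Uv: "U x - v x = D x - (v x - Kop N v x)" by (simp add: D)
      show "\<bar>D x * (U x - v x)\<bar> \<le> 3 / 2 * (D x * D x) + 1 / 2 * (v x - Kop N v x)\<^sup>2"
        unfolding Uv by (rule *)
    qed simp
    finally have l: "lam * (D x * (U x - v x)) \<le> 3 / 2 * \<bar>lam\<bar> * (D x * D x) + 1 / 2 * \<bar>lam\<bar> * (v x - Kop N v x)\<^sup>2"
      by (simp add: algebra_simps)
    have "D x * (fpoly lam n (U x) - fpoly lam n (v x))
        = - 2 * (D x * (gpoly n (U x) - gpoly n (v x))) + lam * (D x * (U x - v x))"
      by (simp add: fpoly_gpoly algebra_simps)
    with g l show "D x * (fpoly lam n (U x) - fpoly lam n (v x)) \<le>
      2 * (Kop N (\<lambda>b. Gpoly n (v b)) x - Gpoly n (v x)) + 2 * ((v x - Kop N v x) * gpoly n (v x))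
      + (3 / 2 * \<bar>lam\<bar> * (D x * D x) + 1 / 2 * \<bar>lam\<bar> * (v x - Kop N v x)\<^sup>2)"
      by linarith
  qed
  also have "\<dots> = 2 * (\<integral>x. (v x - Kop N v x) * gpoly n (v x) \<partial>leb01)
      + (3 / 2 * \<bar>lam\<bar> * (\<integral>x. D x * D x \<partial>leb01) + 1 / 2 * \<bar>lam\<bar> * (\<integral>x. (v x - Kop N v x)\<^sup>2 \<partial>leb01))"
    using DI(1)[OF Di] Kop_sq_defect(1)[OF v] err_split(2)[OF v] Lp_int(3)[OF v] integrable_Kop
    by (simp add: integral_Kop)
  also have "(\<integral>x. D x * D x \<partial>leb01) = (\<Sum>i=1..N. (d i)\<^sup>2)"
  proof -
    have "(\<integral>x. D x * D x \<partial>leb01) = (\<Sum>i\<le>N. d i * (if i \<le> N then d i else 0))"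
      unfolding DI(2)[OF Di] unfolding D_def coeffs_trig ..
    also have "\<dots> = (\<Sum>i\<le>N. (d i)\<^sup>2)" by (intro sum.cong) (auto simp: power2_eq_square)
    finally show ?thesis unfolding sum_0_1 by (simp add: d0)
  qed
  also have "2 * (\<integral>x. (v x - Kop N v x) * gpoly n (v x) \<partial>leb01)
      + (3 / 2 * \<bar>lam\<bar> * (\<Sum>i=1..N. (d i)\<^sup>2) + 1 / 2 * \<bar>lam\<bar> * (\<integral>x. (v x - Kop N v x)\<^sup>2 \<partial>leb01))
     \<le> 3 / 2 * \<bar>lam\<bar> * (\<Sum>i=1..N. (d i)\<^sup>2) + err lam n N v"
  proof -
    have "\<bar>lam\<bar> * (1 / 2 * (\<integral>x. (v x - Kop N v x)\<^sup>2 \<partial>leb01)) \<le> \<bar>lam\<bar> * (\<integral>x. (v x - Kop N v x) * v x \<partial>leb01)"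
      using Kop_sq_defect(2)[OF v, of N] err_split(3)[OF v, of N] by (intro mult_left_mono) auto
    then show ?thesis unfolding err_split(1)[OF v] by simp
  qed
  finally show ?thesis unfolding d_def U_def .
qed

text \<open>Here two solutions are compared and the weight stands once, so the sum is the pairing of
  \<open>Kop N (v - w)\<close> with \<open>f(v) - f(w)\<close>. Only the cross terms mix
  \<open>v\<close> and \<open>w\<close>; the integrals of \<open>Gpoly\<close> that bound them
  cancel when the two bounds, with \<open>v\<close> and \<open>w\<close> exchanged, are
  added.\<close>

lemma monotone_drift:
  assumes v: "Lp n v" and w: "Lp n w" and vw: "coeffs v 0 = coeffs w 0"
  shows "(\<Sum>i=1..N. fejer N i * ((coeffs v i - coeffs w i) *
      (coeffs (\<lambda>x. fpoly lam n (v x)) i - coeffs (\<lambda>x. fpoly lam n (w x)) i)))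
    \<le> \<bar>lam\<bar> * (\<Sum>i=1..N. fejer N i * (coeffs v i - coeffs w i)\<^sup>2) + (err lam n N v + err lam n N w)"
proof -
  have cross: "(\<integral>x. Kop N v x * gpoly n (w x) \<partial>leb01)
      \<le> (\<integral>x. w x * gpoly n (w x) \<partial>leb01) + (\<integral>x. Gpoly n (v x) \<partial>leb01) - (\<integral>x. Gpoly n (w x) \<partial>leb01)"
    if v: "Lp n v" and w: "Lp n w" for v w
  proof -
    have "(\<integral>x. Kop N v x * gpoly n (w x) \<partial>leb01)
      \<le> (\<integral>x. w x * gpoly n (w x) + (Kop N (\<lambda>b. Gpoly n (v b)) x - Gpoly n (w x)) \<partial>leb01)"
    proof (rule integral_mono)
      fix x
      have "Kop N (\<lambda>b. (Gpoly n (w x) - gpoly n (w x) * w x) + gpoly n (w x) * v b) x \<le> Kop N (\<lambda>b. Gpoly n (v b)) x"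
      proof (rule Kop_mono)
        show "Gpoly n (w x) - gpoly n (w x) * w x + gpoly n (w x) * v b \<le> Gpoly n (v b)" for b
          using Gpoly_tangent[of n "w x" "v b"] by (simp add: algebra_simps)
      qed (use Lp_int(1,3)[OF v] in auto)
      also have "Kop N (\<lambda>b. (Gpoly n (w x) - gpoly n (w x) * w x) + gpoly n (w x) * v b) x
          = Gpoly n (w x) - gpoly n (w x) * w x + gpoly n (w x) * Kop N v x"
        using Lp_int(1)[OF v] by (subst Kop_add) (auto simp: Kop_mult Kop_const)
      finally show "Kop N v x * gpoly n (w x) \<le> w x * gpoly n (w x) + (Kop N (\<lambda>b. Gpoly n (v b)) x - Gpoly n (w x))"
        by (simp add: algebra_simps)
    qed (use Lp_int[OF w] integrable_Kop in \<open>auto intro!: integral_Kop_mult\<close>)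
    also have "\<dots> = (\<integral>x. w x * gpoly n (w x) \<partial>leb01) + (\<integral>x. Gpoly n (v x) \<partial>leb01) - (\<integral>x. Gpoly n (w x) \<partial>leb01)"
      using Lp_int[OF w] integrable_Kop by (simp add: integral_Kop)
    finally show ?thesis .
  qed
  define gc where "gc v = coeffs (\<lambda>x. gpoly n (v x))" for v
  have fc: "coeffs (\<lambda>x. fpoly lam n (v x)) i = - 2 * gc v i + lam * coeffs v i" if "Lp n v" for v i
  proof -
    have "fpoly lam n (v x) * eigfun i x = - 2 * (gpoly n (v x) * eigfun i x) + lam * (v x * eigfun i x)" for x
      by (simp add: fpoly_gpoly algebra_simps)
    then show ?thesis
      using integrable_mult_eigfun[OF Lp_int(2)[OF that], of i] integrable_mult_eigfun[OF Lp_int(1)[OF that], of i]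
      by (simp add: coeffs_leb01 gc_def)
  qed
  have KG: "(\<Sum>i\<le>N. fejer N i * coeffs v i * gc w i) = (\<integral>x. Kop N v x * gpoly n (w x) \<partial>leb01)" if "Lp n w" for v w
    unfolding gc_def by (rule integral_Kop_mult(2)[OF Lp_int(2)[OF that], symmetric])
  have dg: "2 * ((\<integral>x. v x * gpoly n (v x) \<partial>leb01) - (\<integral>x. Kop N v x * gpoly n (v x) \<partial>leb01)) \<le> err lam n N v" if "Lp n v" for v
    using err_split(1)[OF that, of lam N] err_split(3)[OF that, of N] Lp_int(6)[OF that]
      integral_Kop_mult(1)[OF Lp_int(2)[OF that], of N v]
    by (simp add: left_diff_distrib)
  have "(\<Sum>i=1..N. fejer N i * ((coeffs v i - coeffs w i) *
      (coeffs (\<lambda>x. fpoly lam n (v x)) i - coeffs (\<lambda>x. fpoly lam n (w x)) i)))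
    = (\<Sum>i=1..N. lam * (fejer N i * (coeffs v i - coeffs w i)\<^sup>2)
       - 2 * (fejer N i * (coeffs v i - coeffs w i) * (gc v i - gc w i)))"
    unfolding fc[OF v] fc[OF w] by (intro sum.cong refl) (simp add: power2_eq_square algebra_simps)
  also have "\<dots> = lam * (\<Sum>i=1..N. fejer N i * (coeffs v i - coeffs w i)\<^sup>2)
      - 2 * (\<Sum>i\<le>N. fejer N i * (coeffs v i - coeffs w i) * (gc v i - gc w i))"
    unfolding sum_0_1 by (simp add: vw sum_subtractf sum_distrib_left)
  also have "(\<Sum>i\<le>N. fejer N i * (coeffs v i - coeffs w i) * (gc v i - gc w i))
     = (\<Sum>i\<le>N. fejer N i * coeffs v i * gc v i) - (\<Sum>i\<le>N. fejer N i * coeffs v i * gc w i)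
      - (\<Sum>i\<le>N. fejer N i * coeffs w i * gc v i) + (\<Sum>i\<le>N. fejer N i * coeffs w i * gc w i)"
    by (simp add: sum_subtractf[symmetric] sum.distrib[symmetric] algebra_simps)
  also have "lam * (\<Sum>i=1..N. fejer N i * (coeffs v i - coeffs w i)\<^sup>2) \<le> \<bar>lam\<bar> * (\<Sum>i=1..N. fejer N i * (coeffs v i - coeffs w i)\<^sup>2)"
    using fejer_pos by (intro mult_right_mono sum_nonneg mult_nonneg_nonneg) (auto intro: less_imp_le)
  finally show ?thesis
    unfolding KG[OF v] KG[OF w]
    using cross[OF v w] cross[OF w v] dg[OF v] dg[OF w] by simp
qed

section \<open>Coercivity around the mean value, uniform in the degree\<close>

definition C0 :: "real \<Rightarrow> real \<Rightarrow> real" where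
  "C0 lam c = (let a = 2 / (1 - \<bar>c\<bar>) + 2 * \<bar>lam\<bar> in a + 3 / 2 * a\<^sup>2)"

lemma C0_nonneg: "\<bar>c\<bar> < 1 \<Longrightarrow> 0 \<le> C0 lam c"
  by (simp add: C0_def Let_def)

text \<open>The bound is uniform in \<open>n \<ge> 1\<close>: \<open>gpoly n c\<close> stays below \<open>artanh\<close>, and the cubic term of
  \<open>gpoly n\<close> absorbs the linear part of either sign.\<close>

lemma fpoly_coercive:
  assumes c: "\<bar>c\<bar> < 1" and n: "1 \<le> n"
  shows "(u - c) * fpoly lam n u \<le> C0 lam c"
proof -
  define G where "G = 1 / (1 - \<bar>c\<bar>)"
  define a where "a = 2 * G + 2 * \<bar>lam\<bar>"
  define z where "z = \<bar>u - c\<bar>"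
  have z: "0 \<le> z" by (simp add: z_def)
  have G: "0 \<le> G" using c by (simp add: G_def)
  have gc: "\<bar>gpoly n c\<bar> \<le> G"
  proof -
    have "\<bar>gpoly n c\<bar> \<le> (\<Sum>k\<le>n. \<bar>c\<bar> ^ k)"
      unfolding gpoly_def
    proof (rule order_trans[OF sum_abs], rule sum_mono)
      fix k
      have "\<bar>c ^ (2 * k + 1) / real (2 * k + 1)\<bar> = \<bar>c\<bar> ^ (2 * k + 1) / real (2 * k + 1)"
        by (simp add: abs_divide power_abs abs_mult)
      also have "\<dots> \<le> \<bar>c\<bar> ^ (2 * k + 1) / 1" by (intro divide_left_mono) auto
      also have "\<dots> \<le> \<bar>c\<bar> ^ k" using c by (simp, intro power_decreasing[of k "Suc (2 * k)", simplified]) auto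
      finally show "\<bar>c ^ (2 * k + 1) / real (2 * k + 1)\<bar> \<le> \<bar>c\<bar> ^ k" .
    qed
    also have "\<dots> \<le> (\<Sum>k. \<bar>c\<bar> ^ k)"
      using c by (intro sum_le_suminf) auto
    also have "\<dots> = G" using c by (simp add: suminf_geometric G_def)
    finally show ?thesis .
  qed
  have mono: "0 \<le> (u - c) * (u ^ (2 * k + 1) - c ^ (2 * k + 1))" for k
  proof (cases "c \<le> u")
    case True
    then have "c ^ (2 * k + 1) \<le> u ^ (2 * k + 1)" by (intro power_mono_odd) auto
    then show ?thesis using True by (intro mult_nonneg_nonneg) auto
  next
    case False
    then have "u ^ (2 * k + 1) \<le> c ^ (2 * k + 1)" by (intro power_mono_odd) auto
    then show ?thesis using False by (intro mult_nonpos_nonpos) auto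
  qed
  have "(u - c) ^ 4 / 12 \<le> (u - c) * (u ^ 3 - c ^ 3) / 3"
  proof -
    \<comment> \<open>This is \<open>4 * (u^2 + u * c + c^2) - (u - c)^2 = 3 * (u + c)^2\<close>,
      multiplied by \<open>(u - c)^2\<close>.\<close>
    have "4 * ((u - c) * (u ^ 3 - c ^ 3)) - (u - c) ^ 4 = 3 * ((u - c) * (u + c))\<^sup>2"
      by (simp add: eval_nat_numeral algebra_simps)
    then have "0 \<le> 4 * ((u - c) * (u ^ 3 - c ^ 3)) - (u - c) ^ 4" by simp
    then show ?thesis by simp
  qed
  also have "\<dots> = (\<Sum>k\<in>{1}. (u - c) * (u ^ (2 * k + 1) - c ^ (2 * k + 1)) / real (2 * k + 1))"
    by (simp add: eval_nat_numeral)
  also have "\<dots> \<le> (\<Sum>k\<le>n. (u - c) * (u ^ (2 * k + 1) - c ^ (2 * k + 1)) / real (2 * k + 1))"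
    using n by (intro sum_mono2 divide_nonneg_nonneg mono) auto
  also have "\<dots> = (u - c) * (gpoly n u - gpoly n c)"
    by (simp add: gpoly_def sum_subtractf[symmetric] sum_distrib_left diff_divide_distrib right_diff_distrib)
  finally have m: "z ^ 4 / 12 \<le> (u - c) * (gpoly n u - gpoly n c)" by (simp add: z_def power_even_abs)
  have t1: "- ((u - c) * gpoly n c) \<le> z * G"
  proof -
    have "\<bar>(u - c) * gpoly n c\<bar> \<le> z * G" unfolding abs_mult z_def using gc by (intro mult_left_mono) auto
    then show ?thesis by linarith
  qed
  have t2: "lam * ((u - c) * u) \<le> \<bar>lam\<bar> * (z\<^sup>2 + z)"
  proof -
    have "lam * ((u - c) * u) \<le> \<bar>lam\<bar> * \<bar>(u - c) * u\<bar>" by (metis abs_ge_self abs_mult)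
    also have "\<dots> \<le> \<bar>lam\<bar> * (z * (z + 1))"
      unfolding abs_mult[of "u - c"] z_def using c by (intro mult_left_mono) auto
    finally show ?thesis by (simp add: power2_eq_square algebra_simps)
  qed
  have z1: "z \<le> 1 + z\<^sup>2"
    using zero_le_power2[of "z - 1"] z by (simp add: power2_eq_square algebra_simps)
  have "(u - c) * fpoly lam n u = - 2 * ((u - c) * (gpoly n u - gpoly n c)) - 2 * ((u - c) * gpoly n c) + lam * ((u - c) * u)"
    by (simp add: fpoly_gpoly algebra_simps)
  also have "\<dots> \<le> - (z ^ 4 / 6) + 2 * (z * G) + \<bar>lam\<bar> * (z\<^sup>2 + z)"
    using m t1 t2 by linarith
  also have "\<dots> = - (z ^ 4 / 6) + (2 * G + \<bar>lam\<bar>) * z + \<bar>lam\<bar> * z\<^sup>2"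
    by (simp add: algebra_simps)
  also have "\<dots> \<le> - (z ^ 4 / 6) + (2 * G + \<bar>lam\<bar>) * (1 + z\<^sup>2) + \<bar>lam\<bar> * z\<^sup>2"
    using z1 G by (intro add_mono mult_left_mono) auto
  also have "\<dots> \<le> a + (a * z\<^sup>2 - z ^ 4 / 6)"
    by (simp add: a_def algebra_simps)
  \<comment> \<open>The maximum of \<open>a * z^2 - z^4 / 6\<close> is \<open>3 / 2 * a^2\<close>,
    attained at \<open>z^2 = 3 * a\<close>; this is where the value of \<open>C0\<close> comes
    from.\<close>
  also have "\<dots> \<le> a + 3 / 2 * a\<^sup>2"
  proof -
    have "0 \<le> (z\<^sup>2 - 3 * a)\<^sup>2" by simp
    also have "\<dots> = z ^ 4 - 6 * (a * z\<^sup>2) + 9 * a\<^sup>2"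
      by (simp add: power2_eq_square eval_nat_numeral algebra_simps)
    finally show ?thesis by simp
  qed
  finally show ?thesis by (simp add: C0_def Let_def a_def G_def)
qed

section \<open>A discrete energy inequality\<close>

lemma set_integral_split:
  fixes f :: "real \<Rightarrow> real"
  assumes "a \<le> b" "b \<le> c" "set_integrable lborel {a<..c} f"
  shows "(LINT s:{a<..c}|lborel. f s) = (LINT s:{a<..b}|lborel. f s) + (LINT s:{b<..c}|lborel. f s)"
proof -
  have "{a<..c} = {a<..b} \<union> {b<..c}" using assms by auto
  then show ?thesis
    using assms by (simp only:) (intro set_integral_Un set_integrable_subset[OF assms(3)]; auto)
qed

lemma set_integrable_const_Ioc: "set_integrable lborel {a<..b} (\<lambda>_. x)" for a b x :: real
proof (rule set_integrable_subset)
  show "set_integrable lborel {a..b} (\<lambda>_. x)" by (rule borel_integrable_atLeastAtMost') simp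
qed auto

lemma set_integral_sum_real:
  fixes f :: "'i \<Rightarrow> real \<Rightarrow> real"
  assumes "finite I" "\<And>i. i \<in> I \<Longrightarrow> set_integrable lborel S (f i)"
  shows "set_integrable lborel S (\<lambda>s. \<Sum>i\<in>I. f i s)"
    "(LINT s:S|lborel. \<Sum>i\<in>I. f i s) = (\<Sum>i\<in>I. LINT s:S|lborel. f i s)"
proof -
  have i: "integrable lborel (\<lambda>s. indicator S s * f i s)" if "i \<in> I" for i
    using assms(2)[OF that] by (simp add: set_integrable_def)
  show "set_integrable lborel S (\<lambda>s. \<Sum>i\<in>I. f i s)"
    unfolding set_integrable_def real_scaleR_def sum_distrib_left by (rule Bochner_Integration.integrable_sum[OF i])
  show "(LINT s:S|lborel. \<Sum>i\<in>I. f i s) = (\<Sum>i\<in>I. LINT s:S|lborel. f i s)"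
    unfolding set_lebesgue_integral_def real_scaleR_def sum_distrib_left
    by (rule Bochner_Integration.integral_sum[OF i])
qed

lemma set_integral_nonneg':
  fixes f :: "real \<Rightarrow> real"
  assumes "\<And>s. 0 \<le> f s" shows "0 \<le> (LINT s:A|lborel. f s)"
  unfolding set_lebesgue_integral_def by (intro integral_nonneg_AE AE_I2) (simp add: assms)

text \<open>A Gronwall argument for a quantity \<open>D\<close> that moves on each cell by the
  integral of \<open>a\<close>. The one-sided bound on the drift is known for a neighbour
  \<open>d\<close> of \<open>D\<close>: in both applications \<open>D\<close> is frozen at the left
  end of the cell while \<open>d\<close> follows the solution. Passing between them costs
  \<open>\<omega>\<close>, and the square of the increment costs \<open>\<omega>'\<close>. A step
  may presuppose \<open>E k \<le> B\<close>, the bound to be proved; this bootstrap later keeps the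
  scheme inside the box in which its drift is switched on.\<close>

lemma discrete_energy:
  fixes D :: "nat \<Rightarrow> 'i \<Rightarrow> real" and A \<epsilon> :: "real \<Rightarrow> real"
  assumes I: "finite I" and w: "\<And>i. i \<in> I \<Longrightarrow> 0 \<le> w i" and L: "0 \<le> L" and h: "0 < h" "real M * h = T"
    and A: "set_integrable lborel {0<..T} A" "\<And>s. 0 \<le> A s"
    and e: "set_integrable lborel {0<..T} \<epsilon>" "\<And>s. 0 \<le> \<epsilon> s"
    and om: "0 \<le> \<omega>" "0 \<le> \<omega>'"
    and om': "\<And>k. k < M \<Longrightarrow> (LINT s:{real k * h<..real (Suc k) * h}|lborel. A s) \<le> \<omega>'"
    and E: "\<And>k. E k = (\<Sum>i\<in>I. w i * (D k i)\<^sup>2)" and W: "W = (\<Sum>i\<in>I. w i)"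
    and B: "B = exp (2 * L * T) * (E 0 + (LINT s:{0<..T}|lborel. \<epsilon> s) + 2 * L * T * W * \<omega>\<^sup>2
        + (2 * W * \<omega> + W * \<omega>') * (LINT s:{0<..T}|lborel. A s))"
    and step: "\<And>k. k < M \<Longrightarrow> E k \<le> B \<Longrightarrow> \<exists>a d.
        (\<forall>i\<in>I. set_integrable lborel {real k * h<..real (Suc k) * h} (a i) \<and>
           D (Suc k) i = D k i + (LINT s:{real k * h<..real (Suc k) * h}|lborel. a i s)) \<and>
        (AE s in lborel. s \<in> {real k * h<..<real (Suc k) * h} \<longrightarrow>
           2 * (\<Sum>i\<in>I. w i * d i s * a i s) \<le> L * (\<Sum>i\<in>I. w i * (d i s)\<^sup>2) + \<epsilon> s \<and>
           (\<forall>i\<in>I. \<bar>d i s - D k i\<bar> \<le> \<omega> \<and> \<bar>a i s\<bar> \<le> A s))"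
    and k: "k \<le> M"
  shows "E k \<le> B"
proof -
  define J where "J f k = (LINT s:{real k * h<..real (Suc k) * h}|lborel. f s)" for f :: "real \<Rightarrow> real" and k
  define c where "c = 2 * W * \<omega> + W * \<omega>'"
  \<comment> \<open>All errors made up to grid point \<open>k\<close>. The induction runs with
    \<open>exp (2 * L * (k * h)) * S k\<close>, which increases to at most \<open>B\<close>, so the
    bootstrap hypothesis is available at every step.\<close>
  define S where "S k = E 0 + (LINT s:{0<..real k * h}|lborel. \<epsilon> s) + 2 * L * (real k * h) * W * \<omega>\<^sup>2
        + c * (LINT s:{0<..real k * h}|lborel. A s)" for k
  have W0: "0 \<le> W" unfolding W using w by (intro sum_nonneg)
  have c0: "0 \<le> c" unfolding c_def using W0 om by auto
  have E0: "0 \<le> E k" for k unfolding E using w by (intro sum_nonneg) auto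
  have kh: "real k * h \<le> T" if "k \<le> M" for k
    using that h by (metis mult_right_mono of_nat_le_iff less_imp_le)
  have k0: "0 \<le> real k * h" for k using h by simp
  have sub: "set_integrable lborel {real k * h<..real (Suc k) * h} f" if "k < M" "set_integrable lborel {0<..T} f" for f :: "real \<Rightarrow> real" and k
    by (rule set_integrable_subset[OF that(2)])
       (use kh[of "Suc k"] k0[of k] that in \<open>auto simp del: of_nat_Suc\<close>)
  have upto: "set_integrable lborel {0<..real k * h} f" if "k \<le> M" "set_integrable lborel {0<..T} f" for f :: "real \<Rightarrow> real" and k
    by (rule set_integrable_subset[OF that(2)]) (use kh[OF that(1)] in auto)
  have split: "(LINT s:{0<..real (Suc k) * h}|lborel. f s) = (LINT s:{0<..real k * h}|lborel. f s) + J f k"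
    if "k < M" "set_integrable lborel {0<..T} f" for f :: "real \<Rightarrow> real" and k
    unfolding J_def by (rule set_integral_split) (use h that upto[of "Suc k" f] in \<open>auto simp: algebra_simps\<close>)
  have SB: "exp (2 * L * (real k * h)) * S k \<le> B" if "k \<le> M" for k
  proof -
    have le: "(LINT s:{0<..real k * h}|lborel. f s) \<le> (LINT s:{0<..T}|lborel. f s)"
      if "set_integrable lborel {0<..T} f" "\<And>s. 0 \<le> f s" for f :: "real \<Rightarrow> real"
      using set_integral_split[of 0 "real k * h" T f] k0[of k] kh[OF \<open>k \<le> M\<close>] that
        set_integral_nonneg'[of f "{real k * h<..T}"] by simp
    have "S k \<le> E 0 + (LINT s:{0<..T}|lborel. \<epsilon> s) + 2 * L * T * W * \<omega>\<^sup>2 + c * (LINT s:{0<..T}|lborel. A s)"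
      unfolding S_def using le[OF A] le[OF e] L W0 c0 kh[OF that]
      by (intro add_mono mult_left_mono mult_right_mono) auto
    moreover have "exp (2 * L * (real k * h)) \<le> exp (2 * L * T)" using L kh[OF that] by (auto intro: mult_left_mono)
    moreover have "0 \<le> S k" unfolding S_def using E0 set_integral_nonneg'[OF A(2)] set_integral_nonneg'[OF e(2)] L W0 c0 k0[of k]
      by (intro add_nonneg_nonneg mult_nonneg_nonneg[OF _ k0[of k]] mult_nonneg_nonneg) (auto simp: zero_le_mult_iff)
    ultimately show ?thesis unfolding B c_def[symmetric] by (intro mult_mono) auto
  qed
  have "E k \<le> exp (2 * L * (real k * h)) * S k" if "k \<le> M" for k
    using that
  proof (induction k)
    case 0
    then show ?case by (simp add: S_def set_lebesgue_integral_def)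
  next
    case (Suc k)
    then have kM: "k < M" "k \<le> M" by auto
    have IH: "E k \<le> exp (2 * L * (real k * h)) * S k" using Suc by simp
    then have "E k \<le> B" using SB[OF kM(2)] by simp
    from step[OF kM(1) this] obtain a d where
      ai: "\<And>i. i \<in> I \<Longrightarrow> set_integrable lborel {real k * h<..real (Suc k) * h} (a i)"
      and DS: "\<And>i. i \<in> I \<Longrightarrow> D (Suc k) i = D k i + J (a i) k"
      and ae: "AE s in lborel. s \<in> {real k * h<..<real (Suc k) * h} \<longrightarrow>
           2 * (\<Sum>i\<in>I. w i * d i s * a i s) \<le> L * (\<Sum>i\<in>I. w i * (d i s)\<^sup>2) + \<epsilon> s \<and>
           (\<forall>i\<in>I. \<bar>d i s - D k i\<bar> \<le> \<omega> \<and> \<bar>a i s\<bar> \<le> A s)"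
      unfolding J_def by blast
    let ?S = "{real k * h<..real (Suc k) * h}"
    \<comment> \<open>The step hypothesis speaks of the open cell, the integrals run over the
      half-open one.\<close>
    have "AE s in lborel. s \<noteq> real (Suc k) * h" by (rule AE_lborel_singleton)
    with ae have ae': "AE s in lborel. s \<in> ?S \<longrightarrow>
           2 * (\<Sum>i\<in>I. w i * d i s * a i s) \<le> L * (\<Sum>i\<in>I. w i * (d i s)\<^sup>2) + \<epsilon> s \<and>
           (\<forall>i\<in>I. \<bar>d i s - D k i\<bar> \<le> \<omega> \<and> \<bar>a i s\<bar> \<le> A s)"
      by eventually_elim auto
    have Ai: "set_integrable lborel ?S A" and ei: "set_integrable lborel ?S \<epsilon>" using sub kM A e by auto
    have ci: "set_integrable lborel ?S (\<lambda>_. x)" for x :: real by (rule set_integrable_const_Ioc)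
    have Jc: "J (\<lambda>_. x) k = x * h" for x :: real
      using h unfolding J_def set_lebesgue_integral_def by (simp add: algebra_simps)
    have Ja: "\<bar>J (a i) k\<bar> \<le> J A k" if "i \<in> I" for i
    proof -
      have "\<bar>J (a i) k\<bar> \<le> (LINT s:?S|lborel. \<bar>a i s\<bar>)"
        unfolding J_def using set_integral_norm_bound[OF ai[OF that]] by simp
      also have "\<dots> \<le> J A k" unfolding J_def
        by (rule set_integral_mono_AE[OF set_integrable_abs[OF ai[OF that]] Ai])
           (use ae' that in \<open>auto elim!: eventually_mono\<close>)
      finally show ?thesis .
    qed
    have JA: "0 \<le> J A k" "J A k \<le> \<omega>'" using set_integral_nonneg'[OF A(2)] om'[OF kM(1)] by (auto simp: J_def)
    have "E (Suc k) = E k + 2 * (\<Sum>i\<in>I. w i * D k i * J (a i) k) + (\<Sum>i\<in>I. w i * (J (a i) k)\<^sup>2)"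
      unfolding E sum_distrib_left sum.distrib[symmetric]
      by (intro sum.cong refl) (simp add: DS power2_eq_square algebra_simps)
    moreover have "(\<Sum>i\<in>I. w i * (J (a i) k)\<^sup>2) \<le> W * (\<omega>' * J A k)"
      unfolding W sum_distrib_right
    proof (intro sum_mono mult_left_mono w)
      fix i assume "i \<in> I"
      have "(J (a i) k)\<^sup>2 \<le> (J A k)\<^sup>2" using Ja[OF \<open>i \<in> I\<close>] by (rule abs_le_square_iff[THEN iffD1, OF order_trans[OF _ abs_ge_self]])
      also have "\<dots> \<le> \<omega>' * J A k" unfolding power2_eq_square using JA by (intro mult_right_mono)
      finally show "(J (a i) k)\<^sup>2 \<le> \<omega>' * J A k" .
    qed
    moreover have "2 * (\<Sum>i\<in>I. w i * D k i * J (a i) k) \<le> (2 * L * E k + 2 * L * W * \<omega>\<^sup>2) * h + J \<epsilon> k + 2 * W * \<omega> * J A k"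
    proof -
      have i1: "set_integrable lborel ?S (\<lambda>s. 2 * (\<Sum>i\<in>I. w i * D k i * a i s))"
        using ai by (intro set_integrable_mult_right set_integral_sum_real I) auto
      have i2: "set_integrable lborel ?S (\<lambda>s. (2 * L * E k + 2 * L * W * \<omega>\<^sup>2) + \<epsilon> s + 2 * W * \<omega> * A s)"
        using Ai ei by (intro set_integral_add(1) set_integrable_mult_right ci) auto
      have "2 * (\<Sum>i\<in>I. w i * D k i * J (a i) k) = (LINT s:?S|lborel. 2 * (\<Sum>i\<in>I. w i * D k i * a i s))"
        using ai unfolding J_def
        by (subst set_integral_mult_right, subst set_integral_sum_real(2)[OF I]) (auto intro: set_integrable_mult_right)
      also have "\<dots> \<le> (LINT s:?S|lborel. (2 * L * E k + 2 * L * W * \<omega>\<^sup>2) + \<epsilon> s + 2 * W * \<omega> * A s)"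
      proof (rule set_integral_mono_AE[OF i1 i2])
        show "AE s\<in>?S in lborel. 2 * (\<Sum>i\<in>I. w i * D k i * a i s) \<le> (2 * L * E k + 2 * L * W * \<omega>\<^sup>2) + \<epsilon> s + 2 * W * \<omega> * A s"
          using ae'
        proof (eventually_elim, intro impI)
          fix s assume "s \<in> ?S \<longrightarrow>
           2 * (\<Sum>i\<in>I. w i * d i s * a i s) \<le> L * (\<Sum>i\<in>I. w i * (d i s)\<^sup>2) + \<epsilon> s \<and>
           (\<forall>i\<in>I. \<bar>d i s - D k i\<bar> \<le> \<omega> \<and> \<bar>a i s\<bar> \<le> A s)" "s \<in> ?S"
          then have s: "2 * (\<Sum>i\<in>I. w i * d i s * a i s) \<le> L * (\<Sum>i\<in>I. w i * (d i s)\<^sup>2) + \<epsilon> s"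
            and b: "\<And>i. i \<in> I \<Longrightarrow> \<bar>d i s - D k i\<bar> \<le> \<omega>" "\<And>i. i \<in> I \<Longrightarrow> \<bar>a i s\<bar> \<le> A s" by auto
          have "(\<Sum>i\<in>I. w i * (D k i - d i s) * a i s) \<le> (\<Sum>i\<in>I. w i * (\<omega> * A s))"
            unfolding mult.assoc
          proof (intro sum_mono mult_left_mono w)
            fix i assume "i \<in> I"
            have "(D k i - d i s) * a i s \<le> \<bar>D k i - d i s\<bar> * \<bar>a i s\<bar>" by (metis abs_ge_self abs_mult)
            also have "\<dots> \<le> \<omega> * A s" using b[OF \<open>i \<in> I\<close>] om by (intro mult_mono) (auto simp: abs_minus_commute)
            finally show "(D k i - d i s) * a i s \<le> \<omega> * A s" .
          qed
          also have "\<dots> = W * \<omega> * A s" by (simp add: W sum_distrib_right mult.assoc)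
          finally have 1: "(\<Sum>i\<in>I. w i * (D k i - d i s) * a i s) \<le> W * \<omega> * A s" .
          have "(\<Sum>i\<in>I. w i * (d i s)\<^sup>2) \<le> (\<Sum>i\<in>I. w i * (2 * (D k i)\<^sup>2 + 2 * \<omega>\<^sup>2))"
          proof (intro sum_mono mult_left_mono w)
            fix i assume "i \<in> I"
            have "(d i s - D k i)\<^sup>2 \<le> \<omega>\<^sup>2" using b(1)[OF \<open>i \<in> I\<close>] om by (metis abs_le_square_iff abs_of_nonneg)
            \<comment> \<open>Replacing \<open>d\<close> by \<open>D k\<close> inside the square
              doubles it; this is why \<open>2 * L\<close> and not \<open>L\<close> stands in the
              exponent.\<close>
            moreover have "(d i s)\<^sup>2 \<le> 2 * (D k i)\<^sup>2 + 2 * (d i s - D k i)\<^sup>2"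
              using zero_le_power2[of "d i s - 2 * D k i"] by (simp add: power2_eq_square algebra_simps)
            ultimately show "(d i s)\<^sup>2 \<le> 2 * (D k i)\<^sup>2 + 2 * \<omega>\<^sup>2" by linarith
          qed
          also have "\<dots> = 2 * E k + 2 * (W * \<omega>\<^sup>2)"
            by (simp add: E W sum.distrib sum_distrib_left sum_distrib_right algebra_simps)
          finally have "L * (\<Sum>i\<in>I. w i * (d i s)\<^sup>2) \<le> L * (2 * E k + 2 * (W * \<omega>\<^sup>2))" using L by (rule mult_left_mono)
          moreover have "(\<Sum>i\<in>I. w i * D k i * a i s) = (\<Sum>i\<in>I. w i * d i s * a i s) + (\<Sum>i\<in>I. w i * (D k i - d i s) * a i s)"
            unfolding sum.distrib[symmetric] by (intro sum.cong) (auto simp: algebra_simps)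
          ultimately show "2 * (\<Sum>i\<in>I. w i * D k i * a i s) \<le> (2 * L * E k + 2 * L * W * \<omega>\<^sup>2) + \<epsilon> s + 2 * W * \<omega> * A s"
            using 1 s by (simp add: algebra_simps)
        qed
      qed
      also have "\<dots> = (2 * L * E k + 2 * L * W * \<omega>\<^sup>2) * h + J \<epsilon> k + 2 * W * \<omega> * J A k"
      proof -
        have "(LINT s:?S|lborel. (2 * L * E k + 2 * L * W * \<omega>\<^sup>2) + \<epsilon> s + 2 * W * \<omega> * A s)
          = J (\<lambda>_. 2 * L * E k + 2 * L * W * \<omega>\<^sup>2) k + J \<epsilon> k + 2 * W * \<omega> * J A k"
          unfolding J_def using Ai ei ci
          by (subst set_integral_add(2), (intro set_integral_add(1) set_integrable_mult_right; simp)+,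
              subst set_integral_add(2)) simp_all
        then show ?thesis unfolding Jc .
      qed
      finally show ?thesis .
    qed
    moreover have SS: "S (Suc k) = S k + (J \<epsilon> k + 2 * L * h * W * \<omega>\<^sup>2 + c * J A k)"
      unfolding S_def split[OF kM(1) A(1)] split[OF kM(1) e(1)] by (simp add: algebra_simps)
    ultimately have "E (Suc k) \<le> (1 + 2 * L * h) * E k + (S (Suc k) - S k)"
      by (simp add: c_def algebra_simps)
    also have "\<dots> \<le> exp (2 * L * h) * (exp (2 * L * (real k * h)) * S k) + exp (2 * L * (real (Suc k) * h)) * (S (Suc k) - S k)"
    proof (intro add_mono mult_mono IH E0)
      show "1 + 2 * L * h \<le> exp (2 * L * h)" by (rule exp_ge_add_one_self)
      have nn: "0 \<le> S (Suc k) - S k"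
        unfolding SS using set_integral_nonneg'[OF e(2)] JA L h W0 c0 by (auto simp: J_def intro!: add_nonneg_nonneg)
      have "1 \<le> exp (2 * L * (real (Suc k) * h))" using L h by simp
      from mult_right_mono[OF this nn] show "S (Suc k) - S k \<le> exp (2 * L * (real (Suc k) * h)) * (S (Suc k) - S k)" by simp
    qed simp
    also have "\<dots> = exp (2 * L * (real (Suc k) * h)) * S (Suc k)"
      by (simp add: algebra_simps exp_add)
    finally show ?case .
  qed
  from order_trans[OF this[OF k] SB[OF k]] show ?thesis .
qed

section \<open>Paths of the equation\<close>

definition mu :: "nat \<Rightarrow> real" where
  "mu i = (real i * pi)\<^sup>2"

lemma eigval_mu: "eigval i = - mu i"
  by (simp add: eigval_def mu_def)

lemma mu_ge_1: "1 \<le> i \<Longrightarrow> 1 \<le> mu i"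
proof -
  assume "1 \<le> i"
  then have "1 * 1 \<le> real i * pi" using pi_ge_two by (intro mult_mono) auto
  then show ?thesis unfolding mu_def using one_le_power[of "real i * pi" 2] by simp
qed

lemma mu_pos: "1 \<le> i \<Longrightarrow> 0 < mu i"
  using mu_ge_1[of i] by linarith

lemma mu_nonneg: "0 \<le> mu i"
  by (simp add: mu_def)

lemma mu_mono: "i \<le> j \<Longrightarrow> mu i \<le> mu j"
  unfolding mu_def by (intro power_mono mult_right_mono) auto

lemma powr_mu: "1 \<le> i \<Longrightarrow> (- eigval i) powr (- 1) = 1 / mu i"
  using mu_pos[of i] by (simp add: eigval_mu powr_minus inverse_eq_divide)

lemma weight_mu: "1 \<le> i \<Longrightarrow> (- eigval i) powr (- 1) * y = y / mu i"
  by (simp only: powr_mu) simp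

lemma V_minus1_iff: "h \<in> V (- 1) \<longleftrightarrow> (\<lambda>i. (h i)\<^sup>2 / mu i) summable_on {1..}"
  unfolding V_def mem_Collect_eq by (intro summable_on_cong) (simp only: weight_mu atLeast_iff)

lemma seminormV_minus1: "seminormV (- 1) h = sqrt (\<Sum>\<^sub>\<infinity>i\<in>{1..}. (h i)\<^sup>2 / mu i)"
  unfolding seminormV_def by (intro arg_cong[where f = sqrt] infsum_cong) (simp only: weight_mu atLeast_iff)

lemma sum_le_seminormV:
  assumes "h \<in> V (- 1)" "finite F" "F \<subseteq> {1..}"
  shows "(\<Sum>i\<in>F. (h i)\<^sup>2 / mu i) \<le> (seminormV (- 1) h)\<^sup>2"
proof -
  have "(\<Sum>i\<in>F. (h i)\<^sup>2 / mu i) \<le> (\<Sum>\<^sub>\<infinity>i\<in>{1..}. (h i)\<^sup>2 / mu i)"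
    using assms by (intro finite_sum_le_infsum) (auto simp: V_minus1_iff mu_nonneg)
  also have "\<dots> = (seminormV (- 1) h)\<^sup>2"
    unfolding seminormV_minus1 by (subst real_sqrt_pow2) (auto intro!: infsum_nonneg simp: mu_nonneg)
  finally show ?thesis .
qed

lemma seminormV_leI:
  assumes "\<And>m. (\<Sum>i=1..m. (h i)\<^sup>2 / mu i) \<le> C\<^sup>2" "0 \<le> C"
  shows "h \<in> V (- 1)" "seminormV (- 1) h \<le> C"
proof -
  have F: "(\<Sum>i\<in>F. (h i)\<^sup>2 / mu i) \<le> C\<^sup>2" if "finite F" "F \<subseteq> {1..}" for F
  proof -
    obtain m where "F \<subseteq> {..m}" using \<open>finite F\<close> finite_nat_set_iff_bounded_le by auto
    then have "(\<Sum>i\<in>F. (h i)\<^sup>2 / mu i) \<le> (\<Sum>i=1..m. (h i)\<^sup>2 / mu i)"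
      using that by (intro sum_mono2) (auto simp: mu_nonneg)
    then show ?thesis using assms(1)[of m] by linarith
  qed
  have s: "(\<lambda>i. (h i)\<^sup>2 / mu i) summable_on {1..}"
    by (rule nonneg_bounded_partial_sums_imp_summable_on[where C = "C\<^sup>2"])
       (use F in \<open>auto simp: mu_nonneg intro!: eventually_finite_subsets_at_top_weakI\<close>)
  then show "h \<in> V (- 1)" by (simp add: V_minus1_iff)
  have "(\<Sum>\<^sub>\<infinity>i\<in>{1..}. (h i)\<^sup>2 / mu i) \<le> C\<^sup>2" by (rule infsum_le_finite_sums[OF s F])
  then show "seminormV (- 1) h \<le> C" unfolding seminormV_minus1 using assms(2) by (intro real_le_lsqrt) auto
qed

lemma abs_coord_le:
  assumes "h \<in> V (- 1)" "1 \<le> i"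
  shows "\<bar>h i\<bar> \<le> real i * pi * seminormV (- 1) h"
proof -
  have "(\<Sum>i\<in>{i}. (h i)\<^sup>2 / mu i) \<le> (seminormV (- 1) h)\<^sup>2" using assms by (intro sum_le_seminormV) auto
  then have "(h i)\<^sup>2 \<le> (real i * pi * seminormV (- 1) h)\<^sup>2"
    using mu_pos[OF assms(2)] by (simp add: divide_le_eq mu_def power_mult_distrib mult_ac)
  moreover have "0 \<le> real i * pi * seminormV (- 1) h"
    by (simp add: seminormV_minus1 infsum_nonneg mu_nonneg)
  ultimately show ?thesis by (metis abs_le_square_iff abs_of_nonneg)
qed

lemma abs_coord_le_normV:
  assumes "h \<in> V (- 1)"
  shows "\<bar>h i\<bar> \<le> (1 + real i * pi) * normV (- 1) h"
proof (cases "1 \<le> i")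
  case True
  have "seminormV (- 1) h \<le> normV (- 1) h"
    unfolding normV_def by (rule real_le_rsqrt) simp
  then have "real i * pi * seminormV (- 1) h \<le> (1 + real i * pi) * normV (- 1) h"
    by (intro mult_mono) (auto simp: seminormV_minus1 infsum_nonneg mu_nonneg)
  then show ?thesis using abs_coord_le[OF assms True] by linarith
next
  case False
  then have "i = 0" by simp
  moreover have "\<bar>h 0\<bar> \<le> normV (- 1) h" unfolding normV_def by (rule real_le_rsqrt) simp
  ultimately show ?thesis by simp
qed

section \<open>Continuity in H and refinement of time grids\<close>

interpretation MH: Metric_space H dist_H
  by (rule Metric_space_H)

lemma continuous_top_H:
  assumes "continuous_map (top_of_set {0..}) top_H X"
  shows "\<And>t. (0::real) \<le> t \<Longrightarrow> X t \<in> H"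
    "\<And>t e. \<lbrakk>0 \<le> t; 0 < e\<rbrakk> \<Longrightarrow> \<exists>d>0. \<forall>s\<ge>0. \<bar>s - t\<bar> < d \<longrightarrow> dist_H (X t) (X s) < e"
proof -
  show H: "X t \<in> H" if "0 \<le> t" for t
    using continuous_map_image_subset_topspace[OF assms] that by (auto simp: top_H_def)
  fix t e :: real assume t: "0 \<le> t" "0 < e"
  have "openin top_H (MH.mball (X t) e)" by (simp add: top_H_def)
  from openin_continuous_map_preimage[OF assms this]
  have "openin (top_of_set {0..}) {s \<in> {0..}. X s \<in> MH.mball (X t) e}" by simp
  moreover have "t \<in> {s \<in> {0..}. X s \<in> MH.mball (X t) e}" using t H[of t] by simp
  ultimately obtain d where "d > 0" "\<And>s. s \<in> {0..} \<Longrightarrow> dist s t < d \<Longrightarrow> s \<in> {s \<in> {0..}. X s \<in> MH.mball (X t) e}"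
    unfolding openin_euclidean_subtopology_iff by blast
  then show "\<exists>d>0. \<forall>s\<ge>0. \<bar>s - t\<bar> < d \<longrightarrow> dist_H (X t) (X s) < e"
    by (intro exI[of _ d]) (auto simp: dist_real_def)
qed

lemma coord_diff_le: "x \<in> H \<Longrightarrow> y \<in> H \<Longrightarrow> \<bar>x i - y i\<bar> \<le> (1 + real i * pi) * dist_H x y"
  using abs_coord_le_normV[OF V_diff, of x y i] by (simp add: H_def dist_H_def)

text \<open>The integrals of \<open>A\<close> over the cells are increments of its indefinite
  integral, which is continuous. All requirements thus reduce to the uniform continuity of finitely
  many functions on a compact interval.\<close>

lemma grid_refine:
  fixes f :: "'i \<Rightarrow> real \<Rightarrow> real" and A :: "real \<Rightarrow> real"
  assumes "finite I" "\<And>i. i \<in> I \<Longrightarrow> continuous_on {0..T} (f i)" "0 < T" "0 < \<eta>"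
    and A: "set_integrable lborel {0<..T} A"
  shows "\<forall>\<^sub>F M in sequentially. 0 < M \<and> (\<forall>k<M.
     (\<forall>i\<in>I. \<forall>s\<in>{real k * (T / real M)..real (Suc k) * (T / real M)}. \<bar>f i s - f i (real k * (T / real M))\<bar> \<le> \<eta>) \<and>
     (LINT s:{real k * (T / real M)<..real (Suc k) * (T / real M)}|lborel. A s) \<le> \<eta>)"
proof -
  define A0 where "A0 s = indicator {0<..T} s * A s" for s
  have A0: "integrable lborel A0" using A by (simp add: set_integrable_def A0_def[abs_def])
  define \<Phi> where "\<Phi> t = integral {0..t} A0" for t
  have A0i: "set_integrable lborel S A0" if "S \<in> sets borel" for S
    using A0 that unfolding set_integrable_def by (intro integrable_mult_indicator) auto
  have "A0 integrable_on {0..T}" by (rule set_borel_integral_eq_integral(1)[OF A0i]) simp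
  then have \<Phi>c: "continuous_on {0..T} \<Phi>" unfolding \<Phi>_def by (rule indefinite_integral_continuous_1)
  have \<Phi>d: "(LINT s:{a<..b}|lborel. A s) = \<Phi> b - \<Phi> a" if "0 \<le> a" "a \<le> b" "b \<le> T" for a b
  proof -
    have e: "\<Phi> t = (LINT s:{0<..t}|lborel. A0 s)" if "0 \<le> t" for t
    proof -
      have "\<Phi> t = (LINT s:{0..t}|lborel. A0 s)"
        unfolding \<Phi>_def by (rule set_borel_integral_eq_integral(2)[OF A0i, symmetric]) simp
      also have "\<dots> = (LINT s:{0<..t}|lborel. A0 s)"
        unfolding set_lebesgue_integral_def
        by (intro Bochner_Integration.integral_cong) (auto simp: A0_def indicator_def)
      finally show ?thesis .
    qed
    have "(LINT s:{a<..b}|lborel. A s) = (LINT s:{a<..b}|lborel. A0 s)"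
      unfolding set_lebesgue_integral_def using that
      by (intro Bochner_Integration.integral_cong) (auto simp: A0_def indicator_def)
    moreover have "\<Phi> b = \<Phi> a + (LINT s:{a<..b}|lborel. A0 s)"
      using that by (subst (1 2) e) (auto intro!: set_integral_split A0i)
    ultimately show ?thesis by simp
  qed
  have unif: "\<forall>\<^sub>F M in sequentially. 0 < M \<and> (\<forall>k<M.
      \<forall>s\<in>{real k * (T / real M)..real (Suc k) * (T / real M)}. \<bar>g s - g (real k * (T / real M))\<bar> \<le> \<eta>)"
    if "continuous_on {0..T} g" for g :: "real \<Rightarrow> real"
  proof -
    have "uniformly_continuous_on {0..T} g" using that by (intro compact_uniformly_continuous) auto
    then obtain d where d: "d > 0" "\<And>s t. s \<in> {0..T} \<Longrightarrow> t \<in> {0..T} \<Longrightarrow> dist s t < d \<Longrightarrow> dist (g s) (g t) < \<eta>"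
      unfolding uniformly_continuous_on_def using \<open>0 < \<eta>\<close> by metis
    have "(\<lambda>M. T / real M) \<longlonglongrightarrow> 0" by (rule lim_const_over_n)
    then have "\<forall>\<^sub>F M in sequentially. T / real M < d" using d(1) by (rule order_tendstoD)
    with eventually_gt_at_top[of 0] show ?thesis
    proof eventually_elim
      case (elim M)
      show ?case
      proof (intro conjI allI impI ballI)
        fix k s assume k: "k < M" and s: "s \<in> {real k * (T / real M)..real (Suc k) * (T / real M)}"
        have "real (Suc k) * (T / real M) \<le> real M * (T / real M)"
          using k \<open>0 < T\<close> by (intro mult_right_mono) auto
        also have "\<dots> = T" using elim by simp
        finally have up: "real (Suc k) * (T / real M) \<le> T" .
        have nn: "0 \<le> real k * (T / real M)" using \<open>0 < T\<close> by simp
        have "real (Suc k) * (T / real M) = real k * (T / real M) + T / real M" by (simp add: algebra_simps add_divide_distrib)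
        then have "\<bar>s - real k * (T / real M)\<bar> < d" using s elim(2) unfolding atLeastAtMost_iff by linarith
        then have "dist s (real k * (T / real M)) < d" by (simp only: dist_real_def)
        then have "dist (g s) (g (real k * (T / real M))) < \<eta>"
          using s up nn by (intro d(2)) auto
        then show "\<bar>g s - g (real k * (T / real M))\<bar> \<le> \<eta>" by (simp add: dist_real_def)
      qed (use elim in auto)
    qed
  qed
  have "\<forall>\<^sub>F M in sequentially. \<forall>i\<in>I. 0 < M \<and> (\<forall>k<M.
      \<forall>s\<in>{real k * (T / real M)..real (Suc k) * (T / real M)}. \<bar>f i s - f i (real k * (T / real M))\<bar> \<le> \<eta>)"
    using assms(1,2) unif by (intro eventually_ball_finite) auto
  with unif[OF \<Phi>c] show ?thesis
  proof eventually_elim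
    case (elim M)
    show ?case
    proof (intro conjI allI impI)
      fix k assume k: "k < M"
      have "real (Suc k) * (T / real M) \<le> real M * (T / real M)"
        using k \<open>0 < T\<close> by (intro mult_right_mono) auto
      also have "\<dots> = T" using elim by simp
      finally have up: "real (Suc k) * (T / real M) \<le> T" .
      have m: "real k * (T / real M) \<le> real (Suc k) * (T / real M)" using \<open>0 < T\<close> by (intro mult_right_mono) auto
      have nn: "0 \<le> real k * (T / real M)" using \<open>0 < T\<close> by simp
      show "(LINT s:{real k * (T / real M)<..real (Suc k) * (T / real M)}|lborel. A s) \<le> \<eta>"
      proof -
        have "\<bar>\<Phi> (real (Suc k) * (T / real M)) - \<Phi> (real k * (T / real M))\<bar> \<le> \<eta>"
          using elim(1) k m by (simp only: atLeastAtMost_iff Ball_def) blast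
        then show ?thesis unfolding \<Phi>d[OF nn m up] by linarith
      qed
      show "\<forall>i\<in>I. \<forall>s\<in>{real k * (T / real M)..real (Suc k) * (T / real M)}. \<bar>f i s - f i (real k * (T / real M))\<bar> \<le> \<eta>"
        using elim(2) k by blast
    qed (use elim in auto)
  qed
qed

lemma set_integral_Icc_Ioc:
  fixes f :: "real \<Rightarrow> real"
  assumes "0 \<le> t" "set_integrable lborel {0<..t} f"
  shows "(LINT s:{0..t}|lborel. f s) = (LINT s:{0<..t}|lborel. f s)"
proof -
  have "(LINT s:{0..t}|lborel. f s) = (\<integral>s. indicator {0<..t} s * f s + indicator {0} s * f 0 \<partial>lborel)"
    unfolding set_lebesgue_integral_def using assms(1)
    by (intro Bochner_Integration.integral_cong) (auto simp: indicator_def)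
  also have "\<dots> = (LINT s:{0<..t}|lborel. f s)"
    using assms(2) unfolding set_lebesgue_integral_def set_integrable_def
    by (subst Bochner_Integration.integral_add) auto
  finally show ?thesis .
qed

text \<open>One realisation of a path. Everything here is deterministic; the noise is present only
  as the value of \<open>CH_lhs\<close>, so that pathwise estimates are separated from
  probability.\<close>

locale CH_traj =
  fixes lam :: real and n :: nat and x :: coefs and X :: "real \<Rightarrow> coefs" and u :: "real \<Rightarrow> real \<Rightarrow> real"
  assumes path: "CH_path n x X u"
begin

lemma X_0: "X 0 = x"
  using path by (simp add: CH_path_def)

lemma X_cont: "continuous_map (top_of_set {0..}) top_H X"
  using path by (simp add: CH_path_def)

lemma X_H: "0 \<le> t \<Longrightarrow> X t \<in> H"
  by (rule continuous_top_H(1)[OF X_cont])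

lemma coord_cont: "continuous_on {0..} (\<lambda>t. X t i)"
  unfolding continuous_on_iff
proof (intro ballI allI impI)
  fix t e :: real assume t: "t \<in> {0..}" and e: "0 < e"
  define c where "c = 1 + real i * pi"
  have c: "0 < c" by (simp add: c_def add_pos_nonneg)
  obtain d where d: "d > 0" "\<And>s. s \<ge> 0 \<Longrightarrow> \<bar>s - t\<bar> < d \<Longrightarrow> dist_H (X t) (X s) < e / c"
    using continuous_top_H(2)[OF X_cont, of t "e / c"] t e c by auto
  show "\<exists>d>0. \<forall>s\<in>{0..}. dist s t < d \<longrightarrow> dist (X s i) (X t i) < e"
  proof (intro exI conjI ballI impI)
    fix s assume s: "s \<in> {0..}" "dist s t < d"
    then have "c * dist_H (X t) (X s) < c * (e / c)"
      using d(2)[of s] c by (intro mult_strict_left_mono) (auto simp: dist_real_def)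
    then show "dist (X s i) (X t i) < e"
      using coord_diff_le[OF X_H X_H, of t s i] s t c by (auto simp: dist_real_def c_def[symmetric] abs_minus_commute)
  qed (rule d)
qed

lemma borel_pair [measurable]: "(\<lambda>(s, \<theta>). u s \<theta>) \<in> borel_measurable (borel \<Otimes>\<^sub>M borel)"
  using path by (simp add: CH_path_def borel_prod)

lemma borel_pair_leb01:
  fixes g :: "real \<Rightarrow> real \<Rightarrow> real"
  assumes "(\<lambda>(s, \<theta>). g s \<theta>) \<in> borel_measurable (borel \<Otimes>\<^sub>M borel)"
  shows "(\<lambda>s. \<integral>\<theta>. g s \<theta> \<partial>leb01) \<in> borel_measurable (borel :: real measure)"
proof -
  have [measurable]: "(\<lambda>x. x) \<in> leb01 \<rightarrow>\<^sub>M borel" by measurable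
  have "(\<lambda>(s, \<theta>). (s, \<theta>)) \<in> borel \<Otimes>\<^sub>M leb01 \<rightarrow>\<^sub>M borel \<Otimes>\<^sub>M borel" by measurable
  from measurable_compose[OF this assms]
  have "(\<lambda>(s, \<theta>). g s \<theta>) \<in> borel_measurable (borel \<Otimes>\<^sub>M leb01)" by (simp add: case_prod_beta')
  from leb01.borel_measurable_lebesgue_integral[OF this] show ?thesis by simp
qed

definition Up :: "real \<Rightarrow> real" where
  "Up s = (\<integral>\<theta>. u s \<theta> ^ (2 * n + 2) \<partial>leb01)"

lemma Up_integrable: "set_integrable lborel {0<..<T} Up"
  and AE_Lp_upto: "AE s in lborel. s \<in> {0<..<T} \<longrightarrow> Lp n (u s)"
proof -
  define f where "f = (\<lambda>(s, \<theta>). indicator ({0<..<max 1 T} \<times> {0<..<1}) (s, \<theta>) * u s \<theta> ^ (2 * n + 2))"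
  have "set_integrable lborel ({0<..<max 1 T} \<times> {0<..<1}) (\<lambda>(s, \<theta>). u s \<theta> ^ (2 * n + 2))"
    using path by (simp add: CH_path_def)
  then have fi: "integrable (lborel \<Otimes>\<^sub>M lborel) f"
    unfolding lborel_prod set_integrable_def f_def by (simp add: case_prod_beta' del: power_Suc)
  have f: "(\<integral>\<theta>. f (s, \<theta>) \<partial>lborel) = indicator {0<..<max 1 T} s * Up s" for s
    unfolding f_def Up_def integral_leb01[symmetric] set_lebesgue_integral_def
    by (simp add: indicator_times mult.assoc del: power_Suc)
  have "integrable lborel (\<lambda>s. \<integral>\<theta>. f (s, \<theta>) \<partial>lborel)" by (rule lborel_pair.integrable_fst'[OF fi])
  then have "set_integrable lborel {0<..<max 1 T} Up" unfolding f set_integrable_def by simp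
  then show "set_integrable lborel {0<..<T} Up" by (rule set_integrable_subset) auto
  have "AE s in lborel. integrable lborel (\<lambda>\<theta>. f (s, \<theta>))" by (rule lborel_pair.AE_integrable_fst'[OF fi])
  then show "AE s in lborel. s \<in> {0<..<T} \<longrightarrow> Lp n (u s)"
  proof (eventually_elim, intro impI)
    fix s assume i: "integrable lborel (\<lambda>\<theta>. f (s, \<theta>))" and s: "s \<in> {0<..<T}"
    have "(\<lambda>\<theta>. f (s, \<theta>)) = (\<lambda>\<theta>. indicator {0<..<1} \<theta> *\<^sub>R u s \<theta> ^ (2 * n + 2))"
      using s by (auto simp: f_def indicator_times fun_eq_iff simp del: power_Suc)
    with i show "Lp n (u s)"
      unfolding Lp_def leb01_def by (simp add: integrable_restrict_space del: power_Suc)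
  qed
qed

lemma Up_int: "set_integrable lborel {0<..T} Up"
  by (rule set_integrable_subset[OF Up_integrable[of "T + 1"]]) auto

lemma AE_Lp: "AE s in lborel. 0 < s \<longrightarrow> Lp n (u s)"
proof -
  have "AE s in lborel. \<forall>m::nat. s \<in> {0<..<real m} \<longrightarrow> Lp n (u s)"
    unfolding AE_all_countable using AE_Lp_upto by blast
  then show ?thesis
  proof (eventually_elim, intro impI)
    fix s :: real assume "\<forall>m::nat. s \<in> {0<..<real m} \<longrightarrow> Lp n (u s)" "0 < s"
    moreover obtain m :: nat where "s < real m" using reals_Archimedean2 by blast
    ultimately show "Lp n (u s)" by auto
  qed
qed

lemma AE_good: "AE s in lborel. 0 < s \<longrightarrow> Lp n (u s) \<and> X s = coeffs (u s)"
  using AE_Lp path unfolding CH_path_def by auto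

definition F :: "nat \<Rightarrow> real \<Rightarrow> real" where
  "F i s = coeffs (\<lambda>\<theta>. fpoly lam n (u s \<theta>)) i"

lemma borel_F [measurable]: "F i \<in> borel_measurable borel"
  unfolding F_def[abs_def] coeffs_leb01 by (rule borel_pair_leb01) measurable

lemma borel_err [measurable]: "(\<lambda>s. err lam n N (u s)) \<in> borel_measurable borel"
proof -
  have [measurable]: "(\<lambda>s. coeffs (u s) i) \<in> borel_measurable borel" for i
    unfolding coeffs_leb01 by (rule borel_pair_leb01) measurable
  show ?thesis unfolding err_def Kop_def by (rule borel_pair_leb01) measurable
qed

lemma abs_F_le:
  assumes "Lp n (u s)" shows "\<bar>F i s\<bar> \<le> 2 * Cg lam n * (1 + Up s)"
proof -
  have i: "integrable leb01 (\<lambda>\<theta>. fpoly lam n (u s \<theta>) * eigfun i \<theta>)"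
    by (intro integrable_mult_eigfun Lp_int assms)
  have "\<bar>F i s\<bar> \<le> (\<integral>\<theta>. \<bar>fpoly lam n (u s \<theta>) * eigfun i \<theta>\<bar> \<partial>leb01)"
    unfolding F_def coeffs_leb01 by (rule integral_abs_bound)
  also have "\<dots> \<le> (\<integral>\<theta>. 2 * Cg lam n * (1 + u s \<theta> ^ (2 * n + 2)) \<partial>leb01)"
  proof (rule integral_mono)
    fix \<theta>
    have "\<bar>fpoly lam n (u s \<theta>) * eigfun i \<theta>\<bar> \<le> (Cg lam n * mx (u s \<theta>) ^ (2 * n + 1)) * 2"
      unfolding abs_mult by (intro mult_mono abs_poly_le abs_eigfun_le) (auto simp: Cg_nonneg mx_ge)
    also have "\<dots> \<le> (Cg lam n * (1 + u s \<theta> ^ (2 * n + 2))) * 2"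
      by (intro mult_right_mono mult_left_mono mx_le_pow Cg_nonneg) auto
    finally show "\<bar>fpoly lam n (u s \<theta>) * eigfun i \<theta>\<bar> \<le> 2 * Cg lam n * (1 + u s \<theta> ^ (2 * n + 2))" by simp
  qed (use i Lp_pow[OF assms] in \<open>auto simp del: power_Suc\<close>)
  also have "\<dots> = 2 * Cg lam n * (1 + Up s)"
    using Lp_pow[OF assms] by (simp add: Up_def leb01.prob_space del: power_Suc)
  finally show ?thesis .
qed

lemma F_int: "set_integrable lborel {0<..T} (F i)"
proof -
  have "set_integrable lborel {0<..T} (\<lambda>s. 2 * Cg lam n * (1 + Up s))"
    using Up_int by (intro set_integrable_mult_right set_integral_add(1) set_integrable_const_Ioc) auto
  then show ?thesis
  proof (rule set_integrable_bound)
    show "set_borel_measurable lborel {0<..T} (F i)" unfolding set_borel_measurable_def by measurable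
    show "AE s in lborel. s \<in> {0<..T} \<longrightarrow> norm (F i s) \<le> norm (2 * Cg lam n * (1 + Up s))"
      using AE_Lp
    proof (eventually_elim, intro impI)
      fix s assume "0 < s \<longrightarrow> Lp n (u s)" "s \<in> {0<..T}"
      then have "\<bar>F i s\<bar> \<le> 2 * Cg lam n * (1 + Up s)" by (intro abs_F_le) auto
      then show "norm (F i s) \<le> norm (2 * Cg lam n * (1 + Up s))" unfolding real_norm_def by linarith
    qed
  qed
qed

lemma X_int: "set_integrable lborel {0<..T} (\<lambda>s. X s i)"
proof -
  have "set_integrable lborel {0..T} (\<lambda>s. X s i)"
    by (intro borel_integrable_atLeastAtMost') (rule continuous_on_subset[OF coord_cont], auto)
  then show ?thesis by (rule set_integrable_subset) auto
qed

text \<open>At almost every time this is \<open>tendsto_err\<close>; the majorant of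
  \<open>abs_err_le\<close> is integrable because the path lies in \<open>L^{2n+2}\<close> of
  space-time.\<close>

lemma err_int: "set_integrable lborel {0<..T} (\<lambda>s. \<bar>err lam n N (u s)\<bar>)"
  and tendsto_err_int: "(\<lambda>N. LINT s:{0<..T}|lborel. \<bar>err lam n N (u s)\<bar>) \<longlonglongrightarrow> 0"
proof -
  let ?w = "\<lambda>s. 2 * Cg lam n * (1 + 2 * Up s)"
  have wi: "set_integrable lborel {0<..T} ?w"
    using Up_int by (intro set_integrable_mult_right set_integral_add(1) set_integrable_const_Ioc) auto
  have b: "AE s in lborel. norm (indicator {0<..T} s *\<^sub>R \<bar>err lam n N (u s)\<bar>) \<le> indicator {0<..T} s *\<^sub>R ?w s" for N
    using AE_Lp
  proof eventually_elim
    case (elim s)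
    then show ?case using abs_err_le[of n "u s" lam N, folded Up_def] by (auto simp: indicator_def)
  qed
  have w: "integrable lborel (\<lambda>s. indicator {0<..T} s *\<^sub>R ?w s)" using wi unfolding set_integrable_def .
  have l: "AE s in lborel. (\<lambda>N. indicator {0<..T} s *\<^sub>R \<bar>err lam n N (u s)\<bar>) \<longlonglongrightarrow> 0"
    using AE_Lp
  proof eventually_elim
    case (elim s)
    show ?case
    proof (cases "s \<in> {0<..T}")
      case True
      then have "(\<lambda>N. \<bar>err lam n N (u s)\<bar>) \<longlonglongrightarrow> \<bar>0\<bar>" using elim by (intro tendsto_rabs tendsto_err) auto
      with True show ?thesis by simp
    qed simp
  qed
  show "set_integrable lborel {0<..T} (\<lambda>s. \<bar>err lam n N (u s)\<bar>)"
    unfolding set_integrable_def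
    by (rule Bochner_Integration.integrable_bound[OF w]) (use b[of N] in \<open>auto elim!: eventually_mono intro: order_trans[OF _ abs_ge_self]\<close>)
  have "(\<lambda>N. \<integral>s. indicator {0<..T} s *\<^sub>R \<bar>err lam n N (u s)\<bar> \<partial>lborel) \<longlonglongrightarrow> (\<integral>s. 0 \<partial>(lborel :: real measure))"
  proof (rule integral_dominated_convergence[where w = "\<lambda>s. indicator {0<..T} s *\<^sub>R ?w s"])
    show "AE s in lborel. (\<lambda>N. indicator {0<..T} s *\<^sub>R \<bar>err lam n N (u s)\<bar>) \<longlonglongrightarrow> 0" by (rule l)
    show "AE s in lborel. norm (indicator {0<..T} s *\<^sub>R \<bar>err lam n N (u s)\<bar>) \<le> indicator {0<..T} s *\<^sub>R ?w s" for N by (rule b)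
  qed (use w in auto)
  then show "(\<lambda>N. LINT s:{0<..T}|lborel. \<bar>err lam n N (u s)\<bar>) \<longlonglongrightarrow> 0"
    by (simp add: set_lebesgue_integral_def)
qed

definition b :: "nat \<Rightarrow> real \<Rightarrow> real" where
  "b i s = - (1 / 2) * ((mu i)\<^sup>2 * X s i - mu i * F i s)"

lemma b_int: "set_integrable lborel {0<..T} (b i)"
  unfolding b_def by (intro set_integrable_mult_right set_integral_diff(1) X_int F_int) 

text \<open>The equation between two times: drift plus the difference of \<open>CH_lhs\<close>,
  which is the increment of the noise. In this form the noise can either be cancelled between two
  paths or fed into the scheme.\<close>

lemma increment:
  assumes "0 \<le> s" "s \<le> t"
  shows "X t i = X s i + (LINT r:{s<..t}|lborel. b i r) + (CH_lhs lam n x X u t i - CH_lhs lam n x X u s i)"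
proof -
  have e: "CH_lhs lam n x X u t i = X t i - x i - (LINT r:{0<..t}|lborel. b i r)" if "0 \<le> t" for t
  proof -
    have "(LINT s:{0..t}|lborel. (eigval i)\<^sup>2 * X s i + eigval i * coeffs (\<lambda>\<theta>. fpoly lam n (u s \<theta>)) i)
      = (LINT s:{0<..t}|lborel. (eigval i)\<^sup>2 * X s i + eigval i * coeffs (\<lambda>\<theta>. fpoly lam n (u s \<theta>)) i)"
    proof (rule set_integral_Icc_Ioc[OF \<open>0 \<le> t\<close>])
      have "set_integrable lborel {0<..t} (\<lambda>s. (eigval i)\<^sup>2 * X s i + eigval i * F i s)"
        by (intro set_integral_add(1) set_integrable_mult_right X_int F_int)
      then show "set_integrable lborel {0<..t} (\<lambda>s. (eigval i)\<^sup>2 * X s i + eigval i * coeffs (\<lambda>\<theta>. fpoly lam n (u s \<theta>)) i)"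
        by (simp add: F_def)
    qed
    also have "\<dots> = (LINT s:{0<..t}|lborel. - 2 * b i s)"
      by (simp add: b_def F_def eigval_mu algebra_simps)
    also have "\<dots> = - 2 * (LINT s:{0<..t}|lborel. b i s)"
      by (rule set_integral_mult_right)
    finally show ?thesis by (simp add: CH_lhs_def)
  qed
  show ?thesis using set_integral_split[OF assms b_int[of t i]] e[of s] e[of t] assms by simp
qed

end

section \<open>Lipschitz dependence on the initial value\<close>

text \<open>Mode 0 has eigenvalue 0, hence no drift. The hypothesis covers only the points
  \<open>k * (T / M)\<close> because these are countably many; continuity of the path extends the
  conclusion to all times.\<close>

lemma (in CH_traj) mean_const:
  assumes T: "0 < T" and g: "\<And>k M. 0 < M \<Longrightarrow> CH_lhs lam n x X u (real k * (T / real M)) 0 = 0" and t: "0 \<le> t"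
  shows "X t 0 = x 0"
proof -
  have b0: "b 0 s = 0" for s by (simp add: b_def mu_def)
  have l0: "CH_lhs lam n x X u 0 0 = 0" using g[of 1 0] by simp
  have grid: "X (real k * (T / real M)) 0 = x 0" if "0 < M" for k M
    using increment[of 0 "real k * (T / real M)" 0] T g[OF that, of k] l0 X_0 by (simp add: b0)
  \<comment> \<open>The last grid point before \<open>t\<close>. As \<open>k\<close> is not bounded
    by \<open>M\<close>, the grids reach beyond \<open>T\<close>.\<close>
  define s where "s M = real (nat \<lfloor>t * real M / T\<rfloor>) * (T / real M)" for M
  have s: "s \<longlonglongrightarrow> t"
  proof (rule tendsto_sandwich)
    show "\<forall>\<^sub>F M in sequentially. t - T / real M \<le> s M"
      using eventually_gt_at_top[of 0]
    proof eventually_elim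
      case (elim M)
      have "t * real M / T - 1 \<le> real (nat \<lfloor>t * real M / T\<rfloor>)" using t T by linarith
      then have "(t * real M / T - 1) * (T / real M) \<le> s M" unfolding s_def using T by (intro mult_right_mono) auto
      moreover have "(t * real M / T - 1) * (T / real M) = t - T / real M" using T elim by (simp add: field_simps)
      ultimately show ?case by simp
    qed
    show "\<forall>\<^sub>F M in sequentially. s M \<le> t"
      using eventually_gt_at_top[of 0]
    proof eventually_elim
      case (elim M)
      have "real (nat \<lfloor>t * real M / T\<rfloor>) \<le> t * real M / T" using t T by simp
      then have "s M \<le> (t * real M / T) * (T / real M)" unfolding s_def using T by (intro mult_right_mono) auto
      also have "\<dots> = t" using T elim by simp
      finally show ?case .
    qed
    have "(\<lambda>M. t - T / real M) \<longlonglongrightarrow> t - 0" by (intro tendsto_diff tendsto_const lim_const_over_n)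
    then show "(\<lambda>M. t - T / real M) \<longlonglongrightarrow> t" by simp
  qed simp
  have "(\<lambda>M. X (s M) 0) \<longlonglongrightarrow> X t 0"
    by (rule continuous_on_tendsto_compose[OF coord_cont s]) (use t T in \<open>auto simp: s_def\<close>)
  moreover have "(\<lambda>M. X (s M) 0) \<longlonglongrightarrow> x 0"
    by (rule tendsto_eventually, rule eventually_mono[OF eventually_gt_at_top[of 0]]) (simp only: s_def grid)
  ultimately show ?thesis by (rule LIMSEQ_unique)
qed

text \<open>Removes the mesh from the conclusion of \<open>discrete_energy\<close> when both
  oscillation bounds there equal \<open>\<eta>\<close>.\<close>

lemma energy_mesh_limit:
  fixes E :: real
  assumes "\<And>\<eta>. 0 < \<eta> \<Longrightarrow> E \<le> exp (2 * L * T) * (E0 + e + 2 * L * T * W * \<eta>\<^sup>2 + (2 * W * \<eta> + W * \<eta>) * a)"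
  shows "E \<le> exp (2 * L * T) * (E0 + e)"
proof (rule tendsto_lowerbound)
  show "((\<lambda>\<eta>. exp (2 * L * T) * (E0 + e + 2 * L * T * W * \<eta>\<^sup>2 + (2 * W * \<eta> + W * \<eta>) * a)) \<longlongrightarrow> exp (2 * L * T) * (E0 + e)) (at_right 0)"
    by (auto intro!: tendsto_eq_intros)
  show "\<forall>\<^sub>F \<eta> in at_right 0. E \<le> exp (2 * L * T) * (E0 + e + 2 * L * T * W * \<eta>\<^sup>2 + (2 * W * \<eta> + W * \<eta>) * a)"
    by (rule eventually_mono[OF eventually_at_right_less]) (rule assms)
qed simp

text \<open>Arithmetic-geometric mean inequality. Summed over the modes it bounds the
  \<open>L2\<close> norm by \<open>|.|_1\<close> and \<open>|.|_{-1}\<close>; the first is available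
  as dissipation, the second goes into Gronwall's argument.\<close>

lemma mu_interpolation:
  assumes "1 \<le> i" shows "\<bar>l\<bar> * d\<^sup>2 \<le> mu i * d\<^sup>2 + l\<^sup>2 / 4 * (d\<^sup>2 / mu i)"
proof -
  have m: "0 < mu i" by (rule mu_pos[OF assms])
  have "0 \<le> (mu i - \<bar>l\<bar> / 2)\<^sup>2 / mu i" using m by simp
  also have "\<dots> = mu i - \<bar>l\<bar> + l\<^sup>2 / 4 / mu i" using m by (simp add: power2_eq_square field_simps)
  finally have "\<bar>l\<bar> * d\<^sup>2 \<le> (mu i + l\<^sup>2 / 4 / mu i) * d\<^sup>2" by (intro mult_right_mono) auto
  then show ?thesis by (simp add: algebra_simps)
qed

text \<open>Two realisations driven by the same noise, which is expressed by equality of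
  \<open>CH_lhs\<close> on the grids; the noise drops out of the difference of the paths.\<close>

locale CH_traj2 = T1: CH_traj lam n x X u + T2: CH_traj lam n x' X' u'
  for lam n x X u x' X' u' +
  fixes T :: real
  assumes T: "0 < T"
    and grid: "\<And>k M i. 0 < M \<Longrightarrow> CH_lhs lam n x X u (real k * (T / real M)) i = CH_lhs lam n x' X' u' (real k * (T / real M)) i"
    and mean: "\<And>t. 0 \<le> t \<Longrightarrow> X t 0 = X' t 0"
begin

text \<open>The weight \<open>fejer N i / mu i\<close> cancels one factor \<open>mu i\<close> of the
  drift and leaves exactly the sum of \<open>monotone_drift\<close>, together with the dissipation
  \<open>mu i * d^2\<close>, which by \<open>mu_interpolation\<close> pays for the term with
  \<open>\<bar>lam\<bar>\<close>.\<close>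

lemma feller_partial:
  "(\<Sum>i=1..N. fejer N i / mu i * (X T i - X' T i)\<^sup>2)
    \<le> exp (2 * (lam\<^sup>2 / 4) * T) * ((\<Sum>i=1..N. fejer N i / mu i * (x i - x' i)\<^sup>2) +
       (LINT s:{0<..T}|lborel. \<bar>err lam n N (u s)\<bar> + \<bar>err lam n N (u' s)\<bar>))"
proof (rule energy_mesh_limit)
  fix \<eta> :: real assume \<eta>: "0 < \<eta>"
  define A where "A s = (\<Sum>i=1..N. \<bar>T1.b i s\<bar> + \<bar>T2.b i s\<bar>)" for s
  have A0: "0 \<le> A s" for s by (auto simp: A_def intro!: sum_nonneg)
  have Ai: "set_integrable lborel {0<..T} A"
    unfolding A_def by (intro set_integral_sum_real set_integral_add(1) set_integrable_abs T1.b_int T2.b_int) auto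
  have cont: "continuous_on {0..T} (\<lambda>s. X s i - X' s i)" for i
    by (intro continuous_on_diff continuous_on_subset[OF T1.coord_cont] continuous_on_subset[OF T2.coord_cont]) auto
  obtain M where *: "0 < M \<and> (\<forall>k<M.
     (\<forall>i\<in>{1..N}. \<forall>s\<in>{real k * (T / real M)..real (Suc k) * (T / real M)}.
        \<bar>X s i - X' s i - (X (real k * (T / real M)) i - X' (real k * (T / real M)) i)\<bar> \<le> \<eta>) \<and>
     (LINT s:{real k * (T / real M)<..real (Suc k) * (T / real M)}|lborel. A s) \<le> \<eta>)"
    using eventually_happens'[OF sequentially_bot grid_refine[of "{1..N}" T "\<lambda>i s. X s i - X' s i", OF _ cont T \<eta> Ai]]
    by (rule exE) simp
  have M: "0 < M" using * by blast
  have mod: "\<bar>X s i - X' s i - (X (real k * (T / real M)) i - X' (real k * (T / real M)) i)\<bar> \<le> \<eta>"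
    if "k < M" "i \<in> {1..N}" "s \<in> {real k * (T / real M)..real (Suc k) * (T / real M)}" for k i s
    using * that by blast
  have small: "(LINT s:{real k * (T / real M)<..real (Suc k) * (T / real M)}|lborel. A s) \<le> \<eta>" if "k < M" for k
    using * that by blast
  define h where "h = T / real M"
  have h: "0 < h" "real M * h = T" using M T by (auto simp: h_def)
  define w where "w i = fejer N i / mu i" for i
  define D where "D k i = X (real k * h) i - X' (real k * h) i" for k i
  define \<epsilon> where "\<epsilon> s = \<bar>err lam n N (u s)\<bar> + \<bar>err lam n N (u' s)\<bar>" for s
  have ei: "set_integrable lborel {0<..T} \<epsilon>"
    unfolding \<epsilon>_def by (intro set_integral_add(1) T1.err_int T2.err_int)
  have w0: "0 \<le> w i" if "i \<in> {1..N}" for i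
    using that fejer_pos[of i N] mu_nonneg[of i] by (auto simp: w_def intro!: divide_nonneg_nonneg)
  define E where "E k = (\<Sum>i=1..N. w i * (D k i)\<^sup>2)" for k
  have "E M \<le> exp (2 * (lam\<^sup>2 / 4) * T) * (E 0 + (LINT s:{0<..T}|lborel. \<epsilon> s) + 2 * (lam\<^sup>2 / 4) * T * (\<Sum>i=1..N. w i) * \<eta>\<^sup>2
        + (2 * (\<Sum>i=1..N. w i) * \<eta> + (\<Sum>i=1..N. w i) * \<eta>) * (LINT s:{0<..T}|lborel. A s))"
  proof (rule discrete_energy[where I = "{1..N}" and w = w and D = D and M = M and h = h and A = A and \<epsilon> = \<epsilon>])
    show "\<And>k. k < M \<Longrightarrow> (LINT s:{real k * h<..real (Suc k) * h}|lborel. A s) \<le> \<eta>"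
      using small by (simp only: h_def)
    fix k assume k: "k < M"
    let ?S = "{real k * h<..real (Suc k) * h}"
    have up: "real (Suc k) * h \<le> T"
    proof -
      have "real (Suc k) * h \<le> real M * h" using k h by (intro mult_right_mono) auto
      then show ?thesis using h by simp
    qed
    have k0: "0 \<le> real k * h" using h by simp
    have kk: "real k * h \<le> real (Suc k) * h" using h by (intro mult_right_mono) auto
    have sub: "set_integrable lborel ?S f" if "set_integrable lborel {0<..T} f" for f :: "real \<Rightarrow> real"
      by (rule set_integrable_subset[OF that]) (use up k0 in \<open>auto simp del: of_nat_Suc\<close>)
    show "\<exists>a d. (\<forall>i\<in>{1..N}. set_integrable lborel ?S (a i) \<and>
           D (Suc k) i = D k i + (LINT s:?S|lborel. a i s)) \<and>
        (AE s in lborel. s \<in> {real k * h<..<real (Suc k) * h} \<longrightarrow>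
           2 * (\<Sum>i=1..N. w i * d i s * a i s) \<le> lam\<^sup>2 / 4 * (\<Sum>i=1..N. w i * (d i s)\<^sup>2) + \<epsilon> s \<and>
           (\<forall>i\<in>{1..N}. \<bar>d i s - D k i\<bar> \<le> \<eta> \<and> \<bar>a i s\<bar> \<le> A s))"
    proof (intro exI conjI ballI)
      fix i
      show "set_integrable lborel ?S (\<lambda>s. T1.b i s - T2.b i s)"
        by (intro set_integral_diff(1) sub T1.b_int T2.b_int)
      have "(LINT s:?S|lborel. T1.b i s - T2.b i s) = (LINT s:?S|lborel. T1.b i s) - (LINT s:?S|lborel. T2.b i s)"
        by (intro set_integral_diff(2) sub T1.b_int T2.b_int)
      then show "D (Suc k) i = D k i + (LINT s:?S|lborel. T1.b i s - T2.b i s)"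
        using T1.increment[OF k0 kk, of i] T2.increment[OF k0 kk, of i] grid[OF M, of k i] grid[OF M, of "Suc k" i]
        unfolding D_def h_def by linarith
    next
      show "AE s in lborel. s \<in> {real k * h<..<real (Suc k) * h} \<longrightarrow>
           2 * (\<Sum>i=1..N. w i * (X s i - X' s i) * (T1.b i s - T2.b i s)) \<le> lam\<^sup>2 / 4 * (\<Sum>i=1..N. w i * (X s i - X' s i)\<^sup>2) + \<epsilon> s \<and>
           (\<forall>i\<in>{1..N}. \<bar>(X s i - X' s i) - D k i\<bar> \<le> \<eta> \<and> \<bar>T1.b i s - T2.b i s\<bar> \<le> A s)"
        using T1.AE_good T2.AE_good
      proof (eventually_elim, intro impI conjI ballI)
        fix s assume g1: "0 < s \<longrightarrow> Lp n (u s) \<and> X s = coeffs (u s)" and g2: "0 < s \<longrightarrow> Lp n (u' s) \<and> X' s = coeffs (u' s)"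
          and s: "s \<in> {real k * h<..<real (Suc k) * h}"
        have s0: "0 < s" using s k0 by (auto simp del: of_nat_Suc)
        with g1 g2 have v: "Lp n (u s)" "Lp n (u' s)" and Xs: "X s = coeffs (u s)" "X' s = coeffs (u' s)" by auto
        {
          fix i assume i: "i \<in> {1..N}"
          show "\<bar>(X s i - X' s i) - D k i\<bar> \<le> \<eta>"
            using mod[OF k i, of s] s unfolding D_def h_def by (auto simp del: of_nat_Suc)
          have "\<bar>T1.b i s - T2.b i s\<bar> \<le> \<bar>T1.b i s\<bar> + \<bar>T2.b i s\<bar>" by linarith
          also have "\<dots> \<le> A s" unfolding A_def using i by (intro member_le_sum[where f = "\<lambda>i. \<bar>T1.b i s\<bar> + \<bar>T2.b i s\<bar>"]) auto
          finally show "\<bar>T1.b i s - T2.b i s\<bar> \<le> A s" .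
        }
        have e1: "2 * (\<Sum>i=1..N. w i * (X s i - X' s i) * (T1.b i s - T2.b i s))
          = (\<Sum>i=1..N. fejer N i * ((X s i - X' s i) * (T1.F i s - T2.F i s)) - fejer N i * (mu i * (X s i - X' s i)\<^sup>2))"
          unfolding sum_distrib_left
        proof (intro sum.cong refl)
          fix i assume "i \<in> {1..N}"
          then have m: "mu i \<noteq> 0" using mu_pos[of i] by auto
          then show "2 * (w i * (X s i - X' s i) * (T1.b i s - T2.b i s)) =
            fejer N i * ((X s i - X' s i) * (T1.F i s - T2.F i s)) - fejer N i * (mu i * (X s i - X' s i)\<^sup>2)"
            by (simp add: w_def T1.b_def T2.b_def power2_eq_square field_simps)
        qed
        have e2: "(\<Sum>i=1..N. fejer N i * ((X s i - X' s i) * (T1.F i s - T2.F i s)))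
          \<le> \<bar>lam\<bar> * (\<Sum>i=1..N. fejer N i * (X s i - X' s i)\<^sup>2) + (err lam n N (u s) + err lam n N (u' s))"
          using monotone_drift[OF v, of N lam] mean[of s] s0 unfolding T1.F_def T2.F_def Xs by simp
        have e3: "\<bar>lam\<bar> * (\<Sum>i=1..N. fejer N i * (X s i - X' s i)\<^sup>2)
          \<le> (\<Sum>i=1..N. fejer N i * (mu i * (X s i - X' s i)\<^sup>2)) + lam\<^sup>2 / 4 * (\<Sum>i=1..N. w i * (X s i - X' s i)\<^sup>2)"
          unfolding sum_distrib_left sum.distrib[symmetric]
        proof (intro sum_mono)
          fix i assume "i \<in> {1..N}"
          then have "fejer N i * (\<bar>lam\<bar> * (X s i - X' s i)\<^sup>2) \<le> fejer N i * (mu i * (X s i - X' s i)\<^sup>2 + lam\<^sup>2 / 4 * ((X s i - X' s i)\<^sup>2 / mu i))"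
            using fejer_pos[of i N] by (intro mult_left_mono mu_interpolation) auto
          then show "\<bar>lam\<bar> * (fejer N i * (X s i - X' s i)\<^sup>2)
            \<le> fejer N i * (mu i * (X s i - X' s i)\<^sup>2) + lam\<^sup>2 / 4 * (w i * (X s i - X' s i)\<^sup>2)"
            by (simp add: w_def algebra_simps)
        qed
        show "2 * (\<Sum>i=1..N. w i * (X s i - X' s i) * (T1.b i s - T2.b i s))
          \<le> lam\<^sup>2 / 4 * (\<Sum>i=1..N. w i * (X s i - X' s i)\<^sup>2) + \<epsilon> s"
          unfolding e1 sum_subtractf \<epsilon>_def using e2 e3 by linarith
      qed
    qed
  qed (use w0 h A0 Ai ei \<eta> in \<open>auto simp: E_def \<epsilon>_def\<close>)
  then show "(\<Sum>i=1..N. fejer N i / mu i * (X T i - X' T i)\<^sup>2)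
    \<le> exp (2 * (lam\<^sup>2 / 4) * T) * ((\<Sum>i=1..N. fejer N i / mu i * (x i - x' i)\<^sup>2) +
       (LINT s:{0<..T}|lborel. \<bar>err lam n N (u s)\<bar> + \<bar>err lam n N (u' s)\<bar>)
       + 2 * (lam\<^sup>2 / 4) * T * (\<Sum>i=1..N. w i) * \<eta>\<^sup>2
        + (2 * (\<Sum>i=1..N. w i) * \<eta> + (\<Sum>i=1..N. w i) * \<eta>) * (LINT s:{0<..T}|lborel. A s))"
    using h(2) by (simp add: E_def D_def w_def \<epsilon>_def T1.X_0 T2.X_0)
qed

text \<open>With the first \<open>m\<close> modes kept on the left, \<open>N\<close> tends to
  infinity: the weights tend to 1 and the defects to 0. The constant contains neither
  \<open>m\<close> nor \<open>n\<close>.\<close>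

lemma feller:
  assumes xx: "x \<in> H" "x' \<in> H"
  shows "seminormV (- 1) (\<lambda>i. X T i - X' T i) \<le> exp (lam\<^sup>2 / 4 * T) * seminormV (- 1) (\<lambda>i. x i - x' i)"
proof (rule seminormV_leI(2))
  let ?K = "exp (2 * (lam\<^sup>2 / 4) * T)" and ?x = "(seminormV (- 1) (\<lambda>i. x i - x' i))\<^sup>2"
  let ?e = "\<lambda>N. LINT s:{0<..T}|lborel. \<bar>err lam n N (u s)\<bar> + \<bar>err lam n N (u' s)\<bar>"
  have e: "?e \<longlonglongrightarrow> 0"
  proof -
    have "?e N = (LINT s:{0<..T}|lborel. \<bar>err lam n N (u s)\<bar>) + (LINT s:{0<..T}|lborel. \<bar>err lam n N (u' s)\<bar>)" for N
      by (intro set_integral_add(2) T1.err_int T2.err_int)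
    then show ?thesis using tendsto_add[OF T1.tendsto_err_int T2.tendsto_err_int, of T T] by simp
  qed
  have xV: "(\<lambda>i. x i - x' i) \<in> V (- 1)" using xx by (simp add: H_def V_diff)
  fix m
  have "(\<Sum>i=1..m. 1 / mu i * (X T i - X' T i)\<^sup>2) \<le> ?K * (?x + 0)"
  proof (rule LIMSEQ_le)
    show "(\<lambda>N. \<Sum>i=1..m. fejer N i / mu i * (X T i - X' T i)\<^sup>2) \<longlonglongrightarrow> (\<Sum>i=1..m. 1 / mu i * (X T i - X' T i)\<^sup>2)"
    proof (intro tendsto_sum tendsto_mult tendsto_divide tendsto_fejer tendsto_const)
      show "mu i \<noteq> 0" if "i \<in> {1..m}" for i using mu_pos[of i] that by auto
    qed
    show "(\<lambda>N. ?K * (?x + ?e N)) \<longlonglongrightarrow> ?K * (?x + 0)"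
      by (intro tendsto_intros e)
    show "\<exists>N0. \<forall>N\<ge>N0. (\<Sum>i=1..m. fejer N i / mu i * (X T i - X' T i)\<^sup>2) \<le> ?K * (?x + ?e N)"
    proof (intro exI allI impI)
      fix N assume N: "m \<le> N"
      have nn: "0 \<le> fejer N i / mu i" if "i \<in> {1..N}" for i
        using that fejer_pos[of i N] mu_nonneg[of i] by (auto intro!: divide_nonneg_nonneg)
      have "(\<Sum>i=1..m. fejer N i / mu i * (X T i - X' T i)\<^sup>2) \<le> (\<Sum>i=1..N. fejer N i / mu i * (X T i - X' T i)\<^sup>2)"
        using N by (intro sum_mono2 mult_nonneg_nonneg nn) auto
      also have "\<dots> \<le> ?K * ((\<Sum>i=1..N. fejer N i / mu i * (x i - x' i)\<^sup>2) + ?e N)" by (rule feller_partial)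
      also have "\<dots> \<le> ?K * (?x + ?e N)"
      proof (intro mult_left_mono add_right_mono)
        have "(\<Sum>i=1..N. fejer N i / mu i * (x i - x' i)\<^sup>2) \<le> (\<Sum>i=1..N. (x i - x' i)\<^sup>2 / mu i)"
        proof (rule sum_mono)
          fix i assume "i \<in> {1..N}"
          have "fejer N i * ((x i - x' i)\<^sup>2 / mu i) \<le> 1 * ((x i - x' i)\<^sup>2 / mu i)"
            using mu_nonneg[of i] by (intro mult_right_mono fejer_le_1) auto
          then show "fejer N i / mu i * (x i - x' i)\<^sup>2 \<le> (x i - x' i)\<^sup>2 / mu i" by simp
        qed
        also have "\<dots> \<le> ?x" by (rule sum_le_seminormV[OF xV]) auto
        finally show "(\<Sum>i=1..N. fejer N i / mu i * (x i - x' i)\<^sup>2) \<le> ?x" .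
      qed simp
      finally show "(\<Sum>i=1..m. fejer N i / mu i * (X T i - X' T i)\<^sup>2) \<le> ?K * (?x + ?e N)" .
    qed
  qed
  also have "?K * (?x + 0) = (exp (lam\<^sup>2 / 4 * T) * seminormV (- 1) (\<lambda>i. x i - x' i))\<^sup>2"
    by (simp add: power_mult_distrib exp_double[symmetric] mult_ac)
  finally show "(\<Sum>i=1..m. (X T i - X' T i)\<^sup>2 / mu i) \<le> (exp (lam\<^sup>2 / 4 * T) * seminormV (- 1) (\<lambda>i. x i - x' i))\<^sup>2"
    by simp
qed (simp add: seminormV_minus1 infsum_nonneg mu_nonneg)

end

section \<open>The Euler--Galerkin scheme\<close>

text \<open>Mode 0 is overwritten by the conserved mean, so the scheme has to get right only the
  modes from 1 on.\<close>

definition galerkin_fun :: "real \<Rightarrow> nat \<Rightarrow> (nat \<Rightarrow> real) \<Rightarrow> real \<Rightarrow> real" where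
  "galerkin_fun c N y \<theta> = (\<Sum>j\<le>N. (if j = 0 then c else y j) * eigfun j \<theta>)"

text \<open>Multiplying the equation for mode \<open>i\<close> by \<open>fejer N i\<close> leaves
  the weight in front of the nonlinear term, whereas the linear term is absorbed into the averaged
  coordinate; the same shape is imposed on the scheme.\<close>

definition galerkin_b :: "real \<Rightarrow> nat \<Rightarrow> real \<Rightarrow> nat \<Rightarrow> (nat \<Rightarrow> real) \<Rightarrow> nat \<Rightarrow> real" where
  "galerkin_b lam n c N y i = - (1 / 2) * ((mu i)\<^sup>2 * y i -
     mu i * fejer N i * coeffs (\<lambda>\<theta>. fpoly lam n (galerkin_fun c N y \<theta>)) i)"

definition below :: "nat \<Rightarrow> real \<Rightarrow> (nat \<Rightarrow> real) \<Rightarrow> bool" where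
  "below N R y \<longleftrightarrow> (\<forall>j\<in>{1..N}. \<bar>y j\<bar> \<le> R)"

text \<open>The noise carries the Fejer weights because the scheme is compared with the Fejer means of the
  solution; switching the drift off outside a box gives second moments for free.\<close>

primrec scheme :: "real \<Rightarrow> nat \<Rightarrow> real \<Rightarrow> nat \<Rightarrow> real \<Rightarrow> real \<Rightarrow> (nat \<Rightarrow> nat \<Rightarrow> real) \<Rightarrow> nat \<Rightarrow> nat \<Rightarrow> real" where
  "scheme lam n c N R h \<xi> 0 = (\<lambda>i. 0)"
| "scheme lam n c N R h \<xi> (Suc k) = (\<lambda>i. scheme lam n c N R h \<xi> k i
     + h * (if below N R (scheme lam n c N R h \<xi> k) then galerkin_b lam n c N (scheme lam n c N R h \<xi> k) i else 0)
     + fejer N i * \<xi> k i)"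

lemma galerkin_b_bounded:
  obtains C where "0 \<le> C" "\<And>y i. below N R y \<Longrightarrow> i \<in> {1..N} \<Longrightarrow> \<bar>galerkin_b lam n c N y i\<bar> \<le> C"
proof -
  define V where "V = 2 * \<bar>c\<bar> + real N * (2 * \<bar>R\<bar>)"
  define K where "K = 2 * (Cg lam n * (1 + V) ^ (2 * n + 1))"
  have V: "0 \<le> V" by (simp add: V_def)
  have K: "0 \<le> K" using V by (simp add: K_def Cg_nonneg)
  show thesis
  proof (rule that[of "(mu N)\<^sup>2 * \<bar>R\<bar> + mu N * K"])
    show "0 \<le> (mu N)\<^sup>2 * \<bar>R\<bar> + mu N * K" using K mu_nonneg[of N] by simp
    fix y i assume y: "below N R y" and i: "i \<in> {1..N}"
    have U: "\<bar>galerkin_fun c N y \<theta>\<bar> \<le> V" for \<theta>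
    proof -
      have "\<bar>galerkin_fun c N y \<theta>\<bar> \<le> (\<Sum>j\<le>N. \<bar>if j = 0 then c else y j\<bar> * 2)"
        unfolding galerkin_fun_def by (rule abs_trig_le)
      also have "\<dots> = 2 * \<bar>c\<bar> + (\<Sum>j=1..N. \<bar>y j\<bar> * 2)" unfolding sum_0_1 by (simp add: mult.commute)
      also have "(\<Sum>j=1..N. \<bar>y j\<bar> * 2) \<le> (\<Sum>j=1..N. 2 * \<bar>R\<bar>)"
        using y by (intro sum_mono) (force simp: below_def)
      finally show ?thesis by (simp add: V_def)
    qed
    have f: "\<bar>fpoly lam n (galerkin_fun c N y \<theta>) * eigfun i \<theta>\<bar> \<le> K" for \<theta>
    proof -
      have "\<bar>fpoly lam n (galerkin_fun c N y \<theta>)\<bar> \<le> Cg lam n * mx (galerkin_fun c N y \<theta>) ^ (2 * n + 1)"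
        by (rule abs_poly_le)
      also have "\<dots> \<le> Cg lam n * (1 + V) ^ (2 * n + 1)"
        using U[of \<theta>] V by (intro mult_left_mono power_mono Cg_nonneg mx_ge(3)) (auto simp: mx_def)
      finally have "\<bar>fpoly lam n (galerkin_fun c N y \<theta>)\<bar> * \<bar>eigfun i \<theta>\<bar> \<le> (Cg lam n * (1 + V) ^ (2 * n + 1)) * 2"
        by (intro mult_mono abs_eigfun_le) (auto simp: Cg_nonneg V)
      then show ?thesis by (simp add: K_def abs_mult)
    qed
    have m: "galerkin_fun c N y \<in> borel_measurable borel" unfolding galerkin_fun_def by measurable
    have fi: "integrable leb01 (\<lambda>\<theta>. fpoly lam n (galerkin_fun c N y \<theta>) * eigfun i \<theta>)"
      by (rule integrable_bounded01[OF _ f]) (use m in measurable)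
    have "\<bar>coeffs (\<lambda>\<theta>. fpoly lam n (galerkin_fun c N y \<theta>)) i\<bar> \<le> (\<integral>\<theta>. \<bar>fpoly lam n (galerkin_fun c N y \<theta>) * eigfun i \<theta>\<bar> \<partial>leb01)"
      unfolding coeffs_leb01 by (rule integral_abs_bound)
    also have "\<dots> \<le> (\<integral>\<theta>. K \<partial>leb01)" using fi f by (intro integral_mono) auto
    finally have co: "\<bar>coeffs (\<lambda>\<theta>. fpoly lam n (galerkin_fun c N y \<theta>)) i\<bar> \<le> K" by (simp add: leb01.prob_space)
    have yi: "\<bar>y i\<bar> \<le> \<bar>R\<bar>" using y i unfolding below_def by force
    have m2: "\<bar>(mu i)\<^sup>2\<bar> \<le> (mu N)\<^sup>2" using i mu_mono[of i N] mu_nonneg[of i] by (simp add: power_mono)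
    have "\<bar>(mu i)\<^sup>2 * y i\<bar> \<le> (mu N)\<^sup>2 * \<bar>R\<bar>"
      unfolding abs_mult by (rule mult_mono[OF m2 yi]) auto
    moreover have "\<bar>mu i * fejer N i * coeffs (\<lambda>\<theta>. fpoly lam n (galerkin_fun c N y \<theta>)) i\<bar> \<le> mu N * 1 * K"
      unfolding abs_mult using i mu_mono[of i N] mu_nonneg fejer_pos[of i N] fejer_le_1[of N i] co
      by (intro mult_mono) auto
    moreover have "\<bar>- (1 / 2) * (p - q)\<bar> \<le> P + Q" if "\<bar>p\<bar> \<le> P" "\<bar>q\<bar> \<le> Q" for p q P Q :: real
      using that by (simp add: abs_mult)
    ultimately show "\<bar>galerkin_b lam n c N y i\<bar> \<le> (mu N)\<^sup>2 * \<bar>R\<bar> + mu N * K"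
      unfolding galerkin_b_def by simp
  qed
qed

text \<open>The seminorm \<open>|.|_1\<close> restricted to the modes 1 to \<open>m\<close>. It
  depends on finitely many coordinates and so is Lipschitz on \<open>Hc c\<close>, where the full
  seminorm may be infinite.\<close>

definition psi :: "nat \<Rightarrow> (nat \<Rightarrow> real) \<Rightarrow> real" where
  "psi m y = sqrt (\<Sum>i=1..m. mu i * (y i)\<^sup>2)"

lemma psi_L2: "psi m y = L2_set (\<lambda>i. sqrt (mu i) * y i) {1..m}"
  unfolding psi_def L2_set_def by (intro arg_cong[where f = sqrt] sum.cong) (auto simp: power_mult_distrib mu_nonneg)

lemma psi_nonneg: "0 \<le> psi m y"
  unfolding psi_L2 by (rule L2_set_nonneg)

lemma psi_le_add: "psi m y \<le> psi m z + (\<Sum>i=1..m. sqrt (mu i) * \<bar>y i - z i\<bar>)"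
proof -
  have "psi m y = L2_set (\<lambda>i. sqrt (mu i) * z i + sqrt (mu i) * (y i - z i)) {1..m}"
    unfolding psi_L2 by (simp add: algebra_simps)
  also have "\<dots> \<le> psi m z + L2_set (\<lambda>i. sqrt (mu i) * (y i - z i)) {1..m}"
    unfolding psi_L2 by (rule L2_set_triangle_ineq)
  also have "L2_set (\<lambda>i. sqrt (mu i) * (y i - z i)) {1..m} \<le> (\<Sum>i=1..m. \<bar>sqrt (mu i) * (y i - z i)\<bar>)"
    by (rule L2_set_le_sum_abs)
  finally show ?thesis by (simp add: abs_mult mu_nonneg)
qed

text \<open>A path that starts at the constant \<open>c\<close>: its modes from 1 on vanish at time
  0, as do those of the scheme, so the initial error is 0.\<close>

locale CH_traj_flat = CH_traj lam n x X u for lam n x X u +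
  fixes T c :: real
  assumes T: "0 < T" and x: "x = (\<lambda>i. if i = 0 then c else 0)"
    and mean: "\<And>t. 0 \<le> t \<Longrightarrow> X t 0 = c"
begin

definition \<xi> :: "nat \<Rightarrow> nat \<Rightarrow> nat \<Rightarrow> real" where
  "\<xi> M k i = CH_lhs lam n x X u (real (Suc k) * (T / real M)) i - CH_lhs lam n x X u (real k * (T / real M)) i"

abbreviation Y :: "nat \<Rightarrow> real \<Rightarrow> nat \<Rightarrow> nat \<Rightarrow> nat \<Rightarrow> real" where
  "Y N R M \<equiv> scheme lam n c N R (T / real M) (\<xi> M)"

text \<open>The constant of \<open>mu_interpolation\<close> for \<open>l = 3 / 2 * lam\<close>, the
  coefficient produced by \<open>galerkin_drift\<close>.\<close>

definition L :: real where "L = (3 / 2 * lam)\<^sup>2 / 4"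

text \<open>The radius \<open>R\<close> is read off from the path: the largest coordinate plus the
  admissible error. While the error is below the bound, the scheme lies in the box, its drift is on,
  and one more step keeps the error below the bound. \<open>B\<close> is what the error bound tends
  to as the mesh is refined, with a margin \<open>e\<close> that is met for all fine meshes.\<close>

lemma scheme_error:
  assumes e: "0 < e"
    and B: "B = exp (2 * L * T) * (LINT s:{0<..T}|lborel. \<bar>err lam n N (u s)\<bar>) + e"
    and S: "\<And>t i. t \<in> {0..T} \<Longrightarrow> i \<in> {1..N} \<Longrightarrow> \<bar>X t i\<bar> \<le> S"
    and R: "S + sqrt (B * mu N) \<le> R"
  shows "\<forall>\<^sub>F M in sequentially. 0 < M \<and> (\<forall>k\<le>M. below N R (Y N R M k) \<and>
     (\<forall>i\<in>{1..N}. (Y N R M k i - fejer N i * X (real k * (T / real M)) i)\<^sup>2 \<le> B * mu i))"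
proof -
  define I where "I = (LINT s:{0<..T}|lborel. \<bar>err lam n N (u s)\<bar>)"
  have I: "0 \<le> I" unfolding I_def by (rule set_integral_nonneg') simp
  have B0: "0 \<le> B" using e I unfolding B I_def[symmetric] by (intro add_nonneg_nonneg mult_nonneg_nonneg) auto
  have L0: "0 \<le> L" by (simp add: L_def)
  \<comment> \<open>The difference of drifts carries \<open>mu i * fejer N i\<close> in front of the
    nonlinear term. This weight cancels it, so that the unweighted sum of
    \<open>galerkin_drift\<close> appears.\<close>
  define w where "w i = 1 / (fejer N i * mu i)" for i
  define W where "W = (\<Sum>i=1..N. w i)"
  have rpos: "0 < fejer N i" "0 < mu i" if "i \<in> {1..N}" for i using that fejer_pos[of i N] mu_pos[of i] by auto
  have w0: "0 \<le> w i" if "i \<in> {1..N}" for i using rpos[OF that] by (auto simp: w_def)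
  obtain Cb where Cb: "0 \<le> Cb" "\<And>y i. below N R y \<Longrightarrow> i \<in> {1..N} \<Longrightarrow> \<bar>galerkin_b lam n c N y i\<bar> \<le> Cb"
    by (rule galerkin_b_bounded[where N = N and R = R and lam = lam and n = n and c = c]) blast
  define A where "A s = Cb + (\<Sum>i=1..N. \<bar>b i s\<bar>)" for s
  have A0: "0 \<le> A s" for s using Cb by (auto simp: A_def intro!: sum_nonneg add_nonneg_nonneg)
  have Ai: "set_integrable lborel {0<..T} A"
    unfolding A_def by (intro set_integral_sum_real set_integral_add(1) set_integrable_abs b_int set_integrable_const_Ioc) auto
  define a where "a = (LINT s:{0<..T}|lborel. A s)"
  have "((\<lambda>\<eta>. exp (2 * L * T) * (0 + I + 2 * L * T * W * \<eta>\<^sup>2 + (2 * W * \<eta> + W * \<eta>) * a)) \<longlongrightarrow> exp (2 * L * T) * I) (at_right 0)"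
    by (auto intro!: tendsto_eq_intros)
  then have "\<forall>\<^sub>F \<eta> in at_right 0. exp (2 * L * T) * (0 + I + 2 * L * T * W * \<eta>\<^sup>2 + (2 * W * \<eta> + W * \<eta>) * a) < B"
    by (rule order_tendstoD) (use e in \<open>simp add: B I_def\<close>)
  with eventually_at_right_less[of 0]
  have "\<forall>\<^sub>F \<eta> in at_right 0. 0 < \<eta> \<and> exp (2 * L * T) * (0 + I + 2 * L * T * W * \<eta>\<^sup>2 + (2 * W * \<eta> + W * \<eta>) * a) < B"
    by eventually_elim simp
  from eventually_happens'[OF _ this] obtain \<eta> :: real where \<eta>: "0 < \<eta>"
    "exp (2 * L * T) * (0 + I + 2 * L * T * W * \<eta>\<^sup>2 + (2 * W * \<eta> + W * \<eta>) * a) < B"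
    by auto
  have cont: "continuous_on {0..T} (\<lambda>s. X s i)" for i
    by (intro continuous_on_subset[OF coord_cont]) auto
  from grid_refine[of "{1..N}" T "\<lambda>i s. X s i", OF _ cont T \<eta>(1) Ai, simplified finite_atLeastAtMost, OF TrueI]
  show ?thesis
  proof eventually_elim
    case (elim M)
    then have M: "0 < M" by blast
    have mod: "\<bar>X s i - X (real k * (T / real M)) i\<bar> \<le> \<eta>"
      if "k < M" "i \<in> {1..N}" "s \<in> {real k * (T / real M)..real (Suc k) * (T / real M)}" for k i s
      using elim that by blast
    have small: "(LINT s:{real k * (T / real M)<..real (Suc k) * (T / real M)}|lborel. A s) \<le> \<eta>" if "k < M" for k
      using elim that by blast
    define h where "h = T / real M"
    have h: "0 < h" "real M * h = T" using M T by (auto simp: h_def)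
    have kh: "real k * h \<in> {0..T}" if "k \<le> M" for k
    proof -
      have "real k * h \<le> real M * h" using that h by (intro mult_right_mono) auto
      then show ?thesis using h by simp
    qed
    define D where "D k i = Y N R M k i - fejer N i * X (real k * h) i" for k i
    define E where "E k = (\<Sum>i=1..N. w i * (D k i)\<^sup>2)" for k
    define B' where "B' = exp (2 * L * T) * (E 0 + (LINT s:{0<..T}|lborel. \<bar>err lam n N (u s)\<bar>) + 2 * L * T * W * \<eta>\<^sup>2
        + (2 * W * \<eta> + W * \<eta>) * (LINT s:{0<..T}|lborel. A s))"
    have E0: "E 0 = 0" by (auto simp: E_def D_def X_0 x intro!: sum.neutral)
    have B': "B' \<le> B" using \<eta>(2) by (simp add: B'_def E0 I_def a_def)
    have DB: "(D k i)\<^sup>2 \<le> B * mu i" if "E k \<le> B'" "i \<in> {1..N}" for k i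
    proof -
      have "w i * (D k i)\<^sup>2 \<le> E k"
        unfolding E_def using that w0 by (intro member_le_sum[where f = "\<lambda>i. w i * (D k i)\<^sup>2"]) auto
      also have "\<dots> \<le> B" using that B' by simp
      finally have "(D k i)\<^sup>2 \<le> B * mu i * fejer N i"
        using rpos[OF that(2)] by (simp add: w_def divide_le_eq mult_ac)
      also have "\<dots> \<le> B * mu i * 1"
        using B0 mu_nonneg[of i] by (intro mult_left_mono fejer_le_1) auto
      finally show ?thesis by simp
    qed
    have bel: "below N R (Y N R M k)" if "E k \<le> B'" "k \<le> M" for k
      unfolding below_def
    proof
      fix i assume i: "i \<in> {1..N}"
      have "\<bar>D k i\<bar> \<le> sqrt (B * mu i)" using DB[OF that(1) i] by (intro real_le_rsqrt) simp
      also have "\<dots> \<le> sqrt (B * mu N)" using i B0 by (intro real_sqrt_le_mono mult_left_mono mu_mono) auto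
      finally have 1: "\<bar>D k i\<bar> \<le> sqrt (B * mu N)" .
      have "\<bar>fejer N i * X (real k * h) i\<bar> \<le> 1 * S"
        unfolding abs_mult using rpos[OF i] fejer_le_1[of N i] S[OF kh[OF that(2)] i] by (intro mult_mono) auto
      with 1 R show "\<bar>Y N R M k i\<bar> \<le> R" unfolding D_def by linarith
    qed
    have EB: "E k \<le> B'" if "k \<le> M" for k
    proof (rule discrete_energy[where I = "{1..N}" and w = w and D = D and M = M and h = h and A = A and \<epsilon> = "\<lambda>s. \<bar>err lam n N (u s)\<bar>"
            and L = L and T = T and \<omega> = \<eta> and \<omega>' = \<eta> and W = W])
      show "\<And>k. k < M \<Longrightarrow> (LINT s:{real k * h<..real (Suc k) * h}|lborel. A s) \<le> \<eta>"
        using small by (simp only: h_def)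
      fix k assume k: "k < M" and Ek: "E k \<le> B'"
      have Yk: "below N R (Y N R M k)" using bel[OF Ek] k by simp
      let ?S = "{real k * h<..real (Suc k) * h}"
      let ?g = "galerkin_b lam n c N (Y N R M k)"
      have up: "real (Suc k) * h \<le> T" using kh[of "Suc k"] k by simp
      have k0: "0 \<le> real k * h" using h by simp
      have kk: "real k * h \<le> real (Suc k) * h" using h by (intro mult_right_mono) auto
      have sub: "set_integrable lborel ?S f" if "set_integrable lborel {0<..T} f" for f :: "real \<Rightarrow> real"
        by (rule set_integrable_subset[OF that]) (use up k0 in \<open>auto simp del: of_nat_Suc\<close>)
      show "\<exists>a d. (\<forall>i\<in>{1..N}. set_integrable lborel ?S (a i) \<and>
           D (Suc k) i = D k i + (LINT s:?S|lborel. a i s)) \<and>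
        (AE s in lborel. s \<in> {real k * h<..<real (Suc k) * h} \<longrightarrow>
           2 * (\<Sum>i=1..N. w i * d i s * a i s) \<le> L * (\<Sum>i=1..N. w i * (d i s)\<^sup>2) + \<bar>err lam n N (u s)\<bar> \<and>
           (\<forall>i\<in>{1..N}. \<bar>d i s - D k i\<bar> \<le> \<eta> \<and> \<bar>a i s\<bar> \<le> A s))"
      proof (intro exI conjI ballI)
        fix i
        show "set_integrable lborel ?S (\<lambda>s. ?g i - fejer N i * b i s)"
          by (intro set_integral_diff(1) set_integrable_const_Ioc set_integrable_mult_right sub b_int)
        have "(LINT s:?S|lborel. ?g i - fejer N i * b i s) = (LINT s:?S|lborel. ?g i) - (LINT s:?S|lborel. fejer N i * b i s)"
          by (intro set_integral_diff(2) set_integrable_const_Ioc set_integrable_mult_right sub b_int)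
        also have "(LINT s:?S|lborel. ?g i) = h * ?g i"
          using h unfolding set_lebesgue_integral_def by (simp add: algebra_simps)
        also have "(LINT s:?S|lborel. fejer N i * b i s) = fejer N i * (LINT s:?S|lborel. b i s)"
          by (rule set_integral_mult_right)
        finally have J: "(LINT s:?S|lborel. ?g i - fejer N i * b i s) = h * ?g i - fejer N i * (LINT s:?S|lborel. b i s)" .
        have \<xi>: "\<xi> M k i = X (real (Suc k) * h) i - X (real k * h) i - (LINT s:?S|lborel. b i s)"
          using increment[OF k0 kk, of i] unfolding \<xi>_def h_def[symmetric] by linarith
        have Y: "Y N R M (Suc k) i = Y N R M k i + h * ?g i + fejer N i * \<xi> M k i" by (simp add: Yk h_def)
        show "D (Suc k) i = D k i + (LINT s:?S|lborel. ?g i - fejer N i * b i s)"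
          unfolding D_def J Y \<xi> by (simp add: algebra_simps del: of_nat_Suc)
      next
        show "AE s in lborel. s \<in> {real k * h<..<real (Suc k) * h} \<longrightarrow>
           2 * (\<Sum>i=1..N. w i * (Y N R M k i - fejer N i * X s i) * (?g i - fejer N i * b i s))
              \<le> L * (\<Sum>i=1..N. w i * (Y N R M k i - fejer N i * X s i)\<^sup>2) + \<bar>err lam n N (u s)\<bar> \<and>
           (\<forall>i\<in>{1..N}. \<bar>(Y N R M k i - fejer N i * X s i) - D k i\<bar> \<le> \<eta> \<and> \<bar>?g i - fejer N i * b i s\<bar> \<le> A s)"
          using AE_good
        proof (eventually_elim, intro impI conjI ballI)
          fix s assume g1: "0 < s \<longrightarrow> Lp n (u s) \<and> X s = coeffs (u s)"
            and s: "s \<in> {real k * h<..<real (Suc k) * h}"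
          have s0: "0 < s" using s k0 by (auto simp del: of_nat_Suc)
          with g1 have v: "Lp n (u s)" and Xs: "X s = coeffs (u s)" by auto
          {
            fix i assume i: "i \<in> {1..N}"
            have "(Y N R M k i - fejer N i * X s i) - D k i = - (fejer N i * (X s i - X (real k * h) i))"
              by (simp add: D_def algebra_simps)
            then have "\<bar>(Y N R M k i - fejer N i * X s i) - D k i\<bar> = fejer N i * \<bar>X s i - X (real k * h) i\<bar>"
              using rpos[OF i] by (simp add: abs_mult)
            also have "\<dots> \<le> 1 * \<eta>"
              using mod[OF k i, of s] s rpos[OF i] fejer_le_1[of N i] unfolding h_def
              by (intro mult_mono) (auto simp del: of_nat_Suc)
            finally show "\<bar>(Y N R M k i - fejer N i * X s i) - D k i\<bar> \<le> \<eta>" by simp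
            have "\<bar>fejer N i * b i s\<bar> \<le> 1 * \<bar>b i s\<bar>"
              unfolding abs_mult using rpos[OF i] fejer_le_1[of N i] by (intro mult_right_mono) auto
            also have "\<dots> \<le> (\<Sum>i=1..N. \<bar>b i s\<bar>)" using i member_le_sum[of i "{1..N}" "\<lambda>i. \<bar>b i s\<bar>"] by simp
            finally show "\<bar>?g i - fejer N i * b i s\<bar> \<le> A s"
              using Cb(2)[OF Yk i] unfolding A_def by linarith
          }
          define d where "d i = Y N R M k i - fejer N i * X s i" for i
          define \<Phi> where "\<Phi> i = coeffs (\<lambda>\<theta>. fpoly lam n (galerkin_fun c N (Y N R M k) \<theta>)) i - F i s" for i
          have e1: "2 * (\<Sum>i=1..N. w i * d i * (?g i - fejer N i * b i s)) = (\<Sum>i=1..N. d i * \<Phi> i - mu i / fejer N i * (d i)\<^sup>2)"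
            unfolding sum_distrib_left
          proof (intro sum.cong refl)
            fix i assume "i \<in> {1..N}"
            then have m: "mu i \<noteq> 0" "fejer N i \<noteq> 0" using rpos[of i] by auto
            have gb: "?g i - fejer N i * b i s = - (1 / 2) * ((mu i)\<^sup>2 * d i - mu i * fejer N i * \<Phi> i)"
              unfolding galerkin_b_def b_def d_def \<Phi>_def by (simp add: algebra_simps)
            show "2 * (w i * d i * (?g i - fejer N i * b i s)) = d i * \<Phi> i - mu i / fejer N i * (d i)\<^sup>2"
              unfolding gb w_def using m by (simp add: field_simps power2_eq_square)
          qed
          have e2: "(\<Sum>i=1..N. d i * \<Phi> i) \<le> \<bar>3 / 2 * lam\<bar> * (\<Sum>i=1..N. (d i)\<^sup>2) + err lam n N (u s)"
          proof -
            have cs: "coeffs (u s) 0 = c" using mean[of s] s0 Xs by auto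
            have "(\<Sum>i=1..N. ((if i = 0 then c else Y N R M k i) - fejer N i * coeffs (u s) i) *
               (coeffs (\<lambda>x. fpoly lam n (\<Sum>i\<le>N. (if i = 0 then c else Y N R M k i) * eigfun i x)) i - coeffs (\<lambda>x. fpoly lam n (u s x)) i))
              \<le> 3 / 2 * \<bar>lam\<bar> * (\<Sum>i=1..N. ((if i = 0 then c else Y N R M k i) - fejer N i * coeffs (u s) i)\<^sup>2) + err lam n N (u s)"
              by (rule galerkin_drift[OF v]) (simp add: cs)
            also have "(\<Sum>i=1..N. ((if i = 0 then c else Y N R M k i) - fejer N i * coeffs (u s) i)\<^sup>2) = (\<Sum>i=1..N. (d i)\<^sup>2)"
              by (intro sum.cong) (auto simp: d_def Xs)
            also have "(\<Sum>i=1..N. ((if i = 0 then c else Y N R M k i) - fejer N i * coeffs (u s) i) *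
               (coeffs (\<lambda>x. fpoly lam n (\<Sum>i\<le>N. (if i = 0 then c else Y N R M k i) * eigfun i x)) i - coeffs (\<lambda>x. fpoly lam n (u s x)) i))
               = (\<Sum>i=1..N. d i * \<Phi> i)"
              by (intro sum.cong) (auto simp: d_def \<Phi>_def galerkin_fun_def[abs_def] F_def Xs)
            finally show ?thesis by (simp add: abs_mult)
          qed
          have e3: "\<bar>3 / 2 * lam\<bar> * (\<Sum>i=1..N. (d i)\<^sup>2) \<le> (\<Sum>i=1..N. mu i / fejer N i * (d i)\<^sup>2) + L * (\<Sum>i=1..N. w i * (d i)\<^sup>2)"
            unfolding sum_distrib_left sum.distrib[symmetric]
          proof (intro sum_mono)
            fix i assume i: "i \<in> {1..N}"
            have inv: "1 \<le> 1 / fejer N i" using rpos[OF i] fejer_le_1[of N i] by simp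
            have "\<bar>3 / 2 * lam\<bar> * (d i)\<^sup>2 \<le> mu i * (d i)\<^sup>2 + L * ((d i)\<^sup>2 / mu i)"
              unfolding L_def using i by (intro mu_interpolation) auto
            also have "\<dots> \<le> (mu i * (d i)\<^sup>2) * (1 / fejer N i) + (L * ((d i)\<^sup>2 / mu i)) * (1 / fejer N i)"
              using mult_left_mono[OF inv, of "mu i * (d i)\<^sup>2"] mult_left_mono[OF inv, of "L * ((d i)\<^sup>2 / mu i)"] L0 mu_nonneg[of i]
              by (simp add: zero_le_divide_iff)
            finally show "\<bar>3 / 2 * lam\<bar> * (d i)\<^sup>2 \<le> mu i / fejer N i * (d i)\<^sup>2 + L * (w i * (d i)\<^sup>2)"
              by (simp add: w_def mult_ac)
          qed
          show "2 * (\<Sum>i=1..N. w i * (Y N R M k i - fejer N i * X s i) * (?g i - fejer N i * b i s))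
              \<le> L * (\<Sum>i=1..N. w i * (Y N R M k i - fejer N i * X s i)\<^sup>2) + \<bar>err lam n N (u s)\<bar>"
            using e2 e3 abs_ge_self[of "err lam n N (u s)"] unfolding d_def[symmetric] e1 sum_subtractf by linarith
        qed
      qed
    qed (use w0 h A0 Ai \<eta> L0 that err_int in \<open>auto simp: E_def W_def B'_def\<close>)
    show ?case
      using M bel[OF EB] DB[OF EB] unfolding D_def h_def by blast
  qed
qed

text \<open>The nested limits record the dependence: the box must contain the first \<open>N\<close>
  modes of the path, and the mesh must be fine for the given \<open>N\<close> and box. The case
  distinction on the right is always true for such a scheme; it is kept because the expected energy
  will be bounded only inside the box.\<close>

lemma scheme_converges:
  assumes e: "0 < e"
  shows "\<forall>\<^sub>F N in sequentially. \<forall>\<^sub>F R in sequentially. \<forall>\<^sub>F M in sequentially.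
     (\<Sum>k<M. T / real M * psi m (X (real k * (T / real M)))) \<le>
     (\<Sum>k<M. T / real M * (if below N (real R) (Y N (real R) M k) then psi m (Y N (real R) M k) else 0)) + e"
proof -
  define B where "B N = exp (2 * L * T) * (LINT s:{0<..T}|lborel. \<bar>err lam n N (u s)\<bar>) + 1 / (real N + 1)" for N
  have bounded: "\<exists>S\<ge>0. \<forall>t\<in>{0..T}. \<forall>i\<in>{1..N}. \<bar>X t i\<bar> \<le> S" for N
  proof -
    have "\<exists>S. \<forall>t\<in>{0..T}. \<bar>X t i\<bar> \<le> S" for i
    proof -
      have "compact ((\<lambda>t. X t i) ` {0..T})"
        by (intro compact_continuous_image continuous_on_subset[OF coord_cont]) auto
      then have "bounded ((\<lambda>t. X t i) ` {0..T})" by (rule compact_imp_bounded)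
      then show ?thesis unfolding bounded_iff by auto
    qed
    then obtain Z where Z: "\<And>i t. t \<in> {0..T} \<Longrightarrow> \<bar>X t i\<bar> \<le> Z i" by metis
    have "\<bar>X t i\<bar> \<le> (\<Sum>i=1..N. \<bar>Z i\<bar>)" if "t \<in> {0..T}" "i \<in> {1..N}" for t i
      using Z[OF that(1), of i] member_le_sum[of i "{1..N}" "\<lambda>i. \<bar>Z i\<bar>"] that by simp
    then show ?thesis by (intro exI[of _ "\<Sum>i=1..N. \<bar>Z i\<bar>"]) (auto intro!: sum_nonneg)
  qed
  obtain Sm where Sm: "0 \<le> Sm" "\<And>t i. t \<in> {0..T} \<Longrightarrow> i \<in> {1..m} \<Longrightarrow> \<bar>X t i\<bar> \<le> Sm" using bounded[of m] by blast
  \<comment> \<open>Distance of the first \<open>m\<close> modes in the weights of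
    \<open>psi\<close>: scheme to averaged path, then averaged path to path. Both parts vanish as
    \<open>N\<close> grows, the first through \<open>tendsto_err_int\<close>.\<close>
  define \<rho> where "\<rho> N = (\<Sum>i=1..m. sqrt (mu i) * (sqrt (B N * mu i) + (1 - fejer N i) * Sm))" for N
  have "\<rho> \<longlonglongrightarrow> (\<Sum>i=1..m. sqrt (mu i) * (sqrt (0 * mu i) + (1 - 1) * Sm))"
  proof -
    have "(\<lambda>N. 1 / (real N + 1)) \<longlonglongrightarrow> 0" by real_asymp
    then have "B \<longlonglongrightarrow> exp (2 * L * T) * 0 + 0"
      unfolding B_def by (intro tendsto_add tendsto_mult tendsto_const tendsto_err_int)
    then have "B \<longlonglongrightarrow> 0" by simp
    then show ?thesis unfolding \<rho>_def by (intro tendsto_intros tendsto_fejer)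
  qed
  then have "\<rho> \<longlonglongrightarrow> 0" by simp
  then have "\<forall>\<^sub>F N in sequentially. \<rho> N < e / T" using e T by (intro order_tendstoD) auto
  with eventually_ge_at_top[of m] show ?thesis
  proof eventually_elim
    case (elim N)
    obtain S where S: "0 \<le> S" "\<And>t i. t \<in> {0..T} \<Longrightarrow> i \<in> {1..N} \<Longrightarrow> \<bar>X t i\<bar> \<le> S" using bounded[of N] by blast
    have "\<forall>\<^sub>F R in sequentially. S + sqrt (B N * mu N) \<le> real R"
      using filterlim_real_sequentially by (auto simp: filterlim_at_top)
    then show ?case
    proof eventually_elim
      case R: (elim R)
      have eN: "0 < 1 / (real N + 1)" by simp
      have "\<forall>\<^sub>F M in sequentially. 0 < M \<and> (\<forall>k\<le>M. below N (real R) (Y N (real R) M k) \<and>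
         (\<forall>i\<in>{1..N}. (Y N (real R) M k i - fejer N i * X (real k * (T / real M)) i)\<^sup>2 \<le> B N * mu i))"
        by (rule scheme_error[OF eN B_def _ R]) (rule S(2))
      then show ?case
      proof eventually_elim
        case M: (elim M)
        have "(\<Sum>k<M. T / real M * psi m (X (real k * (T / real M)))) \<le>
          (\<Sum>k<M. T / real M * (if below N (real R) (Y N (real R) M k) then psi m (Y N (real R) M k) else 0) + T / real M * \<rho> N)"
        proof (rule sum_mono)
          fix k assume k: "k \<in> {..<M}"
          let ?t = "real k * (T / real M)"
          have bel: "below N (real R) (Y N (real R) M k)" using M k by simp
          have t: "?t \<in> {0..T}"
          proof -
            have "?t \<le> real M * (T / real M)" using k T by (intro mult_right_mono) auto
            also have "\<dots> = T" using k by auto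
            finally show ?thesis using T by simp
          qed
          have "psi m (X ?t) \<le> psi m (Y N (real R) M k) + (\<Sum>i=1..m. sqrt (mu i) * \<bar>X ?t i - Y N (real R) M k i\<bar>)"
            by (rule psi_le_add)
          also have "(\<Sum>i=1..m. sqrt (mu i) * \<bar>X ?t i - Y N (real R) M k i\<bar>) \<le> \<rho> N"
            unfolding \<rho>_def
          proof (intro sum_mono mult_left_mono)
            fix i assume i: "i \<in> {1..m}"
            then have iN: "i \<in> {1..N}" using elim(1) by auto
            have "(Y N (real R) M k i - fejer N i * X ?t i)\<^sup>2 \<le> B N * mu i" using M k iN by auto
            then have "\<bar>Y N (real R) M k i - fejer N i * X ?t i\<bar> \<le> sqrt (B N * mu i)" by (intro real_le_rsqrt) simp
            moreover have "\<bar>(1 - fejer N i) * X ?t i\<bar> \<le> (1 - fejer N i) * Sm"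
              unfolding abs_mult using Sm(2)[OF t i] fejer_le_1[of N i] by (auto intro: mult_left_mono)
            moreover have "X ?t i - Y N (real R) M k i = (1 - fejer N i) * X ?t i - (Y N (real R) M k i - fejer N i * X ?t i)"
              by (simp add: algebra_simps)
            ultimately show "\<bar>X ?t i - Y N (real R) M k i\<bar> \<le> sqrt (B N * mu i) + (1 - fejer N i) * Sm" by linarith
          qed (simp add: mu_nonneg)
          finally have "T / real M * psi m (X ?t) \<le> T / real M * (psi m (Y N (real R) M k) + \<rho> N)"
            using T by (intro mult_left_mono) auto
          then show "T / real M * psi m (X ?t) \<le>
            T / real M * (if below N (real R) (Y N (real R) M k) then psi m (Y N (real R) M k) else 0) + T / real M * \<rho> N"
            using bel by (simp add: distrib_left)
        qed
        also have "\<dots> = (\<Sum>k<M. T / real M * (if below N (real R) (Y N (real R) M k) then psi m (Y N (real R) M k) else 0)) + T * \<rho> N"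
          using M by (simp add: sum.distrib)
        also have "T * \<rho> N \<le> e" using elim(2) T by (simp add: pos_less_divide_eq mult.commute)
        finally show ?case by simp
      qed
    qed
  qed
qed

end

section \<open>Increments of the noise\<close>

locale noise = prob_space M for M :: "'w measure" +
  fixes \<beta> :: "nat \<Rightarrow> real \<Rightarrow> 'w \<Rightarrow> real"
  assumes W: "cylindrical_Wiener M \<beta>"
begin

lemma BM: "standard_Brownian_motion M (\<beta> k)"
  using W by (simp add: cylindrical_Wiener_def)

lemma borel_\<beta>: "0 \<le> t \<Longrightarrow> \<beta> k t \<in> borel_measurable M"
  using BM[of k] by (simp add: standard_Brownian_motion_def)

definition past_gen :: "real \<Rightarrow> nat \<Rightarrow> 'w set set" where
  "past_gen s k = {\<beta> k r -` U \<inter> space M | r U. r \<in> {0..s} \<and> U \<in> sets borel}"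

text \<open>Generated by all the Brownian motions up to time \<open>s\<close>, since the scheme at
  that time depends on all of them.\<close>

definition past :: "real \<Rightarrow> 'w measure" where
  "past s = sigma (space M) (\<Union>k. past_gen s k)"

lemma past_gen_events: "past_gen s k \<subseteq> events"
  using borel_\<beta>[of _ k] unfolding past_gen_def by (auto intro: measurable_sets)

lemma past_gen_Pow: "past_gen s k \<subseteq> Pow (space M)"
  unfolding past_gen_def by auto

lemma space_past [simp]: "space (past s) = space M"
  by (simp add: past_def space_measure_of_conv)

lemma sets_past: "sets (past s) = sigma_sets (space M) (\<Union>k. past_gen s k)"
  unfolding past_def by (rule sets_measure_of) (use past_gen_Pow in blast)

lemma past_events: "sets (past s) \<subseteq> events"
  unfolding sets_past by (rule sets.sigma_sets_subset) (use past_gen_events in blast)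

lemma past_borel: "f \<in> borel_measurable (past s) \<Longrightarrow> f \<in> borel_measurable M"
  using past_events by (auto simp: measurable_def)

lemma past_mono: "s \<le> t \<Longrightarrow> f \<in> borel_measurable (past s) \<Longrightarrow> f \<in> borel_measurable (past t)"
proof -
  assume "s \<le> t"
  then have "past_gen s k \<subseteq> past_gen t k" for k unfolding past_gen_def by force
  then have "sets (past s) \<subseteq> sets (past t)" unfolding sets_past by (intro sigma_sets_mono') blast
  then show "f \<in> borel_measurable (past s) \<Longrightarrow> f \<in> borel_measurable (past t)" by (auto simp: measurable_def)
qed

lemma \<beta>_past: "0 \<le> r \<Longrightarrow> r \<le> s \<Longrightarrow> \<beta> k r \<in> borel_measurable (past s)"
proof (rule measurableI)
  fix U :: "real set" assume "0 \<le> r" "r \<le> s" "U \<in> sets borel"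
  then have "\<beta> k r -` U \<inter> space M \<in> (\<Union>k. past_gen s k)"
    unfolding past_gen_def by auto
  then show "\<beta> k r -` U \<inter> space (past s) \<in> sets (past s)" unfolding sets_past space_past by (rule sigma_sets.Basic)
qed simp

definition inc :: "nat \<Rightarrow> real \<Rightarrow> real \<Rightarrow> 'w \<Rightarrow> real" where
  "inc k s t \<omega> = \<beta> k t \<omega> - \<beta> k s \<omega>"

lemma inc_past: "0 \<le> s \<Longrightarrow> s \<le> t \<Longrightarrow> inc k s t \<in> borel_measurable (past t)"
  unfolding inc_def[abs_def] by (intro borel_measurable_diff \<beta>_past) auto

lemma borel_inc: "0 \<le> s \<Longrightarrow> s \<le> t \<Longrightarrow> inc k s t \<in> borel_measurable M"
  by (rule past_borel[OF inc_past])

lemma inc_moments: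
  assumes "0 \<le> s" "s < t"
  shows "integrable M (inc k s t)" "expectation (inc k s t) = 0"
    "integrable M (\<lambda>\<omega>. (inc k s t \<omega>)\<^sup>2)" "expectation (\<lambda>\<omega>. (inc k s t \<omega>)\<^sup>2) = t - s"
proof -
  let ?\<sigma> = "sqrt (t - s)"
  have D: "distributed M lborel (inc k s t) (normal_density 0 ?\<sigma>)"
    using BM[of k] assms unfolding standard_Brownian_motion_def inc_def[abs_def] by auto
  have pos: "0 < ?\<sigma>" using assms by simp
  have i: "integrable M (\<lambda>\<omega>. inc k s t \<omega> ^ j)" "expectation (\<lambda>\<omega>. inc k s t \<omega> ^ j) = (\<integral>x. normal_density 0 ?\<sigma> x * x ^ j \<partial>lborel)" for j
  proof -
    have "integrable lborel (\<lambda>x. normal_density 0 ?\<sigma> x * (x - 0) ^ j)" by (rule integrable_normal_moment[OF pos])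
    then show "integrable M (\<lambda>\<omega>. inc k s t \<omega> ^ j)"
      using distributed_integrable[OF D, of "\<lambda>x. x ^ j"] by simp
    show "expectation (\<lambda>\<omega>. inc k s t \<omega> ^ j) = (\<integral>x. normal_density 0 ?\<sigma> x * x ^ j \<partial>lborel)"
      using distributed_integral[OF D, of "\<lambda>x. x ^ j"] by simp
  qed
  show "integrable M (inc k s t)" using i(1)[of 1] by simp
  show "integrable M (\<lambda>\<omega>. (inc k s t \<omega>)\<^sup>2)" by (rule i)
  show "expectation (inc k s t) = 0" using i(2)[of 1] integral_normal_moment_nz_1[OF pos, of 0] by simp
  show "expectation (\<lambda>\<omega>. (inc k s t \<omega>)\<^sup>2) = t - s"
    using i(2)[of 2] integral_normal_moment_even[OF pos, of 0 1] assms by (simp add: fact_numeral)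
qed

definition proc :: "nat \<Rightarrow> 'w set set" where
  "proc k = sigma_sets (space M) {(\<lambda>\<omega>. \<lambda>t\<in>{0..}. \<beta> k t \<omega>) -` A \<inter> space M | A. A \<in> sets (PiM {0..} (\<lambda>_. borel))}"

lemma indep_proc: "indep_sets proc UNIV"
  using W unfolding cylindrical_Wiener_def indep_vars_def proc_def[abs_def] by auto

lemma proc_algebra: "sigma_algebra (space M) (proc k)"
  unfolding proc_def by (rule sigma_algebra_sigma_sets) auto

lemma proc_Int: "a \<in> proc k \<Longrightarrow> b \<in> proc k \<Longrightarrow> a \<inter> b \<in> proc k"
proof -
  interpret Q: sigma_algebra "space M" "proc k" by (rule proc_algebra)
  show "a \<in> proc k \<Longrightarrow> b \<in> proc k \<Longrightarrow> a \<inter> b \<in> proc k" by (rule Q.Int)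
qed

lemma proc_vimage:
  assumes "0 \<le> r" "U \<in> sets borel" shows "\<beta> k r -` U \<inter> space M \<in> proc k"
proof -
  have "(\<lambda>f. f r) \<in> PiM {0..} (\<lambda>_. borel) \<rightarrow>\<^sub>M (borel :: real measure)"
    using assms by (intro measurable_component_singleton) auto
  then have A: "(\<lambda>f. f r) -` U \<inter> space (PiM {0..} (\<lambda>_. borel)) \<in> sets (PiM {0..} (\<lambda>_. (borel :: real measure)))"
    by (rule measurable_sets) fact
  have "\<beta> k r -` U \<inter> space M = (\<lambda>\<omega>. \<lambda>t\<in>{0..}. \<beta> k t \<omega>) -` ((\<lambda>f. f r) -` U \<inter> space (PiM {0..} (\<lambda>_. borel))) \<inter> space M"
    using assms by (auto simp: space_PiM)
  then show ?thesis unfolding proc_def using A by (intro sigma_sets.Basic) blast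
qed

lemma proc_past: "sigma_sets (space M) (past_gen s k) \<subseteq> proc k"
proof -
  interpret P: sigma_algebra "space M" "proc k" by (rule proc_algebra)
  show ?thesis by (rule P.sigma_sets_subset) (auto simp: past_gen_def intro: proc_vimage)
qed

definition fut :: "nat \<Rightarrow> real \<Rightarrow> real \<Rightarrow> 'w set set" where
  "fut k s t = {inc k s t -` U \<inter> space M | U. U \<in> sets borel}"

lemma fut_proc: "0 \<le> s \<Longrightarrow> s \<le> t \<Longrightarrow> fut k s t \<subseteq> proc k"
proof -
  assume st: "0 \<le> s" "s \<le> t"
  interpret P: sigma_algebra "space M" "proc k" by (rule proc_algebra)
  let ?N = "sigma (space M) (proc k)"
  have sN: "sets ?N = proc k" "space ?N = space M"
    using P.sigma_sets_eq P.space_closed by (simp_all add: sets_measure_of)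
  have m: "\<beta> k r \<in> borel_measurable ?N" if "0 \<le> r" for r
    by (rule measurableI) (use proc_vimage[OF that] sN in auto)
  have "inc k s t \<in> borel_measurable ?N" unfolding inc_def[abs_def] using st by (intro borel_measurable_diff m) auto
  then show ?thesis unfolding fut_def using sN by (auto dest: measurable_sets)
qed

text \<open>Two facts are combined: an increment is independent of the past of its own Brownian
  motion, and different Brownian motions are independent. The increment (index \<open>None\<close>)
  and the individual pasts (index \<open>Some l\<close>) are first shown to form one independent
  family; then all pasts are grouped into one sigma-algebra.\<close>

lemma indep_past_fut:
  assumes st: "0 \<le> s" "s < t"
  shows "indep_set (sets (past s)) (sigma_sets (space M) (fut k s t))"
proof -
  define E where "E = (\<lambda>i. case i of None \<Rightarrow> fut k s t | Some l \<Rightarrow> sigma_sets (space M) (past_gen s l))"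
  define P where "P = (\<lambda>l. sigma_sets (space M) (past_gen s l))"
  have futp: "fut k s t \<subseteq> proc k" using st by (intro fut_proc) auto
  have Pp: "P l \<subseteq> proc l" for l unfolding P_def by (rule proc_past)
  have pe: "proc l \<subseteq> events" for l using indep_proc by (auto simp: indep_sets_def)
  interpret PA: sigma_algebra "space M" "P l" for l
    unfolding P_def using past_gen_Pow by (rule sigma_algebra_sigma_sets)
  have pf: "prob (A \<inter> B) = prob A * prob B" if "A \<in> P k" "B \<in> fut k s t" for A B
  proof -
    have "indep_set (P k) (fut k s t)"
    proof -
      have "prob_space.indep_set M (P k) {(\<lambda>\<omega>. \<beta> k t \<omega> - \<beta> k s \<omega>) -` U \<inter> space M | U. U \<in> sets borel}"
        using BM[of k] st unfolding standard_Brownian_motion_def P_def past_gen_def by blast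
      then show ?thesis unfolding fut_def inc_def[abs_def] .
    qed
    then show ?thesis using that by (simp add: indep_sets2_eq)
  qed
  have ind: "indep_sets E UNIV"
  proof (rule indep_setsI)
    show "E i \<subseteq> events" for i
      unfolding E_def using order_trans[OF futp pe] order_trans[OF Pp pe] by (cases i) (simp_all add: P_def)
    fix A and J :: "nat option set" assume J: "J \<noteq> {}" "finite J" and A: "\<forall>j\<in>J. A j \<in> E j"
    \<comment> \<open>The motion that carries the increment is always included; events of absent
      indices are replaced by the whole space.\<close>
    define K where "K = insert k {l. Some l \<in> J}"
    have Kf: "finite K" "k \<in> K"
      using finite_vimageI[OF J(2), of Some] by (auto simp: K_def vimage_def)
    define a where "a l = (if Some l \<in> J then A (Some l) else space M)" for l
    define z where "z = (if None \<in> J then A None else space M)"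
    have aP: "a l \<in> P l" for l using A PA.top by (auto simp: a_def E_def P_def)
    have sf: "space M \<in> fut k s t" unfolding fut_def by (auto intro!: exI[of _ UNIV])
    have zf: "z \<in> fut k s t" using A sf by (auto simp: z_def E_def)
    have sub: "a l \<subseteq> space M" "z \<subseteq> space M" for l
      using aP[of l] PA.space_closed zf by (auto simp: fut_def)
    have I1: "(\<Inter>j\<in>J. A j) = (\<Inter>l\<in>K. a l) \<inter> z"
    proof (intro equalityI subsetI)
      fix \<omega> assume w: "\<omega> \<in> (\<Inter>j\<in>J. A j)"
      obtain j where "j \<in> J" using J by auto
      then have "\<omega> \<in> A j" "A j \<in> E j" using w A by auto
      then have ws: "\<omega> \<in> space M" using \<open>\<And>i. E i \<subseteq> events\<close> sets.sets_into_space by blast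
      show "\<omega> \<in> (\<Inter>l\<in>K. a l) \<inter> z" using w ws by (auto simp: a_def z_def)
    next
      fix \<omega> assume w: "\<omega> \<in> (\<Inter>l\<in>K. a l) \<inter> z"
      show "\<omega> \<in> (\<Inter>j\<in>J. A j)"
      proof
        fix j assume j: "j \<in> J"
        show "\<omega> \<in> A j"
        proof (cases j)
          case None then show ?thesis using w j by (auto simp: z_def)
        next
          case (Some l) then have "l \<in> K" using j by (auto simp: K_def)
          then have "\<omega> \<in> a l" using w by auto
          then show ?thesis using Some j by (auto simp: a_def)
        qed
      qed
    qed
    \<comment> \<open>The increment is merged with the past of the same motion. Both are events of
      \<open>proc k\<close>, so independence of the processes applies to the \<open>C l\<close>, and
      the factor for \<open>k\<close> is split afterwards by \<open>pf\<close>.\<close>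
    define C where "C l = (if l = k then a k \<inter> z else a l)" for l
    have I2: "(\<Inter>l\<in>K. a l) \<inter> z = (\<Inter>l\<in>K. C l)" using Kf by (auto simp: C_def split: if_splits)
    have Cp: "\<forall>l\<in>K. C l \<in> proc l"
    proof
      fix l
      show "C l \<in> proc l" using aP[of l] Pp[of l] zf futp by (auto simp: C_def intro!: proc_Int)
    qed
    have "prob (\<Inter>l\<in>K. C l) = (\<Prod>l\<in>K. prob (C l))"
      by (rule indep_setsD[OF indep_proc]) (use Kf Cp in auto)
    also have "\<dots> = prob (C k) * (\<Prod>l\<in>K - {k}. prob (C l))" by (rule prod.remove) (use Kf in auto)
    also have "prob (C k) = prob (a k) * prob z" using pf[OF aP zf] by (simp add: C_def)
    also have "(\<Prod>l\<in>K - {k}. prob (C l)) = (\<Prod>l\<in>K - {k}. prob (a l))" by (intro prod.cong) (auto simp: C_def)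
    also have "prob (a k) * prob z * (\<Prod>l\<in>K - {k}. prob (a l)) = (\<Prod>l\<in>K. prob (a l)) * prob z"
      using prod.remove[OF Kf, of "\<lambda>l. prob (a l)"] by simp
    also have "(\<Prod>l\<in>K. prob (a l)) = (\<Prod>l\<in>{l. Some l \<in> J}. prob (A (Some l)))"
      by (rule prod.mono_neutral_cong_right[OF Kf(1)]) (auto simp: K_def a_def prob_space)
    also have "\<dots> * prob z = (\<Prod>j\<in>J. prob (A j))"
    proof -
      have JJ: "J = Some ` {l. Some l \<in> J} \<union> (J \<inter> {None})"
        by (auto simp: image_iff) (metis not_Some_eq)
      have fin: "finite {l. Some l \<in> J}" using Kf(1) by (simp add: K_def)
      have "(\<Prod>j\<in>J. prob (A j)) = (\<Prod>j\<in>Some ` {l. Some l \<in> J}. prob (A j)) * (\<Prod>j\<in>J \<inter> {None}. prob (A j))"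
        by (subst JJ, subst prod.union_disjoint) (use fin J in auto)
      also have "(\<Prod>j\<in>Some ` {l. Some l \<in> J}. prob (A j)) = (\<Prod>l\<in>{l. Some l \<in> J}. prob (A (Some l)))"
        by (subst prod.reindex) auto
      also have "(\<Prod>j\<in>J \<inter> {None}. prob (A j)) = prob z" by (auto simp: z_def prob_space)
      finally show ?thesis by simp
    qed
    finally show "prob (\<Inter>j\<in>J. A j) = (\<Prod>j\<in>J. prob (A j))" unfolding I1 I2 .
  qed
  define G where "G = (\<lambda>b. if b then range Some else {None :: nat option})"
  have UG: "(\<Union>b\<in>UNIV. G b) = UNIV" by (auto simp: G_def UNIV_bool) (metis not_Some_eq rangeI)
  have "indep_sets (\<lambda>b. sigma_sets (space M) (\<Union>i\<in>G b. E i)) UNIV"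
  proof (rule indep_sets_collect_sigma)
    show "indep_sets E (\<Union>b\<in>UNIV. G b)" unfolding UG by (rule ind)
    show "Int_stable (E i)" for i
    proof (cases i)
      case None
      show ?thesis unfolding None E_def
      proof (simp, rule Int_stableI)
        fix a b assume "a \<in> fut k s t" "b \<in> fut k s t"
        then obtain U V where "U \<in> sets borel" "V \<in> sets borel" "a = inc k s t -` U \<inter> space M" "b = inc k s t -` V \<inter> space M"
          by (auto simp: fut_def)
        then show "a \<inter> b \<in> fut k s t" unfolding fut_def by (auto intro!: exI[of _ "U \<inter> V"])
      qed
    next
      case (Some l)
      then show ?thesis unfolding E_def using PA.Int by (auto simp: Int_stable_def P_def)
    qed
    show "disjoint_family_on G UNIV" by (auto simp: disjoint_family_on_def G_def)
  qed
  moreover have "(\<lambda>b. sigma_sets (space M) (\<Union>i\<in>G b. E i)) = case_bool (sets (past s)) (sigma_sets (space M) (fut k s t))"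
  proof (rule ext)
    fix b
    have "sigma_sets (space M) (\<Union>l. sigma_sets (space M) (past_gen s l)) = sets (past s)"
      unfolding sets_past
    proof (rule sigma_sets_eqI)
      fix a assume "a \<in> (\<Union>l. sigma_sets (space M) (past_gen s l))"
      then obtain l where "a \<in> sigma_sets (space M) (past_gen s l)" by auto
      moreover have "sigma_sets (space M) (past_gen s l) \<subseteq> sigma_sets (space M) (\<Union>k. past_gen s k)"
        by (intro sigma_sets_mono') auto
      ultimately show "a \<in> sigma_sets (space M) (\<Union>k. past_gen s k)" by auto
    qed (auto intro: sigma_sets.Basic)
    then show "sigma_sets (space M) (\<Union>i\<in>G b. E i) = case_bool (sets (past s)) (sigma_sets (space M) (fut k s t)) b"
      by (cases b) (simp_all add: G_def E_def)
  qed
  ultimately show ?thesis unfolding indep_set_def by simp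
qed

lemma indep_inc:
  assumes st: "0 \<le> s" "s < t" and G: "G \<in> borel_measurable (past s)"
  shows "indep_var borel G borel (inc k s t)"
  unfolding indep_var_eq
proof (intro conjI)
  show "random_variable borel G" by (rule past_borel[OF G])
  show "random_variable borel (inc k s t)" using st by (intro borel_inc) auto
  have "sigma_sets (space M) {G -` A \<inter> space M | A. A \<in> sets borel} \<subseteq> sets (past s)"
  proof -
    interpret P: sigma_algebra "space M" "sets (past s)" using sets.sigma_algebra_axioms[of "past s"] by simp
    show ?thesis using measurable_sets[OF G] by (intro P.sigma_sets_subset) auto
  qed
  with indep_past_fut[OF st, of k]
  show "indep_set (sigma_sets (space M) {G -` A \<inter> space M | A. A \<in> sets borel})
     (sigma_sets (space M) {inc k s t -` A \<inter> space M | A. A \<in> sets borel})"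
    unfolding indep_sets2_eq fut_def by blast
qed

lemma integrable_mult_square:
  fixes f g :: "'w \<Rightarrow> real"
  assumes "f \<in> borel_measurable M" "g \<in> borel_measurable M" "integrable M (\<lambda>x. (f x)\<^sup>2)" "integrable M (\<lambda>x. (g x)\<^sup>2)"
  shows "integrable M (\<lambda>x. f x * g x)"
proof (rule Bochner_Integration.integrable_bound)
  show "integrable M (\<lambda>x. (f x)\<^sup>2 + (g x)\<^sup>2)" using assms by simp
  show "(\<lambda>x. f x * g x) \<in> borel_measurable M" using assms by simp
  show "AE x in M. norm (f x * g x) \<le> norm ((f x)\<^sup>2 + (g x)\<^sup>2)"
  proof (rule AE_I2)
    fix x
    have "2 * (\<bar>f x\<bar> * \<bar>g x\<bar>) \<le> (f x)\<^sup>2 + (g x)\<^sup>2"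
      using zero_le_power2[of "\<bar>f x\<bar> - \<bar>g x\<bar>"] by (simp add: power2_diff)
    moreover have "0 \<le> \<bar>f x\<bar> * \<bar>g x\<bar>" by simp
    ultimately show "norm (f x * g x) \<le> norm ((f x)\<^sup>2 + (g x)\<^sup>2)"
      unfolding real_norm_def abs_mult by linarith
  qed
qed

lemma inc_orth:
  assumes st: "0 \<le> s" "s < t" and G: "G \<in> borel_measurable (past s)" "integrable M (\<lambda>\<omega>. (G \<omega>)\<^sup>2)"
  shows "expectation (\<lambda>\<omega>. G \<omega> * inc k s t \<omega>) = 0"
proof -
  have "integrable M G"
    by (rule square_integrable_imp_integrable[OF past_borel[OF G(1)] G(2)])
  then show ?thesis using indep_var_lebesgue_integral[OF indep_inc[OF st G(1)]] inc_moments[OF st] by simp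
qed

lemma inc_cross:
  assumes st: "0 \<le> s" "s < t" and kl: "k \<noteq> l"
  shows "expectation (\<lambda>\<omega>. inc k s t \<omega> * inc l s t \<omega>) = 0"
proof -
  have st': "s \<le> t" using st by simp
  have "indep_var borel (inc k s t) borel (inc l s t)"
    unfolding indep_var_eq
  proof (intro conjI)
    show "random_variable borel (inc k s t)" "random_variable borel (inc l s t)" by (rule borel_inc[OF st(1) st'])+
    have sub: "sigma_sets (space M) {inc k s t -` A \<inter> space M | A. A \<in> sets borel} \<subseteq> proc k" for k
    proof -
      interpret P: sigma_algebra "space M" "proc k" by (rule proc_algebra)
      show ?thesis using fut_proc[OF st(1) st'] unfolding fut_def by (intro P.sigma_sets_subset)
    qed
    have ev: "proc l \<subseteq> events" for l using indep_proc by (auto simp: indep_sets_def)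
    have "prob (a \<inter> b) = prob a * prob b" if "a \<in> proc k" "b \<in> proc l" for a b
      using indep_setsD[OF indep_proc, of "{k, l}" "\<lambda>i. if i = k then a else b"] that kl by (auto simp: Int_commute)
    then have "indep_set (proc k) (proc l)" using ev by (simp add: indep_sets2_eq)
    then show "indep_set (sigma_sets (space M) {inc k s t -` A \<inter> space M | A. A \<in> sets borel})
       (sigma_sets (space M) {inc l s t -` A \<inter> space M | A. A \<in> sets borel})"
      using sub[of k] sub[of l] unfolding indep_sets2_eq by blast
  qed
  from indep_var_lebesgue_integral[OF this] inc_moments[OF st] show ?thesis by simp
qed

end

section \<open>Measurability and dissipation of the Galerkin drift\<close>

lemma borel_galerkin_b:
  assumes "\<And>j. (\<lambda>\<omega>. y \<omega> j) \<in> borel_measurable A"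
  shows "(\<lambda>\<omega>. galerkin_b lam n c N (y \<omega>) i) \<in> borel_measurable A"
proof -
  have y: "(\<lambda>p. y (fst p) j) \<in> borel_measurable (A \<Otimes>\<^sub>M leb01)" for j
    by (rule measurable_compose[OF measurable_fst assms])
  have s: "(\<lambda>p. f (snd p)) \<in> borel_measurable (A \<Otimes>\<^sub>M leb01)" if "f \<in> borel_measurable borel" for f :: "real \<Rightarrow> real"
    by (rule measurable_compose[OF measurable_snd measurable_leb01[OF that]])
  have "(\<lambda>p. galerkin_fun c N (y (fst p)) (snd p)) \<in> borel_measurable (A \<Otimes>\<^sub>M leb01)"
    unfolding galerkin_fun_def
  proof (intro borel_measurable_sum borel_measurable_times)
    show "(\<lambda>p. if j = 0 then c else y (fst p) j) \<in> borel_measurable (A \<Otimes>\<^sub>M leb01)" for j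
      using y[of j] by (cases "j = 0") simp_all
    show "(\<lambda>p. eigfun j (snd p)) \<in> borel_measurable (A \<Otimes>\<^sub>M leb01)" for j by (rule s[OF borel_eigfun])
  qed
  from borel_measurable_times[OF measurable_compose[OF this borel_polys(4)] s[OF borel_eigfun]]
  have "(\<lambda>(\<omega>, \<theta>). fpoly lam n (galerkin_fun c N (y \<omega>) \<theta>) * eigfun i \<theta>) \<in> borel_measurable (A \<Otimes>\<^sub>M leb01)"
    by (simp add: case_prod_beta')
  from leb01.borel_measurable_lebesgue_integral[OF this]
  have m: "(\<lambda>\<omega>. coeffs (\<lambda>\<theta>. fpoly lam n (galerkin_fun c N (y \<omega>) \<theta>)) i) \<in> borel_measurable A"
    unfolding coeffs_leb01 by simp
  show ?thesis unfolding galerkin_b_def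
    by (intro borel_measurable_times borel_measurable_diff borel_measurable_const assms m)
qed

text \<open>With these weights the nonlinear term becomes the integral of
  \<open>(U - c) * f_n(U)\<close>, which is bounded pointwise by \<open>fpoly_coercive\<close>; the
  linear term gets the factor \<open>1 / fejer N i\<close>, at least 1, which only increases the
  dissipation.\<close>

lemma galerkin_energy:
  assumes c: "\<bar>c\<bar> < 1" and n: "1 \<le> n"
  shows "(\<Sum>i=1..N. 1 / (fejer N i * mu i) * (2 * (y i * galerkin_b lam n c N y i))) \<le> C0 lam c - (\<Sum>i=1..N. mu i * (y i)\<^sup>2)"
proof -
  define g where "g i = coeffs (\<lambda>\<theta>. fpoly lam n (galerkin_fun c N y \<theta>)) i" for i
  have U: "Lp n (galerkin_fun c N y)"
    unfolding galerkin_fun_def[abs_def] by (rule Lp_trig_diff(1)[OF _ trigI, of n "\<lambda>_. 0"]) (simp add: Lp_def)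
  have fU: "integrable leb01 (\<lambda>\<theta>. fpoly lam n (galerkin_fun c N y \<theta>))" by (rule Lp_int[OF U])
  have "(\<Sum>i=1..N. y i * g i) = (\<Sum>i\<le>N. (if i = 0 then 0 else y i) * g i)" unfolding sum_0_1 by simp
  also have "\<dots> = (\<integral>x. (\<Sum>i\<le>N. (if i = 0 then 0 else y i) * eigfun i x) * fpoly lam n (galerkin_fun c N y x) \<partial>leb01)"
    unfolding g_def by (rule integral_trig_mult(2)[OF fU, symmetric])
  also have "\<dots> \<le> (\<integral>x. C0 lam c \<partial>leb01)"
  proof (rule integral_mono)
    fix x
    have "(\<Sum>i\<le>N. (if i = 0 then 0 else y i) * eigfun i x) = galerkin_fun c N y x - c"
      unfolding galerkin_fun_def sum_0_1 by (simp add: eigfun_def)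
    then show "(\<Sum>i\<le>N. (if i = 0 then 0 else y i) * eigfun i x) * fpoly lam n (galerkin_fun c N y x) \<le> C0 lam c"
      using fpoly_coercive[OF c n] by simp
  qed (use integral_trig_mult(1)[OF fU] in auto)
  finally have yg: "(\<Sum>i=1..N. y i * g i) \<le> C0 lam c" by (simp add: leb01.prob_space)
  have "(\<Sum>i=1..N. 1 / (fejer N i * mu i) * (2 * (y i * galerkin_b lam n c N y i))) \<le> (\<Sum>i=1..N. y i * g i - mu i * (y i)\<^sup>2)"
  proof (rule sum_mono)
    fix i assume "i \<in> {1..N}"
    then have r: "0 < fejer N i" "0 < mu i" using fejer_pos[of i N] mu_pos[of i] by auto
    have "1 / (fejer N i * mu i) * (2 * (y i * galerkin_b lam n c N y i)) = y i * g i - (mu i * (y i)\<^sup>2) / fejer N i"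
      unfolding galerkin_b_def g_def[symmetric] using r by (simp add: field_simps power2_eq_square)
    moreover have "(mu i * (y i)\<^sup>2) / 1 \<le> (mu i * (y i)\<^sup>2) / fejer N i"
      using r fejer_le_1[of N i] by (intro divide_left_mono) auto
    ultimately show "1 / (fejer N i * mu i) * (2 * (y i * galerkin_b lam n c N y i)) \<le> y i * g i - mu i * (y i)\<^sup>2" by simp
  qed
  then show ?thesis using yg unfolding sum_subtractf by linarith
qed

section \<open>Second moments of the coloured noise\<close>

lemma (in prob_space) square_fatou:
  fixes f :: "nat \<Rightarrow> 'a \<Rightarrow> real"
  assumes [measurable]: "\<And>j. f j \<in> borel_measurable M" "g \<in> borel_measurable M"
    and lim: "AE x in M. (\<lambda>j. f j x) \<longlonglongrightarrow> g x"
    and i: "\<And>j. integrable M (\<lambda>x. (f j x)\<^sup>2)" and b: "\<And>j. expectation (\<lambda>x. (f j x)\<^sup>2) \<le> C"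
  shows "integrable M (\<lambda>x. (g x)\<^sup>2)" "expectation (\<lambda>x. (g x)\<^sup>2) \<le> C"
proof -
  have "0 \<le> expectation (\<lambda>x. (f 0 x)\<^sup>2)" by simp
  then have C: "0 \<le> C" using b[of 0] by linarith
  have "(\<integral>\<^sup>+x. ennreal ((g x)\<^sup>2) \<partial>M) = (\<integral>\<^sup>+x. liminf (\<lambda>j. ennreal ((f j x)\<^sup>2)) \<partial>M)"
  proof (rule nn_integral_cong_AE)
    show "AE x in M. ennreal ((g x)\<^sup>2) = liminf (\<lambda>j. ennreal ((f j x)\<^sup>2))"
      using lim
    proof eventually_elim
      case (elim x)
      have "(\<lambda>j. ennreal ((f j x)\<^sup>2)) \<longlonglongrightarrow> ennreal ((g x)\<^sup>2)" by (intro tendsto_ennrealI tendsto_intros elim)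
      then show ?case by (intro lim_imp_Liminf[symmetric]) auto
    qed
  qed
  also have "\<dots> \<le> liminf (\<lambda>j. \<integral>\<^sup>+x. ennreal ((f j x)\<^sup>2) \<partial>M)" by (rule nn_integral_liminf) measurable
  also have "\<dots> \<le> limsup (\<lambda>j. \<integral>\<^sup>+x. ennreal ((f j x)\<^sup>2) \<partial>M)" by (rule Liminf_le_Limsup) simp
  also have "\<dots> \<le> ennreal C"
  proof (rule Limsup_bounded)
    show "\<forall>\<^sub>F j in sequentially. (\<integral>\<^sup>+x. ennreal ((f j x)\<^sup>2) \<partial>M) \<le> ennreal C"
      using i b by (intro always_eventually allI) (subst nn_integral_eq_integral, auto intro!: ennreal_leI)
  qed
  finally have le: "(\<integral>\<^sup>+x. ennreal ((g x)\<^sup>2) \<partial>M) \<le> ennreal C" .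
  show gi: "integrable M (\<lambda>x. (g x)\<^sup>2)"
    by (rule integrableI_bounded) (use le in \<open>auto intro: le_less_trans\<close>)
  have "ennreal (expectation (\<lambda>x. (g x)\<^sup>2)) \<le> ennreal C"
    using le by (subst (asm) nn_integral_eq_integral[OF gi]) auto
  then show "expectation (\<lambda>x. (g x)\<^sup>2) \<le> C" using C by (simp add: ennreal_le_iff)
qed

text \<open>The covariance operator is reduced to its matrix entries: square-summable columns and a
  trace weighted by the inverse eigenvalues. The almost sure convergence of the noise series will be
  supplied by the existence of a solution.\<close>

locale CH_noise = noise M \<beta> for M :: "'w measure" and \<beta> +
  fixes S :: "coefs \<Rightarrow> coefs" and Tr :: real
  assumes S_sq: "\<And>i. summable (\<lambda>k. (S (basis k) i)\<^sup>2)"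
    and S_tr: "\<And>N. (\<Sum>i=1..N. (\<Sum>k. (S (basis k) i)\<^sup>2) / mu i) \<le> Tr"
    and S_conv: "\<And>t. 0 \<le> t \<Longrightarrow> AE \<omega> in M. \<forall>i. summable (\<lambda>k. \<beta> k t \<omega> * S (basis k) i)"
begin

definition q :: "nat \<Rightarrow> real" where
  "q i = (\<Sum>k. (S (basis k) i)\<^sup>2)"

text \<open>Coordinate \<open>i\<close> of the increment of \<open>S W\<close>. Taking the sum of
  the series everywhere, with its default value where it diverges, makes it measurable with respect
  to \<open>past t\<close> without completing the filtration.\<close>

definition dW :: "nat \<Rightarrow> real \<Rightarrow> real \<Rightarrow> 'w \<Rightarrow> real" where
  "dW i s t \<omega> = (\<Sum>k. inc k s t \<omega> * S (basis k) i)"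

lemma dW_past: "0 \<le> s \<Longrightarrow> s \<le> t \<Longrightarrow> dW i s t \<in> borel_measurable (past t)"
  unfolding dW_def[abs_def] by (intro borel_measurable_suminf borel_measurable_times inc_past borel_measurable_const)

lemma dW_sums:
  assumes "0 \<le> s" "s \<le> t"
  shows "AE \<omega> in M. \<forall>i. (\<lambda>k. inc k s t \<omega> * S (basis k) i) sums dW i s t \<omega>"
  using S_conv[OF assms(1)] S_conv[OF order_trans[OF assms]]
proof (eventually_elim)
  fix \<omega> assume a: "\<forall>i. summable (\<lambda>k. \<beta> k s \<omega> * S (basis k) i)" "\<forall>i. summable (\<lambda>k. \<beta> k t \<omega> * S (basis k) i)"
  show "\<forall>i. (\<lambda>k. inc k s t \<omega> * S (basis k) i) sums dW i s t \<omega>"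
  proof
    fix i
    have "summable (\<lambda>k. \<beta> k t \<omega> * S (basis k) i - \<beta> k s \<omega> * S (basis k) i)" using a by (intro summable_diff) auto
    then show "(\<lambda>k. inc k s t \<omega> * S (basis k) i) sums dW i s t \<omega>"
      unfolding dW_def inc_def left_diff_distrib by (rule summable_sums)
  qed
qed

lemma inc_sum_sq:
  assumes st: "0 \<le> s" "s < t" and J: "finite J"
  shows "integrable M (\<lambda>\<omega>. (\<Sum>k\<in>J. inc k s t \<omega> * a k)\<^sup>2)"
    "expectation (\<lambda>\<omega>. (\<Sum>k\<in>J. inc k s t \<omega> * a k)\<^sup>2) = (t - s) * (\<Sum>k\<in>J. (a k)\<^sup>2)"
proof -
  have b: "inc k s t \<in> borel_measurable M" for k using st by (intro borel_inc) auto
  have ij: "integrable M (\<lambda>\<omega>. inc k s t \<omega> * inc l s t \<omega>)" for k l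
    by (intro integrable_mult_square b inc_moments st)
  have eq: "(\<Sum>k\<in>J. inc k s t \<omega> * a k)\<^sup>2 = (\<Sum>k\<in>J. \<Sum>l\<in>J. (a k * a l) * (inc k s t \<omega> * inc l s t \<omega>))" for \<omega>
    unfolding power2_eq_square sum_product by (intro sum.cong refl) (simp add: mult_ac)
  show "integrable M (\<lambda>\<omega>. (\<Sum>k\<in>J. inc k s t \<omega> * a k)\<^sup>2)"
    unfolding eq by (intro Bochner_Integration.integrable_sum integrable_mult_right ij)
  have "expectation (\<lambda>\<omega>. (\<Sum>k\<in>J. inc k s t \<omega> * a k)\<^sup>2) = (\<Sum>k\<in>J. \<Sum>l\<in>J. (a k * a l) * expectation (\<lambda>\<omega>. inc k s t \<omega> * inc l s t \<omega>))"
    unfolding eq using ij by simp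
  also have "\<dots> = (\<Sum>k\<in>J. \<Sum>l\<in>J. if l = k then (t - s) * (a k)\<^sup>2 else 0)"
  proof (intro sum.cong refl)
    fix k l
    show "(a k * a l) * expectation (\<lambda>\<omega>. inc k s t \<omega> * inc l s t \<omega>) = (if l = k then (t - s) * (a k)\<^sup>2 else 0)"
      using inc_cross[OF st, of k l] inc_moments(4)[OF st, of k] by (auto simp: power2_eq_square)
  qed
  also have "\<dots> = (t - s) * (\<Sum>k\<in>J. (a k)\<^sup>2)" using J by (simp add: sum_distrib_left)
  finally show "expectation (\<lambda>\<omega>. (\<Sum>k\<in>J. inc k s t \<omega> * a k)\<^sup>2) = (t - s) * (\<Sum>k\<in>J. (a k)\<^sup>2)" .
qed

text \<open>The second moments of finite sums are explicit and Fatou's lemma passes to the tail. For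
  \<open>m = 0\<close> this bounds the variance of \<open>dW\<close>; for growing \<open>m\<close>
  it makes the partial sums converge in mean square.\<close>

lemma dW_tail_sq:
  assumes st: "0 \<le> s" "s < t"
  shows "integrable M (\<lambda>\<omega>. (dW i s t \<omega> - (\<Sum>k<m. inc k s t \<omega> * S (basis k) i))\<^sup>2)" (is ?i)
    "expectation (\<lambda>\<omega>. (dW i s t \<omega> - (\<Sum>k<m. inc k s t \<omega> * S (basis k) i))\<^sup>2) \<le> (t - s) * (q i - (\<Sum>k<m. (S (basis k) i)\<^sup>2))" (is ?e)
proof -
  have b: "inc k s t \<in> borel_measurable M" for k using st by (intro borel_inc) auto
  have d: "dW i s t \<in> borel_measurable M" by (rule past_borel[OF dW_past]) (use st in auto)
  note [measurable] = b d
  define f where "f j \<omega> = (\<Sum>k\<in>{m..<m + j}. inc k s t \<omega> * S (basis k) i)" for j \<omega>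
  have part: "(\<Sum>k<m + j. g k) = (\<Sum>k<m. g k) + (\<Sum>k\<in>{m..<m + j}. g k)" for g :: "nat \<Rightarrow> real" and j
    by (induction j) simp_all
  have lim: "AE \<omega> in M. (\<lambda>j. f j \<omega>) \<longlonglongrightarrow> dW i s t \<omega> - (\<Sum>k<m. inc k s t \<omega> * S (basis k) i)"
    using dW_sums[OF st(1) less_imp_le[OF st(2)]]
  proof (eventually_elim)
    fix \<omega> assume "\<forall>i. (\<lambda>k. inc k s t \<omega> * S (basis k) i) sums dW i s t \<omega>"
    then have "(\<lambda>j. \<Sum>k<j. inc k s t \<omega> * S (basis k) i) \<longlonglongrightarrow> dW i s t \<omega>" by (simp add: sums_def)
    then have "(\<lambda>j. \<Sum>k<j + m. inc k s t \<omega> * S (basis k) i) \<longlonglongrightarrow> dW i s t \<omega>" by (rule LIMSEQ_ignore_initial_segment)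
    then have "(\<lambda>j. (\<Sum>k<j + m. inc k s t \<omega> * S (basis k) i) - (\<Sum>k<m. inc k s t \<omega> * S (basis k) i)) \<longlonglongrightarrow> dW i s t \<omega> - (\<Sum>k<m. inc k s t \<omega> * S (basis k) i)"
      by (intro tendsto_intros)
    then show "(\<lambda>j. f j \<omega>) \<longlonglongrightarrow> dW i s t \<omega> - (\<Sum>k<m. inc k s t \<omega> * S (basis k) i)"
      unfolding f_def by (simp add: add.commute[of _ m] part)
  qed
  have bd: "expectation (\<lambda>\<omega>. (f j \<omega>)\<^sup>2) \<le> (t - s) * (q i - (\<Sum>k<m. (S (basis k) i)\<^sup>2))" for j
  proof -
    have "(\<Sum>k<m + j. (S (basis k) i)\<^sup>2) \<le> q i" unfolding q_def by (intro sum_le_suminf S_sq) auto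
    then show ?thesis unfolding f_def inc_sum_sq(2)[OF st finite_atLeastLessThan] part
      using st by (intro mult_left_mono) auto
  qed
  have fm: "f j \<in> borel_measurable M" for j unfolding f_def by measurable
  have gm: "(\<lambda>\<omega>. dW i s t \<omega> - (\<Sum>k<m. inc k s t \<omega> * S (basis k) i)) \<in> borel_measurable M" by measurable
  have fi: "integrable M (\<lambda>\<omega>. (f j \<omega>)\<^sup>2)" for j unfolding f_def by (rule inc_sum_sq(1)[OF st]) simp
  show ?i by (rule square_fatou(1)[OF fm gm lim fi bd])
  show ?e by (rule square_fatou(2)[OF fm gm lim fi bd])
qed

lemma dW_sq:
  assumes st: "0 \<le> s" "s < t"
  shows "integrable M (\<lambda>\<omega>. (dW i s t \<omega>)\<^sup>2)" "expectation (\<lambda>\<omega>. (dW i s t \<omega>)\<^sup>2) \<le> (t - s) * q i"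
  using dW_tail_sq[OF st, of i 0] by simp_all

text \<open>Each partial sum is orthogonal to \<open>G\<close> by independence, and the remaining
  tail is small in mean square.\<close>

lemma dW_orth:
  assumes st: "0 \<le> s" "s < t" and G: "G \<in> borel_measurable (past s)" "integrable M (\<lambda>\<omega>. (G \<omega>)\<^sup>2)"
  shows "integrable M (\<lambda>\<omega>. G \<omega> * dW i s t \<omega>)" "expectation (\<lambda>\<omega>. G \<omega> * dW i s t \<omega>) = 0"
proof -
  have b: "inc k s t \<in> borel_measurable M" for k using st by (intro borel_inc) auto
  have d: "dW i s t \<in> borel_measurable M" by (rule past_borel[OF dW_past]) (use st in auto)
  have Gm: "G \<in> borel_measurable M" by (rule past_borel[OF G(1)])
  note [measurable] = b d Gm
  show GW: "integrable M (\<lambda>\<omega>. G \<omega> * dW i s t \<omega>)" by (intro integrable_mult_square dW_sq st G Gm d)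
  define E where "E = expectation (\<lambda>\<omega>. G \<omega> * dW i s t \<omega>)"
  define g where "g = expectation (\<lambda>\<omega>. (G \<omega>)\<^sup>2)"
  define \<tau> where "\<tau> m = (t - s) * (q i - (\<Sum>k<m. (S (basis k) i)\<^sup>2))" for m
  have \<tau>: "\<tau> \<longlonglongrightarrow> 0"
  proof -
    have "(\<lambda>m. \<Sum>k<m. (S (basis k) i)\<^sup>2) \<longlonglongrightarrow> q i" unfolding q_def by (rule summable_LIMSEQ[OF S_sq])
    then have "\<tau> \<longlonglongrightarrow> (t - s) * (q i - q i)" unfolding \<tau>_def by (intro tendsto_intros)
    then show ?thesis by simp
  qed
  \<comment> \<open>Young's inequality with a parameter: \<open>m\<close> tends to infinity for
    fixed \<open>d\<close>, then \<open>d\<close> tends to 0.\<close>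
  have main: "\<bar>E\<bar> \<le> d * g + \<tau> m / d" if dp: "0 < d" for d m
  proof -
    let ?P = "\<lambda>\<omega>. \<Sum>k<m. inc k s t \<omega> * S (basis k) i"
    let ?Z = "\<lambda>\<omega>. dW i s t \<omega> - ?P \<omega>"
    have GI: "integrable M (\<lambda>\<omega>. G \<omega> * inc k s t \<omega>)" for k by (intro integrable_mult_square inc_moments st G Gm b)
    have eqP: "G \<omega> * ?P \<omega> = (\<Sum>k<m. S (basis k) i * (G \<omega> * inc k s t \<omega>))" for \<omega>
      by (simp add: sum_distrib_left mult_ac)
    have GP: "integrable M (\<lambda>\<omega>. G \<omega> * ?P \<omega>)" "expectation (\<lambda>\<omega>. G \<omega> * ?P \<omega>) = 0"
      unfolding eqP using GI inc_orth[OF st G] by (auto intro!: sum.neutral)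
    have Zi: "integrable M (\<lambda>\<omega>. (?Z \<omega>)\<^sup>2)" "expectation (\<lambda>\<omega>. (?Z \<omega>)\<^sup>2) \<le> \<tau> m"
      unfolding \<tau>_def by (rule dW_tail_sq[OF st])+
    have "E = expectation (\<lambda>\<omega>. G \<omega> * dW i s t \<omega> - G \<omega> * ?P \<omega>)" using GW GP by (simp add: E_def)
    also have "\<dots> = expectation (\<lambda>\<omega>. G \<omega> * ?Z \<omega>)" by (simp only: right_diff_distrib)
    finally have "\<bar>E\<bar> \<le> expectation (\<lambda>\<omega>. \<bar>G \<omega> * ?Z \<omega>\<bar>)" by (simp only: integral_abs_bound)
    also have "\<dots> \<le> expectation (\<lambda>\<omega>. d * (G \<omega>)\<^sup>2 + (?Z \<omega>)\<^sup>2 / d)"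
    proof (rule integral_mono)
      have "integrable M (\<lambda>\<omega>. G \<omega> * ?Z \<omega>)" by (intro integrable_mult_square Zi G) measurable
      then show "integrable M (\<lambda>\<omega>. \<bar>G \<omega> * ?Z \<omega>\<bar>)" by simp
      show "integrable M (\<lambda>\<omega>. d * (G \<omega>)\<^sup>2 + (?Z \<omega>)\<^sup>2 / d)" using Zi G by simp
      show "\<bar>G \<omega> * ?Z \<omega>\<bar> \<le> d * (G \<omega>)\<^sup>2 + (?Z \<omega>)\<^sup>2 / d" for \<omega>
      proof -
        have y: "\<bar>x * y\<bar> \<le> d * x\<^sup>2 + y\<^sup>2 / d" for x y :: real
        proof -
          have "0 \<le> (d * \<bar>x\<bar> - \<bar>y\<bar>)\<^sup>2 / d" using dp by simp
          also have "\<dots> = d * x\<^sup>2 - 2 * \<bar>x * y\<bar> + y\<^sup>2 / d"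
            using dp by (simp add: power2_diff abs_mult field_simps power2_eq_square)
          finally show ?thesis using abs_ge_zero[of "x * y"] by linarith
        qed
        show ?thesis by (rule y)
      qed
    qed
    also have "\<dots> = d * g + expectation (\<lambda>\<omega>. (?Z \<omega>)\<^sup>2) / d" using Zi G by (simp add: g_def)
    also have "\<dots> \<le> d * g + \<tau> m / d" using Zi dp by (intro add_left_mono divide_right_mono) auto
    finally show ?thesis .
  qed
  have "\<bar>E\<bar> \<le> d * g" if dp: "0 < d" for d
  proof -
    have "(\<lambda>m. d * g + \<tau> m / d) \<longlonglongrightarrow> d * g + 0 / d" by (intro tendsto_intros \<tau>) (use dp in auto)
    then have "\<bar>E\<bar> \<le> d * g + 0 / d" by (rule LIMSEQ_le_const) (use main[OF dp] in auto)
    then show ?thesis by simp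
  qed
  then have "\<forall>\<^sub>F d in at_right 0. \<bar>E\<bar> \<le> d * g" by (intro eventually_mono[OF eventually_at_right_less])
  moreover have "((\<lambda>d. d * g) \<longlongrightarrow> 0 * g) (at_right 0)" by (intro tendsto_intros)
  ultimately have "\<bar>E\<bar> \<le> 0 * g" by (intro tendsto_lowerbound) auto
  then show "expectation (\<lambda>\<omega>. G \<omega> * dW i s t \<omega>) = 0" by (simp add: E_def)
qed

end

section \<open>The energy estimate\<close>

text \<open>The scheme as a random sequence for fixed step, box and number of modes, driven by
  \<open>dW\<close>. On almost every path it agrees with the pathwise scheme, whose increments
  \<open>\<xi>\<close> are read off from the solution.\<close>

locale CH_energy = CH_noise M \<beta> S Tr for M :: "'w measure" and \<beta> S Tr +
  fixes lam c h R :: real and n N :: nat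
  assumes c: "\<bar>c\<bar> < 1" and n: "1 \<le> n" and h: "0 < h"
begin

definition Yr :: "nat \<Rightarrow> 'w \<Rightarrow> nat \<Rightarrow> real" where
  "Yr k \<omega> = scheme lam n c N R h (\<lambda>k i. dW i (real k * h) (real (Suc k) * h) \<omega>) k"

definition drift :: "nat \<Rightarrow> nat \<Rightarrow> 'w \<Rightarrow> real" where
  "drift k i \<omega> = (if below N R (Yr k \<omega>) then galerkin_b lam n c N (Yr k \<omega>) i else 0)"

lemma Yr_0: "Yr 0 \<omega> i = 0"
  by (simp add: Yr_def)

lemma Yr_Suc: "Yr (Suc k) \<omega> i = (Yr k \<omega> i + h * drift k i \<omega>) + fejer N i * dW i (real k * h) (real (Suc k) * h) \<omega>"
  by (simp add: Yr_def drift_def)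

lemma times: "0 \<le> real k * h" "real k * h < real (Suc k) * h"
  using h by (auto simp: algebra_simps)

lemma drift_past:
  assumes "\<And>i. (\<lambda>\<omega>. Yr k \<omega> i) \<in> borel_measurable A"
  shows "Measurable.pred A (\<lambda>\<omega>. below N R (Yr k \<omega>))" "drift k i \<in> borel_measurable A"
proof -
  show p: "Measurable.pred A (\<lambda>\<omega>. below N R (Yr k \<omega>))"
    unfolding below_def
  proof (intro pred_intros_finite)
    show "Measurable.pred A (\<lambda>\<omega>. \<bar>Yr k \<omega> j\<bar> \<le> R)" for j
      unfolding pred_def by (intro borel_measurable_le borel_measurable_abs assms borel_measurable_const)
  qed simp
  show "drift k i \<in> borel_measurable A"
    unfolding drift_def[abs_def] by (intro measurable_If borel_galerkin_b assms borel_measurable_const) (use p in \<open>simp add: pred_def\<close>)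
qed

lemma Yr_past: "(\<lambda>\<omega>. Yr k \<omega> i) \<in> borel_measurable (past (real k * h))"
proof (induction k arbitrary: i)
  case 0
  show ?case unfolding Yr_0 by simp
next
  case (Suc k)
  have m: "real k * h \<le> real (Suc k) * h" using times(2)[of k] by simp
  show ?case unfolding Yr_Suc
    by (intro borel_measurable_add borel_measurable_times borel_measurable_const past_mono[OF m] Suc drift_past
        dW_past[OF times(1) m])
qed

lemma Yr_borel: "(\<lambda>\<omega>. Yr k \<omega> i) \<in> borel_measurable M"
  by (rule past_borel[OF Yr_past])

lemma drift_borel: "drift k i \<in> borel_measurable M"
  by (rule drift_past(2)[OF Yr_borel])

text \<open>It depends on the box and on \<open>N\<close> but not on the step \<open>h\<close>. In
  the energy it is multiplied by \<open>h\<^sup>2\<close> per step, so it disappears as the mesh is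
  refined.\<close>

definition Cb :: real where
  "Cb = (SOME C. 0 \<le> C \<and> (\<forall>y i. below N R y \<longrightarrow> i \<in> {1..N} \<longrightarrow> \<bar>galerkin_b lam n c N y i\<bar> \<le> C))"

lemma Cb: "0 \<le> Cb" "\<And>i. i \<in> {1..N} \<Longrightarrow> \<bar>drift k i \<omega>\<bar> \<le> Cb"
proof -
  have "\<exists>C. 0 \<le> C \<and> (\<forall>y i. below N R y \<longrightarrow> i \<in> {1..N} \<longrightarrow> \<bar>galerkin_b lam n c N y i\<bar> \<le> C)"
    by (rule galerkin_b_bounded[where N = N and R = R and lam = lam and n = n and c = c]) blast
  then have *: "0 \<le> Cb \<and> (\<forall>y i. below N R y \<longrightarrow> i \<in> {1..N} \<longrightarrow> \<bar>galerkin_b lam n c N y i\<bar> \<le> Cb)"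
    unfolding Cb_def by (rule someI_ex)
  then show "0 \<le> Cb" "\<And>i. i \<in> {1..N} \<Longrightarrow> \<bar>drift k i \<omega>\<bar> \<le> Cb" by (auto simp: drift_def)
qed

lemma drift_sq: "i \<in> {1..N} \<Longrightarrow> integrable M (\<lambda>\<omega>. (drift k i \<omega>)\<^sup>2)"
  "i \<in> {1..N} \<Longrightarrow> expectation (\<lambda>\<omega>. (drift k i \<omega>)\<^sup>2) \<le> Cb\<^sup>2"
proof -
  assume i: "i \<in> {1..N}"
  have b: "(drift k i \<omega>)\<^sup>2 \<le> Cb\<^sup>2" for \<omega> using Cb(2)[OF i, of k \<omega>] Cb(1) by (metis abs_le_square_iff abs_of_nonneg)
  show int: "integrable M (\<lambda>\<omega>. (drift k i \<omega>)\<^sup>2)"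
    by (rule integrable_const_bound[where B = "Cb\<^sup>2"]) (use b drift_borel in auto)
  have "expectation (\<lambda>\<omega>. (drift k i \<omega>)\<^sup>2) \<le> expectation (\<lambda>\<omega>. Cb\<^sup>2)" using int b by (intro integral_mono) auto
  then show "expectation (\<lambda>\<omega>. (drift k i \<omega>)\<^sup>2) \<le> Cb\<^sup>2" by (simp add: prob_space)
qed

lemma square_add:
  fixes f g :: "'w \<Rightarrow> real"
  assumes "f \<in> borel_measurable M" "g \<in> borel_measurable M" "integrable M (\<lambda>x. (f x)\<^sup>2)" "integrable M (\<lambda>x. (g x)\<^sup>2)"
  shows "integrable M (\<lambda>x. (f x + g x)\<^sup>2)"
    "expectation (\<lambda>x. (f x + g x)\<^sup>2) = expectation (\<lambda>x. (f x)\<^sup>2) + 2 * expectation (\<lambda>x. f x * g x) + expectation (\<lambda>x. (g x)\<^sup>2)"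
proof -
  have fg: "integrable M (\<lambda>x. f x * g x)" by (rule integrable_mult_square[OF assms])
  have *: "(f x + g x)\<^sup>2 = (f x)\<^sup>2 + 2 * (f x * g x) + (g x)\<^sup>2" for x by (simp add: power2_sum)
  show "integrable M (\<lambda>x. (f x + g x)\<^sup>2)"
    "expectation (\<lambda>x. (f x + g x)\<^sup>2) = expectation (\<lambda>x. (f x)\<^sup>2) + 2 * expectation (\<lambda>x. f x * g x) + expectation (\<lambda>x. (g x)\<^sup>2)"
    unfolding * using fg assms by simp_all
qed

lemma Yr_sq:
  assumes i: "i \<in> {1..N}"
  shows "integrable M (\<lambda>\<omega>. (Yr k \<omega> i)\<^sup>2)"
    and Yr_sq_Suc: "expectation (\<lambda>\<omega>. (Yr (Suc k) \<omega> i)\<^sup>2) \<le> expectation (\<lambda>\<omega>. (Yr k \<omega> i)\<^sup>2)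
      + h * expectation (\<lambda>\<omega>. 2 * (Yr k \<omega> i * drift k i \<omega>)) + h\<^sup>2 * Cb\<^sup>2 + (fejer N i)\<^sup>2 * (h * q i)"
proof -
  have hd: "integrable M (\<lambda>\<omega>. (h * drift k i \<omega>)\<^sup>2)" for k using drift_sq(1)[OF i, of k] by (simp add: power_mult_distrib)
  have hdm: "(\<lambda>\<omega>. h * drift k i \<omega>) \<in> borel_measurable M" for k using drift_borel by simp
  let ?w = "\<lambda>k \<omega>. dW i (real k * h) (real (Suc k) * h) \<omega>"
  have wi: "integrable M (\<lambda>\<omega>. (fejer N i * ?w k \<omega>)\<^sup>2)" for k
    using dW_sq(1)[OF times, of i k] by (simp add: power_mult_distrib)
  have wm: "(\<lambda>\<omega>. fejer N i * ?w k \<omega>) \<in> borel_measurable M" for k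
    using past_borel[OF dW_past[OF times(1) less_imp_le[OF times(2)], of i k]] by simp
  have Z: "integrable M (\<lambda>\<omega>. (Yr k \<omega> i + h * drift k i \<omega>)\<^sup>2)" if "integrable M (\<lambda>\<omega>. (Yr k \<omega> i)\<^sup>2)" for k
    by (rule square_add[OF Yr_borel hdm that hd])
  have Zm: "(\<lambda>\<omega>. Yr k \<omega> i + h * drift k i \<omega>) \<in> borel_measurable M" for k using Yr_borel[of k i] hdm[of k] by simp
  show Yi: "integrable M (\<lambda>\<omega>. (Yr k \<omega> i)\<^sup>2)" for k
  proof (induction k)
    case 0 show ?case by (simp add: Yr_0)
  next
    case (Suc k) show ?case unfolding Yr_Suc by (rule square_add(1)[OF Zm wm Z[OF Suc] wi])
  qed
  have Zp: "(\<lambda>\<omega>. Yr k \<omega> i + h * drift k i \<omega>) \<in> borel_measurable (past (real k * h))"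
    using Yr_past[of k i] drift_past(2)[OF Yr_past, of k i] by simp
  \<comment> \<open>Solution and drift at the start of the step are measurable with respect to the
    past, hence orthogonal to the noise of the step.\<close>
  have orth: "expectation (\<lambda>\<omega>. (Yr k \<omega> i + h * drift k i \<omega>) * (fejer N i * ?w k \<omega>)) = 0"
  proof -
    have e: "(Yr k \<omega> i + h * drift k i \<omega>) * (fejer N i * ?w k \<omega>) = fejer N i * ((Yr k \<omega> i + h * drift k i \<omega>) * ?w k \<omega>)" for \<omega> by simp
    show ?thesis unfolding e using dW_orth(2)[OF times Zp Z[OF Yi]] by simp
  qed
  have "expectation (\<lambda>\<omega>. (Yr (Suc k) \<omega> i)\<^sup>2) = expectation (\<lambda>\<omega>. (Yr k \<omega> i + h * drift k i \<omega>)\<^sup>2) + expectation (\<lambda>\<omega>. (fejer N i * ?w k \<omega>)\<^sup>2)"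
    unfolding Yr_Suc square_add(2)[OF Zm wm Z[OF Yi] wi] orth by simp
  also have "expectation (\<lambda>\<omega>. (Yr k \<omega> i + h * drift k i \<omega>)\<^sup>2) = expectation (\<lambda>\<omega>. (Yr k \<omega> i)\<^sup>2)
      + 2 * expectation (\<lambda>\<omega>. Yr k \<omega> i * (h * drift k i \<omega>)) + expectation (\<lambda>\<omega>. (h * drift k i \<omega>)\<^sup>2)"
    by (rule square_add(2)[OF Yr_borel hdm Yi hd])
  also have "2 * expectation (\<lambda>\<omega>. Yr k \<omega> i * (h * drift k i \<omega>)) = h * expectation (\<lambda>\<omega>. 2 * (Yr k \<omega> i * drift k i \<omega>))"
  proof -
    have e: "Yr k \<omega> i * (h * drift k i \<omega>) = h * (Yr k \<omega> i * drift k i \<omega>)" for \<omega> by simp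
    show ?thesis unfolding e by simp
  qed
  finally have eq: "expectation (\<lambda>\<omega>. (Yr (Suc k) \<omega> i)\<^sup>2) = expectation (\<lambda>\<omega>. (Yr k \<omega> i)\<^sup>2)
      + h * expectation (\<lambda>\<omega>. 2 * (Yr k \<omega> i * drift k i \<omega>)) + expectation (\<lambda>\<omega>. (h * drift k i \<omega>)\<^sup>2)
      + expectation (\<lambda>\<omega>. (fejer N i * ?w k \<omega>)\<^sup>2)" .
  have 1: "expectation (\<lambda>\<omega>. (h * drift k i \<omega>)\<^sup>2) \<le> h\<^sup>2 * Cb\<^sup>2"
    using mult_left_mono[OF drift_sq(2)[OF i, of k], of "h\<^sup>2"] by (simp add: power_mult_distrib)
  have "real (Suc k) * h - real k * h = h" by (simp add: algebra_simps)
  then have 2: "expectation (\<lambda>\<omega>. (fejer N i * ?w k \<omega>)\<^sup>2) \<le> (fejer N i)\<^sup>2 * (h * q i)"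
    using mult_left_mono[OF dW_sq(2)[OF times, of i k], of "(fejer N i)\<^sup>2"] by (simp add: power_mult_distrib del: of_nat_Suc)
  show "expectation (\<lambda>\<omega>. (Yr (Suc k) \<omega> i)\<^sup>2) \<le> expectation (\<lambda>\<omega>. (Yr k \<omega> i)\<^sup>2)
      + h * expectation (\<lambda>\<omega>. 2 * (Yr k \<omega> i * drift k i \<omega>)) + h\<^sup>2 * Cb\<^sup>2 + (fejer N i)\<^sup>2 * (h * q i)"
    unfolding eq using 1 2 by linarith
qed

text \<open>The dissipation, counted only while the drift is switched on.\<close>

definition Q :: "nat \<Rightarrow> 'w \<Rightarrow> real" where
  "Q k \<omega> = (if below N R (Yr k \<omega>) then \<Sum>i=1..N. mu i * (Yr k \<omega> i)\<^sup>2 else 0)"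

lemma Q_nonneg: "0 \<le> Q k \<omega>"
  by (auto simp: Q_def mu_nonneg intro!: sum_nonneg mult_nonneg_nonneg)

lemma Q_int: "integrable M (Q k)"
proof (rule Bochner_Integration.integrable_bound)
  show "integrable M (\<lambda>\<omega>. \<Sum>i=1..N. mu i * (Yr k \<omega> i)\<^sup>2)"
    by (intro Bochner_Integration.integrable_sum integrable_mult_right Yr_sq) auto
  show "Q k \<in> borel_measurable M"
    unfolding Q_def[abs_def]
    by (intro measurable_If borel_measurable_sum borel_measurable_times borel_measurable_power Yr_borel borel_measurable_const)
       (use drift_past(1)[OF Yr_borel] in \<open>simp add: pred_def\<close>)
  show "AE \<omega> in M. norm (Q k \<omega>) \<le> norm (\<Sum>i=1..N. mu i * (Yr k \<omega> i)\<^sup>2)"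
  proof (rule AE_I2)
    fix \<omega>
    have "0 \<le> (\<Sum>i=1..N. mu i * (Yr k \<omega> i)\<^sup>2)" by (auto intro!: sum_nonneg mult_nonneg_nonneg simp: mu_nonneg)
    then show "norm (Q k \<omega>) \<le> norm (\<Sum>i=1..N. mu i * (Yr k \<omega> i)\<^sup>2)" by (simp add: Q_def)
  qed
qed

definition w :: "nat \<Rightarrow> real" where
  "w i = 1 / (fejer N i * mu i)"

definition Wt :: real where
  "Wt = (\<Sum>i=1..N. w i)"

lemma w_pos: "i \<in> {1..N} \<Longrightarrow> 0 < w i"
  using fejer_pos[of i N] mu_pos[of i] by (simp add: w_def)

lemma q_nonneg: "0 \<le> q i"
  unfolding q_def by (intro suminf_nonneg S_sq) auto

text \<open>The weighted sum of \<open>Yr_sq_Suc\<close>. The drift contributes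
  \<open>C0 - Q\<close> by \<open>galerkin_energy\<close>; the noise contributes the sum of
  \<open>fejer N i * q i / mu i\<close>, at most the trace; the squared drift is of second order in
  \<open>h\<close>.\<close>

lemma energy_step:
  "(\<Sum>i=1..N. w i * expectation (\<lambda>\<omega>. (Yr (Suc k) \<omega> i)\<^sup>2)) + h * expectation (Q k)
    \<le> (\<Sum>i=1..N. w i * expectation (\<lambda>\<omega>. (Yr k \<omega> i)\<^sup>2)) + h * (C0 lam c + Tr + h * Wt * Cb\<^sup>2)"
proof -
  have Yd: "integrable M (\<lambda>\<omega>. 2 * (Yr k \<omega> i * drift k i \<omega>))" if "i \<in> {1..N}" for i
    by (intro integrable_mult_right integrable_mult_square Yr_borel drift_borel Yr_sq drift_sq that)
  have "(\<Sum>i=1..N. w i * expectation (\<lambda>\<omega>. (Yr (Suc k) \<omega> i)\<^sup>2))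
     \<le> (\<Sum>i=1..N. w i * (expectation (\<lambda>\<omega>. (Yr k \<omega> i)\<^sup>2)
      + h * expectation (\<lambda>\<omega>. 2 * (Yr k \<omega> i * drift k i \<omega>)) + h\<^sup>2 * Cb\<^sup>2 + (fejer N i)\<^sup>2 * (h * q i)))"
    using w_pos by (intro sum_mono mult_left_mono Yr_sq_Suc) (auto intro: less_imp_le)
  also have "\<dots> = (\<Sum>i=1..N. w i * expectation (\<lambda>\<omega>. (Yr k \<omega> i)\<^sup>2))
      + h * (\<Sum>i=1..N. w i * expectation (\<lambda>\<omega>. 2 * (Yr k \<omega> i * drift k i \<omega>))) + h * (h * Wt * Cb\<^sup>2)
      + h * (\<Sum>i=1..N. w i * (fejer N i)\<^sup>2 * q i)"
    unfolding Wt_def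
    by (simp add: distrib_left sum.distrib sum_distrib_left sum_distrib_right power2_eq_square mult_ac)
  also have "(\<Sum>i=1..N. w i * (fejer N i)\<^sup>2 * q i) \<le> Tr"
  proof -
    have "(\<Sum>i=1..N. w i * (fejer N i)\<^sup>2 * q i) \<le> (\<Sum>i=1..N. q i / mu i)"
    proof (rule sum_mono)
      fix i assume "i \<in> {1..N}"
      then have r: "0 < fejer N i" "0 < mu i" using fejer_pos[of i N] mu_pos[of i] by auto
      have "w i * (fejer N i)\<^sup>2 * q i = fejer N i * (q i / mu i)" using r by (simp add: w_def power2_eq_square)
      also have "\<dots> \<le> 1 * (q i / mu i)" using r q_nonneg[of i] by (intro mult_right_mono fejer_le_1) auto
      finally show "w i * (fejer N i)\<^sup>2 * q i \<le> q i / mu i" by simp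
    qed
    also have "\<dots> \<le> Tr" unfolding q_def by (rule S_tr)
    finally show ?thesis .
  qed
  also have "(\<Sum>i=1..N. w i * expectation (\<lambda>\<omega>. 2 * (Yr k \<omega> i * drift k i \<omega>))) \<le> C0 lam c - expectation (Q k)"
  proof -
    have "(\<Sum>i=1..N. w i * expectation (\<lambda>\<omega>. 2 * (Yr k \<omega> i * drift k i \<omega>)))
      = expectation (\<lambda>\<omega>. \<Sum>i=1..N. w i * (2 * (Yr k \<omega> i * drift k i \<omega>)))"
      using Yd by (subst Bochner_Integration.integral_sum) (auto simp del: mult_cancel_left integral_mult_right_zero)
    also have "\<dots> \<le> expectation (\<lambda>\<omega>. C0 lam c - Q k \<omega>)"
    proof (rule integral_mono)
      show "integrable M (\<lambda>\<omega>. \<Sum>i=1..N. w i * (2 * (Yr k \<omega> i * drift k i \<omega>)))"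
        using Yd by (intro Bochner_Integration.integrable_sum integrable_mult_right) auto
      show "integrable M (\<lambda>\<omega>. C0 lam c - Q k \<omega>)" using Q_int by simp
      fix \<omega>
      \<comment> \<open>Outside the box both the drift and \<open>Q\<close> vanish, and the claim is
        that \<open>C0\<close> is nonnegative.\<close>
      show "(\<Sum>i=1..N. w i * (2 * (Yr k \<omega> i * drift k i \<omega>))) \<le> C0 lam c - Q k \<omega>"
        using galerkin_energy[OF c n, where y = "Yr k \<omega>" and N = N and lam = lam] C0_nonneg[OF c, of lam]
        by (auto simp: drift_def Q_def w_def)
    qed
    also have "\<dots> = C0 lam c - expectation (Q k)" using Q_int by (simp add: prob_space)
    finally show ?thesis .
  qed
  finally show ?thesis using h by (simp add: algebra_simps)
qed

lemma energy_sum: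
  "h * (\<Sum>k<K. expectation (Q k)) \<le> real K * h * (C0 lam c + Tr + h * Wt * Cb\<^sup>2)"
proof -
  have "(\<Sum>i=1..N. w i * expectation (\<lambda>\<omega>. (Yr K \<omega> i)\<^sup>2)) + h * (\<Sum>k<K. expectation (Q k)) \<le> real K * h * (C0 lam c + Tr + h * Wt * Cb\<^sup>2)"
  proof (induction K)
    case 0 show ?case by (simp add: Yr_0)
  next
    case (Suc K)
    then show ?case using energy_step[of K] by (simp add: algebra_simps)
  qed
  moreover have "0 \<le> (\<Sum>i=1..N. w i * expectation (\<lambda>\<omega>. (Yr K \<omega> i)\<^sup>2))"
    using w_pos by (intro sum_nonneg mult_nonneg_nonneg) (auto intro: less_imp_le)
  ultimately show ?thesis by linarith
qed

end

section \<open>From the scheme to the solution\<close>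

lemma riemann_le:
  fixes \<phi> :: "real \<Rightarrow> real"
  assumes cont: "continuous_on {0..T} \<phi>" and T: "0 < T" and \<eta>: "0 < \<eta>"
  shows "\<forall>\<^sub>F M in sequentially. 0 < M \<and>
    (LINT s:{0<..T}|lborel. \<phi> s) \<le> (\<Sum>k<M. T / real M * \<phi> (real k * (T / real M))) + T * \<eta>"
proof -
  have z: "set_integrable lborel {0<..T} (\<lambda>_. 0 :: real)" by (simp add: set_integrable_def)
  have \<phi>i: "set_integrable lborel {0<..T} \<phi>"
    by (rule set_integrable_subset[OF borel_integrable_atLeastAtMost'[OF cont]]) auto
  have fin: "finite {()}" by simp
  from grid_refine[where I = "{()}" and f = "\<lambda>_. \<phi>", OF fin cont T \<eta> z]
  show ?thesis
  proof eventually_elim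
    case (elim M)
    then have M: "0 < M" by blast
    define h where "h = T / real M"
    have h: "0 < h" "real M * h = T" using M T by (auto simp: h_def)
    have mod: "\<bar>\<phi> s - \<phi> (real k * h)\<bar> \<le> \<eta>" if "k < M" "s \<in> {real k * h..real (Suc k) * h}" for k s
      using elim that unfolding h_def by blast
    have "(LINT s:{0<..real k * h}|lborel. \<phi> s) \<le> (\<Sum>j<k. h * \<phi> (real j * h)) + real k * h * \<eta>" if "k \<le> M" for k
      using that
    proof (induction k)
      case 0 show ?case by (simp add: set_lebesgue_integral_def)
    next
      case (Suc k)
      have kT: "real (Suc k) * h \<le> T"
      proof -
        have "real (Suc k) * h \<le> real M * h" using Suc(2) h by (intro mult_right_mono) auto
        then show ?thesis using h by simp
      qed
      have k0: "0 \<le> real k * h" "real k * h \<le> real (Suc k) * h" using h by (auto simp: algebra_simps)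
      have i: "set_integrable lborel {0<..real (Suc k) * h} \<phi>"
        by (rule set_integrable_subset[OF \<phi>i]) (use kT in auto)
      have i2: "set_integrable lborel {real k * h<..real (Suc k) * h} \<phi>"
        by (rule set_integrable_subset[OF i]) (use k0 in auto)
      have "(LINT s:{real k * h<..real (Suc k) * h}|lborel. \<phi> s) \<le> (LINT s:{real k * h<..real (Suc k) * h}|lborel. \<phi> (real k * h) + \<eta>)"
      proof (rule set_integral_mono[OF i2 set_integrable_const_Ioc])
        fix s assume "s \<in> {real k * h<..real (Suc k) * h}"
        then show "\<phi> s \<le> \<phi> (real k * h) + \<eta>" using mod[of k s] Suc(2) by (auto simp del: of_nat_Suc)
      qed
      also have "\<dots> = h * (\<phi> (real k * h) + \<eta>)"
        using h unfolding set_lebesgue_integral_def by (simp add: algebra_simps)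
      finally have "(LINT s:{0<..real (Suc k) * h}|lborel. \<phi> s) \<le> (LINT s:{0<..real k * h}|lborel. \<phi> s) + h * (\<phi> (real k * h) + \<eta>)"
        using set_integral_split[OF k0 i] by simp
      then show ?case using Suc by (simp add: algebra_simps)
    qed
    from this[OF order_refl] show ?case using M h by (simp add: h_def)
  qed
qed

lemma sets_borel_H_Collect:
  assumes "\<And>x. x \<in> H \<Longrightarrow> P x \<Longrightarrow> \<exists>e>0. \<forall>y\<in>H. dist_H x y < e \<longrightarrow> P y"
  shows "{x \<in> H. P x} \<in> sets borel_H"
proof -
  have "openin top_H {x \<in> H. P x}"
    unfolding top_H_def MH.openin_mtopology
  proof (intro conjI allI impI)
    fix x assume x: "x \<in> {x \<in> H. P x}"
    then obtain e where "e > 0" "\<forall>y\<in>H. dist_H x y < e \<longrightarrow> P y" using assms by blast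
    then show "\<exists>r>0. MH.mball x r \<subseteq> {x \<in> H. P x}" by (intro exI[of _ e]) auto
  qed auto
  moreover have "{U. openin top_H U} \<subseteq> Pow H" using openin_subset[of top_H] by (auto simp: top_H_def)
  ultimately show ?thesis unfolding borel_H_def by (simp add: sets_measure_of sigma_sets.Basic)
qed

lemma space_borel_H: "space borel_H = H"
  unfolding borel_H_def by (rule space_measure_of_conv)

lemma borel_coord_H: "(\<lambda>h. h i) \<in> borel_measurable borel_H"
proof (rule borel_measurableI_less)
  fix a :: real
  have "{x \<in> H. x i < a} \<in> sets borel_H"
  proof (rule sets_borel_H_Collect)
    fix x assume x: "x \<in> H" "x i < a"
    define K where "K = 1 + real i * pi"
    have K: "0 < K" by (simp add: K_def add_pos_nonneg)
    show "\<exists>e>0. \<forall>y\<in>H. dist_H x y < e \<longrightarrow> y i < a"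
    proof (intro exI[of _ "(a - x i) / K"] conjI ballI impI)
      show "0 < (a - x i) / K" using x K by simp
      fix y assume y: "y \<in> H" "dist_H x y < (a - x i) / K"
      then have "K * dist_H x y < a - x i" using K by (simp add: pos_less_divide_eq mult.commute)
      then show "y i < a" using coord_diff_le[OF x(1) y(1), of i] by (simp add: K_def)
    qed
  qed
  then show "{x \<in> space borel_H. x i < a} \<in> sets borel_H" by (simp add: space_borel_H)
qed

lemma psi_lipschitz_coords: "\<bar>psi m y - psi m z\<bar> \<le> (\<Sum>i=1..m. sqrt (mu i) * \<bar>y i - z i\<bar>)"
  using psi_le_add[of m y z] psi_le_add[of m z y] by (simp add: abs_le_iff abs_minus_commute)

lemma tendsto_psi: "(\<And>i. (\<lambda>j. y j i) \<longlonglongrightarrow> z i) \<Longrightarrow> (\<lambda>j. psi m (y j)) \<longlonglongrightarrow> psi m z"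
  unfolding psi_def by (intro tendsto_intros)

lemma borel_psi:
  assumes "\<And>i. (\<lambda>\<omega>. y \<omega> i) \<in> borel_measurable A"
  shows "(\<lambda>\<omega>. psi m (y \<omega>)) \<in> borel_measurable A"
proof -
  have s: "(sqrt :: real \<Rightarrow> real) \<in> borel_measurable borel"
    by (intro borel_measurable_continuous_onI continuous_on_real_sqrt continuous_on_id)
  have "(\<lambda>\<omega>. \<Sum>i=1..m. mu i * (y \<omega> i)\<^sup>2) \<in> borel_measurable A"
    by (intro borel_measurable_sum borel_measurable_times borel_measurable_const borel_measurable_power assms)
  from measurable_compose[OF this s] show ?thesis unfolding psi_def .
qed

definition flat :: "real \<Rightarrow> coefs" where
  "flat c = (\<lambda>i. if i = 0 then c else 0)"

context CH_noise
begin

text \<open>The grid points for all \<open>k\<close> and all meshes are countably many, so one null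
  set serves all schemes simultaneously.\<close>

lemma solution_flat:
  assumes sol: "CH_solution M \<beta> S lam n (flat c) X" and T: "0 < T" and S0: "\<And>k. S (basis k) 0 = 0"
  shows "AE \<omega> in M. \<exists>u. CH_traj_flat n (flat c) (\<lambda>t. X t \<omega>) u T c \<and>
    (\<forall>M k i. 0 < M \<longrightarrow> CH_traj_flat.\<xi> lam n (flat c) (\<lambda>t. X t \<omega>) u T M k i
       = dW i (real k * (T / real M)) (real (Suc k) * (T / real M)) \<omega>)"
proof -
  from sol obtain u where u: "AE \<omega> in M. CH_path n (flat c) (\<lambda>t. X t \<omega>) (u \<omega>)"
    and eq: "\<And>t. 0 \<le> t \<Longrightarrow> AE \<omega> in M. \<forall>i. (\<lambda>k. \<beta> k t \<omega> * S (basis k) i) sums CH_lhs lam n (flat c) (\<lambda>t. X t \<omega>) (u \<omega>) t i"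
    unfolding CH_solution_def by blast
  have "AE \<omega> in M. \<forall>k Mm. \<forall>i. (\<lambda>l. \<beta> l (real k * (T / real Mm)) \<omega> * S (basis l) i) sums
      CH_lhs lam n (flat c) (\<lambda>t. X t \<omega>) (u \<omega>) (real k * (T / real Mm)) i"
    using eq[unfolded AE_all_countable] T unfolding AE_all_countable by simp
  with u show ?thesis
  proof eventually_elim
    case (elim \<omega>)
    interpret CH_traj lam n "flat c" "\<lambda>t. X t \<omega>" "u \<omega>" by standard (rule elim)
    have "CH_lhs lam n (flat c) (\<lambda>t. X t \<omega>) (u \<omega>) (real k * (T / real Mm)) 0 = 0" for k Mm
    proof -
      have "(\<lambda>l. 0 :: real) sums CH_lhs lam n (flat c) (\<lambda>t. X t \<omega>) (u \<omega>) (real k * (T / real Mm)) 0"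
        using elim(2)[rule_format, of k Mm 0] by (simp only: S0 mult_zero_right)
      then show ?thesis by (rule sums_unique2) (rule sums_zero)
    qed
    then have mean: "X t \<omega> 0 = c" if "0 \<le> t" for t
      using mean_const[OF T, of t] that by (simp add: flat_def)
    interpret F: CH_traj_flat lam n "flat c" "\<lambda>t. X t \<omega>" "u \<omega>" T c
      by standard (use T mean in \<open>auto simp: flat_def\<close>)
    show ?case
    proof (intro exI conjI allI impI)
      show "CH_traj_flat n (flat c) (\<lambda>t. X t \<omega>) (u \<omega>) T c" by (rule F.CH_traj_flat_axioms)
      fix Mm k i
      have "(\<lambda>l. inc l (real k * (T / real Mm)) (real (Suc k) * (T / real Mm)) \<omega> * S (basis l) i) sums F.\<xi> Mm k i"
        unfolding inc_def left_diff_distrib F.\<xi>_def by (intro sums_diff elim(2)[rule_format])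
      then show "F.\<xi> Mm k i = dW i (real k * (T / real Mm)) (real (Suc k) * (T / real Mm)) \<omega>"
        unfolding dW_def by (rule sums_unique)
    qed
  qed
qed

text \<open>The minimum with \<open>K\<close> makes all limits under the expectation limits of
  bounded functions, while \<open>K\<close>, \<open>m\<close> and \<open>n\<close> leave no trace in
  the bound. The energy estimate of the scheme is carried over by comparing Riemann sums in time,
  not the solutions themselves.\<close>

lemma expectation_psi_bound:
  assumes sol: "CH_solution M \<beta> S lam n (flat c) X" and T: "0 < T" and S0: "\<And>k. S (basis k) 0 = 0"
    and c: "\<bar>c\<bar> < 1" and n: "1 \<le> n" and K: "0 \<le> K"
  shows "(LINT t:{0<..T}|lborel. expectation (\<lambda>\<omega>. min K (psi m (X t \<omega>)))) \<le> T * (1 + C0 lam c + Tr)"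
proof -
  define \<phi> where "\<phi> t = expectation (\<lambda>\<omega>. min K (psi m (X t \<omega>)))" for t
  have Xm: "(\<lambda>\<omega>. X t \<omega> i) \<in> borel_measurable M" if "0 \<le> t" for t i
    using sol that measurable_compose[OF _ borel_coord_H, of "X t" M i] by (simp add: CH_solution_def)
  have pm: "(\<lambda>\<omega>. min K (psi m (X t \<omega>))) \<in> borel_measurable M" if "0 \<le> t" for t
    by (intro borel_measurable_min borel_measurable_const borel_psi Xm that)
  have pb: "\<bar>min K (psi m y)\<bar> \<le> K" for y using K psi_nonneg[of m y] by (auto simp: min_def)
  have pi: "integrable M (\<lambda>\<omega>. min K (psi m (X t \<omega>)))" if "0 \<le> t" for t
    by (rule integrable_const_bound[where B = K]) (use pb pm that in auto)
  note good = solution_flat[OF sol T S0]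
  have cont: "continuous_on {0..T} \<phi>"
    unfolding continuous_on_sequentially
  proof (intro allI ballI impI)
    fix t and s :: "nat \<Rightarrow> real" assume t: "t \<in> {0..T}" and s: "(\<forall>j. s j \<in> {0..T}) \<and> s \<longlonglongrightarrow> t"
    show "(\<phi> \<circ> s) \<longlonglongrightarrow> \<phi> t"
      unfolding \<phi>_def comp_def
    proof (rule integral_dominated_convergence[where w = "\<lambda>_. K"])
      show "AE \<omega> in M. (\<lambda>j. min K (psi m (X (s j) \<omega>))) \<longlonglongrightarrow> min K (psi m (X t \<omega>))"
        using good
      proof eventually_elim
        case (elim \<omega>)
        then obtain u where "CH_traj_flat n (flat c) (\<lambda>t. X t \<omega>) u T c" by blast
        then interpret CH_traj_flat lam n "flat c" "\<lambda>t. X t \<omega>" u T c .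
        have "(\<lambda>j. X (s j) \<omega> i) \<longlonglongrightarrow> X t \<omega> i" for i
          by (rule continuous_on_tendsto_compose[OF coord_cont]) (use s t in auto)
        then show ?case by (intro tendsto_min tendsto_const tendsto_psi)
      qed
    qed (use pm pb s t in auto)
  qed
  define h where "h Mm = T / real Mm" for Mm
  define Ys where "Ys N R Mm k \<omega> = scheme lam n c N (real R) (h Mm) (\<lambda>k i. dW i (real k * h Mm) (real (Suc k) * h Mm) \<omega>) k" for N R Mm k \<omega>
  define Z where "Z N R Mm \<omega> = (\<Sum>k<Mm. h Mm * (if below N (real R) (Ys N R Mm k \<omega>) then psi m (Ys N R Mm k \<omega>) else 0))" for N R Mm \<omega>
  define A where "A Mm \<omega> = (\<Sum>k<Mm. h Mm * min K (psi m (X (real k * h Mm) \<omega>)))" for Mm \<omega>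
  \<comment> \<open>The excess of the solution's Riemann sum over that of the scheme. It takes
    values in \<open>[0, K * T]\<close>, so its upper limits can be exchanged with the expectation
    even though the choice of \<open>N\<close>, box and mesh in \<open>scheme_converges\<close>
    depends on the path.\<close>
  define G where "G N R Mm \<omega> = max 0 (A Mm \<omega> - Z N R Mm \<omega>)" for N R Mm \<omega>
  have hpos: "0 \<le> h Mm" for Mm using T by (simp add: h_def)
  have A_le: "A Mm \<omega> \<le> K * T" for Mm \<omega>
  proof -
    have "A Mm \<omega> \<le> (\<Sum>k<Mm. h Mm * K)"
      unfolding A_def using hpos by (intro sum_mono mult_left_mono) auto
    also have "\<dots> \<le> K * T" using K T by (cases "Mm = 0") (auto simp: h_def)
    finally show ?thesis .
  qed
  have Z_nn: "0 \<le> Z N R Mm \<omega>" for N R Mm \<omega>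
    unfolding Z_def using hpos psi_nonneg by (intro sum_nonneg mult_nonneg_nonneg) auto
  have G_le: "G N R Mm \<omega> \<le> K * T" for N R Mm \<omega>
    using A_le[of Mm \<omega>] Z_nn[of N R Mm \<omega>] K T by (auto simp: G_def)
  have Zfacts: "Z N R Mm \<in> borel_measurable M \<and> (m \<le> N \<longrightarrow> integrable M (Z N R Mm) \<and>
     expectation (Z N R Mm) \<le> T * (1 + C0 lam c + Tr + h Mm * (CH_energy.Wt N * (CH_energy.Cb lam c (real R) n N)\<^sup>2)))"
    if Mm: "0 < Mm" for N R Mm
  proof -
    interpret E: CH_energy M \<beta> S Tr lam c "h Mm" "real R" n N
      by standard (use c n T Mm in \<open>auto simp: h_def\<close>)
    have Ys: "Ys N R Mm k \<omega> = E.Yr k \<omega>" for k \<omega> by (simp add: Ys_def E.Yr_def)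
    have bm: "(\<lambda>\<omega>. if below N (real R) (E.Yr k \<omega>) then psi m (E.Yr k \<omega>) else 0) \<in> borel_measurable M" for k
      by (intro measurable_If borel_measurable_const borel_psi E.Yr_borel)
        (use E.drift_past(1)[OF E.Yr_borel] in \<open>simp add: pred_def\<close>)
    have Zm: "Z N R Mm \<in> borel_measurable M"
      unfolding Z_def[abs_def] Ys by (intro borel_measurable_sum borel_measurable_times borel_measurable_const bm)
    moreover have "integrable M (Z N R Mm) \<and>
     expectation (Z N R Mm) \<le> T * (1 + C0 lam c + Tr + h Mm * (E.Wt * E.Cb\<^sup>2))" if mN: "m \<le> N"
    proof -
      let ?B = "\<lambda>\<omega>. \<Sum>k<Mm. h Mm * (1 + E.Q k \<omega>)"
      have ZB: "Z N R Mm \<omega> \<le> ?B \<omega>" for \<omega>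
        unfolding Z_def Ys
      proof (intro sum_mono mult_left_mono hpos)
        fix k
        \<comment> \<open>The energy bounds the square of \<open>psi\<close>; this inequality is the
          origin of the summand 1 in the final bound.\<close>
        have "psi m (E.Yr k \<omega>) \<le> 1 + (psi m (E.Yr k \<omega>))\<^sup>2"
          using zero_le_power2[of "psi m (E.Yr k \<omega>) - 1"] psi_nonneg[of m "E.Yr k \<omega>"]
          by (simp add: power2_eq_square algebra_simps)
        also have "(psi m (E.Yr k \<omega>))\<^sup>2 = (\<Sum>i=1..m. mu i * (E.Yr k \<omega> i)\<^sup>2)"
          unfolding psi_def by (intro real_sqrt_pow2 sum_nonneg mult_nonneg_nonneg mu_nonneg) auto
        also have "\<dots> \<le> (\<Sum>i=1..N. mu i * (E.Yr k \<omega> i)\<^sup>2)"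
          using mN by (intro sum_mono2) (auto intro!: mult_nonneg_nonneg mu_nonneg)
        finally show "(if below N (real R) (E.Yr k \<omega>) then psi m (E.Yr k \<omega>) else 0) \<le> 1 + E.Q k \<omega>"
          using E.Q_nonneg[of k \<omega>] by (auto simp: E.Q_def)
      qed
      have Bi: "integrable M ?B" using E.Q_int by simp
      have Zi: "integrable M (Z N R Mm)"
      proof (rule Bochner_Integration.integrable_bound[OF Bi Zm], rule AE_I2)
        fix \<omega>
        show "norm (Z N R Mm \<omega>) \<le> norm (?B \<omega>)"
          using ZB[of \<omega>] Z_nn[of N R Mm \<omega>] unfolding real_norm_def by linarith
      qed
      have "expectation (Z N R Mm) \<le> expectation ?B" by (rule integral_mono[OF Zi Bi ZB])
      also have "\<dots> = real Mm * h Mm + h Mm * (\<Sum>k<Mm. expectation (E.Q k))"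
        using E.Q_int by (simp add: prob_space distrib_left sum.distrib sum_distrib_left)
      also have "\<dots> \<le> real Mm * h Mm + real Mm * h Mm * (C0 lam c + Tr + h Mm * E.Wt * E.Cb\<^sup>2)"
        using E.energy_sum[of Mm] by simp
      also have "real Mm * h Mm = T" using Mm by (simp add: h_def)
      finally show ?thesis using Zi by (simp add: algebra_simps)
    qed
    ultimately show ?thesis by blast
  qed
  have Zm: "Z N R Mm \<in> borel_measurable M" for N R Mm
  proof (cases "Mm = 0")
    case True
    then show ?thesis by (simp add: Z_def[abs_def])
  qed (use Zfacts in auto)
  have tk: "0 \<le> real k * h Mm" for k Mm using hpos by simp
  have Am: "A Mm \<in> borel_measurable M" for Mm
    unfolding A_def[abs_def] by (intro borel_measurable_sum borel_measurable_times borel_measurable_const pm tk)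
  have Ai: "integrable M (A Mm)" for Mm
    unfolding A_def[abs_def] by (intro Bochner_Integration.integrable_sum integrable_mult_right pi tk)
  have EA: "expectation (A Mm) = (\<Sum>k<Mm. h Mm * \<phi> (real k * h Mm))" for Mm
    unfolding A_def \<phi>_def by (subst Bochner_Integration.integral_sum) (auto intro!: integrable_mult_right pi tk)
  have Gm: "G N R Mm \<in> borel_measurable M" for N R Mm
    unfolding G_def[abs_def] by (intro borel_measurable_max borel_measurable_const borel_measurable_diff Am Zm)
  define g where "g N R Mm \<omega> = ennreal (G N R Mm \<omega>)" for N R Mm \<omega>
  have gm: "g N R Mm \<in> borel_measurable M" for N R Mm
    unfolding g_def[abs_def] using Gm by measurable
  have gle: "g N R Mm \<omega> \<le> ennreal (K * T)" for N R Mm \<omega>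
    unfolding g_def by (intro ennreal_leI G_le)
  have fin: "(\<integral>\<^sup>+\<omega>. ennreal (K * T) \<partial>M) < \<infinity>" by (simp add: emeasure_space_1 ennreal_mult_less_top)
  have lim0: "AE \<omega> in M. limsup (\<lambda>N. limsup (\<lambda>R. limsup (\<lambda>Mm. g N R Mm \<omega>))) = 0"
    using good
  proof eventually_elim
    case (elim \<omega>)
    then obtain u where u: "CH_traj_flat n (flat c) (\<lambda>t. X t \<omega>) u T c"
      and xi: "\<And>Mm k i. 0 < Mm \<Longrightarrow> CH_traj_flat.\<xi> lam n (flat c) (\<lambda>t. X t \<omega>) u T Mm k i
       = dW i (real k * h Mm) (real (Suc k) * h Mm) \<omega>" unfolding h_def by blast
    interpret CH_traj_flat lam n "flat c" "\<lambda>t. X t \<omega>" u T c by (rule u)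
    have lim_e: "limsup (\<lambda>N. limsup (\<lambda>R. limsup (\<lambda>Mm. g N R Mm \<omega>))) \<le> 0 + ennreal e" if e: "0 < e" for e
      unfolding add_0
      using scheme_converges[OF e, of m]
    proof (intro Limsup_bounded, elim eventually_mono)
      fix N assume "\<forall>\<^sub>F R in sequentially. \<forall>\<^sub>F Mm in sequentially.
        (\<Sum>k<Mm. T / real Mm * psi m (X (real k * (T / real Mm)) \<omega>))
        \<le> (\<Sum>k<Mm. T / real Mm * (if below N (real R) (Y N (real R) Mm k) then psi m (Y N (real R) Mm k) else 0)) + e"
      then show "limsup (\<lambda>R. limsup (\<lambda>Mm. g N R Mm \<omega>)) \<le> ennreal e"
      proof (intro Limsup_bounded, elim eventually_mono)
        fix R assume "\<forall>\<^sub>F Mm in sequentially.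
          (\<Sum>k<Mm. T / real Mm * psi m (X (real k * (T / real Mm)) \<omega>))
          \<le> (\<Sum>k<Mm. T / real Mm * (if below N (real R) (Y N (real R) Mm k) then psi m (Y N (real R) Mm k) else 0)) + e"
        then have "\<forall>\<^sub>F Mm in sequentially. g N R Mm \<omega> \<le> ennreal e"
          using eventually_gt_at_top[of 0]
        proof eventually_elim
          case (elim Mm)
          have "\<xi> Mm = (\<lambda>k i. dW i (real k * h Mm) (real (Suc k) * h Mm) \<omega>)"
            using xi[OF elim(2)] by (intro ext)
          then have Yeq: "Y N (real R) Mm k = Ys N R Mm k \<omega>" for k by (simp add: Ys_def h_def)
          have "A Mm \<omega> \<le> (\<Sum>k<Mm. T / real Mm * psi m (X (real k * (T / real Mm)) \<omega>))"
            unfolding A_def h_def using T by (intro sum_mono mult_left_mono) auto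
          also have "\<dots> \<le> Z N R Mm \<omega> + e" using elim(1) unfolding Yeq Z_def h_def .
          finally have "G N R Mm \<omega> \<le> e" using e by (simp add: G_def)
          then show ?case unfolding g_def by (rule ennreal_leI)
        qed
        then show "limsup (\<lambda>Mm. g N R Mm \<omega>) \<le> ennreal e" by (rule Limsup_bounded)
      qed
    qed
    have "limsup (\<lambda>N. limsup (\<lambda>R. limsup (\<lambda>Mm. g N R Mm \<omega>))) \<le> 0"
      by (rule ennreal_le_epsilon) (rule lim_e)
    then show ?case by simp
  qed
  have lm: "(\<lambda>\<omega>. limsup (\<lambda>Mm. g N R Mm \<omega>)) \<in> borel_measurable M" for N R by (rule borel_measurable_limsup) (rule gm)
  have lm2: "(\<lambda>\<omega>. limsup (\<lambda>R. limsup (\<lambda>Mm. g N R Mm \<omega>))) \<in> borel_measurable M" for N by (rule borel_measurable_limsup) (rule lm)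
  have lb: "limsup (\<lambda>Mm. g N R Mm \<omega>) \<le> ennreal (K * T)" for N R \<omega> by (intro Limsup_bounded always_eventually allI gle)
  have lb2: "limsup (\<lambda>R. limsup (\<lambda>Mm. g N R Mm \<omega>)) \<le> ennreal (K * T)" for N \<omega> by (intro Limsup_bounded always_eventually allI lb)
  \<comment> \<open>The reverse Fatou lemma, once for each of the three limits.\<close>
  have "limsup (\<lambda>N. limsup (\<lambda>R. limsup (\<lambda>Mm. \<integral>\<^sup>+\<omega>. g N R Mm \<omega> \<partial>M))) \<le> limsup (\<lambda>N. limsup (\<lambda>R. \<integral>\<^sup>+\<omega>. limsup (\<lambda>Mm. g N R Mm \<omega>) \<partial>M))"
    by (intro Limsup_mono always_eventually allI nn_integral_limsup[where w = "\<lambda>_. ennreal (K * T)"] gm fin AE_I2 gle borel_measurable_const)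
  also have "\<dots> \<le> limsup (\<lambda>N. \<integral>\<^sup>+\<omega>. limsup (\<lambda>R. limsup (\<lambda>Mm. g N R Mm \<omega>)) \<partial>M)"
    by (intro Limsup_mono always_eventually allI nn_integral_limsup[where w = "\<lambda>_. ennreal (K * T)"] lm fin AE_I2 lb borel_measurable_const)
  also have "\<dots> \<le> (\<integral>\<^sup>+\<omega>. limsup (\<lambda>N. limsup (\<lambda>R. limsup (\<lambda>Mm. g N R Mm \<omega>))) \<partial>M)"
    by (intro nn_integral_limsup[where w = "\<lambda>_. ennreal (K * T)"] lm2 fin AE_I2 lb2 borel_measurable_const)
  also have "\<dots> = (\<integral>\<^sup>+\<omega>. 0 \<partial>M)" by (rule nn_integral_cong_AE[OF lim0])
  finally have limE: "limsup (\<lambda>N. limsup (\<lambda>R. limsup (\<lambda>Mm. \<integral>\<^sup>+\<omega>. g N R Mm \<omega> \<partial>M))) \<le> 0" by simp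
  have limD: "\<forall>\<^sub>F j in sequentially. f j < ennreal e" if "limsup f < ennreal e" for f :: "nat \<Rightarrow> ennreal" and e
    by (rule Limsup_lessD[OF that])
  have main: "(LINT t:{0<..T}|lborel. \<phi> t) \<le> T * (1 + C0 lam c + Tr) + (2 * T + 1) * e" if e: "0 < e" for e
  proof -
    have "\<forall>\<^sub>F N in sequentially. m \<le> N \<and> limsup (\<lambda>R. limsup (\<lambda>Mm. \<integral>\<^sup>+\<omega>. g N R Mm \<omega> \<partial>M)) < ennreal e"
      using limE e by (intro eventually_conj eventually_ge_at_top limD) (auto intro: le_less_trans)
    then obtain N where N: "m \<le> N" "limsup (\<lambda>R. limsup (\<lambda>Mm. \<integral>\<^sup>+\<omega>. g N R Mm \<omega> \<partial>M)) < ennreal e"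
      by (rule eventually_happens'[OF sequentially_bot, THEN exE]) blast
    obtain R where R: "limsup (\<lambda>Mm. \<integral>\<^sup>+\<omega>. g N R Mm \<omega> \<partial>M) < ennreal e"
      by (rule eventually_happens'[OF sequentially_bot limD[OF N(2)], THEN exE])
    \<comment> \<open>This constant may be enormous, but it is fixed before the mesh is chosen, so
      \<open>h Mm * C\<close> can still be made small.\<close>
    define C where "C = (CH_energy.Wt N * (CH_energy.Cb lam c (real R) n N)\<^sup>2)"
    have "(\<lambda>Mm. h Mm * C) \<longlonglongrightarrow> 0 * C" unfolding h_def by (intro tendsto_mult lim_const_over_n tendsto_const)
    then have "\<forall>\<^sub>F Mm in sequentially. h Mm * C < e" using e by (intro order_tendstoD(2)) auto
    with limD[OF R] riemann_le[OF cont T e]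
    have "\<forall>\<^sub>F Mm in sequentially. (\<integral>\<^sup>+\<omega>. g N R Mm \<omega> \<partial>M) < ennreal e \<and> (0 < Mm \<and>
        (LINT s:{0<..T}|lborel. \<phi> s) \<le> (\<Sum>k<Mm. T / real Mm * \<phi> (real k * (T / real Mm))) + T * e) \<and> h Mm * C < e"
      by eventually_elim simp
    from eventually_happens'[OF sequentially_bot this]
    obtain Mm where Mm: "(\<integral>\<^sup>+\<omega>. g N R Mm \<omega> \<partial>M) < ennreal e" "0 < Mm"
        "(LINT s:{0<..T}|lborel. \<phi> s) \<le> (\<Sum>k<Mm. T / real Mm * \<phi> (real k * (T / real Mm))) + T * e" "h Mm * C < e" by blast
    have Gi: "integrable M (G N R Mm)"
      by (rule integrable_const_bound[where B = "K * T"]) (use G_le Gm in \<open>auto simp: G_def\<close>)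
    have "ennreal (expectation (G N R Mm)) = (\<integral>\<^sup>+\<omega>. g N R Mm \<omega> \<partial>M)"
      unfolding g_def by (rule nn_integral_eq_integral[symmetric, OF Gi]) (auto simp: G_def)
    then have "ennreal (expectation (G N R Mm)) < ennreal e" using Mm(1) by simp
    moreover have "0 \<le> expectation (G N R Mm)" by (intro integral_nonneg_AE AE_I2) (simp add: G_def)
    ultimately have EG: "expectation (G N R Mm) < e" using ennreal_less_iff by blast
    have Zi: "integrable M (Z N R Mm)" and EZ: "expectation (Z N R Mm) \<le> T * (1 + C0 lam c + Tr + h Mm * C)"
      using Zfacts[OF Mm(2), of N R] N(1) by (auto simp: C_def)
    have "expectation (A Mm) \<le> expectation (\<lambda>\<omega>. Z N R Mm \<omega> + G N R Mm \<omega>)"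
      by (rule integral_mono) (use Ai Zi Gi in \<open>auto simp: G_def\<close>)
    also have "\<dots> = expectation (Z N R Mm) + expectation (G N R Mm)" using Zi Gi by simp
    also have "\<dots> \<le> T * (1 + C0 lam c + Tr + h Mm * C) + e" using EZ EG by simp
    also have "\<dots> \<le> T * (1 + C0 lam c + Tr + e) + e"
      using Mm(4) T by (intro add_right_mono mult_left_mono) auto
    finally have "expectation (A Mm) \<le> T * (1 + C0 lam c + Tr + e) + e" .
    then show ?thesis using Mm(3) unfolding EA h_def by (simp add: algebra_simps)
  qed
  have "((\<lambda>e. T * (1 + C0 lam c + Tr) + (2 * T + 1) * e) \<longlongrightarrow> T * (1 + C0 lam c + Tr) + (2 * T + 1) * 0) (at_right 0)"
    by (intro tendsto_intros)
  then have "(LINT t:{0<..T}|lborel. \<phi> t) \<le> T * (1 + C0 lam c + Tr) + (2 * T + 1) * 0"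
    by (rule tendsto_lowerbound) (auto intro: eventually_mono[OF eventually_at_right_less main])
  then show ?thesis by (simp add: \<phi>_def)
qed

end

section \<open>Lipschitz functions on \<open>H\<^sub>c\<close>\<close>

lemma Hc_H: "x \<in> Hc c \<Longrightarrow> x \<in> H"
  by (simp add: Hc_def)

lemma Hc_diff: "x \<in> Hc c \<Longrightarrow> y \<in> Hc c \<Longrightarrow> (\<lambda>i. x i - y i) \<in> V (- 1)"
  by (auto simp: Hc_def H_def V_diff)

lemma Metric_space_Hc: "Metric_space (Hc c) dist_Hc"
proof
  show "0 \<le> dist_Hc x y" for x y by (simp add: dist_Hc_def seminormV_def infsum_nonneg)
  show "dist_Hc x y = dist_Hc y x" for x y by (simp add: dist_Hc_def seminormV_def power2_commute)
  fix x y z assume xy: "x \<in> Hc c" "y \<in> Hc c"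
  show "dist_Hc x y = 0 \<longleftrightarrow> x = y"
    using xy MH.zero[OF Hc_H Hc_H, of x c y c] by (simp add: dist_H_eq_dist_Hc)
  assume "z \<in> Hc c"
  then show "dist_Hc x z \<le> dist_Hc x y + dist_Hc y z"
    using xy MH.triangle[of x y z] by (simp add: Hc_H dist_H_eq_dist_Hc[symmetric, of _ c])
qed

lemma flat_Hc: "flat c \<in> Hc c"
proof -
  have "flat c \<in> V (- 1)" by (rule seminormV_leI(1)[where C = 0]) (auto simp: flat_def)
  then show ?thesis by (simp add: Hc_def H_def flat_def)
qed

lemma dist_Hc_nonneg: "0 \<le> dist_Hc x y"
  by (simp add: dist_Hc_def seminormV_def infsum_nonneg)

lemma dist_Hc_leI:
  assumes "\<And>m. (\<Sum>i=1..m. (x i - y i)\<^sup>2 / mu i) \<le> C\<^sup>2" "0 \<le> C"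
  shows "dist_Hc x y \<le> C"
  unfolding dist_Hc_def by (rule seminormV_leI(2)[OF assms])

lemma sum_le_dist_Hc:
  assumes "x \<in> Hc c" "y \<in> Hc c"
  shows "(\<Sum>i=1..m. (x i - y i)\<^sup>2 / mu i) \<le> (dist_Hc x y)\<^sup>2"
  unfolding dist_Hc_def by (rule sum_le_seminormV[OF Hc_diff[OF assms]]) auto

text \<open>A strict inequality between an infinite sum and \<open>r\<close> is written as countably
  many conditions on finitely many coordinates each, the form in which measurability can be read
  off.\<close>

lemma dist_Hc_less_iff:
  assumes "x \<in> Hc c" "y \<in> Hc c"
  shows "dist_Hc x y < r \<longleftrightarrow> (\<exists>n::nat. 0 \<le> r - 1 / (real n + 1) \<and> (\<forall>m. (\<Sum>i=1..m. (x i - y i)\<^sup>2 / mu i) \<le> (r - 1 / (real n + 1))\<^sup>2))"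
proof
  assume r: "dist_Hc x y < r"
  then obtain n where "inverse (real (Suc n)) < r - dist_Hc x y" using reals_Archimedean[of "r - dist_Hc x y"] by auto
  then have n: "dist_Hc x y \<le> r - 1 / (real n + 1)" by (simp add: inverse_eq_divide add.commute)
  have pw: "(dist_Hc x y)\<^sup>2 \<le> (r - 1 / (real n + 1))\<^sup>2" using n dist_Hc_nonneg[of x y] by (intro power_mono)
  then show "\<exists>n::nat. 0 \<le> r - 1 / (real n + 1) \<and> (\<forall>m. (\<Sum>i=1..m. (x i - y i)\<^sup>2 / mu i) \<le> (r - 1 / (real n + 1))\<^sup>2)"
    using n dist_Hc_nonneg[of x y]
    by (intro exI[of _ n] conjI allI order_trans[OF sum_le_dist_Hc[OF assms] pw]) simp
next
  assume "\<exists>n::nat. 0 \<le> r - 1 / (real n + 1) \<and> (\<forall>m. (\<Sum>i=1..m. (x i - y i)\<^sup>2 / mu i) \<le> (r - 1 / (real n + 1))\<^sup>2)"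
  then obtain n :: nat where n: "0 \<le> r - 1 / (real n + 1)" "\<And>m. (\<Sum>i=1..m. (x i - y i)\<^sup>2 / mu i) \<le> (r - 1 / (real n + 1))\<^sup>2" by blast
  have "dist_Hc x y \<le> r - 1 / (real n + 1)" by (rule dist_Hc_leI[OF n(2,1)])
  also have "\<dots> < r" by simp
  finally show "dist_Hc x y < r" .
qed

lemma space_borel_Hc [simp]: "space (borel_Hc c) = Hc c"
  unfolding borel_Hc_def by (rule space_measure_of_conv)

lemma open_Hc_Pow: "{U. openin (Metric_space.mtopology (Hc c) dist_Hc) U} \<subseteq> Pow (Hc c)"
proof -
  interpret Metric_space "Hc c" dist_Hc by (rule Metric_space_Hc)
  show ?thesis using openin_subset[of mtopology] by auto
qed

lemma sets_borel_Hc: "sets (borel_Hc c) = sigma_sets (Hc c) {U. openin (Metric_space.mtopology (Hc c) dist_Hc) U}"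
  unfolding borel_Hc_def by (rule sets_measure_of[OF open_Hc_Pow])

lemma openin_Hc_iff:
  "openin (Metric_space.mtopology (Hc c) dist_Hc) U \<longleftrightarrow> U \<subseteq> Hc c \<and> (\<forall>x\<in>U. \<exists>r>0. \<forall>y\<in>Hc c. dist_Hc x y < r \<longrightarrow> y \<in> U)"
proof -
  interpret Metric_space "Hc c" dist_Hc by (rule Metric_space_Hc)
  show ?thesis unfolding openin_mtopology by (fastforce simp: subset_iff)
qed

definition lipschitz_Hc :: "real \<Rightarrow> (coefs \<Rightarrow> real) \<Rightarrow> bool" where
  "lipschitz_Hc c \<phi> \<longleftrightarrow> (\<exists>L\<ge>0. \<forall>x\<in>Hc c. \<forall>y\<in>Hc c. \<bar>\<phi> x - \<phi> y\<bar> \<le> L * dist_Hc x y)"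

text \<open>The test functions of the whole argument: the semigroup preserves them, weak limits can
  be taken on them, and they determine a measure.\<close>

definition LipB :: "real \<Rightarrow> (coefs \<Rightarrow> real) \<Rightarrow> bool" where
  "LipB c \<phi> \<longleftrightarrow> lipschitz_Hc c \<phi> \<and> (\<exists>K\<ge>0. \<forall>x\<in>Hc c. \<bar>\<phi> x\<bar> \<le> K)"

lemma lipschitz_Hc_measurable:
  assumes "lipschitz_Hc c \<phi>" shows "\<phi> \<in> borel_measurable (borel_Hc c)"
proof (rule borel_measurableI_less)
  fix a :: real
  from assms obtain L where L: "0 \<le> L" "\<And>x y. x \<in> Hc c \<Longrightarrow> y \<in> Hc c \<Longrightarrow> \<bar>\<phi> x - \<phi> y\<bar> \<le> L * dist_Hc x y"
    unfolding lipschitz_Hc_def by blast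
  have "openin (Metric_space.mtopology (Hc c) dist_Hc) {x \<in> Hc c. \<phi> x < a}"
    unfolding openin_Hc_iff
  proof (intro conjI ballI)
    fix x assume x: "x \<in> {x \<in> Hc c. \<phi> x < a}"
    show "\<exists>r>0. \<forall>y\<in>Hc c. dist_Hc x y < r \<longrightarrow> y \<in> {x \<in> Hc c. \<phi> x < a}"
    proof (intro exI[of _ "(a - \<phi> x) / (L + 1)"] conjI ballI impI)
      show "0 < (a - \<phi> x) / (L + 1)" using x L by simp
      fix y assume y: "y \<in> Hc c" "dist_Hc x y < (a - \<phi> x) / (L + 1)"
      then have "(L + 1) * dist_Hc x y < a - \<phi> x" using L by (simp add: pos_less_divide_eq mult.commute)
      moreover have "L * dist_Hc x y \<le> (L + 1) * dist_Hc x y" using dist_Hc_nonneg by (simp add: distrib_right)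
      ultimately show "y \<in> {x \<in> Hc c. \<phi> x < a}" using L(2)[of x y] x y by auto
    qed
  qed auto
  then show "{x \<in> space (borel_Hc c). \<phi> x < a} \<in> sets (borel_Hc c)"
    unfolding sets_borel_Hc by (intro sigma_sets.Basic) simp
qed

lemma LipB_Bb: "LipB c \<phi> \<Longrightarrow> \<phi> \<in> Bb c"
  unfolding LipB_def Bb_def bounded_iff using lipschitz_Hc_measurable by force

lemma lipschitz_coord: "lipschitz_Hc c (\<lambda>h. h i)"
  unfolding lipschitz_Hc_def
proof (intro exI[of _ "1 + real i * pi"] conjI ballI)
  fix x y assume "x \<in> Hc c" "y \<in> Hc c"
  then show "\<bar>x i - y i\<bar> \<le> (1 + real i * pi) * dist_Hc x y"
    using coord_diff_le[OF Hc_H Hc_H, of x c y c i] by (simp add: dist_H_eq_dist_Hc)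
qed (simp add: add_nonneg_nonneg)

lemma borel_coord_Hc: "(\<lambda>h. h i) \<in> borel_measurable (borel_Hc c)"
  by (rule lipschitz_Hc_measurable[OF lipschitz_coord])

section \<open>Separability and measurability through coordinates\<close>

definition rat_point :: "real \<Rightarrow> rat list \<Rightarrow> coefs" where
  "rat_point c l = (\<lambda>i. if i = 0 then c else if i \<le> length l then of_rat (l ! (i - 1)) else 0)"

lemma eventually_zero_Hc:
  assumes "h 0 = c" "\<And>i. N < i \<Longrightarrow> h i = 0" shows "h \<in> Hc c"
proof -
  have "h \<in> V (- 1)"
  proof (rule seminormV_leI(1))
    fix m
    have "(\<Sum>i=1..m. (h i)\<^sup>2 / mu i) = (\<Sum>i\<in>{i \<in> {1..m}. i \<le> N}. (h i)\<^sup>2 / mu i)"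
    proof (rule sum.mono_neutral_right)
      show "\<forall>i\<in>{1..m} - {i \<in> {1..m}. i \<le> N}. (h i)\<^sup>2 / mu i = 0"
      proof
        fix i assume "i \<in> {1..m} - {i \<in> {1..m}. i \<le> N}"
        then have "N < i" by (auto simp: not_le)
        then show "(h i)\<^sup>2 / mu i = 0" by (simp add: assms(2))
      qed
    qed auto
    also have "\<dots> \<le> (\<Sum>i\<le>N. (h i)\<^sup>2 / mu i)" by (intro sum_mono2) (auto simp: mu_nonneg)
    also have "\<dots> = (sqrt (\<Sum>i\<le>N. (h i)\<^sup>2 / mu i))\<^sup>2" by (subst real_sqrt_pow2) (auto intro!: sum_nonneg simp: mu_nonneg)
    finally show "(\<Sum>i=1..m. (h i)\<^sup>2 / mu i) \<le> (sqrt (\<Sum>i\<le>N. (h i)\<^sup>2 / mu i))\<^sup>2" .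
  qed (auto intro!: sum_nonneg simp: mu_nonneg)
  with assms(1) show ?thesis by (simp add: Hc_def H_def)
qed

lemma rat_point_Hc: "rat_point c l \<in> Hc c"
  by (rule eventually_zero_Hc[where N = "length l"]) (auto simp: rat_point_def)

lemma rat_point_dense:
  assumes x: "x \<in> Hc c" and e: "0 < e"
  obtains l where "dist_Hc x (rat_point c l) < e"
proof -
  have xV: "x \<in> V (- 1)" and x0: "x 0 = c" using x by (auto simp: Hc_def H_def)
  define S where "S = (seminormV (- 1) x)\<^sup>2"
  define p where "p m = (\<Sum>i=1..m. (x i)\<^sup>2 / mu i)" for m
  have pS: "p m \<le> S" for m unfolding p_def S_def by (rule sum_le_seminormV[OF xV]) auto
  have nn: "0 \<le> seminormV (- 1) x" by (simp add: seminormV_def infsum_nonneg)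
  have "\<exists>m. S - e\<^sup>2 / 8 < p m"
  proof (rule ccontr)
    assume "\<not> (\<exists>m. S - e\<^sup>2 / 8 < p m)"
    then have *: "p m \<le> S - e\<^sup>2 / 8" for m by (simp add: not_less)
    have S0: "0 \<le> S - e\<^sup>2 / 8" using *[of 0] by (simp add: p_def)
    have "seminormV (- 1) x \<le> sqrt (S - e\<^sup>2 / 8)"
      by (rule seminormV_leI(2)) (use * S0 in \<open>auto simp: p_def\<close>)
    then have "S \<le> (sqrt (S - e\<^sup>2 / 8))\<^sup>2" unfolding S_def using nn by (intro power_mono)
    then have "S \<le> S - e\<^sup>2 / 8" using S0 by simp
    then show False using e by simp
  qed
  then obtain m where m: "S - e\<^sup>2 / 8 < p m" by blast
  \<comment> \<open>Since \<open>mu i\<close> is at least 1, the first \<open>m\<close> coordinates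
    contribute at most \<open>m * d\<^sup>2\<close>, below \<open>e\<^sup>2 / 8\<close>. The tail
    contributes as much, and together they make \<open>(e / 2)\<^sup>2\<close>.\<close>
  define d where "d = e / sqrt (8 * (real m + 1))"
  have d: "0 < d" using e by (simp add: d_def)
  have d2: "d\<^sup>2 = e\<^sup>2 / (8 * (real m + 1))" by (simp add: d_def power_divide)
  have "\<exists>r::rat. \<bar>x (Suc i) - of_rat r\<bar> < d" for i
  proof -
    obtain r where "x (Suc i) < of_rat r" "of_rat r < x (Suc i) + d" using of_rat_dense[of "x (Suc i)" "x (Suc i) + d"] d by auto
    then show ?thesis by (intro exI[of _ r]) auto
  qed
  then obtain r where r: "\<And>i. \<bar>x (Suc i) - of_rat (r i)\<bar> < d" by metis
  define l where "l = map r [0..<m]"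
  have "dist_Hc x (rat_point c l) \<le> e / 2"
  proof (rule dist_Hc_leI)
    fix M
    let ?y = "rat_point c l"
    have "(\<Sum>i=1..M. (x i - ?y i)\<^sup>2 / mu i) \<le> (\<Sum>i=1..M. (if i \<le> m then d\<^sup>2 else 0) + (if m < i then (x i)\<^sup>2 / mu i else 0))"
    proof (rule sum_mono)
      fix i assume i: "i \<in> {1..M}"
      show "(x i - ?y i)\<^sup>2 / mu i \<le> (if i \<le> m then d\<^sup>2 else 0) + (if m < i then (x i)\<^sup>2 / mu i else 0)"
      proof (cases "i \<le> m")
        case True
        have "?y i = of_rat (r (i - 1))" using True i by (auto simp: rat_point_def l_def)
        then have "\<bar>x i - ?y i\<bar> \<le> d" using r[of "i - 1"] i by (auto simp: less_imp_le)
        then have "(x i - ?y i)\<^sup>2 \<le> d\<^sup>2" using d by (metis abs_le_square_iff abs_of_pos)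
        moreover have "(x i - ?y i)\<^sup>2 / mu i \<le> (x i - ?y i)\<^sup>2 / 1"
          using i mu_ge_1[of i] mu_pos[of i] by (intro divide_left_mono) auto
        ultimately show ?thesis using True by simp
      next
        case False
        then show ?thesis using i by (auto simp: rat_point_def l_def)
      qed
    qed
    also have "\<dots> \<le> real m * d\<^sup>2 + (\<Sum>i\<in>{m<..M}. (x i)\<^sup>2 / mu i)"
    proof -
      have "(\<Sum>i=1..M. if i \<le> m then d\<^sup>2 else 0) = (\<Sum>i\<in>{i \<in> {1..M}. i \<le> m}. d\<^sup>2)"
        by (rule sum.inter_filter[symmetric]) simp
      also have "\<dots> \<le> (\<Sum>i=1..m. d\<^sup>2)" by (intro sum_mono2) auto
      finally have 1: "(\<Sum>i=1..M. if i \<le> m then d\<^sup>2 else 0) \<le> real m * d\<^sup>2" by simp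
      have "(\<Sum>i=1..M. if m < i then (x i)\<^sup>2 / mu i else 0) = (\<Sum>i\<in>{i \<in> {1..M}. m < i}. (x i)\<^sup>2 / mu i)"
        by (rule sum.inter_filter[symmetric]) simp
      also have "\<dots> = (\<Sum>i\<in>{m<..M}. (x i)\<^sup>2 / mu i)" by (intro sum.cong) auto
      finally show ?thesis using 1 by (simp add: sum.distrib)
    qed
    also have "(\<Sum>i\<in>{m<..M}. (x i)\<^sup>2 / mu i) \<le> e\<^sup>2 / 8"
    proof -
      have "{1..max m M} = {1..m} \<union> {m<..M}" by auto
      then have "p (max m M) = p m + (\<Sum>i\<in>{m<..M}. (x i)\<^sup>2 / mu i)"
        unfolding p_def by (simp only:) (rule sum.union_disjoint, auto)
      then show ?thesis using pS[of "max m M"] m by linarith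
    qed
    also have "real m * d\<^sup>2 \<le> e\<^sup>2 / 8"
    proof -
      have "real m * d\<^sup>2 = e\<^sup>2 / 8 * (real m / (real m + 1))" by (simp add: d2)
      also have "\<dots> \<le> e\<^sup>2 / 8 * 1" by (intro mult_left_mono) auto
      finally show ?thesis by simp
    qed
    finally show "(\<Sum>i=1..M. (x i - ?y i)\<^sup>2 / mu i) \<le> (e / 2)\<^sup>2" by (simp add: power_divide)
  qed (use e in simp)
  then show thesis using e by (intro that[of l]) simp
qed

text \<open>An open set is a countable union of balls around the points
  \<open>rat_point c l\<close>, and \<open>dist_Hc_less_iff\<close> describes each ball by
  coordinates.\<close>

lemma measurable_into_Hc:
  assumes H: "\<And>\<omega>. \<omega> \<in> space A \<Longrightarrow> \<Phi> \<omega> \<in> Hc c" and m: "\<And>i. (\<lambda>\<omega>. \<Phi> \<omega> i) \<in> borel_measurable A"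
  shows "\<Phi> \<in> A \<rightarrow>\<^sub>M borel_Hc c"
  unfolding borel_Hc_def
proof (rule measurable_measure_of[OF open_Hc_Pow])
  show "\<Phi> \<in> space A \<rightarrow> Hc c" using H by blast
  interpret Metric_space "Hc c" dist_Hc by (rule Metric_space_Hc)
  have ball: "{\<omega> \<in> space A. dist_Hc (\<Phi> \<omega>) y < r} \<in> sets A" if y: "y \<in> Hc c" for y r
  proof -
    have "{\<omega> \<in> space A. dist_Hc (\<Phi> \<omega>) y < r} = (\<Union>n::nat. if 0 \<le> r - 1 / (real n + 1) then
       (\<Inter>m. {\<omega> \<in> space A. (\<Sum>i=1..m. (\<Phi> \<omega> i - y i)\<^sup>2 / mu i) \<le> (r - 1 / (real n + 1))\<^sup>2}) else {})"
      using dist_Hc_less_iff[OF H y] by (auto split: if_splits)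
    also have "\<dots> \<in> sets A"
      by (intro sets.countable_UN' ) (auto intro!: sets.countable_INT' borel_measurable_le borel_measurable_sum borel_measurable_divide
          borel_measurable_power borel_measurable_diff m)
    finally show ?thesis .
  qed
  fix U assume "U \<in> {U. openin mtopology U}"
  then have U: "U \<subseteq> Hc c" "\<And>x. x \<in> U \<Longrightarrow> \<exists>r>0. \<forall>y\<in>Hc c. dist_Hc x y < r \<longrightarrow> y \<in> U"
    by (auto simp: openin_Hc_iff)
  define Q where "Q = {(l, n :: nat). \<forall>y\<in>Hc c. dist_Hc y (rat_point c l) < 1 / (real n + 1) \<longrightarrow> y \<in> U}"
  have "\<Phi> -` U \<inter> space A = (\<Union>(l, n)\<in>Q. {\<omega> \<in> space A. dist_Hc (\<Phi> \<omega>) (rat_point c l) < 1 / (real n + 1)})"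
  proof (intro equalityI subsetI)
    fix \<omega> assume w: "\<omega> \<in> \<Phi> -` U \<inter> space A"
    then have x: "\<Phi> \<omega> \<in> Hc c" using H by auto
    from U(2)[of "\<Phi> \<omega>"] w obtain r where r: "r > 0" "\<And>y. y \<in> Hc c \<Longrightarrow> dist_Hc (\<Phi> \<omega>) y < r \<Longrightarrow> y \<in> U" by auto
    obtain n where n: "inverse (real (Suc n)) < r / 2" using reals_Archimedean[of "r / 2"] r by auto
    then have n: "1 / (real n + 1) < r / 2" by (simp add: inverse_eq_divide add.commute)
    obtain l where l: "dist_Hc (\<Phi> \<omega>) (rat_point c l) < 1 / (real n + 1)" by (rule rat_point_dense[OF x, of "1 / (real n + 1)"]) simp
    have "(l, n) \<in> Q"
      unfolding Q_def
    proof (clarify)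
      fix y assume y: "y \<in> Hc c" "dist_Hc y (rat_point c l) < 1 / (real n + 1)"
      have "dist_Hc (\<Phi> \<omega>) y \<le> dist_Hc (\<Phi> \<omega>) (rat_point c l) + dist_Hc y (rat_point c l)"
        using triangle[OF x rat_point_Hc y(1), of l] commute[of y "rat_point c l"] by simp
      then show "y \<in> U" using r(2)[OF y(1)] l y(2) n by simp
    qed
    then show "\<omega> \<in> (\<Union>(l, n)\<in>Q. {\<omega> \<in> space A. dist_Hc (\<Phi> \<omega>) (rat_point c l) < 1 / (real n + 1)})"
      using l w by auto
  next
    fix \<omega> assume "\<omega> \<in> (\<Union>(l, n)\<in>Q. {\<omega> \<in> space A. dist_Hc (\<Phi> \<omega>) (rat_point c l) < 1 / (real n + 1)})"
    then obtain l n where "(l, n) \<in> Q" "\<omega> \<in> space A" "dist_Hc (\<Phi> \<omega>) (rat_point c l) < 1 / (real n + 1)" by auto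
    then show "\<omega> \<in> \<Phi> -` U \<inter> space A" using H by (auto simp: Q_def)
  qed
  also have "\<dots> \<in> sets A"
    by (rule sets.countable_UN') (auto intro!: ball rat_point_Hc)
  finally show "\<Phi> -` U \<inter> space A \<in> sets A" .
qed

lemma lipschitz_psi: "lipschitz_Hc c (psi m)"
  unfolding lipschitz_Hc_def
proof (intro exI[of _ "\<Sum>i=1..m. sqrt (mu i) * (1 + real i * pi)"] conjI ballI)
  show "0 \<le> (\<Sum>i=1..m. sqrt (mu i) * (1 + real i * pi))"
    by (intro sum_nonneg mult_nonneg_nonneg) (auto simp: mu_nonneg)
  fix x y assume xy: "x \<in> Hc c" "y \<in> Hc c"
  have "\<bar>psi m x - psi m y\<bar> \<le> (\<Sum>i=1..m. sqrt (mu i) * \<bar>x i - y i\<bar>)" by (rule psi_lipschitz_coords)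
  also have "\<dots> \<le> (\<Sum>i=1..m. sqrt (mu i) * ((1 + real i * pi) * dist_Hc x y))"
    using coord_diff_le[OF Hc_H Hc_H, OF xy] dist_H_eq_dist_Hc[OF xy]
    by (intro sum_mono mult_left_mono) (auto simp: mu_nonneg)
  finally show "\<bar>psi m x - psi m y\<bar> \<le> (\<Sum>i=1..m. sqrt (mu i) * (1 + real i * pi)) * dist_Hc x y"
    by (simp add: sum_distrib_right mult.assoc)
qed

lemma LipB_min_psi: "0 \<le> K \<Longrightarrow> LipB c (\<lambda>h. min K (psi m h))"
proof -
  assume K: "0 \<le> K"
  from lipschitz_psi obtain L where L: "0 \<le> L" "\<And>x y. x \<in> Hc c \<Longrightarrow> y \<in> Hc c \<Longrightarrow> \<bar>psi m x - psi m y\<bar> \<le> L * dist_Hc x y"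
    unfolding lipschitz_Hc_def by blast
  have "\<bar>min K (psi m x) - min K (psi m y)\<bar> \<le> \<bar>psi m x - psi m y\<bar>" for x y by (auto simp: min_def)
  then have "lipschitz_Hc c (\<lambda>h. min K (psi m h))" unfolding lipschitz_Hc_def using L by (meson order_trans)
  moreover have "\<bar>min K (psi m x)\<bar> \<le> K" for x using K psi_nonneg[of m x] by (auto simp: min_def)
  ultimately show ?thesis using K unfolding LipB_def by blast
qed

section \<open>The approximating semigroups\<close>

locale CH_family = CH_noise M \<beta> S Tr for M :: "'w measure" and \<beta> S Tr +
  fixes lam c :: real and n :: nat and X :: "coefs \<Rightarrow> real \<Rightarrow> 'w \<Rightarrow> coefs"
  assumes S0: "\<And>k. S (basis k) 0 = 0"
    and sol: "\<And>x. x \<in> Hc c \<Longrightarrow> CH_solution M \<beta> S lam n x (X x)"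
begin

text \<open>As in \<open>solution_flat\<close>, one null set for all grids; in addition the
  conserved average places the whole path in \<open>Hc c\<close>.\<close>

lemma solution_path:
  assumes x: "x \<in> Hc c" and T: "0 < T"
  shows "AE \<omega> in M. \<exists>u. CH_traj n x (\<lambda>t. X x t \<omega>) u \<and> (\<forall>t\<ge>0. X x t \<omega> \<in> Hc c) \<and>
    (\<forall>k Mm i. (\<lambda>l. \<beta> l (real k * (T / real Mm)) \<omega> * S (basis l) i) sums
      CH_lhs lam n x (\<lambda>t. X x t \<omega>) u (real k * (T / real Mm)) i)"
proof -
  from sol[OF x] obtain u where u: "AE \<omega> in M. CH_path n x (\<lambda>t. X x t \<omega>) (u \<omega>)"
    and eq: "\<And>t. 0 \<le> t \<Longrightarrow> AE \<omega> in M. \<forall>i. (\<lambda>k. \<beta> k t \<omega> * S (basis k) i) sums CH_lhs lam n x (\<lambda>t. X x t \<omega>) (u \<omega>) t i"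
    unfolding CH_solution_def by blast
  have "AE \<omega> in M. \<forall>k Mm. \<forall>i. (\<lambda>l. \<beta> l (real k * (T / real Mm)) \<omega> * S (basis l) i) sums
      CH_lhs lam n x (\<lambda>t. X x t \<omega>) (u \<omega>) (real k * (T / real Mm)) i"
    using eq[unfolded AE_all_countable] T unfolding AE_all_countable by simp
  with u show ?thesis
  proof eventually_elim
    case (elim \<omega>)
    interpret CH_traj lam n x "\<lambda>t. X x t \<omega>" "u \<omega>" by standard (rule elim)
    have "CH_lhs lam n x (\<lambda>t. X x t \<omega>) (u \<omega>) (real k * (T / real Mm)) 0 = 0" for k Mm
    proof -
      have "(\<lambda>l. 0 :: real) sums CH_lhs lam n x (\<lambda>t. X x t \<omega>) (u \<omega>) (real k * (T / real Mm)) 0"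
        using elim(2)[rule_format, of k Mm 0] by (simp only: S0 mult_zero_right)
      then show ?thesis by (rule sums_unique2) (rule sums_zero)
    qed
    then have "X x t \<omega> 0 = c" if "0 \<le> t" for t
      using mean_const[OF T, of t] that x by (simp add: Hc_def)
    then have "\<forall>t\<ge>0. X x t \<omega> \<in> Hc c" using X_H by (simp add: Hc_def)
    with elim CH_traj_axioms show ?case by blast
  qed
qed

lemma X_space: "x \<in> Hc c \<Longrightarrow> 0 \<le> t \<Longrightarrow> \<omega> \<in> space M \<Longrightarrow> X x t \<omega> \<in> H"
  using sol[of x] measurable_space[of "X x t" M borel_H \<omega>] by (simp add: CH_solution_def space_borel_H)

lemma X_coord: "x \<in> Hc c \<Longrightarrow> 0 \<le> t \<Longrightarrow> (\<lambda>\<omega>. X x t \<omega> i) \<in> borel_measurable M"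
  using sol[of x] measurable_compose[OF _ borel_coord_H, of "X x t" M i] by (simp add: CH_solution_def)

definition inHc :: "coefs \<Rightarrow> real \<Rightarrow> 'w set" where
  "inHc x t = {\<omega> \<in> space M. X x t \<omega> \<in> Hc c}"

lemma inHc_sets:
  assumes "x \<in> Hc c" "0 \<le> t" shows "inHc x t \<in> sets M"
proof -
  have "inHc x t = {\<omega> \<in> space M. X x t \<omega> 0 = c}"
    using X_space[OF assms] by (auto simp: inHc_def Hc_def)
  also have "\<dots> \<in> sets M" using X_coord[OF assms, of 0] by measurable
  finally show ?thesis .
qed

lemma AE_inHc:
  assumes "x \<in> Hc c" "0 \<le> t" shows "AE \<omega> in M. \<omega> \<in> inHc x t"
  using solution_path[OF assms(1) zero_less_one] AE_space by eventually_elim (use assms in \<open>auto simp: inHc_def\<close>)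

lemma approx_eq: "approx_semigroup M X c t \<phi> x = expectation (\<lambda>\<omega>. indicator (inHc x t) \<omega> * \<phi> (X x t \<omega>))"
  by (simp add: approx_semigroup_def inHc_def set_lebesgue_integral_def)

lemma approx_measurable:
  assumes x: "x \<in> Hc c" and t: "0 \<le> t" and \<phi>: "LipB c \<phi>"
  shows "(\<lambda>\<omega>. indicator (inHc x t) \<omega> * \<phi> (X x t \<omega>)) \<in> borel_measurable M"
    "integrable M (\<lambda>\<omega>. indicator (inHc x t) \<omega> * \<phi> (X x t \<omega>))"
proof -
  have i: "inHc x t \<in> sets M" by (rule inHc_sets[OF x t])
  \<comment> \<open>Off the event the solution is replaced by a point of \<open>Hc c\<close>, so
    that the test function is evaluated only where it is known to be measurable.\<close>
  define \<Phi> where "\<Phi> \<omega> = (if \<omega> \<in> inHc x t then X x t \<omega> else flat c)" for \<omega>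
  have "\<Phi> \<in> M \<rightarrow>\<^sub>M borel_Hc c"
  proof (rule measurable_into_Hc)
    show "\<Phi> \<omega> \<in> Hc c" for \<omega> by (auto simp: \<Phi>_def inHc_def flat_Hc)
    fix j
    have "(\<lambda>\<omega>. \<Phi> \<omega> j) = (\<lambda>\<omega>. if \<omega> \<in> inHc x t then X x t \<omega> j else flat c j)" by (auto simp: \<Phi>_def)
    also have "\<dots> \<in> borel_measurable M"
      using i sets.sets_into_space[OF i] by (intro measurable_If X_coord x t borel_measurable_const) (simp add: Int_absorb1 Collect_conj_eq Int_commute)
    finally show "(\<lambda>\<omega>. \<Phi> \<omega> j) \<in> borel_measurable M" .
  qed
  moreover have "\<phi> \<in> borel_measurable (borel_Hc c)" using LipB_Bb[OF \<phi>] by (simp add: Bb_def)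
  ultimately have "(\<lambda>\<omega>. \<phi> (\<Phi> \<omega>)) \<in> borel_measurable M" by (rule measurable_compose)
  then have "(\<lambda>\<omega>. indicator (inHc x t) \<omega> * \<phi> (\<Phi> \<omega>)) \<in> borel_measurable M" using i by measurable
  also have "(\<lambda>\<omega>. indicator (inHc x t) \<omega> * \<phi> (\<Phi> \<omega>)) = (\<lambda>\<omega>. indicator (inHc x t) \<omega> * \<phi> (X x t \<omega>))"
    by (auto simp: \<Phi>_def indicator_def)
  finally show m: "(\<lambda>\<omega>. indicator (inHc x t) \<omega> * \<phi> (X x t \<omega>)) \<in> borel_measurable M" .
  obtain K where "0 \<le> K" "\<And>x. x \<in> Hc c \<Longrightarrow> \<bar>\<phi> x\<bar> \<le> K" using \<phi> unfolding LipB_def by blast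
  then show "integrable M (\<lambda>\<omega>. indicator (inHc x t) \<omega> * \<phi> (X x t \<omega>))"
    by (intro integrable_const_bound[where B = K] m) (auto simp: indicator_def inHc_def)
qed

lemma approx_bound:
  assumes x: "x \<in> Hc c" and t: "0 \<le> t" and \<phi>: "LipB c \<phi>" and K: "0 \<le> K" "\<And>x. x \<in> Hc c \<Longrightarrow> \<bar>\<phi> x\<bar> \<le> K"
  shows "\<bar>approx_semigroup M X c t \<phi> x\<bar> \<le> K"
proof -
  have "\<bar>approx_semigroup M X c t \<phi> x\<bar> \<le> expectation (\<lambda>\<omega>. \<bar>indicator (inHc x t) \<omega> * \<phi> (X x t \<omega>)\<bar>)"
    unfolding approx_eq by (rule integral_abs_bound)
  also have "\<dots> \<le> expectation (\<lambda>_. K)"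
    using approx_measurable(2)[OF x t \<phi>] K by (intro integral_mono) (auto simp: indicator_def inHc_def)
  finally show ?thesis by (simp add: prob_space)
qed

text \<open>The solutions from \<open>x\<close> and \<open>y\<close> are coupled through the same
  noise, and \<open>feller\<close> holds path by path. The Lipschitz constant does not involve
  \<open>n\<close> and so passes to the limit semigroup.\<close>

lemma approx_feller:
  assumes xy: "x \<in> Hc c" "y \<in> Hc c" and t: "0 < t" and \<phi>: "LipB c \<phi>"
    and L: "0 \<le> L" "\<And>x y. x \<in> Hc c \<Longrightarrow> y \<in> Hc c \<Longrightarrow> \<bar>\<phi> x - \<phi> y\<bar> \<le> L * dist_Hc x y"
  shows "\<bar>approx_semigroup M X c t \<phi> x - approx_semigroup M X c t \<phi> y\<bar> \<le> L * (exp (lam\<^sup>2 / 4 * t) * dist_Hc x y)"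
proof -
  have t0: "0 \<le> t" using t by simp
  let ?f = "\<lambda>x \<omega>. indicator (inHc x t) \<omega> * \<phi> (X x t \<omega>)"
  have i: "integrable M (?f x)" "integrable M (?f y)" using approx_measurable[OF _ t0 \<phi>] xy by auto
  have ae: "AE \<omega> in M. \<bar>?f x \<omega> - ?f y \<omega>\<bar> \<le> L * (exp (lam\<^sup>2 / 4 * t) * dist_Hc x y)"
    using solution_path[OF xy(1) t] solution_path[OF xy(2) t] AE_inHc[OF xy(1) t0] AE_inHc[OF xy(2) t0]
  proof eventually_elim
    case (elim \<omega>)
    from elim(1) obtain u where u: "CH_traj n x (\<lambda>t. X x t \<omega>) u" "\<And>t. 0 \<le> t \<Longrightarrow> X x t \<omega> \<in> Hc c"
      "\<And>k Mm i. (\<lambda>l. \<beta> l (real k * (t / real Mm)) \<omega> * S (basis l) i) sums CH_lhs lam n x (\<lambda>t. X x t \<omega>) u (real k * (t / real Mm)) i"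
      by blast
    from elim(2) obtain v where v: "CH_traj n y (\<lambda>t. X y t \<omega>) v" "\<And>t. 0 \<le> t \<Longrightarrow> X y t \<omega> \<in> Hc c"
      "\<And>k Mm i. (\<lambda>l. \<beta> l (real k * (t / real Mm)) \<omega> * S (basis l) i) sums CH_lhs lam n y (\<lambda>t. X y t \<omega>) v (real k * (t / real Mm)) i"
      by blast
    interpret T1: CH_traj lam n x "\<lambda>t. X x t \<omega>" u by (rule u)
    interpret T2: CH_traj lam n y "\<lambda>t. X y t \<omega>" v by (rule v)
    interpret CH_traj2 lam n x "\<lambda>t. X x t \<omega>" u y "\<lambda>t. X y t \<omega>" v t
    proof
      show "CH_lhs lam n x (\<lambda>t. X x t \<omega>) u (real k * (t / real Mm)) i = CH_lhs lam n y (\<lambda>t. X y t \<omega>) v (real k * (t / real Mm)) i" for k Mm i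
        by (rule sums_unique2[OF u(3) v(3)])
      show "X x s \<omega> 0 = X y s \<omega> 0" if "0 \<le> s" for s using u(2)[OF that] v(2)[OF that] by (simp add: Hc_def)
    qed (rule t)
    have "dist_Hc (X x t \<omega>) (X y t \<omega>) \<le> exp (lam\<^sup>2 / 4 * t) * dist_Hc x y"
      using feller xy unfolding dist_Hc_def by (simp add: Hc_def)
    then have "L * dist_Hc (X x t \<omega>) (X y t \<omega>) \<le> L * (exp (lam\<^sup>2 / 4 * t) * dist_Hc x y)" using L(1) by (rule mult_left_mono)
    then show ?case using elim(3,4) L(2)[OF u(2)[OF t0] v(2)[OF t0]] by simp
  qed
  have "\<bar>approx_semigroup M X c t \<phi> x - approx_semigroup M X c t \<phi> y\<bar> = \<bar>expectation (\<lambda>\<omega>. ?f x \<omega> - ?f y \<omega>)\<bar>"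
    unfolding approx_eq using i by simp
  also have "\<dots> \<le> expectation (\<lambda>\<omega>. \<bar>?f x \<omega> - ?f y \<omega>\<bar>)" by (rule integral_abs_bound)
  also have "\<dots> \<le> expectation (\<lambda>_. L * (exp (lam\<^sup>2 / 4 * t) * dist_Hc x y))"
    using i ae by (intro integral_mono_AE) auto
  finally show ?thesis by (simp add: prob_space)
qed

text \<open>Continuity in time does not pass to a pointwise limit in \<open>n\<close>, but
  measurability does, and measurability is what the time averages require.\<close>

lemma approx_continuous:
  assumes x: "x \<in> Hc c" and \<phi>: "LipB c \<phi>"
  shows "continuous_on {0..} (\<lambda>t. approx_semigroup M X c t \<phi> x)"
  unfolding continuous_on_sequentially
proof (intro allI ballI impI)
  obtain K where K: "0 \<le> K" "\<And>x. x \<in> Hc c \<Longrightarrow> \<bar>\<phi> x\<bar> \<le> K" using \<phi> unfolding LipB_def by blast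
  obtain L where L: "0 \<le> L" "\<And>x y. x \<in> Hc c \<Longrightarrow> y \<in> Hc c \<Longrightarrow> \<bar>\<phi> x - \<phi> y\<bar> \<le> L * dist_Hc x y"
    using \<phi> unfolding LipB_def lipschitz_Hc_def by blast
  fix t and s :: "nat \<Rightarrow> real" assume t: "t \<in> {0..}" and s: "(\<forall>j. s j \<in> {0..}) \<and> s \<longlonglongrightarrow> t"
  show "((\<lambda>t. approx_semigroup M X c t \<phi> x) \<circ> s) \<longlonglongrightarrow> approx_semigroup M X c t \<phi> x"
    unfolding comp_def approx_eq
  proof (rule integral_dominated_convergence[where w = "\<lambda>_. K"])
    show "AE \<omega> in M. (\<lambda>j. indicator (inHc x (s j)) \<omega> * \<phi> (X x (s j) \<omega>)) \<longlonglongrightarrow> indicator (inHc x t) \<omega> * \<phi> (X x t \<omega>)"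
      using solution_path[OF x zero_less_one] AE_space
    proof eventually_elim
      case (elim \<omega>)
      then obtain u where u: "CH_traj n x (\<lambda>t. X x t \<omega>) u" and hc: "\<And>t. 0 \<le> t \<Longrightarrow> X x t \<omega> \<in> Hc c" by blast
      interpret CH_traj lam n x "\<lambda>t. X x t \<omega>" u by (rule u)
      have in1: "\<omega> \<in> inHc x r" if "0 \<le> r" for r using hc[OF that] elim by (simp add: inHc_def)
      have "(\<lambda>j. \<phi> (X x (s j) \<omega>)) \<longlonglongrightarrow> \<phi> (X x t \<omega>)"
      proof (rule LIMSEQ_I)
        fix e :: real assume e: "0 < e"
        have e': "0 < e / (L + 1)" using e L by simp
        obtain d where d: "d > 0" "\<And>s. s \<ge> 0 \<Longrightarrow> \<bar>s - t\<bar> < d \<Longrightarrow> dist_H (X x t \<omega>) (X x s \<omega>) < e / (L + 1)"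
          using continuous_top_H(2)[OF X_cont _ e', of t] t by auto
        have "\<forall>\<^sub>F j in sequentially. dist (s j) t < d" using s d(1) by (auto dest: tendstoD)
        then obtain J where J: "\<And>j. j \<ge> J \<Longrightarrow> \<bar>s j - t\<bar> < d" unfolding eventually_sequentially dist_real_def by blast
        show "\<exists>J. \<forall>j\<ge>J. norm (\<phi> (X x (s j) \<omega>) - \<phi> (X x t \<omega>)) < e"
        proof (intro exI[of _ J] allI impI)
          fix j assume "J \<le> j"
          have sj: "0 \<le> s j" "0 \<le> t" using s t by auto
          have "dist_Hc (X x t \<omega>) (X x (s j) \<omega>) < e / (L + 1)"
            using d(2)[OF sj(1) J[OF \<open>J \<le> j\<close>]] dist_H_eq_dist_Hc[OF hc[OF sj(2)] hc[OF sj(1)]] by simp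
          then have "(L + 1) * dist_Hc (X x t \<omega>) (X x (s j) \<omega>) < e" using L(1) by (simp add: pos_less_divide_eq mult.commute)
          moreover have "L * dist_Hc (X x t \<omega>) (X x (s j) \<omega>) \<le> (L + 1) * dist_Hc (X x t \<omega>) (X x (s j) \<omega>)"
            using dist_Hc_nonneg by (simp add: distrib_right)
          ultimately show "norm (\<phi> (X x (s j) \<omega>) - \<phi> (X x t \<omega>)) < e"
            using L(2)[OF hc[OF sj(2)] hc[OF sj(1)]] by (simp add: abs_minus_commute)
        qed
      qed
      then show ?case using in1 s t by simp
    qed
    show "AE \<omega> in M. norm (indicator (inHc x (s j)) \<omega> * \<phi> (X x (s j) \<omega>)) \<le> K" for j
      using K by (intro AE_I2) (auto simp: indicator_def inHc_def)
  qed (use approx_measurable(1)[OF x _ \<phi>] s t in auto)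
qed

lemma approx_psi:
  assumes T: "0 < T" and c: "\<bar>c\<bar> < 1" and n: "1 \<le> n" and K: "0 \<le> K"
  shows "(LINT t:{0<..T}|lborel. approx_semigroup M X c t (\<lambda>h. min K (psi m h)) (flat c)) \<le> T * (1 + C0 lam c + Tr)"
proof -
  have "approx_semigroup M X c t (\<lambda>h. min K (psi m h)) (flat c) = expectation (\<lambda>\<omega>. min K (psi m (X (flat c) t \<omega>)))" if t: "0 \<le> t" for t
    unfolding approx_eq
  proof (rule integral_cong_AE)
    show "AE \<omega> in M. indicator (inHc (flat c) t) \<omega> * min K (psi m (X (flat c) t \<omega>)) = min K (psi m (X (flat c) t \<omega>))"
      using AE_inHc[OF flat_Hc t] by eventually_elim simp
    show "(\<lambda>\<omega>. indicator (inHc (flat c) t) \<omega> * min K (psi m (X (flat c) t \<omega>))) \<in> borel_measurable M"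
      by (rule approx_measurable(1)[OF flat_Hc t LipB_min_psi[OF K]])
    show "(\<lambda>\<omega>. min K (psi m (X (flat c) t \<omega>))) \<in> borel_measurable M"
      by (intro borel_measurable_min borel_measurable_const borel_psi X_coord flat_Hc t)
  qed
  then have "(LINT t:{0<..T}|lborel. approx_semigroup M X c t (\<lambda>h. min K (psi m h)) (flat c))
    = (LINT t:{0<..T}|lborel. expectation (\<lambda>\<omega>. min K (psi m (X (flat c) t \<omega>))))"
    unfolding set_lebesgue_integral_def by (intro Bochner_Integration.integral_cong) (auto simp: indicator_def)
  also have "\<dots> \<le> T * (1 + C0 lam c + Tr)"
    by (rule expectation_psi_bound[OF sol[OF flat_Hc] T S0 c n K])
  finally show ?thesis .
qed

end

section \<open>Weak compactness\<close>

text \<open>The digit in place \<open>l + 1\<close> after the binary point.\<close>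

definition bit :: "nat \<Rightarrow> real \<Rightarrow> real" where
  "bit l y = real_of_int (\<lfloor>2 ^ (l + 1) * y\<rfloor> mod 2)"

lemma bit_01: "bit l y \<in> {0, 1}"
  using pos_mod_sign[of 2 "\<lfloor>2 ^ (l + 1) * y\<rfloor>"] pos_mod_bound[of 2 "\<lfloor>2 ^ (l + 1) * y\<rfloor>"]
  unfolding bit_def by (simp add: mod2_eq_if)

lemma bit_sums:
  assumes "0 \<le> y" "y < 1" shows "(\<lambda>l. bit l y / 2 ^ (l + 1)) sums y"
proof -
  have part: "(\<Sum>l<n. bit l y / 2 ^ (l + 1)) = real_of_int \<lfloor>2 ^ n * y\<rfloor> / 2 ^ n" for n
  proof (induction n)
    case 0
    have "\<lfloor>y\<rfloor> = 0" using assms by (simp add: floor_eq_iff)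
    then show ?case by simp
  next
    case (Suc n)
    have "\<lfloor>2 ^ Suc n * y\<rfloor> div 2 = \<lfloor>2 ^ n * y\<rfloor>"
      using floor_divide_real_eq_div[of 2 "2 ^ Suc n * y"] by simp
    then have "\<lfloor>2 ^ Suc n * y\<rfloor> = 2 * \<lfloor>2 ^ n * y\<rfloor> + \<lfloor>2 ^ Suc n * y\<rfloor> mod 2" by (metis mult_div_mod_eq)
    then have "real_of_int \<lfloor>2 ^ Suc n * y\<rfloor> = 2 * real_of_int \<lfloor>2 ^ n * y\<rfloor> + bit n y"
      unfolding bit_def by (metis Suc_eq_plus1 of_int_add of_int_mult of_int_numeral)
    then show ?case using Suc by (simp add: field_simps)
  qed
  have "(\<lambda>n. real_of_int \<lfloor>2 ^ n * y\<rfloor> / 2 ^ n) \<longlonglongrightarrow> y"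
  proof (rule tendsto_sandwich)
    show "\<forall>\<^sub>F n in sequentially. y - (1 / 2) ^ n \<le> real_of_int \<lfloor>2 ^ n * y\<rfloor> / 2 ^ n"
    proof (intro always_eventually allI)
      fix n
      have "2 ^ n * y - 1 \<le> real_of_int \<lfloor>2 ^ n * y\<rfloor>" by linarith
      then have "(2 ^ n * y - 1) / 2 ^ n \<le> real_of_int \<lfloor>2 ^ n * y\<rfloor> / 2 ^ n" by (intro divide_right_mono) auto
      moreover have "(2 ^ n * y - 1) / 2 ^ n = y - (1 / 2) ^ n" by (simp add: diff_divide_distrib power_divide)
      ultimately show "y - (1 / 2) ^ n \<le> real_of_int \<lfloor>2 ^ n * y\<rfloor> / 2 ^ n" by simp
    qed
    show "\<forall>\<^sub>F n in sequentially. real_of_int \<lfloor>2 ^ n * y\<rfloor> / 2 ^ n \<le> y"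
      by (intro always_eventually allI) (simp add: divide_le_eq mult.commute)
    have "(\<lambda>n. y - (1 / 2) ^ n) \<longlonglongrightarrow> y - 0" by (intro tendsto_diff tendsto_const LIMSEQ_power_zero) simp
    then show "(\<lambda>n. y - (1 / 2) ^ n) \<longlonglongrightarrow> y" by simp
  qed simp
  then show ?thesis unfolding sums_def part .
qed

section \<open>Coding a sequence of reals by one real number\<close>

definition enc :: "(nat \<Rightarrow> real) \<Rightarrow> real" where
  "enc b = (\<Sum>m. b m / 3 ^ (m + 1))"

text \<open>\<open>dig\<close> reads off the digits of base-3 expansions with digits 0 and 1 only, and it is continuous:
  such expansions leave room for the transition between the two values.\<close>

definition dig :: "nat \<Rightarrow> real \<Rightarrow> real" where
  "dig m x = max 0 (min 1 (1 - 2 * cos (2 * pi * (3 ^ m * x) - pi / 6)))"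

lemma summable_enc: "(\<And>m. b m \<in> {0, 1}) \<Longrightarrow> summable (\<lambda>m. b m / 3 ^ (m + 1 + j) :: real)"
proof (rule summable_comparison_test')
  show "summable (\<lambda>m. (1 / 3) ^ m :: real)" by (rule summable_geometric) simp
  fix m assume b: "\<And>m. b m \<in> {0, 1 :: real}"
  have "norm (b m / 3 ^ (m + 1 + j)) \<le> 1 / 3 ^ (m + 1 + j)" using b[of m] by auto
  also have "\<dots> \<le> 1 / 3 ^ m" by (intro divide_left_mono power_increasing) auto
  finally show "norm (b m / 3 ^ (m + 1 + j)) \<le> (1 / 3) ^ m" by (simp add: power_divide)
qed

text \<open>\<open>3 ^ m * enc b\<close> is an integer plus \<open>b m / 3\<close> plus a tail
  \<open>\<tau>\<close> between 0 and 1/6, and the cosine ignores the integer. For digit 0 the angle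
  lies in \<open>[-pi/6, pi/6]\<close>, where the cosine is at least 1/2; for digit 1 it lies in
  \<open>[pi/2, 5*pi/6]\<close>, where the cosine is at most 0. The cut-off in \<open>dig\<close>
  then returns exactly 0 or 1.\<close>

lemma dig_enc:
  assumes b: "\<And>m. b m \<in> {0, 1}"
  shows "dig m (enc b) = b m"
proof -
  define \<tau> where "\<tau> = (\<Sum>j. b (j + Suc m) / 3 ^ (j + 1 + 1))"
  have b': "b (j + Suc m) \<in> {0, 1}" for j by (rule b)
  have geo: "(\<Sum>j. (1 / 3) ^ (j + 2) :: real) = 1 / 6"
  proof -
    have "(\<lambda>j. (1 / 9) * (1 / 3) ^ j :: real) sums ((1 / 9) * (1 / (1 - 1 / 3)))"
      by (intro sums_mult geometric_sums) simp
    then show ?thesis by (simp add: sums_iff power_add mult.commute)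
  qed
  have \<tau>0: "0 \<le> \<tau>" unfolding \<tau>_def using b
    by (intro suminf_nonneg summable_enc b') (metis b divide_nonneg_nonneg insertE order_refl singletonD zero_le_numeral zero_le_one zero_le_power)
  have \<tau>1: "\<tau> \<le> 1 / 6"
    unfolding \<tau>_def geo[symmetric]
  proof (rule suminf_le)
    show "summable (\<lambda>j. b (j + Suc m) / 3 ^ (j + 1 + 1))" by (rule summable_enc[OF b'])
    show "summable (\<lambda>j. (1 / 3) ^ (j + 2) :: real)" by (subst summable_iff_shift) (rule summable_geometric, simp)
    show "b (j + Suc m) / 3 ^ (j + 1 + 1) \<le> (1 / 3) ^ (j + 2)" for j
      using b'[of j] by (auto simp: power_divide)
  qed
  have s0: "summable (\<lambda>m. b m / 3 ^ (m + 1))" using summable_enc[OF b, where j = 0] by simp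
  have "enc b = (\<Sum>j. b (j + Suc m) / 3 ^ (j + Suc m + 1)) + (\<Sum>j<Suc m. b j / 3 ^ (j + 1))"
    unfolding enc_def by (rule suminf_split_initial_segment[OF s0])
  also have "(\<Sum>j. b (j + Suc m) / 3 ^ (j + Suc m + 1)) = \<tau> / 3 ^ m"
  proof -
    have "\<tau> / 3 ^ m = (\<Sum>j. b (j + Suc m) / 3 ^ (j + 1 + 1) / 3 ^ m)"
      unfolding \<tau>_def by (rule suminf_divide[symmetric, OF summable_enc[OF b']])
    also have "\<dots> = (\<Sum>j. b (j + Suc m) / 3 ^ (j + Suc m + 1))"
      by (intro suminf_cong) (simp add: power_add)
    finally show ?thesis by simp
  qed
  finally have "3 ^ m * enc b = \<tau> + b m / 3 + 3 ^ m * (\<Sum>j<m. b j / 3 ^ (j + 1))"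
    by (simp add: algebra_simps)
  also have "3 ^ m * (\<Sum>j<m. b j / 3 ^ (j + 1)) = (\<Sum>j<m. b j * 3 ^ (m - Suc j))"
    unfolding sum_distrib_left
  proof (intro sum.cong refl)
    fix j assume "j \<in> {..<m}"
    then have "m = (m - Suc j) + (j + 1)" by simp
    then have "(3::real) ^ m = 3 ^ ((m - Suc j) + (j + 1))" by (rule arg_cong)
    then have "(3::real) ^ m = 3 ^ (m - Suc j) * 3 ^ (j + 1)" by (simp only: power_add)
    then show "3 ^ m * (b j / 3 ^ (j + 1)) = b j * 3 ^ (m - Suc j)" by simp
  qed
  finally have e: "3 ^ m * enc b = \<tau> + b m / 3 + (\<Sum>j<m. b j * 3 ^ (m - Suc j))" .
  have "(\<Sum>j<m. b j * 3 ^ (m - Suc j)) \<in> \<int>"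
    using b by (intro Ints_sum Ints_mult Ints_power) (metis Ints_0 Ints_1 insertE singletonD, simp)
  then obtain z where z: "(\<Sum>j<m. b j * 3 ^ (m - Suc j)) = of_int z" by (rule Ints_cases)
  have "2 * pi * (3 ^ m * enc b) - pi / 6 = (2 * pi * (\<tau> + b m / 3) - pi / 6) + 2 * pi * of_int z"
    unfolding e z by (simp add: algebra_simps)
  then have c: "cos (2 * pi * (3 ^ m * enc b) - pi / 6) = cos (2 * pi * (\<tau> + b m / 3) - pi / 6)"
    by (simp only: cos_add[of "2 * pi * (\<tau> + b m / 3) - pi / 6"] sin_int_2pin cos_int_2pin mult_zero_right mult_1_right diff_zero)
  have \<tau>pi: "0 \<le> pi * \<tau>" "pi * \<tau> \<le> pi * (1 / 6)" using \<tau>0 \<tau>1 by (auto intro: mult_left_mono)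
  show ?thesis
  proof (cases "b m = 0")
    case True
    have "cos (pi / 6) \<le> cos \<bar>2 * pi * \<tau> - pi / 6\<bar>"
    proof (rule cos_monotone_0_pi_le)
      show "\<bar>2 * pi * \<tau> - pi / 6\<bar> \<le> pi / 6" using \<tau>pi unfolding abs_le_iff by linarith
    qed (use pi_gt_zero in auto)
    moreover have "1 \<le> sqrt (3::real)" by simp
    ultimately have "1 / 2 \<le> cos (2 * pi * \<tau> - pi / 6)" unfolding cos_30 cos_abs_real by linarith
    then show ?thesis unfolding dig_def c True by simp
  next
    case False
    then have bm: "b m = 1" using b[of m] by auto
    have "cos (2 * pi * (\<tau> + 1 / 3) - pi / 6) \<le> cos (pi / 2)"
    proof (rule cos_monotone_0_pi_le)
      have "2 * pi * (\<tau> + 1 / 3) - pi / 6 = 2 * (pi * \<tau>) + pi / 2" by (simp add: algebra_simps)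
      then show "pi / 2 \<le> 2 * pi * (\<tau> + 1 / 3) - pi / 6" "2 * pi * (\<tau> + 1 / 3) - pi / 6 \<le> pi"
        using \<tau>pi pi_gt_zero by linarith+
    qed simp
    then show ?thesis unfolding dig_def c bm by simp
  qed
qed

lemma continuous_dig: "continuous_on A (dig m)"
  unfolding dig_def by (intro continuous_intros)

lemma dig_bounds: "0 \<le> dig m x" "dig m x \<le> 1"
  by (auto simp: dig_def)

text \<open>Reassembles coordinate \<open>j\<close> from its binary digits, which are stored at the
  places \<open>prod_encode (j, l)\<close>. It is defined and continuous on the whole line, also off
  the codes.\<close>

definition gdec :: "nat \<Rightarrow> real \<Rightarrow> real" where
  "gdec j x = (\<Sum>l. dig (prod_encode (j, l)) x / 2 ^ (l + 1))"

lemma continuous_gdec: "continuous_on UNIV (gdec j)"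
proof (rule uniform_limit_theorem)
  show "\<forall>\<^sub>F n in sequentially. continuous_on UNIV (\<lambda>x. \<Sum>l<n. dig (prod_encode (j, l)) x / 2 ^ (l + 1))"
    by (intro always_eventually allI continuous_on_sum continuous_on_divide continuous_dig continuous_on_const) auto
  show "uniform_limit UNIV (\<lambda>n x. \<Sum>l<n. dig (prod_encode (j, l)) x / 2 ^ (l + 1)) (gdec j) sequentially"
    unfolding gdec_def
  proof (rule Weierstrass_m_test)
    show "summable (\<lambda>l. (1 / 2) ^ l :: real)" by (rule summable_geometric) simp
    fix l x
    have "norm (dig (prod_encode (j, l)) x / 2 ^ (l + 1)) \<le> 1 / 2 ^ (l + 1)"
      using dig_bounds[of "prod_encode (j, l)" x] by (simp add: divide_right_mono)
    also have "\<dots> \<le> 1 / 2 ^ l" by (intro divide_left_mono power_increasing) auto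
    finally show "norm (dig (prod_encode (j, l)) x / 2 ^ (l + 1)) \<le> (1 / 2) ^ l" by (simp add: power_divide)
  qed
qed simp

definition squash :: "real \<Rightarrow> real" where
  "squash y = 1 / 2 + arctan y / pi"

lemma squash_bounds: "0 \<le> squash y" "squash y < 1"
  using arctan_bounded[of y] pi_gt_zero by (auto simp: squash_def field_simps)

text \<open>Binary digits jump, so the code is treated as a Borel map. Weak limits are taken on the
  line, where the decoding is continuous.\<close>

definition code :: "coefs \<Rightarrow> real" where
  "code h = enc (\<lambda>m. bit (snd (prod_decode m)) (squash (h (fst (prod_decode m)))))"

lemma gdec_code: "gdec j (code h) = squash (h j)"
proof -
  have "dig (prod_encode (j, l)) (code h) = bit l (squash (h j))" for l
    unfolding code_def by (subst dig_enc) (use bit_01 in auto)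
  then show ?thesis unfolding gdec_def using bit_sums[OF squash_bounds, of "h j"] by (simp add: sums_iff)
qed

lemma code_bounds: "0 \<le> code h" "code h \<le> 1"
proof -
  let ?b = "\<lambda>m. bit (snd (prod_decode m)) (squash (h (fst (prod_decode m))))"
  have s: "summable (\<lambda>m. ?b m / 3 ^ (m + 1))" using summable_enc[where j = 0 and b = ?b] bit_01 by simp
  have b: "0 \<le> ?b m" "?b m \<le> 1" for m using bit_01[of "snd (prod_decode m)" "squash (h (fst (prod_decode m)))"] by auto
  show "0 \<le> code h" unfolding code_def enc_def by (intro suminf_nonneg s) (use b in auto)
  have g: "(\<lambda>m. (1 / 3) * (1 / 3) ^ m :: real) sums ((1 / 3) * (1 / (1 - 1 / 3)))"
    by (intro sums_mult geometric_sums) simp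
  have "code h \<le> (\<Sum>m. (1 / 3) * (1 / 3) ^ m)"
    unfolding code_def enc_def
  proof (rule suminf_le[OF _ s])
    show "?b m / 3 ^ (m + 1) \<le> (1 / 3) * (1 / 3) ^ m" for m using b[of m] by (simp add: power_divide divide_le_eq)
    show "summable (\<lambda>m. (1 / 3) * (1 / 3) ^ m :: real)" using g by (rule sums_summable)
  qed
  also have "\<dots> \<le> 1" using g by (simp add: sums_iff)
  finally show "code h \<le> 1" .
qed

lemma borel_code: "code \<in> borel_measurable (borel_Hc c)"
  unfolding code_def[abs_def] enc_def
proof (intro borel_measurable_suminf borel_measurable_divide borel_measurable_const)
  fix m
  have sq: "(\<lambda>h. squash (h (fst (prod_decode m)))) \<in> borel_measurable (borel_Hc c)"
  proof (rule measurable_compose[OF borel_coord_Hc])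
    show "squash \<in> borel_measurable borel"
      unfolding squash_def[abs_def] by (intro borel_measurable_continuous_onI continuous_intros) auto
  qed
  have "bit l \<in> borel_measurable borel" for l
    unfolding bit_def[abs_def] by measurable
  from measurable_compose[OF sq this]
  show "(\<lambda>h. bit (snd (prod_decode m)) (squash (h (fst (prod_decode m))))) \<in> borel_measurable (borel_Hc c)" .
qed

section \<open>Continuous truncations of the decoding\<close>

definition ang :: "nat \<Rightarrow> real \<Rightarrow> real" where
  "ang i x = pi * (gdec i x - 1 / 2)"

lemma ang_code: "ang i (code h) = arctan (h i)"
  by (simp add: ang_def gdec_code squash_def)

lemma continuous_ang: "continuous_on UNIV (ang i)"
  unfolding ang_def by (intro continuous_intros continuous_gdec)

lemma borel_ang [measurable]: "ang i \<in> borel_measurable borel"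
  by (rule borel_measurable_continuous_onI[OF continuous_ang])

text \<open>Off the codes, and in particular for a weak limit of laws, the angle may reach
  \<open>pi / 2\<close> in modulus, which stands for an infinite coordinate. Cutting the angle off
  before applying \<open>tan\<close> yields a continuous function.\<close>

definition tr :: "real \<Rightarrow> real \<Rightarrow> nat \<Rightarrow> real" where
  "tr R x i = tan (clip (arctan R) (ang i x))"

lemma arctan_nonneg: "0 \<le> R \<Longrightarrow> 0 \<le> arctan R"
  by simp

lemma continuous_tr:
  assumes R: "0 \<le> R" shows "continuous_on UNIV (\<lambda>x. tr R x i)"
  unfolding tr_def tan_def
proof (intro continuous_on_divide continuous_on_sin continuous_on_cos continuous_on_clip continuous_ang)
  show "\<forall>x\<in>UNIV. cos (clip (arctan R) (ang i x)) \<noteq> 0"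
  proof
    fix x
    have "\<bar>clip (arctan R) (ang i x)\<bar> < pi / 2"
      using abs_clip_le[OF arctan_nonneg[OF R], of "ang i x"] arctan_ubound[of R] by linarith
    then have "0 < cos (clip (arctan R) (ang i x))" by (intro cos_gt_zero_pi) auto
    then show "cos (clip (arctan R) (ang i x)) \<noteq> 0" by simp
  qed
qed

lemma abs_tr_eq:
  assumes "0 \<le> R" "\<not> \<bar>ang i x\<bar> \<le> arctan R" shows "\<bar>tr R x i\<bar> = R"
proof -
  have "clip (arctan R) (ang i x) = arctan R \<or> clip (arctan R) (ang i x) = - arctan R"
    using assms arctan_nonneg[OF assms(1)] by (auto simp: clip_def max_def min_def abs_le_iff)
  then show ?thesis using assms(1) by (auto simp: tr_def tan_arctan)
qed

lemma tr_code: "0 \<le> R \<Longrightarrow> tr R (code h) i = clip R (h i)"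
proof -
  assume R: "0 \<le> R"
  have "clip (arctan R) (arctan (h i)) = arctan (clip R (h i))"
    unfolding clip_def by (auto simp: max_def min_def arctan_le_iff arctan_minus[symmetric])
  then show ?thesis by (simp add: tr_def ang_code tan_arctan)
qed

text \<open>In terms of the decoded sequence: the first \<open>m\<close> coordinates and their
  \<open>psi\<close> are at most \<open>R\<close>. The condition on the angles excludes the infinite
  coordinates, at which \<open>tan\<close> is 0 by convention and would look harmless in
  \<open>psi\<close>.\<close>

definition good :: "nat \<Rightarrow> nat \<Rightarrow> real \<Rightarrow> bool" where
  "good m R x \<longleftrightarrow> (\<forall>i\<in>{1..m}. \<bar>ang i x\<bar> \<le> arctan (real R)) \<and> psi m (\<lambda>i. tan (ang i x)) \<le> real R"

definition vgood :: "nat \<Rightarrow> real \<Rightarrow> bool" where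
  "vgood R x \<longleftrightarrow> (\<forall>m. good m R x)"

lemma good_antimono: "m \<le> m' \<Longrightarrow> good m' R x \<Longrightarrow> good m R x"
proof -
  assume mm: "m \<le> m'" and g: "good m' R x"
  have "psi m (\<lambda>i. tan (ang i x)) \<le> psi m' (\<lambda>i. tan (ang i x))"
    unfolding psi_def using mm by (intro real_sqrt_le_mono sum_mono2) (auto simp: mu_nonneg)
  then show ?thesis using g mm by (auto simp: good_def)
qed

lemma tr_good: "\<bar>ang i x\<bar> \<le> arctan R \<Longrightarrow> tr R x i = tan (ang i x)"
  by (simp add: tr_def clip_eq)

text \<open>A continuous majorant of the indicator of the points that are not \<open>good\<close>
  (for \<open>R\<close> at least 1): Markov's inequality in a form that passes to weak
  limits.\<close>

definition chi :: "nat \<Rightarrow> nat \<Rightarrow> real \<Rightarrow> real" where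
  "chi m R x = min 1 (psi m (tr (real R) x) / real R)"

lemma abs_le_psi: "i \<in> {1..m} \<Longrightarrow> \<bar>y i\<bar> \<le> psi m y"
proof -
  assume i: "i \<in> {1..m}"
  have "(y i)\<^sup>2 \<le> mu i * (y i)\<^sup>2" using mult_right_mono[OF mu_ge_1[of i], of "(y i)\<^sup>2"] i by simp
  also have "\<dots> \<le> (\<Sum>i=1..m. mu i * (y i)\<^sup>2)" using i by (intro member_le_sum) (auto simp: mu_nonneg)
  finally show ?thesis unfolding psi_def by (intro real_le_rsqrt) simp
qed

lemma chi_not_good:
  assumes R: "1 \<le> R" and g: "\<not> good m R x" shows "chi m R x = 1"
proof -
  have "real R \<le> psi m (tr (real R) x)"
  proof (cases "\<forall>i\<in>{1..m}. \<bar>ang i x\<bar> \<le> arctan (real R)")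
    case True
    then have "real R \<le> psi m (\<lambda>i. tan (ang i x))" using g by (auto simp: good_def)
    also have "\<dots> = psi m (tr (real R) x)"
      unfolding psi_def using True by (intro arg_cong[where f = sqrt] sum.cong) (auto simp: tr_good)
    finally show ?thesis .
  next
    case False
    then obtain i where i: "i \<in> {1..m}" "\<not> \<bar>ang i x\<bar> \<le> arctan (real R)" by blast
    then show ?thesis using abs_le_psi[OF i(1), of "tr (real R) x"] abs_tr_eq[OF _ i(2)] by simp
  qed
  then show ?thesis using R by (simp add: chi_def)
qed

lemma chi_bounds: "0 \<le> chi m R x" "chi m R x \<le> 1"
  by (auto simp: chi_def psi_nonneg)

lemma continuous_chi: "1 \<le> R \<Longrightarrow> continuous_on UNIV (chi m R)"
  unfolding chi_def psi_def by (intro continuous_intros continuous_tr) auto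

lemma psi_mono: "(\<And>i. \<bar>y i\<bar> \<le> \<bar>z i\<bar>) \<Longrightarrow> psi m y \<le> psi m z"
  unfolding psi_def by (intro real_sqrt_le_mono sum_mono mult_left_mono) (auto simp: abs_le_square_iff mu_nonneg)

lemma chi_code: "1 \<le> R \<Longrightarrow> chi m R (code h) \<le> min (real R) (psi m h) / real R"
proof -
  assume R: "1 \<le> R"
  have "psi m (tr (real R) (code h)) \<le> psi m h"
    by (rule psi_mono) (auto simp: tr_code clip_def)
  then have "psi m (tr (real R) (code h)) / real R \<le> psi m h / real R" by (intro divide_right_mono) auto
  moreover have "min (real R) (psi m h) / real R = min 1 (psi m h / real R)"
    using R by (auto simp: min_def field_simps)
  ultimately show ?thesis unfolding chi_def by (auto simp: min_le_iff_disj)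
qed

lemma borel_tan_ang [measurable]: "(\<lambda>x. tan (ang i x)) \<in> borel_measurable borel"
proof -
  have [measurable]: "(\<lambda>x. sin (ang i x)) \<in> borel_measurable borel" "(\<lambda>x. cos (ang i x)) \<in> borel_measurable borel"
    by (intro borel_measurable_continuous_onI continuous_on_sin continuous_on_cos continuous_ang)+
  show ?thesis unfolding tan_def by measurable
qed

lemma pred_good [measurable]: "Measurable.pred borel (good m R)"
proof -
  have [measurable]: "(\<lambda>x. psi m (\<lambda>i. tan (ang i x))) \<in> borel_measurable borel" by (intro borel_psi borel_tan_ang)
  show ?thesis unfolding good_def by measurable
qed

lemma pred_vgood [measurable]: "Measurable.pred borel (vgood R)"
  unfolding vgood_def by measurable

text \<open>Points with finite seminorm are decoded; all others go to a fixed point of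
  \<open>Hc c\<close>, so that the image of every law lives there.\<close>

definition decode :: "real \<Rightarrow> real \<Rightarrow> coefs" where
  "decode c x = (if \<exists>R. vgood R x then (\<lambda>i. if i = 0 then c else tan (ang i x)) else flat c)"

text \<open>A finite-dimensional substitute for \<open>decode\<close>, continuous in
  \<open>x\<close> under every Lipschitz test function.\<close>

definition trunc :: "real \<Rightarrow> nat \<Rightarrow> real \<Rightarrow> coefs" where
  "trunc c R x = (\<lambda>i. if i = 0 then c else if i \<le> R then tr (real R) x i else 0)"

lemma trunc_Hc: "trunc c R x \<in> Hc c"
  by (rule eventually_zero_Hc[where N = R]) (auto simp: trunc_def)

lemma decode_Hc: "decode c x \<in> Hc c"
proof (cases "\<exists>R. vgood R x")
  case True
  then obtain R where R: "vgood R x" by blast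
  have "(\<lambda>i. if i = 0 then c else tan (ang i x)) \<in> V (- 1)"
  proof (rule seminormV_leI(1)[where C = "real R"])
    fix m
    have "(\<Sum>i=1..m. (if i = 0 then c else tan (ang i x))\<^sup>2 / mu i) \<le> (\<Sum>i=1..m. mu i * (tan (ang i x))\<^sup>2)"
    proof (rule sum_mono)
      fix i assume i: "i \<in> {1..m}"
      then have m1: "1 \<le> mu i" using mu_ge_1[of i] by simp
      have "(tan (ang i x))\<^sup>2 / mu i \<le> (tan (ang i x))\<^sup>2 / 1" using m1 by (intro divide_left_mono) auto
      also have "\<dots> \<le> mu i * (tan (ang i x))\<^sup>2" using mult_right_mono[OF m1, of "(tan (ang i x))\<^sup>2"] by simp
      finally show "(if i = 0 then c else tan (ang i x))\<^sup>2 / mu i \<le> mu i * (tan (ang i x))\<^sup>2" using i by auto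
    qed
    also have "\<dots> = (psi m (\<lambda>i. tan (ang i x)))\<^sup>2"
      unfolding psi_def by (rule real_sqrt_pow2[symmetric]) (auto intro!: sum_nonneg simp: mu_nonneg)
    also have "\<dots> \<le> (real R)\<^sup>2" using R psi_nonneg by (intro power_mono) (auto simp: vgood_def good_def)
    finally show "(\<Sum>i=1..m. (if i = 0 then c else tan (ang i x))\<^sup>2 / mu i) \<le> (real R)\<^sup>2" .
  qed simp
  then show ?thesis using True by (simp add: decode_def Hc_def H_def)
qed (simp add: decode_def flat_Hc)

lemma measurable_decode: "decode c \<in> borel \<rightarrow>\<^sub>M borel_Hc c"
proof (rule measurable_into_Hc[OF decode_Hc])
  fix i
  have [measurable]: "Measurable.pred borel (\<lambda>x. \<exists>R. vgood R x)" by measurable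
  have "(\<lambda>x. decode c x i) = (\<lambda>x. if \<exists>R. vgood R x then (if i = 0 then c else tan (ang i x)) else flat c i)"
    by (auto simp: decode_def)
  also have "\<dots> \<in> borel_measurable borel" by (cases "i = 0") simp_all
  finally show "(\<lambda>x. decode c x i) \<in> borel_measurable borel" .
qed

lemma decode_code:
  assumes h: "h \<in> Hc c" and g: "\<exists>R. vgood R (code h)"
  shows "decode c (code h) = h"
  using g h by (auto simp: decode_def ang_code tan_arctan Hc_def)

text \<open>The compact embedding in quantitative form. The modes up to \<open>R\<close> agree; for
  the others \<open>mu i\<close> is at least \<open>R^2\<close>, so their share of the squared
  \<open>|.|_{-1}\<close> norm is at most \<open>R^{-4}\<close> times the squared
  \<open>|.|_1\<close> norm, which is at most \<open>R^2\<close>.\<close>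

lemma dist_trunc_decode:
  assumes R: "1 \<le> R" and g: "vgood R x"
  shows "dist_Hc (trunc c R x) (decode c x) \<le> 1 / real R"
proof (rule dist_Hc_leI)
  fix m
  have ang: "\<bar>ang i x\<bar> \<le> arctan (real R)" if "1 \<le> i" for i
    using g that unfolding vgood_def good_def by (auto dest!: spec[of _ i])
  have dec: "decode c x = (\<lambda>i. if i = 0 then c else tan (ang i x))" using g by (auto simp: decode_def)
  have R4: "0 < real R ^ 4" using R by simp
  have "(\<Sum>i=1..m. (trunc c R x i - decode c x i)\<^sup>2 / mu i) \<le> (\<Sum>i=1..m. mu i * (tan (ang i x))\<^sup>2 / real R ^ 4)"
  proof (rule sum_mono)
    fix i assume i: "i \<in> {1..m}"
    show "(trunc c R x i - decode c x i)\<^sup>2 / mu i \<le> mu i * (tan (ang i x))\<^sup>2 / real R ^ 4"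
    proof (cases "i \<le> R")
      case True
      then show ?thesis using i tr_good[OF ang, of i] by (auto simp: trunc_def dec mu_nonneg)
    next
      case False
      have m: "0 < mu i" using mu_pos[of i] i by simp
      have "real R \<le> real i * pi"
      proof -
        have "real R * 1 \<le> real i * pi" using False pi_ge_two by (intro mult_mono) auto
        then show ?thesis by simp
      qed
      then have "(real R)\<^sup>2 \<le> mu i" unfolding mu_def by (intro power_mono) auto
      then have "(real R)\<^sup>2 * (real R)\<^sup>2 \<le> mu i * mu i" by (intro mult_mono) (auto simp: mu_nonneg)
      then have "real R ^ 4 \<le> mu i * mu i" by (simp add: power2_eq_square eval_nat_numeral mult.assoc)
      then have "(tan (ang i x))\<^sup>2 * real R ^ 4 \<le> (tan (ang i x))\<^sup>2 * (mu i * mu i)" by (intro mult_left_mono) auto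
      then have "(tan (ang i x))\<^sup>2 / mu i \<le> mu i * (tan (ang i x))\<^sup>2 / real R ^ 4"
        using m R4 by (simp add: divide_le_eq le_divide_eq mult_ac)
      then show ?thesis using False i by (simp add: trunc_def dec)
    qed
  qed
  also have "\<dots> = (\<Sum>i=1..m. mu i * (tan (ang i x))\<^sup>2) / real R ^ 4" by (simp add: sum_divide_distrib)
  also have "(\<Sum>i=1..m. mu i * (tan (ang i x))\<^sup>2) = (psi m (\<lambda>i. tan (ang i x)))\<^sup>2"
    unfolding psi_def by (rule real_sqrt_pow2[symmetric]) (auto intro!: sum_nonneg simp: mu_nonneg)
  also have "(psi m (\<lambda>i. tan (ang i x)))\<^sup>2 / real R ^ 4 \<le> (real R)\<^sup>2 / real R ^ 4"
    using g psi_nonneg by (intro divide_right_mono power_mono) (auto simp: vgood_def good_def)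
  also have "\<dots> = (1 / real R)\<^sup>2" using R by (simp add: power2_eq_square eval_nat_numeral)
  finally show "(\<Sum>i=1..m. (trunc c R x i - decode c x i)\<^sup>2 / mu i) \<le> (1 / real R)\<^sup>2" .
qed simp

lemma isCont_trunc:
  assumes \<phi>: "lipschitz_Hc c \<phi>"
  shows "isCont (\<lambda>x. \<phi> (trunc c R x)) x"
proof -
  from \<phi> obtain L where L: "0 \<le> L" "\<And>x y. x \<in> Hc c \<Longrightarrow> y \<in> Hc c \<Longrightarrow> \<bar>\<phi> x - \<phi> y\<bar> \<le> L * dist_Hc x y"
    unfolding lipschitz_Hc_def by blast
  define s where "s y = (\<Sum>i=1..R. \<bar>tr (real R) y i - tr (real R) x i\<bar>)" for y
  have d: "dist_Hc (trunc c R y) (trunc c R x) \<le> s y" for y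
  proof (rule dist_Hc_leI)
    show "0 \<le> s y" unfolding s_def by (intro sum_nonneg) auto
    fix m
    have "(\<Sum>i=1..m. (trunc c R y i - trunc c R x i)\<^sup>2 / mu i) \<le> (\<Sum>i=1..m. s y * (if i \<le> R then \<bar>tr (real R) y i - tr (real R) x i\<bar> else 0))"
    proof (rule sum_mono)
      fix i assume i: "i \<in> {1..m}"
      have m: "1 \<le> mu i" using mu_ge_1[of i] i by simp
      show "(trunc c R y i - trunc c R x i)\<^sup>2 / mu i \<le> s y * (if i \<le> R then \<bar>tr (real R) y i - tr (real R) x i\<bar> else 0)"
      proof (cases "i \<le> R")
        case True
        define z where "z = \<bar>tr (real R) y i - tr (real R) x i\<bar>"
        have zs: "z \<le> s y" unfolding z_def s_def using i True by (intro member_le_sum[where f = "\<lambda>i. \<bar>tr (real R) y i - tr (real R) x i\<bar>"]) auto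
        have "(trunc c R y i - trunc c R x i)\<^sup>2 / mu i = z\<^sup>2 / mu i" using True i by (simp add: trunc_def z_def)
        also have "\<dots> \<le> z\<^sup>2 / 1" using m by (intro divide_left_mono) auto
        also have "\<dots> \<le> s y * z" using mult_right_mono[OF zs, of z] by (simp add: power2_eq_square z_def)
        finally show ?thesis using True by (simp add: z_def)
      qed (use i in \<open>auto simp: trunc_def\<close>)
    qed
    also have "\<dots> = s y * (\<Sum>i\<in>{i \<in> {1..m}. i \<le> R}. \<bar>tr (real R) y i - tr (real R) x i\<bar>)"
      unfolding sum_distrib_left[symmetric] by (subst sum.inter_filter) auto
    also have "\<dots> \<le> s y * s y"
      unfolding s_def by (intro mult_left_mono sum_mono2 sum_nonneg) auto
    finally show "(\<Sum>i=1..m. (trunc c R y i - trunc c R x i)\<^sup>2 / mu i) \<le> (s y)\<^sup>2" by (simp add: power2_eq_square)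
  qed
  have "isCont (\<lambda>y. L * s y) x"
  proof -
    have "isCont (\<lambda>y. tr (real R) y i) x" for i
      using continuous_tr[of "real R" i] by (simp add: continuous_on_eq_continuous_at)
    then show ?thesis unfolding s_def by (intro continuous_intros) 
  qed
  then have "(\<lambda>y. L * s y) \<midarrow>x\<rightarrow> L * s x" by (rule isContD)
  then have 0: "(\<lambda>y. L * s y) \<midarrow>x\<rightarrow> 0" by (simp add: s_def)
  have "(\<lambda>y. \<phi> (trunc c R y) - \<phi> (trunc c R x)) \<midarrow>x\<rightarrow> 0"
  proof (rule Lim_null_comparison[OF _ 0])
    have "\<bar>\<phi> (trunc c R y) - \<phi> (trunc c R x)\<bar> \<le> L * s y" for y
      using L(2)[OF trunc_Hc trunc_Hc, of R y R x] mult_left_mono[OF d L(1), of y] by linarith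
    then show "\<forall>\<^sub>F y in at x. norm (\<phi> (trunc c R y) - \<phi> (trunc c R x)) \<le> L * s y" by simp
  qed
  then show ?thesis unfolding isCont_def by (rule LIM_zero_cancel)
qed

section \<open>Concentration on decodable points and weak limits\<close>

lemma measure_not_vgood:
  assumes "real_distribution \<rho>" and b: "\<And>m. (\<integral>x. chi m R x \<partial>\<rho>) \<le> C / real R" and R: "1 \<le> R"
  shows "measure \<rho> {x. \<not> vgood R x} \<le> C / real R"
proof -
  interpret real_distribution \<rho> by fact
  have m: "measure \<rho> {x. \<not> good m R x} \<le> C / real R" for m
  proof -
    have s: "{x. \<not> good m R x} \<in> sets \<rho>" using pred_good[of m R] by (simp add: pred_def) measurable
    have "measure \<rho> {x. \<not> good m R x} = (\<integral>x. indicator {x. \<not> good m R x} x \<partial>\<rho>)" using s by simp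
    also have "\<dots> \<le> (\<integral>x. chi m R x \<partial>\<rho>)"
    proof (rule integral_mono)
      show "integrable \<rho> (indicat_real {x. \<not> good m R x})" using s by (simp add: emeasure_eq_measure)
      have "chi m R \<in> borel_measurable borel" by (rule borel_measurable_continuous_onI[OF continuous_chi[OF R]])
      then show "integrable \<rho> (chi m R)" using chi_bounds by (intro integrable_const_bound[where B = 1]) auto
      show "indicat_real {x. \<not> good m R x} x \<le> chi m R x" for x
        using chi_not_good[OF R, of m x] chi_bounds[of m R x] by (auto simp: indicator_def)
    qed
    also note b
    finally show ?thesis .
  qed
  have e: "{x. \<not> vgood R x} = (\<Union>m. {x. \<not> good m R x})" by (auto simp: vgood_def)
  have "(\<lambda>m. measure \<rho> {x. \<not> good m R x}) \<longlonglongrightarrow> measure \<rho> (\<Union>m. {x. \<not> good m R x})"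
  proof (rule finite_Lim_measure_incseq)
    show "range (\<lambda>m. {x. \<not> good m R x}) \<subseteq> sets \<rho>" using pred_good[of _ R] by (auto simp: pred_def) 
    show "incseq (\<lambda>m. {x. \<not> good m R x})" using good_antimono by (auto simp: incseq_def)
  qed
  then show ?thesis unfolding e by (rule LIMSEQ_le_const2) (use m in auto)
qed

text \<open>On the points that are \<open>vgood\<close> the error is the Lipschitz constant times
  \<open>1 / R\<close>; the others have probability at most \<open>C / R\<close> and cost at most
  \<open>2 * K\<close>. The bound is the same for every law satisfying the hypothesis on
  \<open>chi\<close>.\<close>

lemma trunc_decode_integral:
  assumes "real_distribution \<rho>" and b: "\<And>m. (\<integral>x. chi m R x \<partial>\<rho>) \<le> C / real R" and R: "1 \<le> R"
    and L: "0 \<le> L" "\<And>x y. x \<in> Hc c \<Longrightarrow> y \<in> Hc c \<Longrightarrow> \<bar>\<phi> x - \<phi> y\<bar> \<le> L * dist_Hc x y"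
    and K: "0 \<le> K" "\<And>x. x \<in> Hc c \<Longrightarrow> \<bar>\<phi> x\<bar> \<le> K" and \<phi>: "LipB c \<phi>"
  shows "\<bar>(\<integral>x. \<phi> (trunc c R x) \<partial>\<rho>) - (\<integral>x. \<phi> (decode c x) \<partial>\<rho>)\<bar> \<le> (L + 2 * K * C) / real R"
proof -
  interpret real_distribution \<rho> by fact
  have "(\<lambda>x. \<phi> (trunc c R x)) \<in> borel_measurable borel"
    using isCont_trunc \<phi> by (intro borel_measurable_continuous_onI continuous_at_imp_continuous_on) (auto simp: LipB_def)
  then have i1: "integrable \<rho> (\<lambda>x. \<phi> (trunc c R x))"
    using K trunc_Hc by (intro integrable_const_bound[where B = K]) auto
  have "(\<lambda>x. \<phi> (decode c x)) \<in> borel_measurable borel"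
    using LipB_Bb[OF \<phi>] by (intro measurable_compose[OF measurable_decode]) (simp add: Bb_def)
  then have i2: "integrable \<rho> (\<lambda>x. \<phi> (decode c x))"
    using K decode_Hc by (intro integrable_const_bound[where B = K]) auto
  have s: "{x. \<not> vgood R x} \<in> sets \<rho>" using pred_vgood[of R] by (simp add: pred_def) measurable
  have i3: "integrable \<rho> (\<lambda>x. L / real R + 2 * K * indicator {x. \<not> vgood R x} x)"
    using s by (simp add: emeasure_eq_measure)
  have p: "\<bar>\<phi> (trunc c R x) - \<phi> (decode c x)\<bar> \<le> L / real R + 2 * K * indicator {x. \<not> vgood R x} x" for x
  proof (cases "vgood R x")
    case True
    have "\<bar>\<phi> (trunc c R x) - \<phi> (decode c x)\<bar> \<le> L * dist_Hc (trunc c R x) (decode c x)" by (rule L(2)[OF trunc_Hc decode_Hc])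
    also have "\<dots> \<le> L * (1 / real R)" by (rule mult_left_mono[OF dist_trunc_decode[OF R True] L(1)])
    finally show ?thesis using True by simp
  next
    case False
    have "\<bar>\<phi> (trunc c R x) - \<phi> (decode c x)\<bar> \<le> 2 * K" using K(2)[OF trunc_Hc, of R x] K(2)[OF decode_Hc, of x] by linarith
    also have "\<dots> \<le> L / real R + 2 * K" using L by simp
    finally show ?thesis using False by simp
  qed
  have "\<bar>(\<integral>x. \<phi> (trunc c R x) \<partial>\<rho>) - (\<integral>x. \<phi> (decode c x) \<partial>\<rho>)\<bar> = \<bar>\<integral>x. \<phi> (trunc c R x) - \<phi> (decode c x) \<partial>\<rho>\<bar>"
    using i1 i2 by simp
  also have "\<dots> \<le> (\<integral>x. \<bar>\<phi> (trunc c R x) - \<phi> (decode c x)\<bar> \<partial>\<rho>)" by (rule integral_abs_bound)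
  also have "\<dots> \<le> (\<integral>x. L / real R + 2 * K * indicator {x. \<not> vgood R x} x \<partial>\<rho>)"
    using i1 i2 i3 p by (intro integral_mono) auto
  also have "\<dots> = L / real R + 2 * K * measure \<rho> {x. \<not> vgood R x}"
    using s prob_space by (simp add: emeasure_eq_measure)
  also have "\<dots> \<le> L / real R + 2 * K * (C / real R)"
    using K by (intro add_left_mono mult_left_mono measure_not_vgood assms) auto
  finally show ?thesis by (simp add: add_divide_distrib)
qed

text \<open>The laws of the codes live on the unit interval and are tight for trivial reasons. The
  seminorm bound serves to show that the limit law charges only decodable points;
  \<open>trunc\<close> mediates between weak convergence on the line and the integrals over
  \<open>Hc c\<close>.\<close>

theorem weak_compactness:
  fixes \<mu> :: "nat \<Rightarrow> coefs measure"
  assumes ps: "\<And>j. prob_space (\<mu> j)" and sets: "\<And>j. sets (\<mu> j) = sets (borel_Hc c)"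
    and C: "\<And>j m R. 1 \<le> R \<Longrightarrow> (\<integral>h. min (real R) (psi m h) \<partial>\<mu> j) \<le> C"
  shows "\<exists>\<nu> r. strict_mono r \<and> prob_space \<nu> \<and> sets \<nu> = sets (borel_Hc c) \<and>
    (\<forall>\<phi>. LipB c \<phi> \<longrightarrow> (\<lambda>k. \<integral>h. \<phi> h \<partial>\<mu> (r k)) \<longlonglongrightarrow> (\<integral>h. \<phi> h \<partial>\<nu>))"
proof -
  have space: "space (\<mu> j) = Hc c" for j using sets_eq_imp_space_eq[OF sets[of j]] by simp
  have code_m: "code \<in> borel_measurable (\<mu> j)" for j
    using borel_code[of c] by (simp add: measurable_cong_sets[OF sets refl])
  define \<rho> where "\<rho> j = distr (\<mu> j) borel code" for j
  have rd: "real_distribution (\<rho> j)" for j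
  proof -
    interpret prob_space "\<mu> j" by (rule ps)
    show ?thesis unfolding \<rho>_def real_distribution_def real_distribution_axioms_def
      using prob_space_distr[OF code_m[of j]] by simp
  qed
  have C0: "0 \<le> C"
  proof -
    have "0 \<le> (\<integral>h. min (real 1) (psi 0 h) \<partial>\<mu> 0)" by (intro integral_nonneg_AE AE_I2) (simp add: psi_nonneg)
    then show ?thesis using C[of 1 0 0] by simp
  qed
  have tight: "tight \<rho>"
    unfolding tight_def
  proof (intro conjI allI impI)
    show "real_distribution (\<rho> j)" for j by (rule rd)
    fix e :: real assume e: "0 < e"
    have "measure (\<rho> j) {- 1<..1} = 1" for j
    proof -
      interpret prob_space "\<mu> j" by (rule ps)
      have "measure (\<rho> j) {- 1<..1} = measure (\<mu> j) (code -` {- 1<..1} \<inter> space (\<mu> j))"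
        unfolding \<rho>_def by (rule measure_distr[OF code_m]) simp
      also have "code -` {- 1<..1} \<inter> space (\<mu> j) = space (\<mu> j)"
      proof -
        have "- 1 < code h" for h using code_bounds(1)[of h] by linarith
        then show ?thesis using code_bounds by auto
      qed
      finally show ?thesis by (simp add: prob_space)
    qed
    then show "\<exists>a b. a < b \<and> (\<forall>j. 1 - e < measure (\<rho> j) {a<..b})" using e by (intro exI[of _ "- 1"] exI[of _ 1]) auto
  qed
  from tight_imp_convergent_subsubsequence[OF this strict_mono_id] obtain r M0 where
    r: "strict_mono r" and M0: "real_distribution M0" and wc: "weak_conv_m (\<rho> \<circ> r) M0" by (auto simp: comp_def)
  have conv: "(\<lambda>k. \<integral>x. f x \<partial>\<rho> (r k)) \<longlonglongrightarrow> (\<integral>x. f x \<partial>M0)" if "\<And>x. isCont f x" "\<And>x. \<bar>f x\<bar> \<le> B" for f :: "real \<Rightarrow> real" and B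
    using weak_conv_imp_integral_bdd_continuous_conv[of "\<rho> \<circ> r" M0 f B] rd M0 wc that by (simp add: comp_def)
  have chi_\<rho>: "(\<integral>x. chi m R x \<partial>\<rho> j) \<le> C / real R" if R: "1 \<le> R" for m R j
  proof -
    interpret prob_space "\<mu> j" by (rule ps)
    have cm: "chi m R \<in> borel_measurable borel" by (rule borel_measurable_continuous_onI[OF continuous_chi[OF R]])
    have "(\<integral>x. chi m R x \<partial>\<rho> j) = (\<integral>h. chi m R (code h) \<partial>\<mu> j)" unfolding \<rho>_def by (rule integral_distr[OF code_m cm])
    also have "\<dots> \<le> (\<integral>h. min (real R) (psi m h) / real R \<partial>\<mu> j)"
    proof (rule integral_mono)
      show "integrable (\<mu> j) (\<lambda>h. chi m R (code h))"
        using measurable_compose[OF code_m cm] chi_bounds by (intro integrable_const_bound[where B = 1]) auto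
      have "(\<lambda>h. min (real R) (psi m h)) \<in> borel_measurable (\<mu> j)"
        using LipB_Bb[OF LipB_min_psi[of "real R" c m]] by (simp add: Bb_def measurable_cong_sets[OF sets refl])
      then have "integrable (\<mu> j) (\<lambda>h. min (real R) (psi m h))"
        by (intro integrable_const_bound[where B = "real R"]) (auto simp: psi_nonneg)
      then show "integrable (\<mu> j) (\<lambda>h. min (real R) (psi m h) / real R)" by simp
    qed (rule chi_code[OF R])
    also have "\<dots> \<le> C / real R" using C[OF R, of j m] by (simp add: divide_right_mono)
    finally show ?thesis .
  qed
  \<comment> \<open>The bound is inherited by the limit because \<open>chi\<close> is continuous and
    bounded.\<close>
  have chi_M0: "(\<integral>x. chi m R x \<partial>M0) \<le> C / real R" if R: "1 \<le> R" for m R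
  proof (rule LIMSEQ_le_const2[OF conv[where B = 1]])
    show "isCont (chi m R) x" for x using continuous_chi[OF R, of m] by (simp add: continuous_on_eq_continuous_at)
  qed (use chi_\<rho>[OF R] chi_bounds in auto)
  define \<nu> where "\<nu> = distr M0 (borel_Hc c) (decode c)"
  interpret M0: real_distribution M0 by (rule M0)
  have dec_m: "decode c \<in> M0 \<rightarrow>\<^sub>M borel_Hc c" using measurable_decode[of c] by (simp add: measurable_cong_sets[OF M0.events_eq_borel refl])
  have \<nu>: "prob_space \<nu>" "sets \<nu> = sets (borel_Hc c)" unfolding \<nu>_def using M0.prob_space_distr[OF dec_m] by auto
  have "(\<lambda>k. \<integral>h. \<phi> h \<partial>\<mu> (r k)) \<longlonglongrightarrow> (\<integral>h. \<phi> h \<partial>\<nu>)" if \<phi>: "LipB c \<phi>" for \<phi>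
  proof -
    obtain L where L: "0 \<le> L" "\<And>x y. x \<in> Hc c \<Longrightarrow> y \<in> Hc c \<Longrightarrow> \<bar>\<phi> x - \<phi> y\<bar> \<le> L * dist_Hc x y"
      using \<phi> unfolding LipB_def lipschitz_Hc_def by blast
    obtain K where K: "0 \<le> K" "\<And>x. x \<in> Hc c \<Longrightarrow> \<bar>\<phi> x\<bar> \<le> K" using \<phi> unfolding LipB_def by blast
    have \<phi>m: "\<phi> \<in> borel_measurable (borel_Hc c)" using LipB_Bb[OF \<phi>] by (simp add: Bb_def)
    have \<nu>i: "(\<integral>h. \<phi> h \<partial>\<nu>) = (\<integral>x. \<phi> (decode c x) \<partial>M0)" unfolding \<nu>_def by (rule integral_distr[OF dec_m \<phi>m])
    \<comment> \<open>Each given measure is carried by points of finite \<open>|.|_1\<close>, and on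
      these the decoding inverts the code.\<close>
    have \<mu>i: "(\<integral>h. \<phi> h \<partial>\<mu> j) = (\<integral>x. \<phi> (decode c x) \<partial>\<rho> j)" for j
    proof -
      interpret prob_space "\<mu> j" by (rule ps)
      interpret R: real_distribution "\<rho> j" by (rule rd)
      have pv: "Measurable.pred borel (\<lambda>x. \<exists>R. vgood R x)" by measurable
      have "measure (\<rho> j) {x. \<not> (\<exists>R. vgood R x)} \<le> C / real R" if "1 \<le> R" for R
      proof -
        have "measure (\<rho> j) {x. \<not> (\<exists>R. vgood R x)} \<le> measure (\<rho> j) {x. \<not> vgood R x}"
          using pred_vgood[of R] by (intro R.finite_measure_mono) (auto simp: pred_def)
        also have "\<dots> \<le> C / real R" by (rule measure_not_vgood[OF rd chi_\<rho>[OF that] that])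
        finally show ?thesis .
      qed
      then have "measure (\<rho> j) {x. \<not> (\<exists>R. vgood R x)} \<le> 0"
        by (intro LIMSEQ_le_const[OF lim_const_over_n[of C]]) blast
      then have "measure (\<rho> j) {x. \<not> (\<exists>R. vgood R x)} = 0" using measure_nonneg[of "\<rho> j"] by (intro antisym) auto
      moreover have "{x. \<not> (\<exists>R. vgood R x)} \<in> sets (\<rho> j)" using pv by (simp add: pred_def) measurable
      ultimately have "AE x in \<rho> j. \<exists>R. vgood R x"
        by (intro AE_I[of _ _ "{x. \<not> (\<exists>R. vgood R x)}"]) (auto simp: R.emeasure_eq_measure)
      then have ae: "AE h in \<mu> j. \<exists>R. vgood R (code h)"
        unfolding \<rho>_def using pv by (subst (asm) AE_distr_iff[OF code_m]) (auto simp: pred_def)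
      have dm: "(\<lambda>x. \<phi> (decode c x)) \<in> borel_measurable borel" by (rule measurable_compose[OF measurable_decode \<phi>m])
      have "(\<integral>x. \<phi> (decode c x) \<partial>\<rho> j) = (\<integral>h. \<phi> (decode c (code h)) \<partial>\<mu> j)"
        unfolding \<rho>_def by (rule integral_distr[OF code_m dm])
      also have "\<dots> = (\<integral>h. \<phi> h \<partial>\<mu> j)"
      proof (rule integral_cong_AE)
        show "(\<lambda>h. \<phi> (decode c (code h))) \<in> borel_measurable (\<mu> j)" by (rule measurable_compose[OF code_m dm])
        show "\<phi> \<in> borel_measurable (\<mu> j)" using \<phi>m by (simp add: measurable_cong_sets[OF sets refl])
        show "AE h in \<mu> j. \<phi> (decode c (code h)) = \<phi> h"
          using ae AE_space by eventually_elim (simp add: decode_code space)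
      qed
      finally show ?thesis by simp
    qed
    show ?thesis
    proof (rule LIMSEQ_I)
      fix e :: real assume e: "0 < e"
      have "(\<lambda>R. (L + 2 * K * C) / real R) \<longlonglongrightarrow> 0" by (rule lim_const_over_n)
      then have "\<forall>\<^sub>F R in sequentially. (L + 2 * K * C) / real R < e / 3" using e by (intro order_tendstoD) auto
      then have "\<forall>\<^sub>F R in sequentially. 1 \<le> R \<and> (L + 2 * K * C) / real R < e / 3" by (intro eventually_conj eventually_ge_at_top)
      from eventually_happens'[OF sequentially_bot this] obtain R where R: "1 \<le> R" "(L + 2 * K * C) / real R < e / 3" by blast
      have "(\<lambda>k. \<integral>x. \<phi> (trunc c R x) \<partial>\<rho> (r k)) \<longlonglongrightarrow> (\<integral>x. \<phi> (trunc c R x) \<partial>M0)"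
        using \<phi> by (intro conv[where B = K] isCont_trunc K trunc_Hc) (simp add: LipB_def)
      from LIMSEQ_D[OF this, of "e / 3"] e obtain k0 where
        k0: "\<And>k. k \<ge> k0 \<Longrightarrow> \<bar>(\<integral>x. \<phi> (trunc c R x) \<partial>\<rho> (r k)) - (\<integral>x. \<phi> (trunc c R x) \<partial>M0)\<bar> < e / 3" by auto
      show "\<exists>k0. \<forall>k\<ge>k0. norm ((\<integral>h. \<phi> h \<partial>\<mu> (r k)) - (\<integral>h. \<phi> h \<partial>\<nu>)) < e"
      proof (intro exI[of _ k0] allI impI)
        fix k assume "k0 \<le> k"
        from k0[OF this] trunc_decode_integral[OF rd chi_\<rho>[OF R(1)] R(1) L K \<phi>, of "r k"]
          trunc_decode_integral[OF M0 chi_M0[OF R(1)] R(1) L K \<phi>] R(2)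
        show "norm ((\<integral>h. \<phi> h \<partial>\<mu> (r k)) - (\<integral>h. \<phi> h \<partial>\<nu>)) < e"
          unfolding \<mu>i \<nu>i real_norm_def by linarith
      qed
    qed
  qed
  with r \<nu> show ?thesis by blast
qed

section \<open>Time averages and invariance\<close>

lemma open_indicator_approx:
  assumes U: "openin (Metric_space.mtopology (Hc c) dist_Hc) U"
  obtains \<phi> :: "nat \<Rightarrow> coefs \<Rightarrow> real" where "\<And>j. LipB c (\<phi> j)" "\<And>j x. 0 \<le> \<phi> j x" "\<And>j x. \<phi> j x \<le> 1"
    "\<And>x. x \<in> Hc c \<Longrightarrow> (\<lambda>j. \<phi> j x) \<longlonglongrightarrow> indicator U x"
proof
  interpret Metric_space "Hc c" dist_Hc by (rule Metric_space_Hc)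
  have UH: "U \<subseteq> Hc c" and Ur: "\<And>x. x \<in> U \<Longrightarrow> \<exists>r>0. \<forall>y\<in>Hc c. dist_Hc x y < r \<longrightarrow> y \<in> U" using U by (auto simp: openin_Hc_iff)
  \<comment> \<open>The inserted 1 keeps the set nonempty when \<open>U\<close> is all of
    \<open>Hc c\<close> and makes the distance to the complement bounded.\<close>
  define A where "A x = insert 1 ((\<lambda>y. dist_Hc x y) ` (Hc c - U))" for x
  define \<delta> where "\<delta> x = Inf (A x)" for x
  have bdd: "bdd_below (A x)" for x by (rule bdd_belowI[where m = 0]) (auto simp: A_def dist_Hc_nonneg)
  have le1: "\<delta> x \<le> 1" for x unfolding \<delta>_def by (rule cInf_lower[OF _ bdd]) (simp add: A_def)
  have led: "\<delta> x \<le> dist_Hc x y" if "y \<in> Hc c" "y \<notin> U" for x y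
    unfolding \<delta>_def by (rule cInf_lower[OF _ bdd]) (use that in \<open>simp add: A_def\<close>)
  have ge: "a \<le> \<delta> x" if "a \<le> 1" "\<And>y. y \<in> Hc c \<Longrightarrow> y \<notin> U \<Longrightarrow> a \<le> dist_Hc x y" for a x
    unfolding \<delta>_def by (rule cInf_greatest) (use that in \<open>auto simp: A_def\<close>)
  have ge0: "0 \<le> \<delta> x" for x by (rule ge) (auto simp: dist_Hc_nonneg)
  have lip1: "\<delta> x - dist_Hc x y \<le> \<delta> y" if xy: "x \<in> Hc c" "y \<in> Hc c" for x y
  proof (rule ge)
    show "\<delta> x - dist_Hc x y \<le> 1" using le1[of x] dist_Hc_nonneg[of x y] by linarith
    fix z assume z: "z \<in> Hc c" "z \<notin> U"
    show "\<delta> x - dist_Hc x y \<le> dist_Hc y z" using led[OF z, of x] triangle[OF xy z(1)] by linarith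
  qed
  have lip: "\<bar>\<delta> x - \<delta> y\<bar> \<le> dist_Hc x y" if xy: "x \<in> Hc c" "y \<in> Hc c" for x y
    using lip1[OF xy] lip1[OF xy(2,1)] commute[of x y] by linarith
  let ?\<phi> = "\<lambda>j x. min 1 (real j * \<delta> x)"
  show "0 \<le> ?\<phi> j x" "?\<phi> j x \<le> 1" for j x using ge0[of x] by auto
  show "LipB c (?\<phi> j)" for j
  proof -
    have "\<bar>?\<phi> j x - ?\<phi> j y\<bar> \<le> real j * dist_Hc x y" if xy: "x \<in> Hc c" "y \<in> Hc c" for x y
    proof -
    have "\<bar>?\<phi> j x - ?\<phi> j y\<bar> \<le> \<bar>real j * \<delta> x - real j * \<delta> y\<bar>" by linarith
    also have "\<dots> = real j * \<bar>\<delta> x - \<delta> y\<bar>" by (simp add: right_diff_distrib[symmetric] abs_mult)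
    also have "\<dots> \<le> real j * dist_Hc x y" by (rule mult_left_mono[OF lip[OF xy]]) simp
    finally show ?thesis .
    qed
    then have "lipschitz_Hc c (?\<phi> j)" unfolding lipschitz_Hc_def by (intro exI[of _ "real j"]) simp
    moreover have "\<bar>?\<phi> j x\<bar> \<le> 1" for x using ge0[of x] by simp
    ultimately show ?thesis unfolding LipB_def by (metis zero_le_one)
  qed
  fix x assume x: "x \<in> Hc c"
  show "(\<lambda>j. ?\<phi> j x) \<longlonglongrightarrow> indicator U x"
  proof (cases "x \<in> U")
    case True
    with Ur obtain r where r: "r > 0" "\<And>y. y \<in> Hc c \<Longrightarrow> dist_Hc x y < r \<Longrightarrow> y \<in> U" by blast
    have "min 1 r \<le> \<delta> x" by (rule ge) (use r in \<open>auto simp: min_le_iff_disj not_less[symmetric]\<close>)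
    then have d: "0 < \<delta> x" using r by simp
    obtain N :: nat where N: "1 / \<delta> x < real N" using reals_Archimedean2 by blast
    have "\<forall>\<^sub>F j in sequentially. ?\<phi> j x = 1"
      using eventually_ge_at_top[of N]
    proof eventually_elim
      case (elim j)
      have "1 \<le> real N * \<delta> x" using N d by (simp add: pos_divide_less_eq)
      also have "\<dots> \<le> real j * \<delta> x" using elim d by (intro mult_right_mono) auto
      finally show ?case by simp
    qed
    then show ?thesis using True by (simp add: tendsto_eventually)
  next
    case False
    then have "\<delta> x = 0" using led[OF x False, of x] ge0[of x] x by simp
    then show ?thesis using False by simp
  qed
qed

lemma LipB_integral_LIMSEQ_measure:
  assumes "prob_space \<nu>" and sets: "sets \<nu> = sets (borel_Hc c)"
    and \<phi>: "\<And>j. LipB c (\<phi> j)" "\<And>j x. 0 \<le> \<phi> j x" "\<And>j x. \<phi> j x \<le> 1"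
    "\<And>x. x \<in> Hc c \<Longrightarrow> (\<lambda>j. \<phi> j x) \<longlonglongrightarrow> indicator U x"
    and U: "U \<in> sets (borel_Hc c)"
  shows "(\<lambda>j. \<integral>x. \<phi> j x \<partial>\<nu>) \<longlonglongrightarrow> measure \<nu> U"
proof -
  interpret prob_space \<nu> by fact
  have sp: "space \<nu> = Hc c" using sets_eq_imp_space_eq[OF sets] by simp
  have "(\<lambda>j. \<integral>x. \<phi> j x \<partial>\<nu>) \<longlonglongrightarrow> (\<integral>x. indicator U x \<partial>\<nu>)"
  proof (rule integral_dominated_convergence[where w = "\<lambda>_. 1"])
    show "\<phi> j \<in> borel_measurable \<nu>" for j
      using LipB_Bb[OF \<phi>(1)] by (simp add: Bb_def measurable_cong_sets[OF sets refl])
    show "indicator U \<in> borel_measurable \<nu>" using U sets by simp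
  qed (use \<phi>(2,3,4) sp in auto)
  moreover have "U \<inter> space \<nu> = U" using sets.sets_into_space[OF U] sp by auto
  ultimately show ?thesis by simp
qed

text \<open>Indicators of open sets are pointwise limits of bounded Lipschitz functions, and the
  open sets form a generator stable under intersection.\<close>

lemma LipB_integral_eqD:
  assumes \<mu>: "prob_space \<mu>" "sets \<mu> = sets (borel_Hc c)" and \<nu>: "prob_space \<nu>" "sets \<nu> = sets (borel_Hc c)"
    and eq: "\<And>\<phi>. LipB c \<phi> \<Longrightarrow> (\<integral>x. \<phi> x \<partial>\<mu>) = (\<integral>x. \<phi> x \<partial>\<nu>)"
  shows "\<mu> = \<nu>"
proof (rule measure_eqI_generator_eq[where \<Omega> = "Hc c" and E = "{U. openin (Metric_space.mtopology (Hc c) dist_Hc) U}" and A = "\<lambda>_. Hc c"])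
  show "Int_stable {U. openin (Metric_space.mtopology (Hc c) dist_Hc) U}" by (auto simp: Int_stable_def)
  show "{U. openin (Metric_space.mtopology (Hc c) dist_Hc) U} \<subseteq> Pow (Hc c)" by (rule open_Hc_Pow)
  show "sets \<mu> = sigma_sets (Hc c) {U. openin (Metric_space.mtopology (Hc c) dist_Hc) U}"
    "sets \<nu> = sigma_sets (Hc c) {U. openin (Metric_space.mtopology (Hc c) dist_Hc) U}"
    using \<mu>(2) \<nu>(2) sets_borel_Hc by auto
  interpret M: prob_space \<mu> by fact
  interpret N: prob_space \<nu> by fact
  show "emeasure \<mu> (Hc c) \<noteq> \<infinity>" by simp
  show "range (\<lambda>_. Hc c) \<subseteq> {U. openin (Metric_space.mtopology (Hc c) dist_Hc) U}"
    by (auto simp: openin_Hc_iff intro: exI[of _ 1])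
  fix U assume "U \<in> {U. openin (Metric_space.mtopology (Hc c) dist_Hc) U}"
  then have U: "openin (Metric_space.mtopology (Hc c) dist_Hc) U" by simp
  then have Us: "U \<in> sets (borel_Hc c)" unfolding sets_borel_Hc by (intro sigma_sets.Basic) simp
  obtain \<phi> where \<phi>: "\<And>j. LipB c (\<phi> j)" "\<And>j x. 0 \<le> \<phi> j x" "\<And>j x. \<phi> j x \<le> 1"
    "\<And>x. x \<in> Hc c \<Longrightarrow> (\<lambda>j. \<phi> j x) \<longlonglongrightarrow> indicator U x" using open_indicator_approx[OF U] by blast
  have "measure \<mu> U = measure \<nu> U"
  proof (rule LIMSEQ_unique)
    show "(\<lambda>j. \<integral>x. \<phi> j x \<partial>\<mu>) \<longlonglongrightarrow> measure \<mu> U" by (rule LipB_integral_LIMSEQ_measure[OF \<mu> \<phi> Us])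
    show "(\<lambda>j. \<integral>x. \<phi> j x \<partial>\<mu>) \<longlonglongrightarrow> measure \<nu> U"
      using LipB_integral_LIMSEQ_measure[OF \<nu> \<phi> Us] by (simp add: eq[OF \<phi>(1)])
  qed
  then show "emeasure \<mu> U = emeasure \<nu> U" by (simp add: M.emeasure_eq_measure N.emeasure_eq_measure)
qed simp

section \<open>Time averages along an orbit\<close>

lemma integral_leb01_scale:
  fixes g :: "real \<Rightarrow> real"
  assumes T: "0 < T"
  shows "(\<integral>s. g (T * s) \<partial>leb01) = (LINT t:{0<..<T}|lborel. g t) / T"
proof -
  have "(LINT t:{0<..<T}|lborel. g t) = T * (LINT s|lborel. indicator {0<..<T} (0 + T * s) *\<^sub>R g (0 + T * s))"
    unfolding set_lebesgue_integral_def using lborel_integral_real_affine[of T "\<lambda>t. indicator {0<..<T} t *\<^sub>R g t" 0] T by simp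
  also have "(\<lambda>s. indicator {0<..<T} (0 + T * s) *\<^sub>R g (0 + T * s)) = (\<lambda>s. indicator {0<..<1} s *\<^sub>R g (T * s))"
    using T by (auto simp: indicator_def zero_less_mult_iff fun_eq_iff)
  also have "(LINT s|lborel. indicator {0<..<1} s *\<^sub>R g (T * s)) = (\<integral>s. g (T * s) \<partial>leb01)"
    unfolding leb01_def by (subst integral_restrict_space) auto
  finally show ?thesis using T by simp
qed

text \<open>The two time windows differ by two intervals of length \<open>t\<close>; dividing by
  their length \<open>T\<close> makes the difference disappear as \<open>T\<close> grows.\<close>

lemma time_average_shift:
  fixes g :: "real \<Rightarrow> real"
  assumes m: "g \<in> borel_measurable borel" and K: "\<And>u. \<bar>g u\<bar> \<le> K" and t: "0 \<le> t" and T: "0 < T"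
  shows "\<bar>(\<integral>s. g (T * s + t) \<partial>leb01) - (\<integral>s. g (T * s) \<partial>leb01)\<bar> \<le> 2 * t * K / T"
proof -
  have K0: "0 \<le> K" using K[of 0] by linarith
  have i: "integrable lborel (\<lambda>u. indicator {a<..<b} u *\<^sub>R g u)" for a b
  proof (rule Bochner_Integration.integrable_bound[where f = "\<lambda>u. K * indicator {a<..<b} u"])
    show "integrable lborel (\<lambda>u. K * indicator {a<..<b} u)" by (cases "a \<le> b") auto
  qed (use m K K0 in \<open>auto simp: indicator_def\<close>)
  have "(LINT u:{0<..<T}|lborel. g (u + t)) = (LINT u:{t<..<T + t}|lborel. g u)"
  proof -
    have "(LINT u:{t<..<T + t}|lborel. g u) = (LINT u|lborel. indicator {t<..<T + t} (t + 1 * u) *\<^sub>R g (t + 1 * u))"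
      unfolding set_lebesgue_integral_def using lborel_integral_real_affine[of 1 "\<lambda>u. indicator {t<..<T + t} u *\<^sub>R g u" t] by simp
    also have "\<dots> = (LINT u:{0<..<T}|lborel. g (u + t))"
      unfolding set_lebesgue_integral_def by (intro Bochner_Integration.integral_cong) (auto simp: indicator_def add.commute)
    finally show ?thesis ..
  qed
  then have "(\<integral>s. g (T * s + t) \<partial>leb01) - (\<integral>s. g (T * s) \<partial>leb01)
      = ((LINT u:{t<..<T + t}|lborel. g u) - (LINT u:{0<..<T}|lborel. g u)) / T"
    using integral_leb01_scale[OF T, of "\<lambda>u. g (u + t)"] integral_leb01_scale[OF T, of g] by (simp add: diff_divide_distrib)
  moreover have "\<bar>(LINT u:{t<..<T + t}|lborel. g u) - (LINT u:{0<..<T}|lborel. g u)\<bar> \<le> 2 * t * K"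
  proof -
    have "\<bar>(LINT u:{t<..<T + t}|lborel. g u) - (LINT u:{0<..<T}|lborel. g u)\<bar>
      = \<bar>LINT u|lborel. indicator {t<..<T + t} u *\<^sub>R g u - indicator {0<..<T} u *\<^sub>R g u\<bar>"
      unfolding set_lebesgue_integral_def using i by simp
    also have "\<dots> \<le> (LINT u|lborel. \<bar>indicator {t<..<T + t} u *\<^sub>R g u - indicator {0<..<T} u *\<^sub>R g u\<bar>)"
      by (rule integral_abs_bound)
    also have "\<dots> \<le> (LINT u|lborel. K * indicator {0..t} u + K * indicator {T..T + t} u)"
    proof (rule integral_mono)
      show "integrable lborel (\<lambda>u. \<bar>indicator {t<..<T + t} u *\<^sub>R g u - indicator {0<..<T} u *\<^sub>R g u\<bar>)"
        using i by (intro integrable_abs Bochner_Integration.integrable_diff)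
      show "integrable lborel (\<lambda>u. K * indicator {0..t} u + K * indicator {T..T + t} u)" using t by simp
      fix u
      show "\<bar>indicator {t<..<T + t} u *\<^sub>R g u - indicator {0<..<T} u *\<^sub>R g u\<bar> \<le> K * indicator {0..t} u + K * indicator {T..T + t} u"
        using K[of u] K0 t by (auto simp: indicator_def)
    qed
    also have "\<dots> = 2 * t * K" using t by simp
    finally show ?thesis .
  qed
  ultimately show ?thesis using T by (simp add: divide_right_mono)
qed

text \<open>Weak convergence can be applied to \<open>\<phi>\<close> and to
  \<open>P t \<phi>\<close> alike if \<open>\<phi>\<close> is bounded and Lipschitz, which gives
  invariance on this class. The image of \<open>\<nu>\<close> under the kernel is then a measure
  with the same integrals as \<open>\<nu>\<close>, hence equal to it, and invariance follows for all
  bounded Borel functions.\<close>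

theorem krylov_bogoliubov:
  assumes P: "transition_semigroup c P" and x0: "x0 \<in> Hc c"
    and feller: "\<And>\<phi> t. LipB c \<phi> \<Longrightarrow> 0 \<le> t \<Longrightarrow> LipB c (P t \<phi>)"
    and time_measurable: "\<And>\<phi>. LipB c \<phi> \<Longrightarrow> (\<lambda>t. P (max 0 t) \<phi> x0) \<in> borel_measurable borel"
    and bound: "\<And>m R T. 1 \<le> R \<Longrightarrow> 0 < T \<Longrightarrow> (LINT t:{0<..T}|lborel. P t (\<lambda>h. min (real R) (psi m h)) x0) \<le> T * C"
  shows "\<exists>\<nu>. invariant_measure c P \<nu>"
proof -
  from P[unfolded transition_semigroup_def, THEN conjunct1] obtain \<kappa> where
    \<kappa>_all: "\<forall>t\<ge>0. \<kappa> t \<in> borel_Hc c \<rightarrow>\<^sub>M prob_algebra (borel_Hc c) \<and>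
        (\<forall>\<phi>\<in>Bb c. \<forall>x\<in>Hc c. P t \<phi> x = (LINT y|\<kappa> t x. \<phi> y))" ..
  have \<kappa>: "\<kappa> t \<in> borel_Hc c \<rightarrow>\<^sub>M prob_algebra (borel_Hc c)"
    and P\<kappa>: "\<phi> \<in> Bb c \<Longrightarrow> x \<in> Hc c \<Longrightarrow> P t \<phi> x = (\<integral>y. \<phi> y \<partial>\<kappa> t x)" if "0 \<le> t" for t \<phi> x
    using \<kappa>_all that by simp_all
  have P_add: "P (s + t) \<phi> x = P s (P t \<phi>) x" if "0 \<le> s" "0 \<le> t" "\<phi> \<in> Bb c" "x \<in> Hc c" for s t \<phi> x
    using P[unfolded transition_semigroup_def, THEN conjunct2, THEN conjunct2] that by simp
  have \<kappa>p: "prob_space (\<kappa> t x)" "sets (\<kappa> t x) = sets (borel_Hc c)" if "0 \<le> t" "x \<in> Hc c" for t x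
    using measurable_space[OF \<kappa>[OF that(1)], of x] that(2) by (auto simp: space_prob_algebra)
  \<comment> \<open>The extension to negative times by the value at 0 allows measurability to be
    stated on the whole line.\<close>
  define k where "k t = \<kappa> (max 0 t) x0" for t
  have kp: "prob_space (k t)" "sets (k t) = sets (borel_Hc c)" for t unfolding k_def using \<kappa>p[of "max 0 t" x0] x0 by auto
  have k_int: "(\<integral>y. \<phi> y \<partial>k t) = P (max 0 t) \<phi> x0" if "\<phi> \<in> Bb c" for \<phi> t
    unfolding k_def using P\<kappa>[of "max 0 t" \<phi> x0] that x0 by simp
  \<comment> \<open>A measurable kernel in time is required in order to form averages of measures
    with \<open>bind\<close>. It suffices to test open sets, whose probabilities are limits of
    integrals of Lipschitz functions.\<close>
  have km: "k \<in> borel \<rightarrow>\<^sub>M prob_algebra (borel_Hc c)"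
  proof (rule measurable_prob_algebra_generated[OF sets_borel_Hc])
    fix U assume "U \<in> {U. openin (Metric_space.mtopology (Hc c) dist_Hc) U}"
    then have U: "openin (Metric_space.mtopology (Hc c) dist_Hc) U" by simp
    then have Us: "U \<in> sets (borel_Hc c)" unfolding sets_borel_Hc by (intro sigma_sets.Basic) simp
    obtain \<phi> where \<phi>: "\<And>j. LipB c (\<phi> j)" "\<And>j x. 0 \<le> \<phi> j x" "\<And>j x. \<phi> j x \<le> 1"
      "\<And>x. x \<in> Hc c \<Longrightarrow> (\<lambda>j. \<phi> j x) \<longlonglongrightarrow> indicator U x" using open_indicator_approx[OF U] by blast
    have "(\<lambda>t. measure (k t) U) \<in> borel_measurable borel"
    proof (rule borel_measurable_LIMSEQ_real)
      show "(\<lambda>j. \<integral>y. \<phi> j y \<partial>k t) \<longlonglongrightarrow> measure (k t) U" for t by (rule LipB_integral_LIMSEQ_measure[OF kp \<phi> Us])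
      show "(\<lambda>t. \<integral>y. \<phi> j y \<partial>k t) \<in> borel_measurable borel" for j
        using time_measurable[OF \<phi>(1)] by (simp add: k_int[OF LipB_Bb[OF \<phi>(1)]])
    qed
    moreover have "emeasure (k t) U = ennreal (measure (k t) U)" for t
    proof -
      interpret prob_space "k t" by (rule kp)
      show ?thesis by (rule emeasure_eq_measure)
    qed
    ultimately show "(\<lambda>t. emeasure (k t) U) \<in> borel_measurable borel" by simp
  qed (use kp open_Hc_Pow in \<open>auto simp: Int_stable_def\<close>)
  \<comment> \<open>The average of the laws over the interval of length \<open>j + 1\<close>, as the
    law at a uniformly distributed time.\<close>
  define \<mu> where "\<mu> j = leb01 \<bind> (\<lambda>s. k ((real j + 1) * s))" for j :: nat
  have kj: "(\<lambda>s. k ((real j + 1) * s)) \<in> leb01 \<rightarrow>\<^sub>M prob_algebra (borel_Hc c)" for j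
    by (rule measurable_compose[OF _ km]) measurable
  have leb: "leb01 \<in> space (prob_algebra leb01)" by (simp add: space_prob_algebra prob_space_leb01)
  have \<mu>p: "prob_space (\<mu> j)" "sets (\<mu> j) = sets (borel_Hc c)" for j
    unfolding \<mu>_def by (rule prob_space_bind'[OF leb kj], rule sets_bind'[OF leb kj])
  have bind: "(\<integral>y. \<phi> y \<partial>(N \<bind> q)) = (\<integral>s. (\<integral>y. \<phi> y \<partial>q s) \<partial>N)"
    if "\<phi> \<in> Bb c" "prob_space N" "q \<in> N \<rightarrow>\<^sub>M prob_algebra (borel_Hc c)" for \<phi> q and N :: "'x measure"
  proof -
    interpret N: prob_space N by fact
    have "bounded (\<phi> ` Hc c)" using that(1) by (simp add: Bb_def)
    then obtain K where K: "\<And>x. x \<in> Hc c \<Longrightarrow> \<bar>\<phi> x\<bar> \<le> K" by (auto simp: bounded_iff)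
    show ?thesis
    proof (rule integral_bind[where K = "borel_Hc c" and B = K and B' = 1])
      show "\<phi> \<in> borel_measurable (borel_Hc c)" using that by (simp add: Bb_def)
      show "q \<in> N \<rightarrow>\<^sub>M subprob_algebra (borel_Hc c)" by (rule measurable_prob_algebraD[OF that(3)])
      show "finite_measure N" by (rule N.finite_measure_axioms)
      show "AE x in N. emeasure (q x) (space (q x)) \<le> ennreal 1"
      proof (rule AE_I2)
        fix x assume "x \<in> space N"
        then have "prob_space (q x)" using measurable_space[OF that(3)] by (simp add: space_prob_algebra)
        then show "emeasure (q x) (space (q x)) \<le> ennreal 1" by (simp add: prob_space.emeasure_space_1)
      qed
    qed (use K in simp)
  qed
  have \<mu>_int: "(\<integral>y. \<phi> y \<partial>\<mu> j) = (\<integral>s. P (max 0 ((real j + 1) * s)) \<phi> x0 \<partial>leb01)" if "\<phi> \<in> Bb c" for \<phi> j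
    unfolding \<mu>_def by (simp add: bind[OF that prob_space_leb01 kj] k_int[OF that])
  have \<mu>_bound: "(\<integral>h. min (real R) (psi m h) \<partial>\<mu> j) \<le> C" if R: "1 \<le> R" for R m j
  proof -
    let ?\<phi> = "\<lambda>h. min (real R) (psi m h)" and ?T = "real j + 1"
    have T: "0 < ?T" by simp
    have "(\<integral>h. ?\<phi> h \<partial>\<mu> j) = (LINT t:{0<..<?T}|lborel. P (max 0 t) ?\<phi> x0) / ?T"
      unfolding \<mu>_int[OF LipB_Bb[OF LipB_min_psi[of "real R"], OF of_nat_0_le_iff]]
      by (rule integral_leb01_scale[OF T, of "\<lambda>t. P (max 0 t) ?\<phi> x0"])
    also have "(LINT t:{0<..<?T}|lborel. P (max 0 t) ?\<phi> x0) = (LINT t:{0<..?T}|lborel. P (max 0 t) ?\<phi> x0)"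
      using time_measurable[OF LipB_min_psi[of "real R" c m]] unfolding set_lebesgue_integral_def
      by (intro integral_cong_AE AE_I[where N = "{?T}"]) (auto simp: indicator_def)
    also have "\<dots> = (LINT t:{0<..?T}|lborel. P t ?\<phi> x0)"
      unfolding set_lebesgue_integral_def by (intro Bochner_Integration.integral_cong) (auto simp: indicator_def max_def)
    finally show ?thesis using bound[OF R T, of m] by (simp add: pos_divide_le_eq mult.commute)
  qed
  from weak_compactness[of \<mu> c C, OF \<mu>p \<mu>_bound] obtain \<nu> r where r: "strict_mono r"
    and \<nu>: "prob_space \<nu>" "sets \<nu> = sets (borel_Hc c)"
    and lim: "\<And>\<phi>. LipB c \<phi> \<Longrightarrow> (\<lambda>i. \<integral>h. \<phi> h \<partial>\<mu> (r i)) \<longlonglongrightarrow> (\<integral>h. \<phi> h \<partial>\<nu>)" by blast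
  have inv: "(\<integral>x. P t \<phi> x \<partial>\<nu>) = (\<integral>x. \<phi> x \<partial>\<nu>)" if \<phi>: "LipB c \<phi>" and t: "0 \<le> t" for \<phi> t
  proof -
    have \<phi>B: "\<phi> \<in> Bb c" "P t \<phi> \<in> Bb c" using LipB_Bb[OF \<phi>] LipB_Bb[OF feller[OF \<phi> t]] .
    obtain K where K: "0 \<le> K" "\<And>x. x \<in> Hc c \<Longrightarrow> \<bar>\<phi> x\<bar> \<le> K" using \<phi> unfolding LipB_def by blast
    let ?g = "\<lambda>u. P (max 0 u) \<phi> x0"
    have gK: "\<bar>?g u\<bar> \<le> K" for u
    proof -
      interpret prob_space "k u" by (rule kp)
      have sp: "space (k u) = Hc c" using sets_eq_imp_space_eq[OF kp(2)[of u]] by simp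
      have "\<bar>\<integral>y. \<phi> y \<partial>k u\<bar> \<le> (\<integral>y. \<bar>\<phi> y\<bar> \<partial>k u)" by (rule integral_abs_bound)
      also have "\<dots> \<le> (\<integral>y. K \<partial>k u)"
      proof (rule integral_mono)
        have "\<phi> \<in> borel_measurable (k u)" using \<phi>B(1) by (simp add: Bb_def measurable_cong_sets[OF kp(2) refl])
        then show "integrable (k u) (\<lambda>y. \<bar>\<phi> y\<bar>)" using K sp by (intro integrable_const_bound[where B = K]) auto
      qed (use K sp in auto)
      finally show ?thesis by (simp add: k_int[OF \<phi>B(1)] prob_space)
    qed
    have diff: "\<bar>(\<integral>x. P t \<phi> x \<partial>\<mu> j) - (\<integral>x. \<phi> x \<partial>\<mu> j)\<bar> \<le> 2 * t * K / (real j + 1)" for j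
    proof -
      have "(\<integral>x. P t \<phi> x \<partial>\<mu> j) = (\<integral>s. ?g ((real j + 1) * s + t) \<partial>leb01)"
        unfolding \<mu>_int[OF \<phi>B(2)]
      proof (rule Bochner_Integration.integral_cong)
        fix s assume "s \<in> space leb01"
        then have s: "0 \<le> (real j + 1) * s" by (simp add: leb01_def space_restrict_space)
        then show "P (max 0 ((real j + 1) * s)) (P t \<phi>) x0 = ?g ((real j + 1) * s + t)"
          using P_add[OF s t \<phi>B(1) x0] t by (simp add: max_def)
      qed simp
      moreover have "0 < real j + 1" by simp
      ultimately show ?thesis unfolding \<mu>_int[OF \<phi>B(1)] using time_average_shift[OF time_measurable[OF \<phi>] gK t, of "real j + 1"] by simp
    qed
    have "(\<lambda>j. 2 * t * K / (real j + 1)) \<longlonglongrightarrow> 0" by real_asymp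
    then have "(\<lambda>j. (\<integral>x. P t \<phi> x \<partial>\<mu> j) - (\<integral>x. \<phi> x \<partial>\<mu> j)) \<longlonglongrightarrow> 0"
      by (rule Lim_null_comparison[rotated]) (use diff in simp)
    from LIMSEQ_subseq_LIMSEQ[OF this r] have "(\<lambda>i. (\<integral>x. P t \<phi> x \<partial>\<mu> (r i)) - (\<integral>x. \<phi> x \<partial>\<mu> (r i))) \<longlonglongrightarrow> 0"
      by (simp add: comp_def)
    moreover have "(\<lambda>i. (\<integral>x. P t \<phi> x \<partial>\<mu> (r i)) - (\<integral>x. \<phi> x \<partial>\<mu> (r i))) \<longlonglongrightarrow> (\<integral>x. P t \<phi> x \<partial>\<nu>) - (\<integral>x. \<phi> x \<partial>\<nu>)"
      by (intro tendsto_diff lim feller \<phi> t)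
    ultimately have "(\<integral>x. P t \<phi> x \<partial>\<nu>) - (\<integral>x. \<phi> x \<partial>\<nu>) = 0" by (rule LIMSEQ_unique[rotated])
    then show ?thesis by simp
  qed
  have sp: "space \<nu> = Hc c" using sets_eq_imp_space_eq[OF \<nu>(2)] by simp
  have "invariant_measure c P \<nu>"
    unfolding invariant_measure_def
  proof (intro conjI \<nu> allI impI ballI)
    fix t :: real and \<phi> assume t: "0 \<le> t" and \<phi>: "\<phi> \<in> Bb c"
    have \<kappa>\<nu>: "\<kappa> t \<in> \<nu> \<rightarrow>\<^sub>M prob_algebra (borel_Hc c)" using \<kappa>[OF t] by (simp add: measurable_cong_sets[OF \<nu>(2) refl])
    have \<nu>a: "\<nu> \<in> space (prob_algebra \<nu>)" using \<nu> by (simp add: space_prob_algebra)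
    have push: "(\<integral>y. f y \<partial>(\<nu> \<bind> \<kappa> t)) = (\<integral>x. P t f x \<partial>\<nu>)" if "f \<in> Bb c" for f
      unfolding bind[OF that \<nu>(1) \<kappa>\<nu>] using P\<kappa>[OF t that] sp by (intro Bochner_Integration.integral_cong) auto
    have "\<nu> \<bind> \<kappa> t = \<nu>"
    proof (rule LipB_integral_eqD[OF _ _ \<nu>])
      show "prob_space (\<nu> \<bind> \<kappa> t)" by (rule prob_space_bind'[OF \<nu>a \<kappa>\<nu>])
      show "sets (\<nu> \<bind> \<kappa> t) = sets (borel_Hc c)" by (rule sets_bind'[OF \<nu>a \<kappa>\<nu>])
      show "(\<integral>x. f x \<partial>(\<nu> \<bind> \<kappa> t)) = (\<integral>x. f x \<partial>\<nu>)" if "LipB c f" for f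
        unfolding push[OF LipB_Bb[OF that]] by (rule inv[OF that t])
    qed
    then show "(\<integral>x. P t \<phi> x \<partial>\<nu>) = (\<integral>x. \<phi> x \<partial>\<nu>)" using push[OF \<phi>] by simp
  qed
  then show ?thesis by blast
qed

section \<open>The covariance operator in coordinates\<close>

lemma L2_iff_summable: "h \<in> L2 \<longleftrightarrow> summable (\<lambda>i. (h i)\<^sup>2)"
proof -
  have "h \<in> L2 \<longleftrightarrow> (\<lambda>i. (h i)\<^sup>2) summable_on {1..}"
    unfolding V_def mem_Collect_eq by (rule summable_on_cong) (simp add: eigval_def)
  also have "\<dots> \<longleftrightarrow> (\<lambda>i. (h i)\<^sup>2) summable_on insert 0 {1..}" by (simp add: summable_on_insert_iff)
  also have "insert 0 {1..} = (UNIV :: nat set)" by auto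
  finally show ?thesis by (simp add: summable_on_UNIV_nonneg_real_iff)
qed

lemma basis_L2: "basis j \<in> L2"
  unfolding L2_iff_summable by (rule summable_finite[of "{j}"]) (auto simp: basis_def)

lemma innerL2_commute: "innerL2 h k = innerL2 k h"
  by (simp add: innerL2_def mult.commute)

lemma innerL2_basis: "innerL2 h (basis j) = h j"
proof -
  have "innerL2 h (basis j) = (\<Sum>\<^sub>\<infinity>i\<in>{j}. h i)"
    unfolding innerL2_def by (rule infsum_cong_neutral) (auto simp: basis_def)
  then show ?thesis by simp
qed

text \<open>Self-adjointness makes the matrix of \<open>S\<close> symmetric: the vanishing image of
  \<open>basis 0\<close> removes the noise from mode 0, and square-summable rows become
  square-summable columns. The diagonal terms of the trace are the sums over \<open>i\<close> of
  squared entries divided by \<open>mu i\<close>, so an exchange of sums gives the last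
  bound.\<close>

lemma sqrt_op_noise:
  assumes S: "nonneg_selfadjoint S" and tr: "finite_trace (- 1) S" and S0: "S (basis 0) = (\<lambda>_. 0)"
  shows "S (basis k) 0 = 0" "summable (\<lambda>k. (S (basis k) i)\<^sup>2)"
    "(\<Sum>i=1..N. (\<Sum>k. (S (basis k) i)\<^sup>2) / mu i) \<le> (\<Sum>k. innerL2 (S (negA_pow (- 1) (S (basis k)))) (basis k))"
proof -
  have SL: "S h \<in> L2" if "h \<in> L2" for h using S that by (simp add: nonneg_selfadjoint_def)
  have sa: "innerL2 (S h) k = innerL2 h (S k)" if "h \<in> L2" "k \<in> L2" for h k
    using S that by (simp add: nonneg_selfadjoint_def)
  have sym: "S (basis k) i = S (basis i) k" for i k
    using sa[OF basis_L2 basis_L2, of k i] innerL2_commute[of "basis k" "S (basis i)"] by (simp add: innerL2_basis)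
  show "S (basis k) 0 = 0" using sym[of k 0] S0 by simp
  show sq: "summable (\<lambda>k. (S (basis k) i)\<^sup>2)" for i
    using SL[OF basis_L2[of i]] by (simp add: sym[of _ i] L2_iff_summable)
  define d where "d k = innerL2 (S (negA_pow (- 1) (S (basis k)))) (basis k)" for k
  have d_ge: "(\<Sum>i=1..N. (S (basis k) i)\<^sup>2 / mu i) \<le> d k" for k N
  proof -
    let ?h = "S (basis k)"
    have h: "summable (\<lambda>i. (?h i)\<^sup>2)" using SL[OF basis_L2[of k]] by (simp add: L2_iff_summable)
    have n: "negA_pow (- 1) ?h i = (if i = 0 then 0 else ?h i / mu i)" for i
      by (simp add: negA_pow_def eigval_mu mu_nonneg powr_minus inverse_eq_divide)
    have le1: "y / mu i \<le> y" if "i \<noteq> 0" "0 \<le> y" for i y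
      using divide_left_mono[of 1 "mu i" y] mu_ge_1[of i] mu_pos[of i] that by simp
    have "negA_pow (- 1) ?h \<in> L2"
      unfolding L2_iff_summable
    proof (rule summable_comparison_test'[OF h])
      fix i :: nat assume "0 \<le> i"
      show "norm ((negA_pow (- 1) ?h i)\<^sup>2) \<le> (?h i)\<^sup>2"
      proof (cases "i = 0")
        case False
        then have "\<bar>?h i / mu i\<bar> \<le> \<bar>?h i\<bar>" using le1[OF False, of "\<bar>?h i\<bar>"] mu_pos[of i] by simp
        then have "(?h i / mu i)\<^sup>2 \<le> (?h i)\<^sup>2" by (simp only: abs_le_square_iff)
        then show ?thesis using False by (simp add: n)
      qed (simp add: n)
    qed
    then have "d k = innerL2 (negA_pow (- 1) ?h) ?h" unfolding d_def by (rule sa[OF _ basis_L2])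
    also have "\<dots> = (\<Sum>\<^sub>\<infinity>i. if i = 0 then 0 else (?h i)\<^sup>2 / mu i)"
      unfolding innerL2_def by (rule infsum_cong) (simp add: n power2_eq_square)
    finally have dk: "d k = (\<Sum>\<^sub>\<infinity>i. if i = 0 then 0 else (?h i)\<^sup>2 / mu i)" .
    have "summable (\<lambda>i. if i = 0 then 0 else (?h i)\<^sup>2 / mu i)"
      by (rule summable_comparison_test'[OF h, of 0]) (simp add: le1 mu_nonneg)
    then have "(\<lambda>i. if i = 0 then 0 else (?h i)\<^sup>2 / mu i) summable_on UNIV"
      by (subst summable_on_UNIV_nonneg_real_iff) (simp_all add: mu_nonneg)
    then have "(\<Sum>i=1..N. if i = 0 then 0 else (?h i)\<^sup>2 / mu i) \<le> d k"
      unfolding dk by (rule finite_sum_le_infsum) (auto simp: mu_nonneg)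
    moreover have "(\<Sum>i=1..N. if i = 0 then 0 else (?h i)\<^sup>2 / mu i) = (\<Sum>i=1..N. (?h i)\<^sup>2 / mu i)"
      by (intro sum.cong) auto
    ultimately show ?thesis by simp
  qed
  have "0 \<le> d k" for k using d_ge[where N = 0] by simp
  moreover have "d summable_on UNIV" using tr by (simp add: finite_trace_def d_def[abs_def])
  ultimately have ds: "summable d" by (simp add: summable_on_UNIV_nonneg_real_iff)
  have "(\<Sum>i=1..N. (\<Sum>k. (S (basis k) i)\<^sup>2) / mu i) = (\<Sum>k. \<Sum>i=1..N. (S (basis k) i)\<^sup>2 / mu i)"
    by (subst suminf_sum) (auto intro!: summable_divide sq sum.cong simp: suminf_divide[OF sq])
  also have "\<dots> \<le> (\<Sum>k. d k)" by (intro suminf_le d_ge summable_sum summable_divide sq ds)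
  finally show "(\<Sum>i=1..N. (\<Sum>k. (S (basis k) i)\<^sup>2) / mu i) \<le> (\<Sum>k. innerL2 (S (negA_pow (- 1) (S (basis k)))) (basis k))"
    by (simp add: d_def)
qed

theorem theorem3p1:
  fixes M :: "'w measure"
    and \<beta> :: "nat \<Rightarrow> real \<Rightarrow> 'w \<Rightarrow> real"
    and B S :: "coefs \<Rightarrow> coefs"
    and lam c :: real
    and X :: "nat \<Rightarrow> coefs \<Rightarrow> real \<Rightarrow> 'w \<Rightarrow> coefs"
    and nk :: "nat \<Rightarrow> nat"
    and P :: "real \<Rightarrow> (coefs \<Rightarrow> real) \<Rightarrow> coefs \<Rightarrow> real"
  assumes "prob_space M"
    and "cylindrical_Wiener M \<beta>"
    and "nonneg_selfadjoint B" and "is_sqrt_op S B"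
    and "S (basis 0) = (\<lambda>_. 0)"
    and "finite_trace (- 1) S"
    and "\<And>n x. x \<in> H \<Longrightarrow> CH_unique_solution M \<beta> S lam n x (X n x)"
    and "- 1 < c" and "c < 1"
    and "strict_mono nk"
    and "transition_semigroup c P"
    and "\<And>\<phi> x t. \<phi> \<in> Bb c \<Longrightarrow> x \<in> Hc c \<Longrightarrow> 0 \<le> t \<Longrightarrow>
           (\<lambda>k. approx_semigroup M (X (nk k)) c t \<phi> x) \<longlonglongrightarrow> P t \<phi> x"
  shows "\<exists>\<nu>. invariant_measure c P \<nu>"
proof -
  have S: "nonneg_selfadjoint S" using assms(4) by (simp add: is_sqrt_op_def)
  define Tr where "Tr = (\<Sum>k. innerL2 (S (negA_pow (- 1) (S (basis k)))) (basis k))"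
  note noise_facts = sqrt_op_noise[OF S assms(6,5)]
  have sol: "CH_solution M \<beta> S lam n x (X n x)" if "x \<in> Hc c" for n x
    using assms(7)[OF Hc_H[OF that]] by (simp add: CH_unique_solution_def)
  have family: "CH_family M \<beta> S Tr lam c n (X n)" for n
  proof -
    \<comment> \<open>The solution concept contains the convergence of the noise series. Any
      solution provides it, here the one with \<open>n = 0\<close> from the constant initial
      value.\<close>
    have conv: "AE \<omega> in M. \<forall>i. summable (\<lambda>k. \<beta> k t \<omega> * S (basis k) i)" if t: "0 \<le> t" for t
    proof -
      from sol[OF flat_Hc, of 0] obtain u where
        "AE \<omega> in M. \<forall>i. (\<lambda>k. \<beta> k t \<omega> * S (basis k) i) sums CH_lhs lam 0 (flat c) (\<lambda>t. X 0 (flat c) t \<omega>) (u \<omega>) t i"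
        unfolding CH_solution_def using t by auto
      then show ?thesis by eventually_elim (auto simp: sums_iff)
    qed
    show ?thesis
      unfolding CH_family_def CH_family_axioms_def CH_noise_def CH_noise_axioms_def noise_def noise_axioms_def Tr_def
      using assms(1,2) noise_facts conv sol by simp
  qed
  have lim: "(\<lambda>k. approx_semigroup M (X (nk k)) c t \<phi> x) \<longlonglongrightarrow> P t \<phi> x" if "LipB c \<phi>" "x \<in> Hc c" "0 \<le> t" for t \<phi> x
    by (rule assms(12)[OF LipB_Bb[OF that(1)] that(2,3)])
  have P_bound: "\<bar>P t \<phi> x\<bar> \<le> K"
    if "LipB c \<phi>" "x \<in> Hc c" "0 \<le> t" "0 \<le> K" "\<And>x. x \<in> Hc c \<Longrightarrow> \<bar>\<phi> x\<bar> \<le> K" for t \<phi> x K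
    by (rule LIMSEQ_le_const2[OF tendsto_rabs[OF lim[OF that(1-3)]]])
      (use CH_family.approx_bound[OF family that(2,3,1,4,5)] in blast)
  show ?thesis
  proof (rule krylov_bogoliubov[OF assms(11) flat_Hc, of "1 + C0 lam c + Tr"])
    fix \<phi> and t :: real assume \<phi>: "LipB c \<phi>" and t: "0 \<le> t"
    obtain K where K: "0 \<le> K" "\<And>x. x \<in> Hc c \<Longrightarrow> \<bar>\<phi> x\<bar> \<le> K" using \<phi> unfolding LipB_def by blast
    obtain L where L: "0 \<le> L" "\<And>x y. x \<in> Hc c \<Longrightarrow> y \<in> Hc c \<Longrightarrow> \<bar>\<phi> x - \<phi> y\<bar> \<le> L * dist_Hc x y"
      using \<phi> unfolding LipB_def lipschitz_Hc_def by blast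
    have Lip: "\<bar>P t \<phi> x - P t \<phi> y\<bar> \<le> L * exp (lam\<^sup>2 / 4 * t) * dist_Hc x y" if xy: "x \<in> Hc c" "y \<in> Hc c" for x y
    \<comment> \<open>\<open>approx_feller\<close> works with grids on an interval of positive
      length; at time 0 the semigroup is the identity.\<close>
    proof (cases "t = 0")
      case True
      have "P 0 \<phi> x = \<phi> x" if "x \<in> Hc c" for x using assms(11) LipB_Bb[OF \<phi>] that by (simp add: transition_semigroup_def)
      then show ?thesis using True L(2) xy by simp
    next
      case False
      then have "0 < t" using t by simp
      show ?thesis
        by (rule LIMSEQ_le_const2[OF tendsto_rabs[OF tendsto_diff[OF lim[OF \<phi> xy(1) t] lim[OF \<phi> xy(2) t]]]])
          (use CH_family.approx_feller[OF family xy \<open>0 < t\<close> \<phi> L] in \<open>auto simp: mult.assoc\<close>)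
    qed
    then have "lipschitz_Hc c (P t \<phi>)"
      unfolding lipschitz_Hc_def using L(1) by (intro exI[of _ "L * exp (lam\<^sup>2 / 4 * t)"]) simp
    then show "LipB c (P t \<phi>)" unfolding LipB_def using K(1) P_bound[OF \<phi> _ t K] by blast
  next
    fix \<phi> assume \<phi>: "LipB c \<phi>"
    show "(\<lambda>t. P (max 0 t) \<phi> (flat c)) \<in> borel_measurable borel"
    proof (rule borel_measurable_LIMSEQ_real)
      show "(\<lambda>k. approx_semigroup M (X (nk k)) c (max 0 t) \<phi> (flat c)) \<longlonglongrightarrow> P (max 0 t) \<phi> (flat c)" for t
        by (rule lim[OF \<phi> flat_Hc]) simp
      show "(\<lambda>t. approx_semigroup M (X (nk k)) c (max 0 t) \<phi> (flat c)) \<in> borel_measurable borel" for k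
        by (intro borel_measurable_continuous_onI continuous_on_compose2[OF CH_family.approx_continuous[OF family flat_Hc \<phi>]] continuous_intros) auto
    qed
  next
    fix m R :: nat and T :: real assume R: "1 \<le> R" and T: "0 < T"
    let ?\<phi> = "\<lambda>h. min (real R) (psi m h)"
    have \<phi>: "LipB c ?\<phi>" by (rule LipB_min_psi) simp
    have R\<phi>: "\<bar>?\<phi> h\<bar> \<le> real R" for h by (simp add: psi_nonneg)
    let ?a = "\<lambda>k t. approx_semigroup M (X (nk k)) c (max 0 t) ?\<phi> (flat c)"
    have am: "?a k \<in> borel_measurable borel" for k
      by (intro borel_measurable_continuous_onI continuous_on_compose2[OF CH_family.approx_continuous[OF family flat_Hc \<phi>]] continuous_intros) auto
    have "(\<lambda>k. LINT t:{0<..T}|lborel. ?a k t) \<longlonglongrightarrow> (LINT t:{0<..T}|lborel. P (max 0 t) ?\<phi> (flat c))"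
      unfolding set_lebesgue_integral_def
    proof (rule integral_dominated_convergence[where w = "\<lambda>t. indicator {0<..T} t * real R"])
      have al: "(\<lambda>k. ?a k t) \<longlonglongrightarrow> P (max 0 t) ?\<phi> (flat c)" for t by (rule lim[OF \<phi> flat_Hc]) simp
      show "AE t in lborel. (\<lambda>k. indicator {0<..T} t *\<^sub>R ?a k t) \<longlonglongrightarrow> indicator {0<..T} t *\<^sub>R P (max 0 t) ?\<phi> (flat c)"
        by (intro AE_I2 tendsto_scaleR tendsto_const al)
      show "(\<lambda>t. indicator {0<..T} t *\<^sub>R P (max 0 t) ?\<phi> (flat c)) \<in> borel_measurable lborel"
        using borel_measurable_LIMSEQ_real[OF al am] by simp
      show "(\<lambda>t. indicator {0<..T} t *\<^sub>R ?a k t) \<in> borel_measurable lborel" for k using am by simp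
      show "integrable lborel (\<lambda>t. indicator {0<..T} t * real R)" using T by simp
      show "AE t in lborel. norm (indicator {0<..T} t *\<^sub>R ?a k t) \<le> indicator {0<..T} t * real R" for k
        using CH_family.approx_bound[OF family flat_Hc _ \<phi> of_nat_0_le_iff R\<phi>]
        by (intro AE_I2) (auto simp: indicator_def)
    qed
    moreover have "(LINT t:{0<..T}|lborel. f (max 0 t)) = (LINT t:{0<..T}|lborel. f t)" for f :: "real \<Rightarrow> real"
      unfolding set_lebesgue_integral_def by (intro Bochner_Integration.integral_cong) (auto simp: indicator_def max_def)
    note drop = this
    ultimately have "(\<lambda>k. LINT t:{0<..T}|lborel. approx_semigroup M (X (nk k)) c t ?\<phi> (flat c)) \<longlonglongrightarrow> (LINT t:{0<..T}|lborel. P t ?\<phi> (flat c))"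
      by (simp only: drop[of "\<lambda>t. P t ?\<phi> (flat c)"] drop[of "\<lambda>t. approx_semigroup M (X (nk k)) c t ?\<phi> (flat c)" for k])
    then show "(LINT t:{0<..T}|lborel. P t ?\<phi> (flat c)) \<le> T * (1 + C0 lam c + Tr)"
    proof (rule LIMSEQ_le_const2, intro exI[of _ 1] allI impI)
      fix k :: nat assume "1 \<le> k"
      \<comment> \<open>The uniform coercivity starts at \<open>n = 1\<close>; a strictly increasing
        subsequence has reached it from index 1 on.\<close>
      then have "1 \<le> nk k" using seq_suble[OF assms(10), of k] by simp
      then show "(LINT t:{0<..T}|lborel. approx_semigroup M (X (nk k)) c t ?\<phi> (flat c)) \<le> T * (1 + C0 lam c + Tr)"
        using assms(8,9) by (intro CH_family.approx_psi[OF family T]) auto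
    qed
  qed
qed

end
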